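(* Let $X$ be a complete holomorphic vector field with isolated singularities on a connected Stein surface $N$ with $H^2(N,\mathbb{Z})=0$. Denote by $\xi(X)\subset N$ the subset of periodic orbits, i.e., orbits diffeomorphic to $\mathbb{C}^*$. Then at least one of the following possibilities holds: (1) The set $\xi(X)$ of periodic orbits has no convergence set on $N$ (its set of convergence points is empty), or its convergence set contains only simply-connected orbits. (2) There is a meromorphic first integral for the flow on $N$. (3) $X$ has a (nRnL) periodic orbit.
   Context: A Stein surface is a Stein manifold of complex dimension two; complete means that the flow is defined for all complex times. For a subset $\xi\subset N\setminus\mathrm{sing}(X)$ consisting of orbits of $X$, a point $q\in N$ is a convergence point for $\xi$ if each neighborhood $V$ of $q$ in $N$ intersects infinitely many orbits in $\xi$; the convergence set is the set of convergence points (it contains the orbit of each of its points). A meromorphic first integral is a nonconstant meromorphic function on $N$ constant along the orbits. A germ of holomorphic diffeomorphism $f\in\mathrm{Diff}(\mathbb{C},0)$ is non-resonant if $f'(0)=e^{2\pi\sqrt{-1}\lambda}$ with $\lambda\in\mathbb{R}\setminus\mathbb{Q}$. A (nRnL) map is a germ that is non-resonant and not analytically linearizable. A (nRnL) orbit is a periodic orbit (diffeomorphic to $\mathbb{C}^*$) whose holonomy map, with respect to the foliation by orbits of $X$, is a (nRnL) map. *)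

theory Defs
  imports "HOL-Analysis.Analysis" "HOL-Homology.Homology"
begin

section \<open>Holomorphy in several complex variables\<close>

text \<open>Holomorphic means complex differentiable: the real Frechet derivative exists and is
  complex linear. These notions are only used on open sets.\<close>

definition holomorphic_map_on ::
    "(complex^'n \<Rightarrow> complex^'m) \<Rightarrow> (complex^'n) set \<Rightarrow> bool" where
  "holomorphic_map_on f S \<longleftrightarrow>
     (\<forall>x\<in>S. \<exists>D. (f has_derivative D) (at x) \<and> (\<forall>c v. D (c *s v) = c *s D v))"

definition holomorphic_fun_on :: "(complex^'n \<Rightarrow> complex) \<Rightarrow> (complex^'n) set \<Rightarrow> bool" where
  "holomorphic_fun_on f S \<longleftrightarrow>
     (\<forall>x\<in>S. \<exists>D. (f has_derivative D) (at x) \<and> (\<forall>c v. D (c *s v) = c * D v))"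


section \<open>Complex manifolds\<close>

text \<open>A chart is a pair of its domain and its coordinate map (arbitrary off the domain).
  The manifold is the whole type, with the topology of the type; the Hausdorff and
  second countability axioms are the sort of the type.\<close>

type_synonym ('a, 'n) chart = "'a set \<times> ('a \<Rightarrow> complex^'n)"

abbreviation chart_inv :: "('a, 'n::finite) chart \<Rightarrow> complex^'n \<Rightarrow> 'a" where
  "chart_inv c \<equiv> inv_into (fst c) (snd c)"

definition complex_manifold ::
    "('a::{t2_space, second_countable_topology}, 'n::finite) chart set \<Rightarrow> bool" where
  "complex_manifold A \<longleftrightarrow>
     (\<Union>c\<in>A. fst c) = UNIV \<and>
     (\<forall>c\<in>A. open (fst c) \<and> open (snd c ` fst c) \<and>
             homeomorphism (fst c) (snd c ` fst c) (snd c) (chart_inv c)) \<and>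
     (\<forall>c\<in>A. \<forall>d\<in>A. holomorphic_map_on (snd d \<circ> chart_inv c) (snd c ` (fst c \<inter> fst d)))"

text \<open>Holomorphic functions on an open subset \<open>S\<close> of the manifold.\<close>

definition holo_on :: "('a, 'n::finite) chart set \<Rightarrow> 'a set \<Rightarrow> ('a \<Rightarrow> complex) \<Rightarrow> bool" where
  "holo_on A S f \<longleftrightarrow>
     (\<forall>c\<in>A. holomorphic_fun_on (f \<circ> chart_inv c) (snd c ` (fst c \<inter> S)))"

definition holomorphic_hull :: "('a, 'n::finite) chart set \<Rightarrow> 'a set \<Rightarrow> 'a set" where
  "holomorphic_hull A K =
     {x. \<forall>f. holo_on A UNIV f \<longrightarrow> norm (f x) \<le> (SUP y\<in>K. norm (f y))}"

text \<open>The supremum over the empty set is unspecified for reals, hence \<open>K \<noteq> {}\<close>.\<close>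

definition stein_manifold ::
    "('a::{t2_space, second_countable_topology}, 'n::finite) chart set \<Rightarrow> bool" where
  "stein_manifold A \<longleftrightarrow>
     complex_manifold A \<and>
     (\<forall>K. compact K \<and> K \<noteq> {} \<longrightarrow> compact (holomorphic_hull A K)) \<and>
     (\<forall>x y. x \<noteq> y \<longrightarrow> (\<exists>f. holo_on A UNIV f \<and> f x \<noteq> f y))"

abbreviation stein_surface ::
    "('a::{t2_space, second_countable_topology}, 2) chart set \<Rightarrow> bool" where
  "stein_surface A \<equiv> stein_manifold A"


section \<open>Singular cohomology with integer coefficients\<close>

definition cochain_group :: "nat \<Rightarrow> 'a topology \<Rightarrow> ('a chain \<Rightarrow> int) monoid" where
  "cochain_group p T =
     \<lparr>carrier = hom (chain_group p T) integer_group \<inter> extensional (singular_chain_set p T),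
      monoid.mult = (\<lambda>\<phi> \<psi>. restrict (\<lambda>c. \<phi> c + \<psi> c) (singular_chain_set p T)),
      one = restrict (\<lambda>_. 0) (singular_chain_set p T)\<rparr>"

definition coboundary :: "nat \<Rightarrow> 'a topology \<Rightarrow> ('a chain \<Rightarrow> int) \<Rightarrow> 'a chain \<Rightarrow> int" where
  "coboundary p T \<phi> =
     restrict (\<lambda>c. \<phi> (chain_boundary (Suc p) c)) (singular_chain_set (Suc p) T)"

definition cocycles :: "nat \<Rightarrow> 'a topology \<Rightarrow> ('a chain \<Rightarrow> int) set" where
  "cocycles p T = kernel (cochain_group p T) (cochain_group (Suc p) T) (coboundary p T)"

definition coboundaries :: "nat \<Rightarrow> 'a topology \<Rightarrow> ('a chain \<Rightarrow> int) set" where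
  "coboundaries p T =
     (if p = 0 then {one (cochain_group p T)}
      else coboundary (p - 1) T ` carrier (cochain_group (p - 1) T))"

definition cohomology_group :: "nat \<Rightarrow> 'a topology \<Rightarrow> ('a chain \<Rightarrow> int) set monoid" where
  "cohomology_group p T =
     (subgroup_generated (cochain_group p T) (cocycles p T)) Mod (coboundaries p T)"


section \<open>Holomorphic vector fields and their flows\<close>

text \<open>A vector field is given by its components \<open>X c p\<close> at \<open>p\<close> in each chart \<open>c\<close> around \<open>p\<close>,
  which transform by the derivatives of the transition maps.\<close>

type_synonym ('a, 'n) vfield = "('a, 'n) chart \<Rightarrow> 'a \<Rightarrow> complex^'n"

definition holomorphic_vfield ::
    "('a, 'n::finite) chart set \<Rightarrow> ('a, 'n) vfield \<Rightarrow> bool" where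
  "holomorphic_vfield A X \<longleftrightarrow>
     (\<forall>c\<in>A. holomorphic_map_on (X c \<circ> chart_inv c) (snd c ` fst c)) \<and>
     (\<forall>c\<in>A. \<forall>d\<in>A. \<forall>p\<in>fst c \<inter> fst d.
        X d p = frechet_derivative (snd d \<circ> chart_inv c) (at (snd c p)) (X c p))"

definition sing :: "('a, 'n::finite) chart set \<Rightarrow> ('a, 'n) vfield \<Rightarrow> 'a set" where
  "sing A X = {p. \<forall>c\<in>A. p \<in> fst c \<longrightarrow> X c p = 0}"

definition isolated_singularities ::
    "('a::topological_space, 'n::finite) chart set \<Rightarrow> ('a, 'n) vfield \<Rightarrow> bool" where
  "isolated_singularities A X \<longleftrightarrow> (\<forall>p\<in>sing A X. p isolated_in sing A X)"

text \<open>The holomorphic curve \<open>\<gamma>\<close> has velocity \<open>v\<close> at \<open>z\<close>, read in the chart \<open>c\<close>.\<close>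

definition has_velocity ::
    "('a, 'n::finite) chart \<Rightarrow> (complex \<Rightarrow> 'a) \<Rightarrow> complex \<Rightarrow> complex^'n \<Rightarrow> bool" where
  "has_velocity c \<gamma> z v \<longleftrightarrow> ((snd c \<circ> \<gamma>) has_derivative (\<lambda>s. s *s v)) (at z)"

definition integral_curve ::
    "('a::topological_space, 'n::finite) chart set \<Rightarrow> ('a, 'n) vfield \<Rightarrow> (complex \<Rightarrow> 'a) \<Rightarrow> bool" where
  "integral_curve A X \<gamma> \<longleftrightarrow>
     continuous_on UNIV \<gamma> \<and>
     (\<forall>t. \<forall>c\<in>A. \<gamma> t \<in> fst c \<longrightarrow> has_velocity c \<gamma> t (X c (\<gamma> t)))"

definition complete_vfield ::
    "('a::topological_space, 'n::finite) chart set \<Rightarrow> ('a, 'n) vfield \<Rightarrow> bool" where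
  "complete_vfield A X \<longleftrightarrow> (\<forall>p. \<exists>\<gamma>. integral_curve A X \<gamma> \<and> \<gamma> 0 = p)"

text \<open>\<open>flow A X p t\<close> is the position at complex time \<open>t\<close> of the point starting at \<open>p\<close>
  (well defined for complete \<open>X\<close>, by uniqueness of integral curves).\<close>

definition flow ::
    "('a::topological_space, 'n::finite) chart set \<Rightarrow> ('a, 'n) vfield \<Rightarrow> 'a \<Rightarrow> complex \<Rightarrow> 'a" where
  "flow A X p = (THE \<gamma>. integral_curve A X \<gamma> \<and> \<gamma> 0 = p)"

definition orbit ::
    "('a::topological_space, 'n::finite) chart set \<Rightarrow> ('a, 'n) vfield \<Rightarrow> 'a \<Rightarrow> 'a set" where
  "orbit A X p = range (flow A X p)"


section \<open>Orbits as leaves\<close>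

text \<open>An orbit is an immersed, in general not embedded, Riemann surface. Its own topology is
  the finest one for which the parametrization by complex time is continuous.\<close>

definition orbit_topology ::
    "('a::topological_space, 'n::finite) chart set \<Rightarrow> ('a, 'n) vfield \<Rightarrow> 'a \<Rightarrow> 'a topology" where
  "orbit_topology A X p = topology (\<lambda>U. U \<subseteq> orbit A X p \<and> open (flow A X p -` U))"

text \<open>Same form as the library notion \<open>simply_connected\<close>, but for an abstract topology.\<close>

definition simply_connected_top :: "'a topology \<Rightarrow> bool" where
  "simply_connected_top T \<longleftrightarrow>
     path_connected_space T \<and>
     (\<forall>g h. pathin T g \<and> g 1 = g 0 \<and> pathin T h \<and> h 1 = h 0 \<longrightarrow>
        homotopic_with (\<lambda>r. r 1 = r 0) (top_of_set {0..1::real}) T g h)"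

primrec Ck_map ::
    "nat \<Rightarrow> ('b::real_normed_vector \<Rightarrow> 'c::real_normed_vector) \<Rightarrow> bool" where
  "Ck_map 0 f \<longleftrightarrow> continuous_on UNIV f"
| "Ck_map (Suc k) f \<longleftrightarrow>
     f differentiable_on UNIV \<and> (\<forall>v. Ck_map k (\<lambda>x. frechet_derivative f (at x) v))"

definition smooth_map :: "('b::real_normed_vector \<Rightarrow> 'c::real_normed_vector) \<Rightarrow> bool" where
  "smooth_map f \<longleftrightarrow> (\<forall>k. Ck_map k f)"

text \<open>\<open>h\<close> is a diffeomorphism from the orbit of \<open>p\<close>, as an immersed surface, onto the
  punctured plane. For \<open>p\<close> nonsingular the parametrization of the orbit by complex time is a
  surjective local diffeomorphism, so the bijection \<open>h\<close> is a diffeomorphism iff its composition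
  with the parametrization is smooth with invertible derivatives. For \<open>p\<close> singular the orbit
  is a single point and there is no such \<open>h\<close>.\<close>

definition orbit_diffeo ::
    "('a::topological_space, 'n::finite) chart set \<Rightarrow> ('a, 'n) vfield \<Rightarrow> 'a \<Rightarrow> ('a \<Rightarrow> complex) \<Rightarrow> bool" where
  "orbit_diffeo A X p h \<longleftrightarrow>
     bij_betw h (orbit A X p) (- {0}) \<and>
     smooth_map (h \<circ> flow A X p) \<and>
     (\<forall>t. bij (frechet_derivative (h \<circ> flow A X p) (at t)))"

definition periodic_orbit ::
    "('a::topological_space, 'n::finite) chart set \<Rightarrow> ('a, 'n) vfield \<Rightarrow> 'a \<Rightarrow> bool" where
  "periodic_orbit A X p \<longleftrightarrow> (\<exists>h. orbit_diffeo A X p h)"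

text \<open>The union of the periodic orbits.\<close>

definition periodic_set ::
    "('a::topological_space, 'n::finite) chart set \<Rightarrow> ('a, 'n) vfield \<Rightarrow> 'a set" where
  "periodic_set A X = {p. periodic_orbit A X p}"

text \<open>Here \<open>\<xi>\<close> is a union of orbits, and the orbits meeting \<open>V\<close> are counted, not the points.\<close>

definition convergence_set ::
    "('a::topological_space, 'n::finite) chart set \<Rightarrow> ('a, 'n) vfield \<Rightarrow> 'a set \<Rightarrow> 'a set" where
  "convergence_set A X \<xi> =
     {q. \<forall>V. open V \<and> q \<in> V \<longrightarrow> infinite {L \<in> orbit A X ` \<xi>. L \<inter> V \<noteq> {}}}"


section \<open>Meromorphic first integrals\<close>

text \<open>A meromorphic function is represented by a function that is locally a quotient of
  holomorphic functions off the zeros of the denominator; the values at the remaining points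
  carry no information. All conditions on \<open>f\<close> are therefore imposed on the dense
  open set \<open>regular_points A f\<close>.\<close>

definition meromorphic_fun ::
    "('a::topological_space, 'n::finite) chart set \<Rightarrow> ('a \<Rightarrow> complex) \<Rightarrow> bool" where
  "meromorphic_fun A f \<longleftrightarrow>
     (\<forall>q. \<exists>V g h. open V \<and> connected V \<and> q \<in> V \<and> holo_on A V g \<and> holo_on A V h \<and>
        (\<exists>x\<in>V. h x \<noteq> 0) \<and> (\<forall>x\<in>V. h x \<noteq> 0 \<longrightarrow> f x = g x / h x))"

definition regular_points ::
    "('a::topological_space, 'n::finite) chart set \<Rightarrow> ('a \<Rightarrow> complex) \<Rightarrow> 'a set" where
  "regular_points A f = {x. \<exists>V. open V \<and> x \<in> V \<and> holo_on A V f}"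

definition meromorphic_first_integral ::
    "('a::topological_space, 'n::finite) chart set \<Rightarrow> ('a, 'n) vfield \<Rightarrow> ('a \<Rightarrow> complex) \<Rightarrow> bool" where
  "meromorphic_first_integral A X f \<longleftrightarrow>
     meromorphic_fun A f \<and>
     \<not> f constant_on regular_points A f \<and>
     (\<forall>p. f constant_on (orbit A X p \<inter> regular_points A f))"


section \<open>Germs of diffeomorphisms and holonomy\<close>

text \<open>Germs at the origin are represented by functions, of which only the behaviour near the
  origin matters.\<close>

definition germ_diffeo :: "(complex \<Rightarrow> complex) \<Rightarrow> bool" where
  "germ_diffeo f \<longleftrightarrow>
     (\<exists>r>0. f holomorphic_on ball 0 r) \<and> f 0 = 0 \<and> deriv f 0 \<noteq> 0"

definition non_resonant :: "(complex \<Rightarrow> complex) \<Rightarrow> bool" where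
  "non_resonant f \<longleftrightarrow>
     (\<exists>l::real. l \<notin> \<rat> \<and> deriv f 0 = exp (2 * of_real pi * \<i> * of_real l))"

definition analytically_linearizable :: "(complex \<Rightarrow> complex) \<Rightarrow> bool" where
  "analytically_linearizable f \<longleftrightarrow>
     (\<exists>\<phi>. germ_diffeo \<phi> \<and> (\<forall>\<^sub>F z in nhds 0. \<phi> (f z) = deriv f 0 * \<phi> z))"

definition nRnL_map :: "(complex \<Rightarrow> complex) \<Rightarrow> bool" where
  "nRnL_map f \<longleftrightarrow> germ_diffeo f \<and> non_resonant f \<and> \<not> analytically_linearizable f"

text \<open>\<open>\<sigma>\<close> embeds the disc of radius \<open>R\<close> as a holomorphic transverse section at \<open>p\<close>.\<close>

definition transverse_section ::
    "('a::topological_space, 2) chart set \<Rightarrow> ('a, 2) vfield \<Rightarrow> 'a \<Rightarrow> (complex \<Rightarrow> 'a) \<Rightarrow> real \<Rightarrow> bool" where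
  "transverse_section A X p \<sigma> R \<longleftrightarrow>
     R > 0 \<and> \<sigma> 0 = p \<and> continuous_on (ball 0 R) \<sigma> \<and> inj_on \<sigma> (ball 0 R) \<and>
     (\<forall>z\<in>ball 0 R. \<forall>c\<in>A. \<sigma> z \<in> fst c \<longrightarrow>
        (\<exists>v. has_velocity c \<sigma> z v \<and>
             (\<forall>a b. a *s v + b *s X c (\<sigma> z) = 0 \<longrightarrow> a = 0 \<and> b = 0)))"

text \<open>\<open>f\<close> represents the holonomy, in the transverse section \<open>(\<sigma>, R)\<close>, of the loop \<open>\<gamma>\<close>
  in a leaf: \<open>\<gamma>\<close> is deformed continuously along the section to paths \<open>s \<mapsto> H s z\<close> lying in the
  leaves through the points \<open>\<sigma> z\<close> (continuous in the leaves) and returning to the section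
  at \<open>\<sigma> (f z)\<close>.\<close>

definition holonomy_along ::
    "('a::topological_space, 2) chart set \<Rightarrow> ('a, 2) vfield \<Rightarrow> (real \<Rightarrow> 'a) \<Rightarrow>
     (complex \<Rightarrow> 'a) \<Rightarrow> real \<Rightarrow> (complex \<Rightarrow> complex) \<Rightarrow> bool" where
  "holonomy_along A X \<gamma> \<sigma> R f \<longleftrightarrow>
     germ_diffeo f \<and>
     (\<exists>r H. 0 < r \<and> r \<le> R \<and>
        continuous_on ({0..1} \<times> ball 0 r) (\<lambda>(s, z). H s z) \<and>
        (\<forall>s\<in>{0..1}. H s 0 = \<gamma> s) \<and>
        (\<forall>z\<in>ball 0 r. H 0 z = \<sigma> z \<and> f z \<in> ball 0 R \<and> H 1 z = \<sigma> (f z) \<and>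
           pathin (orbit_topology A X (\<sigma> z)) (\<lambda>s. H s z)))"

text \<open>The loop in the orbit that corresponds to the unit circle, a generator of the fundamental
  group of the punctured plane, under a diffeomorphism \<open>h\<close>.\<close>

definition orbit_loop ::
    "('a::topological_space, 'n::finite) chart set \<Rightarrow> ('a, 'n) vfield \<Rightarrow> 'a \<Rightarrow> ('a \<Rightarrow> complex) \<Rightarrow> real \<Rightarrow> 'a" where
  "orbit_loop A X p h s = inv_into (orbit A X p) h (exp (2 * of_real pi * \<i> * of_real s))"

text \<open>The holonomy map of a periodic orbit is determined by this up to conjugation (choice
  of the section) and inversion (choice of the generator).\<close>

definition holonomy_map ::
    "('a::topological_space, 2) chart set \<Rightarrow> ('a, 2) vfield \<Rightarrow> 'a \<Rightarrow> (complex \<Rightarrow> complex) \<Rightarrow> bool" where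
  "holonomy_map A X p f \<longleftrightarrow>
     (\<exists>h \<sigma> R. orbit_diffeo A X p h \<and>
        transverse_section A X (orbit_loop A X p h 0) \<sigma> R \<and>
        holonomy_along A X (orbit_loop A X p h) \<sigma> R f)"

definition nRnL_orbit ::
    "('a::topological_space, 2) chart set \<Rightarrow> ('a, 2) vfield \<Rightarrow> 'a \<Rightarrow> bool" where
  "nRnL_orbit A X p \<longleftrightarrow> periodic_orbit A X p \<and> (\<exists>f. holonomy_map A X p f \<and> nRnL_map f)"

end

theory Submission
  imports Defs "HOL-Complex_Analysis.Complex_Analysis"
begin

(* Let q be a convergence point whose orbit is not simply connected. By uniqueness of integral
   curves its orbit is periodic; global functions separate points, so by Liouville's theorem the
   periods form a discrete subgroup of a line, and the return map to a transverse disc at q is a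
   germ of holomorphic diffeomorphism f. Unless f is a (nRnL) map, f is of finite order or the
   leaves through all small points other than q meet the disc infinitely often.

   In the second case a periodic leaf near q has infinitely many points in the disc. Its period T
   is the same at all of them, so the time-T map is the identity on the set of these points, near
   an accumulation point, and hence everywhere. Averaging global functions against the characters
   of the resulting C^*-action gives eigenfunctions. If none of their quotients of weight zero
   were a nonconstant first integral, the eigenfunctions could not separate nearby orbits.

   In the first case the points near q have periods that vary continuously. Let v(p) = 1/T^2 for a
   generator T of the group of such periods at p, and v(p) = 0 if there are none. Limits of stable
   periods are stable, so v is continuous; it is holomorphic where it does not vanish, hence
   everywhere by Rado's theorem, and it extends over the isolated singularities by Hartogs. If it
   is constant, then the flow is periodic with a common period and the previous case applies. *)

text \<open>Two obstacles shape the argument. First, the shortest period is not continuous: a leaf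
  whose return germ has order n > 1 has a period about n times shorter than its neighbours. So only
  periods that extend to a continuous family of periods around the point are counted
  (\<open>stable_period\<close>). Their generator is determined up to sign, whence the square in
  1/T^2, and where periods escape to infinity 1/T^2 tends to 0, the value at points without stable
  periods. Since nothing is known about the shape of the zero set, Rado's theorem is the tool that
  crosses it.

  Second, a common period gives many eigenfunctions but no evident invariant one. If all
  combinations of weight zero were constant, consider a curve across the leaves on which one
  eigenfunction of nonzero weight is constant: a fixed power of every other eigenfunction is
  constant there, so by continuity is the eigenfunction itself. Fourier uniqueness then makes every
  global function agree at distinct points of the curve, against separation of points.

  Eigenfunctions and frequency are built off the singular points only; as these are isolated in
  dimension two, Hartogs' extension fills them in.\<close>

no_notation exact_seq_arrow
  (\<open>(\<open>indent=3 notation=\<open>mixfix exact_seq\<close>\<close>_ / \<longlongrightarrow>\<index> _)\<close> [1000, 60])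

section \<open>Local dynamics of germs\<close>

lemma germ_diffeo_tendsto:
  assumes "germ_diffeo f"
  shows "(f \<longlongrightarrow> 0) (nhds 0)" "f analytic_on {0}"
proof -
  obtain r where r: "r > 0" "f holomorphic_on ball 0 r" and f0: "f 0 = 0"
    using assms by (auto simp: germ_diffeo_def)
  show an: "f analytic_on {0}" using r by (auto simp: analytic_on_def)
  then have "isCont f 0" by (simp add: analytic_at_imp_isCont)
  then show "(f \<longlongrightarrow> 0) (nhds 0)"
    by (metis f0 isCont_def tendsto_at_iff_tendsto_nhds)
qed

lemma germ_diffeo_nonzero:
  assumes "germ_diffeo f"
  shows "\<forall>\<^sub>F z in at 0. f z \<noteq> 0"
proof -
  obtain r where r: "r > 0" "f holomorphic_on ball 0 r" and f0: "f 0 = 0" and d: "deriv f 0 \<noteq> 0"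
    using assms by (auto simp: germ_diffeo_def)
  obtain s where s: "s > 0" "ball (0::complex) s \<subseteq> ball 0 r" "inj_on f (ball 0 s)"
    by (rule has_complex_derivative_locally_injective[OF r(2) centre_in_ball[THEN iffD2, OF r(1)] open_ball d])
  show ?thesis
    unfolding eventually_at
  proof (intro exI[of _ s] conjI ballI impI)
    fix z :: complex assume "z \<noteq> 0 \<and> dist z 0 < s"
    then show "f z \<noteq> 0" using s f0 by (metis dist_commute inj_onD mem_ball centre_in_ball)
  qed (use s in auto)
qed

lemma germ_diffeo_inverse:
  assumes "germ_diffeo f"
  obtains g where "germ_diffeo g" "deriv g 0 = 1 / deriv f 0"
    "\<forall>\<^sub>F z in nhds 0. f (g z) = z" "\<forall>\<^sub>F z in nhds 0. g (f z) = z"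
proof -
  obtain r where r: "r > 0" "f holomorphic_on ball 0 r" and f0: "f 0 = 0" and d: "deriv f 0 \<noteq> 0"
    using assms by (auto simp: germ_diffeo_def)
  obtain s where s: "s > 0" "ball (0::complex) s \<subseteq> ball 0 r" "open (f ` ball 0 s)" "inj_on f (ball 0 s)"
    by (rule has_complex_derivative_locally_invertible[OF r(2) centre_in_ball[THEN iffD2, OF r(1)] open_ball d])
  have hf: "f holomorphic_on ball 0 s" using r s holomorphic_on_subset by blast
  obtain g where g: "g holomorphic_on f ` ball 0 s"
     "\<And>z. z \<in> ball 0 s \<Longrightarrow> deriv f z * deriv g (f z) = 1"
     "\<And>z. z \<in> ball 0 s \<Longrightarrow> g(f z) = z"
    using holomorphic_has_inverse[OF hf open_ball s(4)] by blast
  have 0: "0 \<in> f ` ball 0 s" using f0 s(1) by (metis centre_in_ball image_eqI)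
  have dg: "deriv g 0 = 1 / deriv f 0" using g(2)[of 0] f0 s(1) d by (simp add: field_simps)
  have "\<forall>\<^sub>F z in nhds 0. z \<in> f ` ball 0 s" by (rule eventually_nhds_in_open[OF s(3) 0])
  then have 1: "\<forall>\<^sub>F z in nhds 0. f (g z) = z" by (rule eventually_mono) (use g(3) in auto)
  have "\<forall>\<^sub>F z in nhds 0. z \<in> ball (0::complex) s" by (rule eventually_nhds_in_open) (use s in auto)
  then have 2: "\<forall>\<^sub>F z in nhds 0. g (f z) = z" by (rule eventually_mono) (use g(3) in auto)
  obtain e where "e > 0" "ball 0 e \<subseteq> f ` ball 0 s" using 0 s(3) openE by blast
  then have "germ_diffeo g"
    unfolding germ_diffeo_def using g holomorphic_on_subset f0 s(1) dg d
    by (metis centre_in_ball divide_eq_0_iff one_neq_zero)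
  then show thesis using that dg 1 2 by blast
qed

lemma germ_diffeo_compose:
  assumes "germ_diffeo f" "germ_diffeo g"
  shows "germ_diffeo (f \<circ> g)" "deriv (f \<circ> g) 0 = deriv f 0 * deriv g 0"
proof -
  have g0: "g 0 = 0" "f 0 = 0" using assms by (auto simp: germ_diffeo_def)
  have an: "f analytic_on {0}" "g analytic_on {0}" using assms germ_diffeo_tendsto by auto
  then have "(f \<circ> g) analytic_on {0}"
    using analytic_on_compose[of g "{0}" f] g0 by simp
  then obtain r where r: "r > 0" "(f \<circ> g) holomorphic_on ball 0 r" by (auto simp: analytic_on_def)
  show D: "deriv (f \<circ> g) 0 = deriv f 0 * deriv g 0"
    using deriv_chain[of g 0 f] an g0
    by (simp add: analytic_on_imp_differentiable_at)
  show "germ_diffeo (f \<circ> g)"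
    unfolding germ_diffeo_def using r D g0 assms by (auto simp: germ_diffeo_def)
qed

lemma germ_diffeo_funpow:
  assumes "germ_diffeo f"
  shows "germ_diffeo (f ^^ n)" "deriv (f ^^ n) 0 = deriv f 0 ^ n"
proof -
  have "germ_diffeo (f ^^ n) \<and> deriv (f ^^ n) 0 = deriv f 0 ^ n"
  proof (induction n)
    case 0
    have "id holomorphic_on ball 0 1" by (simp add: id_def)
    then show ?case by (auto simp: germ_diffeo_def id_def intro!: exI[of _ 1])
  next
    case (Suc n)
    then show ?case using germ_diffeo_compose[OF assms, of "f ^^ n"] by (simp add: o_def)
  qed
  then show "germ_diffeo (f ^^ n)" "deriv (f ^^ n) 0 = deriv f 0 ^ n" by auto
qed

text \<open>\<open>R\<close> will be the relation of lying on the same leaf, read in the parameter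
  of a transverse disc. The recurrence lemmas use of the foliation only that the return germ stays
  within the classes of this equivalence relation.\<close>

locale germ_class =
  fixes R :: "complex \<Rightarrow> complex \<Rightarrow> bool" and \<rho> :: real
  assumes sym: "R x y \<Longrightarrow> R y x" and trans: "R x y \<Longrightarrow> R y z \<Longrightarrow> R x z"
    and refl: "R x x" and \<rho>: "\<rho> > 0"
begin

lemma invariant_inverse:
  assumes f: "germ_diffeo f" and inv: "\<forall>\<^sub>F z in nhds 0. R z (f z)"
    and g: "germ_diffeo g" and fg: "\<forall>\<^sub>F z in nhds 0. f (g z) = z"
  shows "\<forall>\<^sub>F z in nhds 0. R z (g z)"
proof -
  have "\<forall>\<^sub>F z in nhds 0. R (g z) (f (g z))"
    by (rule eventually_compose_filterlim[OF inv germ_diffeo_tendsto(1)[OF g]])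
  then show ?thesis using fg by eventually_elim (metis sym)
qed

lemma invariant_funpow:
  assumes f: "germ_diffeo f" and inv: "\<forall>\<^sub>F z in nhds 0. R z (f z)"
  shows "\<forall>\<^sub>F z in nhds 0. R z ((f ^^ n) z)"
proof (induction n)
  case (Suc n)
  have "\<forall>\<^sub>F z in nhds 0. R ((f ^^ n) z) (f ((f ^^ n) z))"
    by (rule eventually_compose_filterlim[OF inv germ_diffeo_tendsto(1)[OF germ_diffeo_funpow(1)[OF f, of n]]])
  then show ?case using Suc by eventually_elim (auto intro: trans)
qed (simp add: refl)

text \<open>The disc is closed so that an infinite class has an accumulation point inside it; the
  periods are tested at such a point.\<close>

definition recurrent :: "complex \<Rightarrow> bool" where
  "recurrent z \<longleftrightarrow> infinite {w \<in> cball 0 \<rho>. R z w}"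

lemma recurrent_sequence:
  fixes s :: "nat \<Rightarrow> complex"
  assumes "\<And>n. R z (s n)" "\<And>n. norm (s n) \<le> \<rho>" "inj s"
  shows "recurrent z"
proof -
  have "infinite (range s)" using assms(3) by (rule range_inj_infinite)
  moreover have "range s \<subseteq> {w \<in> cball 0 \<rho>. R z w}" using assms by auto
  ultimately show ?thesis unfolding recurrent_def using finite_subset by blast
qed

text \<open>Under a contraction the norms along a forward orbit decrease strictly, so its points are
  distinct and never leave the disc.\<close>

lemma recurrent_contraction:
  assumes f: "germ_diffeo f" and inv: "\<forall>\<^sub>F z in nhds 0. R z (f z)" and d: "norm (deriv f 0) < 1"
  shows "\<forall>\<^sub>F z in at 0. recurrent z"
proof -
  define c where "c = (norm (deriv f 0) + 1) / 2"
  have c: "norm (deriv f 0) < c" "c < 1" using d by (auto simp: c_def)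
  have f0: "f 0 = 0" using f by (simp add: germ_diffeo_def)
  have "(f has_field_derivative deriv f 0) (at 0)"
    using germ_diffeo_tendsto(2)[OF f] by (simp add: analytic_on_imp_differentiable_at DERIV_deriv_iff_field_differentiable)
  then have "((\<lambda>z. f z / z) \<longlongrightarrow> deriv f 0) (at 0)"
    using f0 by (simp add: has_field_derivative_iff)
  then have "\<forall>\<^sub>F z in at 0. norm (f z / z) < c"
    using c(1) by (intro order_tendstoD[OF tendsto_norm])
  then have "\<forall>\<^sub>F z in at 0. norm (f z / z) < c \<and> f z \<noteq> 0 \<and> R z (f z)"
    using germ_diffeo_nonzero[OF f] inv
    by (auto simp: eventually_conj_iff eventually_at_filter elim: eventually_mono)
  then obtain e where e: "e > 0" "\<And>z. z \<noteq> 0 \<Longrightarrow> norm z < e \<Longrightarrow> norm (f z / z) < c \<and> f z \<noteq> 0 \<and> R z (f z)"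
    by (auto simp: eventually_at)
  have step: "norm (f z) < norm z" if "z \<noteq> 0" "norm z < e" for z
  proof -
    have "norm (f z) < c * norm z" using e(2)[OF that] that(1) by (simp add: norm_divide divide_simps)
    also have "\<dots> < norm z" using c that by simp
    finally show ?thesis .
  qed
  have "recurrent z" if z: "z \<noteq> 0" "norm z < min e \<rho>" for z
  proof (rule recurrent_sequence[where s = "\<lambda>n. (f ^^ n) z"])
    have *: "(f ^^ n) z \<noteq> 0 \<and> norm ((f ^^ n) z) < min e \<rho> \<and> R z ((f ^^ n) z)" for n
    proof (induction n)
      case (Suc n)
      then have "norm (f ((f ^^ n) z)) < norm ((f ^^ n) z)" using step by auto
      moreover have "f ((f ^^ n) z) \<noteq> 0" "R ((f ^^ n) z) (f ((f ^^ n) z))" using Suc e(2) by auto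
      ultimately show ?case using Suc trans by (auto intro: trans)
    qed (use z refl in auto)
    show "R z ((f ^^ n) z)" "norm ((f ^^ n) z) \<le> \<rho>" for n using *[of n] by auto
    have "norm ((f ^^ Suc n) z) < norm ((f ^^ n) z)" for n using *[of n] step[of "(f ^^ n) z"] by auto
    then have "strict_mono (\<lambda>n. - norm ((f ^^ n) z))" by (simp add: strict_mono_Suc_iff)
    from strict_mono_imp_inj_on[OF this, of UNIV] show "inj (\<lambda>n. (f ^^ n) z)"
      by (auto simp: inj_on_def)
  qed
  then show ?thesis unfolding eventually_at using e \<rho> by (intro exI[of _ "min e \<rho>"]) auto
qed

text \<open>\<open>W = b / z ^ m\<close> is an approximate Fatou coordinate: in it \<open>f\<close>
  is nearly the translation by 1. Starting in the closed right half-plane, translates move away from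
  the origin, so \<open>W\<close> stays large and the orbit stays near the fixed point, while the
  growth of \<open>Re W\<close> keeps its points distinct.\<close>

lemma recurrent_petal:
  assumes f: "germ_diffeo f" and inv: "\<forall>\<^sub>F z in nhds 0. R z (f z)"
    and b: "b \<noteq> 0" and m: "m \<ge> 1"
    and lim: "((\<lambda>z. b / f z ^ m - b / z ^ m) \<longlongrightarrow> 1) (at 0)"
  shows "\<forall>\<^sub>F z in at 0. Re (b / z ^ m) \<ge> 0 \<longrightarrow> recurrent z"
proof -
  define W where "W z = b / z ^ m" for z
  have "\<forall>\<^sub>F z in at 0. dist (b / f z ^ m - b / z ^ m) 1 < 1/4"
    by (rule tendstoD[OF lim]) auto
  then have "\<forall>\<^sub>F z in at 0. dist (W (f z) - W z) 1 < 1/4 \<and> f z \<noteq> 0 \<and> R z (f z)"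
    using germ_diffeo_nonzero[OF f] inv unfolding W_def
    by (auto simp: eventually_conj_iff eventually_at_filter elim: eventually_mono)
  then obtain e0 where e0: "e0 > 0"
    "\<And>z. z \<noteq> 0 \<Longrightarrow> norm z < e0 \<Longrightarrow> norm (W (f z) - W z - 1) < 1/4 \<and> f z \<noteq> 0 \<and> R z (f z)"
    by (auto simp: eventually_at dist_norm)
  define e where "e = min e0 \<rho>"
  have e: "e > 0" "e \<le> \<rho>"
    "\<And>z. z \<noteq> 0 \<Longrightarrow> norm z < e \<Longrightarrow> norm (W (f z) - W z - 1) < 1/4 \<and> f z \<noteq> 0 \<and> R z (f z)"
    using e0 \<rho> by (auto simp: e_def)
  \<comment> \<open>\<open>K\<close> is the modulus of \<open>W\<close> on the circle of radius
    \<open>e\<close>. Starting in the disc of half the radius gives modulus at least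
    \<open>2 * K\<close>, which leaves room for the loss of a quarter below.\<close>
  define K where "K = norm b / e ^ m"
  have K: "K > 0" using b e by (simp add: K_def)
  have small: "norm z < e" if "z \<noteq> 0" "norm (W z) > K" for z
  proof (rule ccontr)
    assume "\<not> norm z < e"
    then have "e ^ m \<le> norm z ^ m" using e by (intro power_mono) auto
    then have "norm b / norm z ^ m \<le> K" unfolding K_def using e that(1) by (intro divide_left_mono) auto
    then show False using that by (simp add: W_def norm_divide norm_power)
  qed
  have large: "norm (W z) \<ge> 2 * K" if "z \<noteq> 0" "norm z < e / 2" for z
  proof -
    have "norm z ^ m \<le> (e / 2) ^ m" using that e by (intro power_mono) auto
    also have "\<dots> \<le> e ^ m / 2"
    proof -
      have "(2::real) ^ 1 \<le> 2 ^ m" using m by (intro power_increasing) auto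
      then show ?thesis using e by (simp add: power_divide divide_simps)
    qed
    finally have "norm b / norm z ^ m \<ge> norm b / (e ^ m / 2)" using that e by (intro divide_left_mono) auto
    then show ?thesis by (simp add: W_def K_def norm_divide norm_power mult.commute)
  qed
  have "recurrent z" if z: "z \<noteq> 0" "norm z < e / 2" "Re (W z) \<ge> 0" for z
  proof (rule recurrent_sequence[where s = "\<lambda>n. (f ^^ n) z"])
    \<comment> \<open>An error below 1/4 per step adds up to at most n/4, while
      \<open>W z + n\<close> has modulus at least n and at least that of \<open>W z\<close>. Hence
      three quarters of the modulus of \<open>W z\<close> always survive.\<close>
    have *: "(f ^^ n) z \<noteq> 0 \<and> norm (W ((f ^^ n) z) - W z - of_nat n) \<le> n / 4 \<and> norm ((f ^^ n) z) < e \<and> R z ((f ^^ n) z)" for n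
    proof (induction n)
      case (Suc n)
      let ?y = "(f ^^ n) z"
      have y: "norm (W (f ?y) - W ?y - 1) < 1/4" "f ?y \<noteq> 0" "R ?y (f ?y)" using Suc e(3) by auto
      have eq: "W (f ?y) - W z - of_nat (Suc n) = (W (f ?y) - W ?y - 1) + (W ?y - W z - of_nat n)" by simp
      have A: "norm (W (f ?y) - W z - of_nat (Suc n)) \<le> Suc n / 4"
        unfolding eq using y(1) Suc by (intro norm_triangle_le) auto
      have "norm (W z) \<le> norm (W z + of_nat (Suc n))"
        unfolding cmod_def using z(3) by (intro real_sqrt_le_mono) (auto intro!: power_mono)
      moreover have "Suc n \<le> norm (W z + of_nat (Suc n))"
        using abs_Re_le_cmod[of "W z + of_nat (Suc n)"] z(3) by auto
      moreover have "norm (W z + of_nat (Suc n)) \<le> norm (W (f ?y)) + norm (W (f ?y) - W z - of_nat (Suc n))"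
        using norm_triangle_ineq4[of "W (f ?y)" "W (f ?y) - W z - of_nat (Suc n)"] by (simp add: algebra_simps)
      moreover have "a \<ge> (3/4) * b" if "b \<le> N" "k \<le> N" "N \<le> a + d" "d \<le> k / 4" for a b N k d :: real
        using that by (simp add: field_simps)
      ultimately have "norm (W (f ?y)) \<ge> (3/4) * norm (W z)" using A by blast
      then have "norm (W (f ?y)) > K" using large[OF z(1,2)] K by linarith
      then have "norm (f ?y) < e" using small y by auto
      then show ?case using y A Suc by (auto intro: trans)
    qed (use z e refl in auto)
    show "R z ((f ^^ n) z)" "norm ((f ^^ n) z) \<le> \<rho>" for n using *[of n] e by auto
    have inc: "norm (W ((f ^^ Suc n) z) - W ((f ^^ n) z) - 1) < 1/4" for n using *[of n] e(3) by auto
    have "Re (W ((f ^^ n) z)) < Re (W ((f ^^ Suc n) z))" for n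
      using inc[of n] abs_Re_le_cmod[of "W ((f ^^ Suc n) z) - W ((f ^^ n) z) - 1"] by simp
    then have "strict_mono (\<lambda>n. Re (W ((f ^^ n) z)))" by (simp add: strict_mono_Suc_iff)
    from strict_mono_imp_inj_on[OF this, of UNIV] show "inj (\<lambda>n. (f ^^ n) z)"
      by (auto simp: inj_on_def)
  qed
  then show ?thesis unfolding eventually_at W_def using e by (intro exI[of _ "e / 2"]) auto
qed

text \<open>Write f(z) = z + z^(m+1) h(z) with h(0) nonzero. Forward orbits stay near 0 where
  \<open>Re (b / z ^ m)\<close> is nonnegative; the inverse germ has the same normal form with
  \<open>- b\<close>, so backward orbits take care of the remaining points. Both kinds of orbit
  remain in the class of their starting point.\<close>

lemma recurrent_parabolic:
  assumes f: "germ_diffeo f" and inv: "\<forall>\<^sub>F z in nhds 0. R z (f z)" and d: "deriv f 0 = 1"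
    and ni: "\<not> (\<forall>\<^sub>F z in nhds 0. f z = z)"
  shows "\<forall>\<^sub>F z in at 0. recurrent z"
proof -
  obtain r where r: "r > 0" "f holomorphic_on ball 0 r" and f0: "f 0 = 0"
    using f by (auto simp: germ_diffeo_def)
  have hol: "(\<lambda>z. f z - z) holomorphic_on ball 0 r" using r by (intro holomorphic_intros)
  have nc: "\<not> (\<lambda>z. f z - z) constant_on ball 0 r"
  proof
    assume "(\<lambda>z. f z - z) constant_on ball 0 r"
    then have "f z = z" if "z \<in> ball 0 r" for z
      using that f0 r(1) unfolding constant_on_def by (auto dest: bspec[of _ _ 0] simp: algebra_simps)
    then show False using ni r(1) eventually_nhds_in_open[of "ball 0 r" 0]
      by (metis (mono_tags, lifting) centre_in_ball eventually_mono open_ball)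
  qed
  obtain h s n where hs: "0 < n"  "0 < s" "ball (0::complex) s \<subseteq> ball 0 r" "h holomorphic_on ball 0 s"
    "\<And>w. w \<in> ball 0 s \<Longrightarrow> f w - w = w ^ n * h w" "\<And>w. w \<in> ball 0 s \<Longrightarrow> h w \<noteq> 0"
    by (rule holomorphic_factor_zero_nonconstant[OF hol open_ball connected_ball
          centre_in_ball[THEN iffD2, OF r(1)] _ nc]) (use f0 in auto)
  have contf: "h \<midarrow>0\<rightarrow> h 0"
    using holomorphic_on_imp_continuous_on[OF hs(4)] hs(2)
    by (simp add: continuous_on_eq_continuous_at isCont_def)
  have h0: "h 0 \<noteq> 0" using hs by auto
  have ev: "\<forall>\<^sub>F z in at 0. z \<in> ball (0::complex) s - {0}"
    by (rule eventually_at_in_open) (use hs in auto)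
  have dlim: "((\<lambda>z. f z / z) \<longlongrightarrow> 1) (at 0)"
  proof -
    have "(f has_field_derivative 1) (at 0)"
      using germ_diffeo_tendsto(2)[OF f] d
      by (metis analytic_on_imp_differentiable_at DERIV_deriv_iff_field_differentiable singletonI)
    then show ?thesis using f0 by (simp add: has_field_derivative_iff)
  qed
  \<comment> \<open>A zero of order one of f(z) - z would give f the derivative 1 + h(0) at 0, which
    differs from 1.\<close>
  have n2: "n \<ge> 2"
  proof (rule ccontr)
    assume "\<not> n \<ge> 2"
    then have n: "n = 1" using hs(1) by simp
    have "\<forall>\<^sub>F z in at 0. f z / z - 1 = h z"
      using ev by eventually_elim (use hs(5) n in \<open>auto simp: divide_simps\<close>)
    then have "((\<lambda>z. f z / z - 1) \<longlongrightarrow> h 0) (at 0)"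
      using contf by (simp add: tendsto_cong)
    moreover have "((\<lambda>z. f z / z - 1) \<longlongrightarrow> 1 - 1) (at 0)" by (intro tendsto_intros dlim)
    ultimately have "h 0 = 1 - 1" by (rule LIM_unique)
    then show False using h0 by simp
  qed
  define m where "m = n - 1"
  have m: "m \<ge> 1" "n = Suc m" using n2 by (auto simp: m_def)
  \<comment> \<open>The increment of \<open>b / z ^ m\<close> under \<open>f\<close> tends to
    \<open>- of_nat m * b * h 0\<close>, because (1 + u)^(-m) has derivative -m at u = 0. This
    \<open>b\<close> normalizes the limit to 1.\<close>
  define b where "b = - 1 / (of_nat m * h 0)"
  have b: "b \<noteq> 0" "- b \<noteq> 0" using m h0 by (auto simp: b_def)
  define u where "u z = z ^ m * h z" for z
  have fz: "f z = z * (1 + u z)" if "z \<in> ball 0 s" for z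
    using hs(5)[OF that] by (simp add: u_def m algebra_simps)
  have ulim: "(u \<longlongrightarrow> 0) (at 0)"
  proof -
    have "(u \<longlongrightarrow> 0 ^ m * h 0) (at 0)" unfolding u_def by (intro tendsto_intros contf)
    then show ?thesis using m by (simp add: zero_power)
  qed
  have un: "\<forall>\<^sub>F z in at 0. u z \<noteq> 0"
    using ev by eventually_elim (use hs(6) in \<open>auto simp: u_def\<close>)
  have "((\<lambda>w. inverse ((1 + w) ^ m)) has_field_derivative - of_nat m) (at (0::complex))"
    by (auto intro!: derivative_eq_intros)
  then have "((\<lambda>w. (inverse ((1 + w) ^ m) - 1) / w) \<longlongrightarrow> - of_nat m) (at (0::complex))"
    by (simp add: has_field_derivative_iff)
  then have L: "((\<lambda>z. (inverse ((1 + u z) ^ m) - 1) / u z) \<longlongrightarrow> - of_nat m) (at 0)"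
    by (rule filterlim_compose) (use ulim un in \<open>auto simp: filterlim_at\<close>)
  have "((\<lambda>z. b * h z * ((inverse ((1 + u z) ^ m) - 1) / u z)) \<longlongrightarrow> b * h 0 * (- of_nat m)) (at 0)"
    by (intro tendsto_intros contf L)
  also have "b * h 0 * (- of_nat m) = 1" using h0 m by (simp add: b_def)
  finally have "((\<lambda>z. b * h z * ((inverse ((1 + u z) ^ m) - 1) / u z)) \<longlongrightarrow> 1) (at 0)" .
  moreover have "\<forall>\<^sub>F z in at 0. b / f z ^ m - b / z ^ m = b * h z * ((inverse ((1 + u z) ^ m) - 1) / u z)"
    using ev germ_diffeo_nonzero[OF f]
  proof eventually_elim
    case (elim z)
    then have z: "z \<noteq> 0" "z \<in> ball 0 s" "1 + u z \<noteq> 0" using fz by auto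
    then have "h z \<noteq> 0" using hs(6) by auto
    then have "b * h z * ((inverse ((1 + u z) ^ m) - 1) / u z) = b * (inverse ((1 + u z) ^ m) - 1) / z ^ m"
      using z(1) by (simp add: u_def)
    also have "\<dots> = b / f z ^ m - b / z ^ m"
      using z fz[of z] by (simp add: power_mult_distrib divide_simps right_diff_distrib)
    finally show ?case by simp
  qed
  ultimately have lim: "((\<lambda>z. b / f z ^ m - b / z ^ m) \<longlongrightarrow> 1) (at 0)" by (simp add: tendsto_cong)
  have 1: "\<forall>\<^sub>F z in at 0. Re (b / z ^ m) \<ge> 0 \<longrightarrow> recurrent z"
    by (rule recurrent_petal[OF f inv b(1) m(1) lim])
  obtain g where g: "germ_diffeo g" "\<forall>\<^sub>F z in nhds 0. f (g z) = z"
    using germ_diffeo_inverse[OF f] by metis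
  have gl: "filterlim g (at 0) (at 0)"
  proof -
    have "(g \<longlongrightarrow> 0) (at 0)"
      by (rule tendsto_mono[OF _ germ_diffeo_tendsto(1)[OF g(1)]]) (simp add: at_within_def)
    then show ?thesis using germ_diffeo_nonzero[OF g(1)] by (simp add: filterlim_at)
  qed
  have "((\<lambda>z. b / f (g z) ^ m - b / g z ^ m) \<longlongrightarrow> 1) (at 0)"
    by (rule filterlim_compose[OF lim gl])
  moreover have "\<forall>\<^sub>F z in at 0. f (g z) = z" using g(2) by (auto simp: eventually_at_filter elim: eventually_mono)
  ultimately have "((\<lambda>z. b / z ^ m - b / g z ^ m) \<longlongrightarrow> 1) (at 0)"
    by - (rule Lim_transform_eventually[of "\<lambda>z. b / f (g z) ^ m - b / g z ^ m"], assumption, erule eventually_mono, simp)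
  then have lim2: "((\<lambda>z. (- b) / g z ^ m - (- b) / z ^ m) \<longlongrightarrow> 1) (at 0)" by simp
  have 2: "\<forall>\<^sub>F z in at 0. Re ((- b) / z ^ m) \<ge> 0 \<longrightarrow> recurrent z"
    by (rule recurrent_petal[OF g(1) invariant_inverse[OF f inv g] b(2) m(1) lim2])
  show ?thesis using 1 2 by eventually_elim auto
qed

text \<open>In the linearizing coordinate the germ is an irrational rotation. The orbit of a nonzero
  point is an infinite subset of a circle, and small circles are mapped back into the disc.\<close>

lemma recurrent_linearizable:
  assumes f: "germ_diffeo f" and inv: "\<forall>\<^sub>F z in nhds 0. R z (f z)"
    and nr: "non_resonant f" and lin: "analytically_linearizable f"
  shows "\<forall>\<^sub>F z in at 0. recurrent z"
proof -
  obtain l :: real where l: "l \<notin> \<rat>" "deriv f 0 = exp (2 * of_real pi * \<i> * of_real l)"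
    using nr by (auto simp: non_resonant_def)
  define \<mu> where "\<mu> = deriv f 0"
  have \<mu>1: "norm \<mu> = 1" unfolding \<mu>_def l(2) by (simp add: norm_exp_eq_Re)
  have \<mu>n: "\<mu> ^ i \<noteq> \<mu> ^ j" if "i < j" for i j
  proof
    assume "\<mu> ^ i = \<mu> ^ j"
    moreover have "\<mu> ^ j = \<mu> ^ i * \<mu> ^ (j - i)" using that by (simp flip: power_add)
    moreover have "\<mu> \<noteq> 0" using \<mu>1 by auto
    ultimately have "\<mu> ^ (j - i) = 1" by simp
    then have "exp (of_nat (j - i) * (2 * of_real pi * \<i> * of_real l)) = 1"
      by (simp add: \<mu>_def l(2) exp_of_nat_mult)
    then obtain k :: int where "of_nat (j - i) * (2 * pi * l) = of_int (2 * k) * pi"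
      by (auto simp: exp_eq_1)
    then have "2 * pi * (of_nat (j - i) * l) = 2 * pi * of_int k" by (simp add: mult_ac)
    then have "of_nat (j - i) * l = of_int k" by (subst (asm) mult_left_cancel) auto
    then have "l = of_int k / of_nat (j - i)" using that by (simp add: field_simps)
    then show False using l(1) by auto
  qed
  obtain \<phi> where \<phi>: "germ_diffeo \<phi>" "\<forall>\<^sub>F z in nhds 0. \<phi> (f z) = \<mu> * \<phi> z"
    using lin by (auto simp: analytically_linearizable_def \<mu>_def)
  obtain \<psi> where \<psi>: "germ_diffeo \<psi>" "\<forall>\<^sub>F z in nhds 0. \<phi> (\<psi> z) = z" "\<forall>\<^sub>F z in nhds 0. \<psi> (\<phi> z) = z"
    using germ_diffeo_inverse[OF \<phi>(1)] by metis
  have "\<forall>\<^sub>F z in nhds 0. \<psi> (\<phi> (f z)) = f z"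
    by (rule eventually_compose_filterlim[OF \<psi>(3) germ_diffeo_tendsto(1)[OF f]])
  moreover have "\<forall>\<^sub>F z in nhds 0. z \<in> ball (0::complex) \<rho>"
    by (rule eventually_nhds_in_open) (use \<rho> in auto)
  ultimately have "\<forall>\<^sub>F z in nhds 0. \<phi> (f z) = \<mu> * \<phi> z \<and> R z (f z) \<and> \<psi> (\<phi> (f z)) = f z \<and> z \<in> ball 0 \<rho>"
    using \<phi>(2) inv by eventually_elim auto
  then have "\<forall>\<^sub>F w in nhds 0. \<phi> (f (\<psi> w)) = \<mu> * \<phi> (\<psi> w) \<and> R (\<psi> w) (f (\<psi> w)) \<and> \<psi> (\<phi> (f (\<psi> w))) = f (\<psi> w) \<and> \<psi> w \<in> ball 0 \<rho>"
    by (rule eventually_compose_filterlim[OF _ germ_diffeo_tendsto(1)[OF \<psi>(1)]])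
  then have "\<forall>\<^sub>F w in nhds 0. R (\<psi> w) (\<psi> (\<mu> * w)) \<and> norm (\<psi> w) \<le> \<rho> \<and> \<phi> (\<psi> w) = w"
    using \<psi>(2) by eventually_elim auto
  then obtain e where e: "e > 0" "\<And>w. norm w < e \<Longrightarrow> R (\<psi> w) (\<psi> (\<mu> * w)) \<and> norm (\<psi> w) \<le> \<rho> \<and> \<phi> (\<psi> w) = w"
    by (auto simp: eventually_nhds_metric)
  have main: "recurrent z" if z: "\<psi> (\<phi> z) = z" "norm (\<phi> z) < e" "\<phi> z \<noteq> 0" for z
  proof (rule recurrent_sequence[where s = "\<lambda>n. \<psi> (\<mu> ^ n * \<phi> z)"])
    have small: "norm (\<mu> ^ n * \<phi> z) < e" for n using z \<mu>1 by (simp add: norm_mult norm_power)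
    show "R z (\<psi> (\<mu> ^ n * \<phi> z))" for n
    proof (induction n)
      case (Suc n)
      then show ?case using e(2)[OF small[of n]] trans by (metis mult.assoc power_Suc)
    qed (use z refl in auto)
    show "norm (\<psi> (\<mu> ^ n * \<phi> z)) \<le> \<rho>" for n using e(2)[OF small] by auto
    show "inj (\<lambda>n. \<psi> (\<mu> ^ n * \<phi> z))"
    proof (rule injI)
      fix i j assume "\<psi> (\<mu> ^ i * \<phi> z) = \<psi> (\<mu> ^ j * \<phi> z)"
      then have "\<mu> ^ i * \<phi> z = \<mu> ^ j * \<phi> z" using e(2)[OF small] by metis
      then have "\<mu> ^ i = \<mu> ^ j" using z by simp
      then show "i = j" using \<mu>n by (metis linorder_neqE_nat)
    qed
  qed
  have "\<forall>\<^sub>F z in nhds 0. dist (\<phi> z) 0 < e"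
    by (rule tendstoD[OF germ_diffeo_tendsto(1)[OF \<phi>(1)]]) (use e in auto)
  then have "\<forall>\<^sub>F z in at 0. \<psi> (\<phi> z) = z \<and> norm (\<phi> z) < e"
    using \<psi>(3) by (auto simp: eventually_at_filter elim: eventually_elim2)
  then show ?thesis
    using germ_diffeo_nonzero[OF \<phi>(1)] by eventually_elim (use main in auto)
qed

text \<open>If the multiplier is off the unit circle, \<open>f\<close> or its inverse contracts. A
  multiplier with irrational angle gives a rotation, unless \<open>f\<close> is not linearizable and
  hence of the excluded kind. With rational angle an iterate is tangent to the identity, and is
  either the identity or parabolic.\<close>

theorem germ_trichotomy:
  assumes f: "germ_diffeo f" and inv: "\<forall>\<^sub>F z in nhds 0. R z (f z)"
  shows "nRnL_map f \<or> (\<exists>n\<ge>1. \<forall>\<^sub>F z in nhds 0. (f ^^ n) z = z) \<or> (\<forall>\<^sub>F z in at 0. recurrent z)"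
proof -
  consider "norm (deriv f 0) < 1" | "norm (deriv f 0) > 1" | "norm (deriv f 0) = 1" by linarith
  then show ?thesis
  proof cases
    case 1 then show ?thesis using recurrent_contraction[OF f inv] by blast
  next
    case 2
    obtain g where g: "germ_diffeo g" "\<forall>\<^sub>F z in nhds 0. f (g z) = z" "deriv g 0 = 1 / deriv f 0"
      using germ_diffeo_inverse[OF f] by metis
    have "norm (deriv g 0) < 1" using 2 g(3) by (simp add: norm_divide divide_less_eq_1)
    then show ?thesis using recurrent_contraction[OF g(1) invariant_inverse[OF f inv g(1,2)]] by blast
  next
    case 3
    define l where "l = Arg (deriv f 0) / (2 * pi)"
    have "deriv f 0 = exp (\<i> * of_real (Arg (deriv f 0)))" using 3 Arg_eq[of "deriv f 0"] by force
    then have l: "deriv f 0 = exp (2 * of_real pi * \<i> * of_real l)" by (simp add: l_def mult_ac)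
    show ?thesis
    proof (cases "l \<in> \<rat>")
      case False
      then have "non_resonant f" using l by (auto simp: non_resonant_def)
      then show ?thesis using f recurrent_linearizable[OF f inv] by (auto simp: nRnL_map_def)
    next
      case True
      then obtain a :: int and k :: nat where ak: "k > 0" "l = of_int a / of_nat k"
        by (metis Rats_cases' of_int_of_nat_eq zero_less_imp_eq_int of_nat_0_less_iff)
      have "deriv (f ^^ k) 0 = exp (of_nat k * (2 * of_real pi * \<i> * of_real l))"
        using germ_diffeo_funpow(2)[OF f, of k] l by (simp add: exp_of_nat_mult)
      also have "of_nat k * (2 * of_real pi * \<i> * of_real l) = of_int (2 * a) * pi * \<i>"
        using ak by simp
      also have "exp (of_int (2 * a) * pi * \<i>) = 1"
        unfolding exp_eq_1 by auto
      finally have d: "deriv (f ^^ k) 0 = 1" .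
      show ?thesis
        using recurrent_parabolic[OF germ_diffeo_funpow(1)[OF f] invariant_funpow[OF f inv] d] ak(1)
        by (metis Suc_leI One_nat_def)
    qed
  qed
qed

end

section \<open>Rado's theorem\<close>

text \<open>These are the real trigonometric polynomials, given as functions on the plane whose
  values off the unit circle are arbitrary.\<close>

inductive_set trig :: "(complex \<Rightarrow> real) set" where
  mono: "(\<And>z. norm z = 1 \<Longrightarrow> u z = Re (c * z ^ k)) \<Longrightarrow> u \<in> trig"
| add: "u \<in> trig \<Longrightarrow> v \<in> trig \<Longrightarrow> (\<And>z. norm z = 1 \<Longrightarrow> w z = u z + v z) \<Longrightarrow> w \<in> trig"

text \<open>This is the product formula 2 Re a Re b = Re (a b) + Re (a conj b). On the circle conj z
  is 1/z, so the second term is again a monomial; if its exponent comes out negative, conjugating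
  leaves the real part unchanged and reverses the sign of the exponent.\<close>

lemma trig_mono_mult:
  assumes "\<And>z. norm z = 1 \<Longrightarrow> u z = Re (c * z ^ j) * Re (d * z ^ k)"
  shows "u \<in> trig"
proof -
  have two: "Re a * Re b = Re (a * b) / 2 + Re (a * cnj b) / 2" for a b by (simp add: field_simps)
  have cz: "z ^ n * cnj z ^ n = 1" if "norm z = 1" for z n
    using that by (simp add: complex_norm_square[symmetric] flip: power_mult_distrib)
  have 1: "(\<lambda>z. Re ((c * d / 2) * z ^ (j + k))) \<in> trig" by (rule trig.mono[of _ "c * d / 2" "j + k"]) auto
  have 2: "(\<lambda>z. Re (c * z ^ j * cnj (d * z ^ k)) / 2) \<in> trig"
  proof (cases "k \<le> j")
    case True
    have eq: "c * z ^ j * cnj (d * z ^ k) = c * cnj d * z ^ (j - k)" if "norm z = 1" for z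
    proof -
      have "z ^ j = z ^ (j - k) * z ^ k" using True by (simp flip: power_add)
      then show ?thesis using cz[OF that, of k] by (simp add: mult_ac)
    qed
    show ?thesis
      by (rule trig.mono[of _ "c * cnj d / 2" "j - k"]) (simp only: eq, simp)
  next
    case False
    have eq: "c * z ^ j * cnj (d * z ^ k) = cnj (cnj c * d * z ^ (k - j))" if "norm z = 1" for z
    proof -
      have "cnj z ^ k = cnj z ^ (k - j) * cnj z ^ j" using False by (simp flip: power_add)
      then show ?thesis using cz[OF that, of j] by (simp add: mult_ac)
    qed
    show ?thesis
      by (rule trig.mono[of _ "cnj c * d / 2" "k - j"]) (simp only: eq, simp del: complex_cnj_mult complex_cnj_power)
  qed
  show ?thesis
    by (rule trig.add[OF 1 2]) (simp only: assms two, simp add: power_add mult_ac)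
qed

lemma trig_mult:
  assumes "u \<in> trig" "v \<in> trig" shows "(\<lambda>z. u z * v z) \<in> trig"
  using assms
proof (induction u rule: trig.induct)
  case (mono u c k)
  from \<open>v \<in> trig\<close> show ?case
  proof (induction v rule: trig.induct)
    case (mono v d j)
    then show ?case using \<open>\<And>z. norm z = 1 \<Longrightarrow> u z = Re (c * z ^ k)\<close> by (intro trig_mono_mult[of _ c k d j]) auto
  next
    case (add v1 v2 w)
    show ?case by (rule trig.add[OF add.IH]) (auto simp: algebra_simps add.hyps)
  qed
next
  case (add u1 u2 w)
  show ?case by (rule trig.add[OF add.IH]) (auto simp: algebra_simps add.hyps assms)
qed

lemma trig_entire: "u \<in> trig \<Longrightarrow> \<exists>p. p holomorphic_on UNIV \<and> (\<forall>z. norm z = 1 \<longrightarrow> u z = Re (p z))"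
proof (induction u rule: trig.induct)
  case (mono u c k)
  then show ?case by (intro exI[of _ "\<lambda>z. c * z ^ k"]) (auto intro!: holomorphic_intros)
next
  case (add u v w)
  then obtain p q where "p holomorphic_on UNIV" "q holomorphic_on UNIV"
    "\<And>z. norm z = 1 \<Longrightarrow> u z = Re (p z)" "\<And>z. norm z = 1 \<Longrightarrow> v z = Re (q z)" by blast
  then show ?case using add by (intro exI[of _ "\<lambda>z. p z + q z"]) (auto intro!: holomorphic_intros)
qed

lemma circle_approx_trig:
  assumes "continuous_on (sphere 0 1) u" "e > 0"
  obtains g where "g \<in> trig" "\<And>z. norm z = 1 \<Longrightarrow> \<bar>u z - g z\<bar> < e"
proof -
  interpret function_ring_on trig "sphere (0::complex) 1"
  proof
    show "continuous_on (sphere 0 1) f" if "f \<in> trig" for f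
    proof -
      obtain p where p: "p holomorphic_on UNIV" "\<forall>z. norm z = 1 \<longrightarrow> f z = Re (p z)"
        using trig_entire \<open>f \<in> trig\<close> by blast
      have "continuous_on (sphere 0 1) (\<lambda>z. Re (p z))"
        using p(1) by (intro continuous_intros continuous_on_subset[OF holomorphic_on_imp_continuous_on]) auto
      then show ?thesis by (rule continuous_on_eq) (use p in auto)
    qed
    show "(\<lambda>x. f x + g x) \<in> trig" if "f \<in> trig" "g \<in> trig" for f g
      using that by (rule trig.add) auto
    show "\<exists>f\<in>trig. f x \<noteq> f y" if "x \<noteq> y" for x y :: complex
    proof (cases "Re x = Re y")
      case True
      have "(\<lambda>z. Re (\<i> * z ^ 1)) \<in> trig" by (rule trig.mono[of _ "\<i>" 1]) auto
      then show ?thesis using True that by (intro bexI) (auto simp: complex_eq_iff)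
    next
      case False
      have "(\<lambda>z. Re (1 * z ^ 1)) \<in> trig" by (rule trig.mono[of _ 1 1]) auto
      then show ?thesis using False by (intro bexI) (auto simp: complex_eq_iff)
    qed
    show "(\<lambda>_. c) \<in> trig" for c by (rule trig.mono[of _ "of_real c" 0]) auto
  qed (auto intro: trig_mult)
  show thesis using Stone_Weierstrass_basic[OF assms] that by auto
qed

text \<open>The approximants come with their harmonic extension to the disc, as real parts of entire
  functions. They play the role of approximate solutions of the Dirichlet problem.\<close>

lemma circle_approx_real_part:
  assumes "continuous_on (sphere 0 1) u" "e > 0"
  obtains p where "p holomorphic_on UNIV" "\<And>z. norm z = 1 \<Longrightarrow> \<bar>u z - Re (p z)\<bar> < e"
proof -
  obtain g where g: "g \<in> trig" "\<And>z. norm z = 1 \<Longrightarrow> \<bar>u z - g z\<bar> < e"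
    using circle_approx_trig[OF assms] by blast
  then show thesis using trig_entire[OF g(1)] that by metis
qed

text \<open>A bound on the real part alone controls the derivative: exp(g/d) has modulus between 1/e
  and e, so Cauchy's estimate applies to it and its derivative can be divided by it. With 3 in place
  of e and the circle of radius r/2, the constant is 3 * (3 / (1/2)) = 18.\<close>

lemma Re_deriv_bound:
  assumes g: "g holomorphic_on ball z r" and r: "r > 0" and d: "d > 0"
    and b: "\<And>w. w \<in> ball z r \<Longrightarrow> \<bar>Re (g w)\<bar> \<le> d"
  shows "norm (deriv g z) \<le> 18 * d / r"
proof -
  define G where "G w = exp (g w / of_real d)" for w
  have dg: "(g has_field_derivative deriv g z) (at z)"
    using g r by (intro holomorphic_derivI[OF g]) auto
  have DG: "deriv G z = G z * (deriv g z / d)"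
    unfolding G_def by (rule DERIV_imp_deriv) (use d in \<open>auto intro!: derivative_eq_intros dg\<close>)
  have Gb: "norm (G w) \<le> 3" "norm (G w) \<ge> 1/3" if "w \<in> ball z r" for w
  proof -
    have 1: "\<bar>Re (g w) / d\<bar> \<le> 1" using b[OF that] d by (simp add: abs_divide divide_simps)
    have "exp (Re (g w) / d) \<le> exp 1" using 1 by (subst exp_le_cancel_iff) linarith
    from order_trans[OF this exp_le] show "norm (G w) \<le> 3" by (simp add: G_def norm_exp_eq_Re)
    have "exp (Re (g w) / d) \<ge> exp (-1)" using 1 by (subst exp_le_cancel_iff) linarith
    moreover have "exp (-1) \<ge> (1/3::real)" using exp_le by (simp add: exp_minus divide_simps)
    ultimately have "exp (Re (g w) / d) \<ge> 1/3" by (rule order_trans[rotated])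
    then show "norm (G w) \<ge> 1/3" by (simp add: G_def norm_exp_eq_Re)
  qed
  have sub: "ball z (r/2) \<subseteq> ball z r" "cball z (r/2) \<subseteq> ball z r" using r by auto
  have hG: "G holomorphic_on ball z r" unfolding G_def using d by (intro holomorphic_intros g) auto
  have "norm ((deriv ^^ 1) G z) \<le> fact 1 * 3 / (r/2) ^ 1"
  proof (rule Cauchy_inequality)
    show "G holomorphic_on ball z (r/2)" using hG sub holomorphic_on_subset by blast
    show "continuous_on (cball z (r/2)) G" using hG sub holomorphic_on_imp_continuous_on continuous_on_subset by blast
    show "norm (G x) \<le> 3" if "norm (z - x) = r/2" for x using Gb(1)[of x] that r by (auto simp: dist_norm)
  qed (use r in auto)
  then have "norm (G z) * (norm (deriv g z) / d) \<le> 6 / r"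
    using DG d by (simp add: norm_mult norm_divide)
  moreover have "1/3 * (norm (deriv g z) / d) \<le> norm (G z) * (norm (deriv g z) / d)"
    using Gb(2)[of z] r d by (intro mult_right_mono) auto
  ultimately have "1/3 * (norm (deriv g z) / d) \<le> 6 / r" by linarith
  then show ?thesis using r d by (simp add: field_simps)
qed

section \<open>Maximum principle off the zeros and extension across them\<close>

context
  fixes f :: "complex \<Rightarrow> complex"
  assumes contf: "continuous_on (cball 0 1) f"
    and holf: "f holomorphic_on {z \<in> ball 0 1. f z \<noteq> 0}"
begin

lemma open_nonzero: "open {z \<in> ball 0 1. f z \<noteq> 0}"
proof -
  have "continuous_on (ball 0 1) f" using contf by (rule continuous_on_subset) auto
  then have "open (ball 0 1 \<inter> f -` (- {0}))" by (intro continuous_open_preimage) auto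
  also have "ball 0 1 \<inter> f -` (- {0}) = {z \<in> ball 0 1. f z \<noteq> 0}" by auto
  finally show ?thesis .
qed

text \<open>The factor \<open>f\<close> kills the boundary of \<open>{f \<noteq> 0}\<close> inside the disc; letting \<open>n \<rightarrow> \<infinity>\<close> in the
  maximum principle for \<open>exp (n h) f\<close> makes it disappear on the circle.\<close>

lemma real_part_le_on_nonzero:
  assumes h: "h holomorphic_on {z \<in> ball 0 1. f z \<noteq> 0}" "continuous_on (cball 0 1) h"
    and b: "\<And>z. norm z = 1 \<Longrightarrow> Re (h z) \<le> e" and a: "a \<in> ball 0 1" "f a \<noteq> 0"
  shows "Re (h a) \<le> e"
proof (rule ccontr)
  assume neg: "\<not> ?thesis"
  define \<Omega> where "\<Omega> = {z \<in> ball 0 1. f z \<noteq> 0}"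
  have \<Omega>: "open \<Omega>" "bounded \<Omega>" "closure \<Omega> \<subseteq> cball 0 1"
  proof -
    show "open \<Omega>" using open_nonzero unfolding \<Omega>_def .
    show "bounded \<Omega>" by (rule bounded_subset[OF bounded_ball[of 0 1]]) (auto simp: \<Omega>_def)
    show "closure \<Omega> \<subseteq> cball 0 1" by (rule closure_minimal) (auto simp: \<Omega>_def)
  qed
  have "compact (f ` cball 0 1)" by (rule compact_continuous_image[OF contf]) auto
  then have "bounded (f ` cball 0 1)" by (rule compact_imp_bounded)
  then obtain M where M: "M > 0" "\<And>z. z \<in> cball 0 1 \<Longrightarrow> norm (f z) \<le> M"
    by (auto simp: bounded_pos)
  have main: "exp (real n * (Re (h a) - e)) * norm (f a) \<le> M" for n :: nat
  proof -
    let ?H = "\<lambda>z. exp (of_nat n * (h z - of_real e)) * f z"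
    have "norm (?H a) \<le> M"
    proof (rule maximum_modulus_frontier[of ?H \<Omega> M a])
      show "?H holomorphic_on interior \<Omega>"
        using h holf \<Omega>(1) unfolding \<Omega>_def[symmetric] by (auto simp: interior_open intro!: holomorphic_intros)
      show "continuous_on (closure \<Omega>) ?H"
        using \<Omega>(3) by (intro continuous_intros continuous_on_subset[OF h(2)] continuous_on_subset[OF contf]) auto
      show "norm (?H z) \<le> M" if z: "z \<in> frontier \<Omega>" for z
      proof -
        have zc: "z \<in> cball 0 1" "z \<notin> \<Omega>" using z \<Omega> by (auto simp: frontier_def interior_open)
        show ?thesis
        proof (cases "f z = 0")
          case True then show ?thesis using M by simp
        next
          case False
          then have "norm z = 1" using zc by (auto simp: \<Omega>_def)
          then have "real n * (Re (h z) - e) \<le> 0" using b by (simp add: mult_nonneg_nonpos)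
          then have "exp (real n * (Re (h z) - e)) * norm (f z) \<le> 1 * M"
            using M zc by (intro mult_mono) auto
          then show ?thesis by (simp add: norm_mult norm_exp_eq_Re)
        qed
      qed
      show "a \<in> \<Omega>" using a by (simp add: \<Omega>_def)
    qed (use \<Omega> in auto)
    then show ?thesis by (simp add: norm_mult norm_exp_eq_Re)
  qed
  have d: "Re (h a) - e > 0" using neg by simp
  obtain n :: nat where n: "M / norm (f a) < real n * (Re (h a) - e)"
    using reals_Archimedean3[OF d] by blast
  have "M / norm (f a) < exp (real n * (Re (h a) - e))"
    using n exp_ge_add_one_self[of "real n * (Re (h a) - e)"] by linarith
  then show False using main[of n] a by (simp add: field_simps)
qed

text \<open>Entire \<open>p n\<close> approximate \<open>Re (c * f)\<close> on the circle. The
  previous lemma carries this to the points where \<open>f\<close> is nonzero, and the maximum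
  principle makes the real parts of the \<open>p n\<close> a Cauchy sequence on the whole disc;
  derivative bounds upgrade this to the functions themselves. The limit lives across the zeros. The
  cases \<open>c = 1\<close> and \<open>c = - \<i>\<close> give the real and imaginary parts of
  \<open>f\<close>.\<close>

lemma real_part_extends:
  assumes s: "0 < s" "s < 1" and c: "norm c = 1"
  obtains F where "F holomorphic_on ball 0 s" "\<And>z. z \<in> ball 0 s \<Longrightarrow> f z \<noteq> 0 \<Longrightarrow> Re (F z) = Re (c * f z)"
proof -
  have cu: "continuous_on (sphere 0 1) (\<lambda>z. Re (c * f z))"
    by (intro continuous_intros continuous_on_subset[OF contf]) auto
  have "\<exists>p. p holomorphic_on UNIV \<and> (\<forall>z. norm z = 1 \<longrightarrow> \<bar>Re (c * f z) - Re (p z)\<bar> < 1 / real (Suc n))" for n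
    using circle_approx_real_part[OF cu, of "1 / real (Suc n)"] by (metis divide_pos_pos of_nat_0_less_iff zero_less_Suc zero_less_one)
  then obtain p where p: "\<And>n. p n holomorphic_on UNIV"
    "\<And>n z. norm z = 1 \<Longrightarrow> \<bar>Re (c * f z) - Re (p n z)\<bar> < 1 / real (Suc n)" by metis
  have hp: "p n holomorphic_on S" for n S using p(1) holomorphic_on_subset by blast
  have cp: "continuous_on S (p n)" for n S using hp holomorphic_on_imp_continuous_on by blast
  have fp: "\<bar>Re (c * f z) - Re (p n z)\<bar> \<le> 1 / real (Suc n)" if "z \<in> ball 0 1" "f z \<noteq> 0" for z n
  proof -
    have "Re (c * f z - p n z) \<le> 1 / real (Suc n)"
      by (rule real_part_le_on_nonzero[of "\<lambda>z. c * f z - p n z", OF _ _ _ that])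
        (use p(2)[of _ n] in \<open>auto intro!: less_imp_le holomorphic_intros continuous_intros hp holf[simplified] cp contf simp: abs_less_iff\<close>)
    moreover have "Re (p n z - c * f z) \<le> 1 / real (Suc n)"
      by (rule real_part_le_on_nonzero[of "\<lambda>z. p n z - c * f z", OF _ _ _ that])
        (use p(2)[of _ n] in \<open>auto intro!: less_imp_le holomorphic_intros continuous_intros hp holf[simplified] cp contf simp: abs_less_iff\<close>)
    ultimately show ?thesis by simp
  qed
  have pp: "\<bar>Re (p n z - p m z)\<bar> \<le> 1 / real (Suc n) + 1 / real (Suc m)" if "z \<in> ball 0 1" for z n m
  proof -
    have le: "Re (p n z - p m z) \<le> 1 / real (Suc n) + 1 / real (Suc m)" for n m
    proof (rule maximum_real_frontier[of "\<lambda>z. p n z - p m z" "ball 0 1"])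
      show "Re (p n z - p m z) \<le> 1 / real (Suc n) + 1 / real (Suc m)" if "z \<in> frontier (ball 0 1)" for z
        using p(2)[of z n] p(2)[of z m] that unfolding minus_complex.sel by (simp add: abs_less_iff)
    qed (use that in \<open>auto intro!: holomorphic_intros continuous_intros hp cp\<close>)
    show ?thesis using le[of n m] le[of m n] by (simp add: abs_le_iff)
  qed
  \<comment> \<open>Real parts determine the functions only up to imaginary constants, so the
    imaginary part at 0 is subtracted before convergence is claimed.\<close>
  define q where "q n z = p n z - \<i> * of_real (Im (p n 0))" for n z
  have hq: "q n holomorphic_on S" for n S unfolding q_def by (intro holomorphic_intros hp)
  have Req: "Re (q n z) = Re (p n z)" for n z by (simp add: q_def)
  \<comment> \<open>The first summand bounds the variation between 0 and a point of norm below 1,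
    the discs for the derivative bound having radius 1 - s; the second bounds the value at
    0.\<close>
  define C where "C = 18 / (1 - s) + 1"
  have C: "C > 0" using s by (simp add: C_def add_pos_pos)
  have qq: "norm (q n z - q m z) \<le> C * (1 / real (Suc n) + 1 / real (Suc m))" if z: "z \<in> ball 0 s" for z n m
  proof -
    define d where "d = 1 / real (Suc n) + 1 / real (Suc m)"
    have d: "d > 0" by (simp add: d_def add_pos_pos)
    let ?g = "\<lambda>z. q n z - q m z"
    have hg: "?g holomorphic_on S" for S by (intro holomorphic_intros hq)
    have "norm (?g z - ?g 0) \<le> (18 * d / (1 - s)) * norm (z - 0)"
    proof (rule field_differentiable_bound[of "ball 0 s"])
      show "(?g has_field_derivative deriv ?g w) (at w within ball 0 s)" for w
        using holomorphic_derivI[OF hg open_UNIV, of w] has_field_derivative_at_within by blast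
      show "norm (deriv ?g w) \<le> 18 * d / (1 - s)" if w: "w \<in> ball 0 s" for w
      proof (rule Re_deriv_bound[OF hg _ d])
        show "\<bar>Re (?g x)\<bar> \<le> d" if x: "x \<in> ball w (1 - s)" for x
        proof -
          have "norm x \<le> norm w + norm (x - w)" by (metis add.commute diff_add_cancel norm_triangle_ineq)
          then have "x \<in> ball 0 1" using x w by (simp add: dist_norm norm_minus_commute)
          then show ?thesis using pp[of x n m] by (simp add: d_def Req)
        qed
      qed (use s in auto)
    qed (use s z in auto)
    also have "\<dots> \<le> (18 * d / (1 - s)) * 1"
      using z s d by (intro mult_left_mono) auto
    finally have 1: "norm (?g z - ?g 0) \<le> 18 * d / (1 - s)" by simp
    have "?g 0 = of_real (Re (p n 0 - p m 0))" by (auto simp: q_def complex_eq_iff)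
    then have 2: "norm (?g 0) \<le> d" using pp[of 0 n m] by (simp only: norm_of_real d_def) auto
    have "norm (?g z) \<le> norm (?g z - ?g 0) + norm (?g 0)" by (metis diff_add_cancel norm_triangle_ineq)
    then have "norm (?g z) \<le> 18 * d / (1 - s) + d" using 1 2 by linarith
    also have "18 * d / (1 - s) + d = C * d" by (simp add: C_def algebra_simps)
    finally show ?thesis by (simp only: d_def)
  qed
  have "uniformly_Cauchy_on (ball 0 s) q"
    unfolding uniformly_Cauchy_on_def
  proof (intro allI impI)
    fix e :: real assume e: "e > 0"
    obtain M :: nat where M: "2 * C / e < real M" using reals_Archimedean2 by blast
    have "dist (q m x) (q n x) < e" if "x \<in> ball 0 s" "m \<ge> M" "n \<ge> M" for x m n
    proof -
      have Mp: "real M > 0" using M C e by (smt (verit) divide_pos_pos)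
      have "1 / real (Suc m) \<le> 1 / real M" "1 / real (Suc n) \<le> 1 / real M"
        using that Mp by (auto intro!: divide_left_mono)
      then have "C * (1 / real (Suc m) + 1 / real (Suc n)) \<le> C * (2 / real M)" using C by (intro mult_left_mono) auto
      also have "\<dots> < e" using M Mp e by (simp add: field_simps)
      finally show ?thesis using qq[OF that(1), of m n] by (simp add: dist_norm)
    qed
    then show "\<exists>M. \<forall>x\<in>ball 0 s. \<forall>m\<ge>M. \<forall>n\<ge>M. dist (q m x) (q n x) < e" by blast
  qed
  then obtain F where F: "uniform_limit (ball 0 s) q F sequentially"
    using uniformly_convergent_eq_Cauchy uniformly_convergent_on_def by blast
  have hF: "F holomorphic_on ball 0 s"
  proof (rule holomorphic_uniform_sequence[OF open_ball hq])
    fix x :: complex assume "x \<in> ball 0 s"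
    then obtain d where "d > 0" "cball x d \<subseteq> ball 0 s" using open_contains_cball open_ball by blast
    then show "\<exists>d>0. cball x d \<subseteq> ball 0 s \<and> uniform_limit (cball x d) q F sequentially"
      using F uniform_limit_on_subset by blast
  qed
  have "Re (F z) = Re (c * f z)" if z: "z \<in> ball 0 s" "f z \<noteq> 0" for z
  proof (rule LIMSEQ_unique)
    show "(\<lambda>n. Re (p n z)) \<longlonglongrightarrow> Re (F z)"
      using tendsto_Re[OF tendsto_uniform_limitI[OF F z(1)]] by (simp add: Req)
    have "(\<lambda>n. Re (c * f z) - Re (p n z)) \<longlonglongrightarrow> 0"
    proof (rule Lim_null_comparison)
      show "\<forall>\<^sub>F n in sequentially. norm (Re (c * f z) - Re (p n z)) \<le> 1 / real (Suc n)"
        using fp[of z] z s by auto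
      show "(\<lambda>n. 1 / real (Suc n)) \<longlonglongrightarrow> 0" by (rule LIMSEQ_Suc[OF lim_1_over_n])
    qed
    from tendsto_diff[OF tendsto_const[of "Re (c * f z)"] this]
    show "(\<lambda>n. Re (p n z)) \<longlonglongrightarrow> Re (c * f z)" by simp
  qed
  then show thesis using that hF by blast
qed

text \<open>\<open>F\<close> and \<open>G\<close> are holomorphic with real parts Re f and Im f off
  the zeros of \<open>f\<close>. There G + iF has derivative 0, hence it is constant on the whole
  disc, and \<open>F\<close> plus a constant is a holomorphic \<open>H\<close> equal to
  \<open>f\<close> where \<open>f\<close> is nonzero. It remains to see that \<open>H\<close>
  vanishes where \<open>f\<close> does.\<close>

lemma rado_inner:
  assumes s: "0 < s" "s < 1"
  shows "f holomorphic_on ball 0 s"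
proof (cases "\<forall>z\<in>ball 0 s. f z = 0")
  case True
  then show ?thesis by (metis holomorphic_on_const holomorphic_cong)
next
  case False
  define W where "W = {z \<in> ball 0 s. f z \<noteq> 0}"
  have "W = ball 0 s \<inter> {z \<in> ball 0 1. f z \<noteq> 0}" using s by (auto simp: W_def)
  then have W: "open W" "W \<noteq> {}" "W \<subseteq> ball 0 s" using open_nonzero False by (auto simp: W_def)
  have hfW: "f holomorphic_on W"
    by (rule holomorphic_on_subset[OF holf]) (use s in \<open>auto simp: W_def\<close>)
  obtain F where F0: "F holomorphic_on ball 0 s"
      "\<And>z. z \<in> ball 0 s \<Longrightarrow> f z \<noteq> 0 \<Longrightarrow> Re (F z) = Re (1 * f z)"
    using real_part_extends[OF s norm_one] by blast
  have ni: "norm (- \<i>) = 1" by simp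
  obtain G where G0: "G holomorphic_on ball 0 s"
      "\<And>z. z \<in> ball 0 s \<Longrightarrow> f z \<noteq> 0 \<Longrightarrow> Re (G z) = Re (- \<i> * f z)"
    using real_part_extends[OF s ni] by blast
  have F: "F holomorphic_on ball 0 s" "\<And>z. z \<in> W \<Longrightarrow> Re (F z) = Re (f z)"
    and G: "G holomorphic_on ball 0 s" "\<And>z. z \<in> W \<Longrightarrow> Re (G z) = Im (f z)"
    using F0 G0 by (auto simp: W_def)
  have const: "deriv g z = 0" if g: "g holomorphic_on W" "\<And>z. z \<in> W \<Longrightarrow> Re (g z) = 0" and z: "z \<in> W" for g z
  proof -
    obtain r where r: "r > 0" "ball z r \<subseteq> W" using W(1) z openE by blast
    have "norm (deriv g z) \<le> 18 * d / r" if "d > 0" for d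
    proof (rule Re_deriv_bound[OF _ r(1) that])
      show "g holomorphic_on ball z r" using g(1) r(2) by (rule holomorphic_on_subset)
      show "\<bar>Re (g w)\<bar> \<le> d" if "w \<in> ball z r" for w
        using g(2)[of w] r(2) that \<open>d > 0\<close> by (simp add: subsetD)
    qed
    from this[of "r * e / 18" for e] have "norm (deriv g z) \<le> 0 + e" if "e > 0" for e
      using that r(1) by simp
    then have "norm (deriv g z) \<le> 0" by (rule field_le_epsilon)
    then show ?thesis by simp
  qed
  have dF: "deriv F z = deriv f z" "deriv G z = - \<i> * deriv f z" if z: "z \<in> W" for z
  proof -
    have zs: "z \<in> ball 0 s" using z W by auto
    have d: "(f has_field_derivative deriv f z) (at z)" "(F has_field_derivative deriv F z) (at z)"
       "(G has_field_derivative deriv G z) (at z)"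
      using holomorphic_derivI[OF hfW W(1) z] holomorphic_derivI[OF F(1) open_ball zs]
        holomorphic_derivI[OF G(1) open_ball zs] by auto
    have hFW: "F holomorphic_on W" "G holomorphic_on W" using F G W holomorphic_on_subset by blast+
    have "deriv (\<lambda>z. F z - f z) z = 0"
      by (rule const[OF _ _ z]) (use F hfW hFW in \<open>auto intro!: holomorphic_intros\<close>)
    moreover have "deriv (\<lambda>z. F z - f z) z = deriv F z - deriv f z"
      by (rule DERIV_imp_deriv) (auto intro!: derivative_eq_intros d)
    ultimately show "deriv F z = deriv f z" by simp
    have "deriv (\<lambda>z. G z + \<i> * f z) z = 0"
      by (rule const[OF _ _ z]) (use G hfW hFW in \<open>auto intro!: holomorphic_intros\<close>)
    moreover have "deriv (\<lambda>z. G z + \<i> * f z) z = deriv G z + \<i> * deriv f z"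
      by (rule DERIV_imp_deriv) (auto intro!: derivative_eq_intros d)
    ultimately show "deriv G z = - \<i> * deriv f z" by (simp add: add_eq_0_iff)
  qed
  have hGF: "(\<lambda>z. G z + \<i> * F z) holomorphic_on ball 0 s" by (intro holomorphic_intros F G)
  have "deriv (\<lambda>z. G z + \<i> * F z) z = 0" if "z \<in> ball 0 s" for z
  proof (rule analytic_continuation_open[of W "ball 0 s" "deriv (\<lambda>z. G z + \<i> * F z)" "\<lambda>_. 0"])
    show "deriv (\<lambda>z. G z + \<i> * F z) z = 0" if z: "z \<in> W" for z
    proof -
      have zs: "z \<in> ball 0 s" using z W by auto
      have "deriv (\<lambda>z. G z + \<i> * F z) z = deriv G z + \<i> * deriv F z"
        using holomorphic_derivI[OF F(1) open_ball zs] holomorphic_derivI[OF G(1) open_ball zs]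
        by (intro DERIV_imp_deriv) (auto intro!: derivative_eq_intros)
      then show ?thesis using dF[OF z] by simp
    qed
  qed (use W that holomorphic_deriv[OF hGF] in auto)
  then have "(\<lambda>z. G z + \<i> * F z) constant_on ball 0 s"
    using holomorphic_derivI[OF hGF open_ball]
    by (intro has_field_derivative_0_imp_constant_on) force+
  then obtain c where c: "\<And>z. z \<in> ball 0 s \<Longrightarrow> G z + \<i> * F z = c" by (auto simp: constant_on_def)
  \<comment> \<open>Taking real parts in G + iF = c gives Im f = Im F + Re c on
    \<open>W\<close>.\<close>
  define H where "H z = F z + \<i> * of_real (Re c)" for z
  have hH: "H holomorphic_on ball 0 s" unfolding H_def by (intro holomorphic_intros F)
  have fH: "f z = H z" if "z \<in> W" for z
  proof -
    have "Re (G z) = Im (F z) + Re c" using arg_cong[OF c[of z], of Re] that W by auto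
    then show ?thesis using F(2)[OF that] G(2)[OF that] by (auto simp: H_def complex_eq_iff)
  qed
  define U where "U = {z \<in> ball 0 s. H z \<noteq> 0}"
  \<comment> \<open>A nonconstant \<open>H\<close> has countably many zeros, so its nonzero set
    \<open>U\<close> is connected. In it \<open>W\<close> is open, and closed as the set where
    \<open>f\<close> and \<open>H\<close> agree: at a point of \<open>U\<close> agreement forces
    \<open>f\<close> to be nonzero.\<close>
  have nc: "W = U" if nz: "\<not> H constant_on ball 0 s"
  proof -
    obtain C :: "nat \<Rightarrow> complex set" where "\<And>n. compact (C n)" "(\<Union>n. C n) = ball (0::complex) s"
      using open_Union_compact_subsets[OF open_ball[of "0::complex" s]] by metis
    then have "fsigma (ball (0::complex) s)" unfolding fsigma_Union_compact by (intro exI[of _ C]) auto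
    then have "countable {z \<in> ball 0 s. H z = 0}"
      by (rule holomorphic_countable_zeros[OF hH open_ball connected_ball _ nz])
    then have "connected (ball 0 s - {z \<in> ball 0 s. H z = 0})"
      by (intro connected_open_diff_countable) auto
    moreover have "ball 0 s - {z \<in> ball 0 s. H z = 0} = U" by (auto simp: U_def)
    ultimately have cU: "connected U" by simp
    have WU: "W \<subseteq> U"
    proof
      fix z assume z: "z \<in> W"
      then show "z \<in> U" using fH[OF z] by (simp add: W_def U_def)
    qed
    have contH: "continuous_on U H"
      by (rule continuous_on_subset[OF holomorphic_on_imp_continuous_on[OF hH]]) (auto simp: U_def)
    have contfU: "continuous_on U f"
      by (rule continuous_on_subset[OF contf]) (use s in \<open>auto simp: U_def\<close>)
    have "closedin (top_of_set U) {z \<in> U. f z - H z = 0}"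
      by (rule continuous_closedin_preimage_constant) (intro continuous_intros contH contfU)
    moreover have "{z \<in> U. f z - H z = 0} = W"
    proof (intro equalityI subsetI)
      fix z assume "z \<in> {z \<in> U. f z - H z = 0}"
      then have "f z \<noteq> 0" "z \<in> ball 0 s" by (auto simp: U_def)
      then show "z \<in> W" by (simp add: W_def)
    next
      fix z assume z: "z \<in> W"
      then show "z \<in> {z \<in> U. f z - H z = 0}" using WU fH[OF z] by auto
    qed
    ultimately have "closedin (top_of_set U) W" by simp
    moreover have "openin (top_of_set U) W" using W WU by (simp add: open_subset)
    ultimately show "W = U" using cU W by (auto simp: connected_clopen)
  qed
  have "f z = H z" if z: "z \<in> ball 0 s" for z
  proof (cases "H constant_on ball 0 s")
    case False
    show ?thesis
    proof (cases "z \<in> W")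
      case True then show ?thesis by (rule fH)
    next
      case nW: False
      then have "z \<notin> U" using nc[OF False] by simp
      then show ?thesis using nW z by (simp add: U_def W_def)
    qed
  next
    case True
    then obtain k where k: "\<And>z. z \<in> ball 0 s \<Longrightarrow> H z = k" by (auto simp: constant_on_def)
    have "continuous_on (ball 0 s) f" using contf s by (rule_tac continuous_on_subset) auto
    then have "closedin (top_of_set (ball 0 s)) {z \<in> ball 0 s. f z = k}"
      by (rule continuous_closedin_preimage_constant)
    moreover have "{z \<in> ball 0 s. f z = k} = W"
    proof (intro equalityI subsetI)
      obtain w where w: "w \<in> W" using W by blast
      have "k \<noteq> 0" using fH[OF w] k[of w] w by (simp add: W_def)
      fix z assume "z \<in> {z \<in> ball 0 s. f z = k}"
      then show "z \<in> W" using \<open>k \<noteq> 0\<close> by (simp add: W_def)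
    next
      fix z assume z: "z \<in> W"
      then show "z \<in> {z \<in> ball 0 s. f z = k}" using k[of z] fH[OF z] W(3) by auto
    qed
    moreover have "openin (top_of_set (ball 0 s)) W" using W by (simp add: open_subset)
    ultimately have "W = ball 0 s" using W connected_ball[of 0 s] by (auto simp: connected_clopen)
    then show ?thesis using fH[of z] z by blast
  qed
  then show ?thesis using hH by (metis holomorphic_cong)
qed

end

theorem rado:
  assumes S: "open S" and contf: "continuous_on S f" and holf: "f holomorphic_on {z \<in> S. f z \<noteq> 0}"
  shows "f holomorphic_on S"
proof -
  have "\<exists>e>0. f holomorphic_on ball a e" if "a \<in> S" for a
  proof -
    obtain r where r: "r > 0" "cball a r \<subseteq> S" using S \<open>a \<in> S\<close> open_contains_cball_eq by metis
    let ?k = "\<lambda>z. a + of_real r * z"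
    have k: "?k z \<in> S" if "z \<in> cball 0 1" for z
    proof -
      have "?k z \<in> cball a r" using that r by (simp add: dist_norm norm_mult)
      then show ?thesis using r by blast
    qed
    have "(\<lambda>z. f (?k z)) holomorphic_on ball 0 (1/2)"
    proof (rule rado_inner)
      show "continuous_on (cball 0 1) (\<lambda>z. f (?k z))"
        by (rule continuous_on_compose2[OF contf]) (use k in \<open>auto intro!: continuous_intros\<close>)
      have "(f \<circ> ?k) holomorphic_on {z \<in> ball 0 1. f (?k z) \<noteq> 0}"
        by (rule holomorphic_on_compose_gen[OF _ holf]) (use k in \<open>auto intro!: holomorphic_intros\<close>)
      then show "(\<lambda>z. f (?k z)) holomorphic_on {z \<in> ball 0 1. f (?k z) \<noteq> 0}" by (simp add: o_def)
    qed auto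
    then have *: "(\<lambda>z. f (?k z)) holomorphic_on ball 0 (1/2)" .
    have "((\<lambda>z. f (?k z)) \<circ> (\<lambda>w. (w - a) / of_real r)) holomorphic_on ball a (r/2)"
    proof (rule holomorphic_on_compose_gen[OF _ *])
      show "(\<lambda>w. (w - a) / of_real r) holomorphic_on ball a (r/2)"
        using r by (intro holomorphic_intros) auto
      show "(\<lambda>w. (w - a) / of_real r) ` ball a (r/2) \<subseteq> ball 0 (1/2)"
        using r by (auto simp: norm_divide dist_norm norm_minus_commute field_simps)
    qed
    moreover have "(\<lambda>z. f (?k z)) \<circ> (\<lambda>w. (w - a) / of_real r) = f" using r by (simp add: fun_eq_iff)
    ultimately show ?thesis using r by (intro exI[of _ "r/2"]) simp
  qed
  then have "f analytic_on S" by (simp add: analytic_on_def)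
  then show ?thesis by (rule analytic_imp_holomorphic)
qed

no_notation fps_nth (infixl \<open>$\<close> 75)

section \<open>Functions of several complex variables\<close>

text \<open>The pointwise form of the given notion, so that chain rules apply at a single point.
  Complex homogeneity is a separate clause because the Frechet derivative is only real
  linear.\<close>

definition cdiff :: "(complex^'n \<Rightarrow> complex) \<Rightarrow> complex^'n \<Rightarrow> bool" where
  "cdiff f x \<longleftrightarrow> (\<exists>D. (f has_derivative D) (at x) \<and> (\<forall>c v. D (c *s v) = c * D v))"

definition cdiffv :: "(complex^'n \<Rightarrow> complex^'m) \<Rightarrow> complex^'n \<Rightarrow> bool" where
  "cdiffv f x \<longleftrightarrow> (\<exists>D. (f has_derivative D) (at x) \<and> (\<forall>c v. D (c *s v) = c *s D v))"

section \<open>Calculus of complex differentiable functions\<close>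

lemma holomorphic_fun_on_cdiff: "holomorphic_fun_on f S \<longleftrightarrow> (\<forall>x\<in>S. cdiff f x)"
  by (simp add: holomorphic_fun_on_def cdiff_def)

lemma holomorphic_map_on_cdiffv: "holomorphic_map_on f S \<longleftrightarrow> (\<forall>x\<in>S. cdiffv f x)"
  by (simp add: holomorphic_map_on_def cdiffv_def)

lemma bounded_linear_axis: "bounded_linear (axis i :: complex \<Rightarrow> complex^'n)"
  unfolding linear_conv_bounded_linear[symmetric]
  by (rule linearI) (auto simp: axis_def vec_eq_iff)

lemma bounded_linear_smult: "bounded_linear (\<lambda>c::complex. c *s (v::complex^'n))"
  unfolding linear_conv_bounded_linear[symmetric]
  by (rule linearI) (auto simp: vec_eq_iff algebra_simps)

lemma norm_smult: "norm (c *s (v::complex^'n)) = norm c * norm v"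
  by (simp add: norm_vec_def norm_mult L2_set_right_distrib)

lemma continuous_on_smult [continuous_intros]:
  "continuous_on S f \<Longrightarrow> continuous_on S g \<Longrightarrow> continuous_on S (\<lambda>x. (f x :: complex) *s (g x :: complex^'n))"
  unfolding vector_scalar_mult_def by (intro continuous_intros)

lemma has_derivative_vecI:
  fixes f :: "'a::real_normed_vector \<Rightarrow> complex^'n"
  assumes "\<And>i. ((\<lambda>x. f x $ i) has_derivative (\<lambda>h. D h $ i)) F"
  shows "(f has_derivative D) F"
proof -
  have eq: "f = (\<lambda>x. \<Sum>i\<in>UNIV. axis i (f x $ i))" "D = (\<lambda>h. \<Sum>i\<in>UNIV. axis i (D h $ i))"
    by (auto simp: fun_eq_iff vec_eq_iff axis_def if_distrib sum.delta cong: if_cong)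
  show ?thesis
    by (subst eq(1), subst eq(2))
      (intro has_derivative_sum bounded_linear.has_derivative[OF bounded_linear_axis] assms)
qed

lemma cdiffv_iff: "cdiffv f x \<longleftrightarrow> (\<forall>i. cdiff (\<lambda>x. f x $ i) x)"
proof
  assume "cdiffv f x"
  then obtain D where D: "(f has_derivative D) (at x)" "\<And>c v. D (c *s v) = c *s D v"
    by (auto simp: cdiffv_def)
  show "\<forall>i. cdiff (\<lambda>x. f x $ i) x"
  proof
    fix i
    show "cdiff (\<lambda>x. f x $ i) x" unfolding cdiff_def
      by (rule exI, rule conjI, rule bounded_linear.has_derivative[OF bounded_linear_vec_nth D(1)]) (simp add: D)
  qed
next
  assume "\<forall>i. cdiff (\<lambda>x. f x $ i) x"
  then obtain D where D: "\<And>i. ((\<lambda>x. f x $ i) has_derivative D i) (at x)" "\<And>i c v. D i (c *s v) = c * D i v"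
    unfolding cdiff_def by metis
  show "cdiffv f x" unfolding cdiffv_def
  proof (intro exI conjI)
    show "(f has_derivative (\<lambda>h. \<chi> i. D i h)) (at x)" by (rule has_derivative_vecI) (simp add: D)
  qed (simp add: D vec_eq_iff)
qed

lemma cdiffv_isCont: "cdiffv f x \<Longrightarrow> isCont f x"
  unfolding cdiffv_def using has_derivative_continuous by blast

lemma cdiff_isCont: "cdiff f x \<Longrightarrow> isCont f x"
  unfolding cdiff_def using has_derivative_continuous by blast

lemma cdiffv_compose:
  assumes "cdiffv f x" "cdiffv g (f x)" shows "cdiffv (\<lambda>x. g (f x)) x"
proof -
  obtain D E where D: "(f has_derivative D) (at x)" "\<And>c v. D (c *s v) = c *s D v"
    "(g has_derivative E) (at (f x))" "\<And>c v. E (c *s v) = c *s E v" using assms by (auto simp: cdiffv_def)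
  show ?thesis unfolding cdiffv_def
    by (rule exI, rule conjI, rule has_derivative_compose[OF D(1,3)]) (simp add: D)
qed

lemma cdiff_compose:
  assumes "cdiffv f x" "cdiff g (f x)" shows "cdiff (\<lambda>x. g (f x)) x"
proof -
  obtain D E where D: "(f has_derivative D) (at x)" "\<And>c v. D (c *s v) = c *s D v"
    "(g has_derivative E) (at (f x))" "\<And>c v. E (c *s v) = c * E v"
    using assms by (auto simp: cdiffv_def cdiff_def)
  show ?thesis unfolding cdiff_def
    by (rule exI, rule conjI, rule has_derivative_compose[OF D(1,3)]) (simp add: D)
qed

lemma has_derivative_transform_nhds:
  assumes "(f has_derivative D) (at x)" "\<forall>\<^sub>F y in nhds x. f y = g y"
  shows "(g has_derivative D) (at x)"
proof -
  have "\<forall>\<^sub>F y in at x. f y = g y" using assms(2) by (simp add: eventually_at_filter eventually_mono)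
  then show ?thesis
    using has_derivative_transform_eventually[OF assms(1)] eventually_nhds_x_imp_x[OF assms(2)] by simp
qed

lemma cdiff_transform: "cdiff f x \<Longrightarrow> \<forall>\<^sub>F y in nhds x. f y = g y \<Longrightarrow> cdiff g x"
  unfolding cdiff_def using has_derivative_transform_nhds by blast

lemma cdiffv_transform: "cdiffv f x \<Longrightarrow> \<forall>\<^sub>F y in nhds x. f y = g y \<Longrightarrow> cdiffv g x"
  unfolding cdiffv_def using has_derivative_transform_nhds by blast

lemma cdiff_const [simp]: "cdiff (\<lambda>_. c) x"
  unfolding cdiff_def by (intro exI[of _ "\<lambda>_. 0"]) auto

lemma cdiff_nth [simp]: "cdiff (\<lambda>x. x $ i) x"
  unfolding cdiff_def
  by (intro exI[of _ "\<lambda>v. v $ i"] conjI bounded_linear_imp_has_derivative bounded_linear_vec_nth) auto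

lemma cdiffv_ident [simp]: "cdiffv (\<lambda>x. x) x"
  by (simp add: cdiffv_iff)

lemma cdiff_field_compose:
  assumes "cdiff f x" "(g has_field_derivative g') (at (f x))"
  shows "cdiff (\<lambda>x. g (f x)) x"
proof -
  obtain D where D: "(f has_derivative D) (at x)" "\<And>c v. D (c *s v) = c * D v"
    using assms by (auto simp: cdiff_def)
  have "((\<lambda>x. g (f x)) has_derivative (\<lambda>h. g' * D h)) (at x)"
    using has_derivative_compose[OF D(1), of g "(*) g'"] assms(2) by (simp add: has_field_derivative_def)
  then show ?thesis unfolding cdiff_def using D(2) by (intro exI[of _ "\<lambda>h. g' * D h"]) auto
qed

lemma cdiff_add:
  assumes "cdiff f x" "cdiff g x" shows "cdiff (\<lambda>x. f x + g x) x"
proof -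
  obtain D E where D: "(f has_derivative D) (at x)" "\<And>c v. D (c *s v) = c * D v"
    "(g has_derivative E) (at x)" "\<And>c v. E (c *s v) = c * E v" using assms by (auto simp: cdiff_def)
  show ?thesis unfolding cdiff_def
    by (rule exI, rule conjI, rule has_derivative_add[OF D(1,3)]) (simp add: D algebra_simps)
qed

lemma cdiff_mult:
  assumes "cdiff f x" "cdiff g x" shows "cdiff (\<lambda>x. f x * g x) x"
proof -
  obtain D E where D: "(f has_derivative D) (at x)" "\<And>c v. D (c *s v) = c * D v"
    "(g has_derivative E) (at x)" "\<And>c v. E (c *s v) = c * E v" using assms by (auto simp: cdiff_def)
  show ?thesis unfolding cdiff_def
    by (rule exI, rule conjI, rule has_derivative_mult[OF D(1,3)]) (simp add: D algebra_simps)
qed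

lemma cdiff_power: "cdiff f x \<Longrightarrow> cdiff (\<lambda>x. f x ^ n) x"
  by (induction n) (auto intro: cdiff_mult)

lemma cdiff_diff:
  assumes "cdiff f x" "cdiff g x" shows "cdiff (\<lambda>x. f x - g x) x"
  using cdiff_add[OF assms(1) cdiff_mult[OF cdiff_const[of "-1"] assms(2)]] by simp

lemma cdiff_divide:
  assumes "cdiff f x" "cdiff g x" "g x \<noteq> 0" shows "cdiff (\<lambda>x. f x / g x) x"
proof -
  have "cdiff (\<lambda>x. inverse (g x)) x"
    by (rule cdiff_field_compose[OF assms(2)]) (use assms(3) in \<open>auto intro!: derivative_eq_intros\<close>)
  from cdiff_mult[OF assms(1) this] show ?thesis by (simp add: field_class.field_divide_inverse)
qed

lemma cdiffv_add: "cdiffv f x \<Longrightarrow> cdiffv g x \<Longrightarrow> cdiffv (\<lambda>x. f x + g x) x"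
  unfolding cdiffv_iff by (auto intro: cdiff_add)

lemma cdiffv_const [simp]: "cdiffv (\<lambda>_. c) x" by (simp add: cdiffv_iff)

lemma has_derivative_complex_field:
  assumes "(f has_derivative D) (at z)" "\<And>c v::complex. D (c * v) = c * D v"
  shows "(f has_field_derivative D 1) (at z)"
proof -
  have "D c = D 1 * c" for c
    using assms(2)[of c 1] by (metis mult.commute mult_1_right)
  then have "D = (*) (D 1)" by (rule ext)
  then show ?thesis using assms(1) by (simp add: has_field_derivative_def)
qed

text \<open>Curves in \<open>\<complex>\<^sup>n\<close>: the derivative \<open>v\<close> is a vector, acting by \<open>s \<mapsto> s *s v\<close> as in
  \<^const>\<open>has_velocity\<close>.\<close>

lemma cdiff_curve:
  assumes "cdiff f (g z)" "(g has_derivative (\<lambda>s. s *s v)) (at z)"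
  shows "(\<lambda>z. f (g z)) field_differentiable (at z)"
proof -
  obtain D where D: "(f has_derivative D) (at (g z))" "\<And>c v. D (c *s v) = c * D v"
    using assms by (auto simp: cdiff_def)
  have "((\<lambda>z. f (g z)) has_derivative (\<lambda>s. D (s *s v))) (at z)"
    by (rule has_derivative_compose[OF assms(2) D(1)])
  from has_derivative_complex_field[OF this] D(2) show ?thesis
    by (auto simp: field_differentiable_def)
qed

lemma has_derivative_curve:
  fixes g :: "complex \<Rightarrow> complex^'n"
  assumes "\<And>i. ((\<lambda>z. g z $ i) has_field_derivative (v $ i)) (at z)"
  shows "(g has_derivative (\<lambda>s. s *s v)) (at z)"
proof (rule has_derivative_vecI)
  fix i
  have "(\<lambda>h. (h *s v) $ i) = (*) (v $ i)" by (auto simp: fun_eq_iff)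
  then show "((\<lambda>z. g z $ i) has_derivative (\<lambda>h. (h *s v) $ i)) (at z)"
    using assms[of i] by (simp add: has_field_derivative_def)
qed

lemma has_derivative_line: "((\<lambda>z. x + z *s v) has_derivative (\<lambda>s. s *s (v::complex^'n))) (at z)"
proof -
  have "((\<lambda>z. z *s v) has_derivative (\<lambda>s. s *s v)) (at z)"
    by (rule bounded_linear_imp_has_derivative[OF bounded_linear_smult])
  from has_derivative_add[OF has_derivative_const[of x] this] show ?thesis by simp
qed

lemma cdiff_line:
  assumes "cdiff f (x + z *s v)"
  shows "(\<lambda>z. f (x + z *s v)) field_differentiable (at z)"
  by (rule cdiff_curve[OF assms has_derivative_line])

subsection \<open>Holomorphic dependence on parameters\<close>

text \<open>Cauchy's formula over one fixed circle writes the derivative as an integral whose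
  integrand is jointly continuous in the point and the parameter. This is the source of all C^1
  statements below.\<close>

lemma deriv_continuous_param:
  fixes f :: "complex \<Rightarrow> 'b::t2_space \<Rightarrow> complex"
  assumes "open U" and cont: "continuous_on (U \<times> B) (\<lambda>(z, b). f z b)"
    and hol: "\<And>b. b \<in> B \<Longrightarrow> (\<lambda>z. f z b) holomorphic_on U"
  shows "continuous_on (U \<times> B) (\<lambda>(z, b). deriv (\<lambda>z. f z b) z)"
  unfolding continuous_on_eq_continuous_within
proof (intro ballI, elim SigmaE, hypsubst)
  fix z0 b0 assume z0: "z0 \<in> U" and b0: "b0 \<in> B"
  obtain r where r: "r > 0" "cball z0 r \<subseteq> U" using \<open>open U\<close> z0 open_contains_cball_eq by metis
  let ?c = "\<lambda>t::real. circlepath z0 r t"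
  define G where "G p t = f (?c t) (snd p) / (?c t - fst p)\<^sup>2 * (2 * pi * \<i> * r * exp (2 * of_real pi * \<i> * t))"
    for p :: "complex \<times> 'b" and t :: real
  have c: "?c t \<in> sphere z0 r" for t using r by (simp add: circlepath dist_norm norm_mult norm_exp_eq_Re)
  have cc: "continuous_on S ?c" for S unfolding circlepath by (intro continuous_intros)
  have eq: "deriv (\<lambda>z. f z b) z = integral (cbox 0 1) (G (z, b)) / (2 * pi * \<i>)" if z: "z \<in> ball z0 r" and b: "b \<in> B" for z b
  proof -
    have h: "(\<lambda>z. f z b) holomorphic_on cball z0 r" using hol[OF b] r(2) by (rule holomorphic_on_subset)
    have "contour_integral (circlepath z0 r) (\<lambda>u. f u b/(u-z)^2) = (2 * pi * \<i>) * deriv (\<lambda>z. f z b) z"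
      by (rule Cauchy_contour_integral_circlepath_2[OF holomorphic_on_imp_continuous_on[OF h] _ z])
         (rule holomorphic_on_subset[OF h], auto)
    also have "contour_integral (circlepath z0 r) (\<lambda>u. f u b/(u-z)^2) = integral (cbox 0 1) (G (z, b))"
      unfolding contour_integral_integral G_def
      by (auto intro!: integral_cong simp: vector_derivative_circlepath)
    finally show ?thesis by simp
  qed
  have "continuous_on (ball z0 r \<times> B) (\<lambda>p. integral (cbox 0 1) (G p))"
  proof (rule integral_continuous_on_param)
    have "continuous_on ((ball z0 r \<times> B) \<times> cbox 0 1) (\<lambda>q. (case (?c (snd q), snd (fst q)) of (z, b) \<Rightarrow> f z b))"
      by (rule continuous_on_compose2[OF cont])
        (use c r in \<open>auto intro!: continuous_intros continuous_on_compose2[OF cc[of UNIV]] simp: subset_iff\<close>)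
    then have "continuous_on ((ball z0 r \<times> B) \<times> cbox 0 1) (\<lambda>q. f (?c (snd q)) (snd (fst q)))" by simp
    then show "continuous_on ((ball z0 r \<times> B) \<times> cbox 0 1) (\<lambda>(p, t). G p t)"
      unfolding G_def split_beta
      by (intro continuous_intros continuous_on_compose2[OF cc[of UNIV]])
        (use c in \<open>auto simp: dist_norm\<close>)
  qed
  then have "continuous_on (ball z0 r \<times> B) (\<lambda>(z, b). deriv (\<lambda>z. f z b) z)"
    by (rule continuous_on_eq[OF continuous_on_divide[OF _ continuous_on_const[of _ "2 * pi * \<i>"]]]) (auto simp: eq)
  then have "continuous (at (z0, b0) within ball z0 r \<times> B) (\<lambda>(z, b). deriv (\<lambda>z. f z b) z)"
    using r b0 by (auto simp: continuous_on_eq_continuous_within)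
  moreover have "at (z0, b0) within ball z0 r \<times> B = at (z0, b0) within U \<times> B"
    by (rule at_within_nhd[of _ "ball z0 r \<times> UNIV"]) (use r in \<open>auto intro: open_Times\<close>)
  ultimately show "continuous (at (z0, b0) within U \<times> B) (\<lambda>(z, b). deriv (\<lambda>z. f z b) z)" by simp
qed

text \<open>Differentiation under the integral needs the derivative to be jointly continuous, which
  joint continuity of the integrand already implies by the previous lemma.\<close>

lemma integral_holomorphic:
  fixes f :: "complex \<Rightarrow> 'b::euclidean_space \<Rightarrow> complex"
  assumes U: "open U" and cont: "continuous_on (U \<times> cbox a b) (\<lambda>(z, t). f z t)"
    and hol: "\<And>t. t \<in> cbox a b \<Longrightarrow> (\<lambda>z. f z t) holomorphic_on U"
  shows "(\<lambda>z. integral (cbox a b) (f z)) holomorphic_on U"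
proof -
  have "(\<lambda>z. integral (cbox a b) (f z)) holomorphic_on ball z0 r" if r: "ball z0 r \<subseteq> U" for z0 r
  proof (rule leibniz_rule_holomorphic)
    show "((\<lambda>z. f z t) has_field_derivative deriv (\<lambda>z. f z t) z) (at z within ball z0 r)"
      if "z \<in> ball z0 r" "t \<in> cbox a b" for z t
      using holomorphic_derivI[OF hol[OF that(2)] U] that(1) r by blast
    show "f z integrable_on cbox a b" if "z \<in> ball z0 r" for z
    proof (rule integrable_continuous)
      have "continuous_on (cbox a b) (\<lambda>t. case (z, t) of (z, t) \<Rightarrow> f z t)"
        by (rule continuous_on_compose2[OF cont]) (use that r in \<open>auto intro!: continuous_intros\<close>)
      then show "continuous_on (cbox a b) (f z)" by simp
    qed
    show "continuous_on (ball z0 r \<times> cbox a b) (\<lambda>(z, t). deriv (\<lambda>z. f z t) z)"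
      by (rule continuous_on_subset[OF deriv_continuous_param[OF U cont hol]]) (use r in auto)
  qed auto
  then have "(\<lambda>z. integral (cbox a b) (f z)) analytic_on U"
    unfolding analytic_on_def using U openE by metis
  then show ?thesis by (rule analytic_imp_holomorphic)
qed

section \<open>Two complex variables and regularity of derivatives\<close>

definition vec2 :: "complex \<Rightarrow> complex \<Rightarrow> complex^2" where
  "vec2 a b = (\<chi> i. if i = 1 then a else b)"

lemma vec2_nth [simp]: "vec2 a b $ 1 = a" "vec2 a b $ 2 = b"
  by (simp_all add: vec2_def)

lemma vec2_eta: "vec2 (x $ 1) (x $ 2) = x"
  by (simp add: vec2_def vec_eq_iff forall_2)

lemma vec2_eq_iff: "vec2 a b = vec2 c d \<longleftrightarrow> a = c \<and> b = d"
  by (metis vec2_nth)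

lemma vec2_0: "vec2 0 0 = 0" by (simp add: vec_eq_iff forall_2)

lemma continuous_on_vec2 [continuous_intros]:
  "continuous_on S f \<Longrightarrow> continuous_on S g \<Longrightarrow> continuous_on S (\<lambda>x. vec2 (f x) (g x))"
  unfolding vec2_def
proof (rule continuous_on_vec_lambda)
  fix i :: 2
  assume "continuous_on S f" "continuous_on S g"
  then show "continuous_on S (\<lambda>x. if i = 1 then f x else g x)" by (cases "i = 1") auto
qed

lemma open_bidisc: "open U \<Longrightarrow> open V \<Longrightarrow> open {x::complex^2. x $ 1 \<in> U \<and> x $ 2 \<in> V}"
  by (intro open_Collect_conj open_vimage[unfolded vimage_def] continuous_intros) auto

text \<open>A function with two partial derivatives is differentiable as soon as one of them is
  jointly continuous, and the derivative in the second variable is.\<close>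

lemma osgood:
  assumes U: "open U" and V: "open V" and cont: "continuous_on (U \<times> V) (\<lambda>(z, w). g z w)"
    and h1: "\<And>w. w \<in> V \<Longrightarrow> (\<lambda>z. g z w) holomorphic_on U"
    and h2: "\<And>z. z \<in> U \<Longrightarrow> g z holomorphic_on V"
    and x: "x $ 1 \<in> U" "x $ 2 \<in> V"
  shows "cdiff (\<lambda>x. g (x $ 1) (x $ 2)) x"
proof -
  obtain r where r: "r > 0" "ball (x $ 2) r \<subseteq> V" using V x openE by metis
  let ?V = "ball (x $ 2) r"
  have c2: "continuous_on (V \<times> U) (\<lambda>(w, z). deriv (g z) w)"
  proof (rule deriv_continuous_param[OF V])
    have "continuous_on (V \<times> U) (\<lambda>p. case (snd p, fst p) of (z, w) \<Rightarrow> g z w)"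
      by (rule continuous_on_compose2[OF cont]) (auto intro!: continuous_intros)
    then show "continuous_on (V \<times> U) (\<lambda>(w, z). g z w)" by (simp add: split_beta)
  qed (rule h2)
  define a where "a = deriv (\<lambda>z. g z (x $ 2)) (x $ 1)"
  have "((\<lambda>(z, w). g z w) has_derivative
      (\<lambda>(tx, ty). a * tx + blinfun_mult_right (deriv (g (x $ 1)) (x $ 2)) ty)) (at (x $ 1, x $ 2) within U \<times> ?V)"
  proof (rule has_derivative_partialsI)
    show "((\<lambda>z. g z (x $ 2)) has_derivative (*) a) (at (x $ 1) within U)"
      using holomorphic_derivI[OF h1[OF x(2)] U x(1), of U] unfolding a_def has_field_derivative_def .
    show "(g z has_derivative blinfun_apply (blinfun_mult_right (deriv (g z) w))) (at w within ?V)"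
      if zw: "z \<in> U" "w \<in> ?V" for z w
    proof -
      have "w \<in> V" using zw(2) r(2) by (rule subsetD[rotated])
      from holomorphic_derivI[OF h2[OF zw(1)] V this, of ?V] show ?thesis
        by (simp add: has_field_derivative_def)
    qed
    have "continuous_on (U \<times> ?V) (\<lambda>p. case (snd p, fst p) of (w, z) \<Rightarrow> deriv (g z) w)"
      by (rule continuous_on_compose2[OF c2]) (use r in \<open>auto intro!: continuous_intros\<close>)
    then have "continuous_on (U \<times> ?V) (\<lambda>(z, w). blinfun_mult_right (deriv (g z) w))"
      using bounded_linear.continuous_on[OF bounded_linear_blinfun_mult_right] by (simp add: split_beta)
    then show "continuous (at (x $ 1, x $ 2) within U \<times> ?V) (\<lambda>(z, w). blinfun_mult_right (deriv (g z) w))"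
      using x r by (simp add: continuous_on_eq_continuous_within)
  qed (use r in auto)
  moreover have "at (x $ 1, x $ 2) within U \<times> ?V = at (x $ 1, x $ 2)"
    by (rule at_within_open) (use x r U in \<open>auto intro: open_Times\<close>)
  ultimately have d: "((\<lambda>(z, w). g z w) has_derivative
      (\<lambda>(tx, ty). a * tx + deriv (g (x $ 1)) (x $ 2) * ty)) (at (x $ 1, x $ 2))" by simp
  have "((\<lambda>x. (x $ 1, x $ 2)) has_derivative (\<lambda>h. (h $ 1, h $ 2))) (at x)"
    by (intro has_derivative_Pair bounded_linear_imp_has_derivative bounded_linear_vec_nth)
  from has_derivative_compose[OF this d]
  show ?thesis unfolding cdiff_def by (auto simp: algebra_simps)
qed

text \<open>The derivative in direction \<open>v\<close> is the one-variable derivative of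
  \<open>f (x + z *s v)\<close> at \<open>z = 0\<close>, with \<open>x\<close> as a parameter. So
  mere complex differentiability on an open set gives C^1, as needed for Lipschitz bounds and the
  inverse function theorem.\<close>

lemma derivative_continuous:
  fixes f :: "complex^'n \<Rightarrow> complex"
  assumes S: "open S" and f: "\<And>x. x \<in> S \<Longrightarrow> cdiff f x"
  shows "continuous_on S (\<lambda>x. frechet_derivative f (at x) v)"
  unfolding continuous_on_eq_continuous_within
proof
  fix x0 assume x0: "x0 \<in> S"
  obtain e where e: "e > 0" "ball x0 (2 * e) \<subseteq> S"
    using S x0 openE[of S x0] by (metis field_sum_of_halves mult_2 half_gt_zero)
  define r where "r = e / (norm v + 1)"
  have n: "norm v + 1 > 0" by (simp add: add_nonneg_pos)
  have r: "r > 0" using e n by (simp add: r_def)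
  have mem: "x + z *s v \<in> S" if "x \<in> ball x0 e" "z \<in> ball 0 r" for x z
  proof -
    have "norm z * norm v \<le> r * (norm v + 1)" using that r by (intro mult_mono) auto
    also have "\<dots> = e" using n by (simp add: r_def)
    finally have "norm (z *s v) \<le> e" by (simp add: norm_smult)
    then have "dist x0 (x + z *s v) < 2 * e"
      using that(1) norm_triangle_ineq[of "x - x0" "z *s v"] by (simp add: dist_norm norm_minus_commute algebra_simps)
    then show ?thesis using e by auto
  qed
  have contf: "continuous_on S f"
    using f cdiff_isCont continuous_at_imp_continuous_on by blast
  have "continuous_on (ball 0 r \<times> ball x0 e) (\<lambda>(z, x). deriv (\<lambda>z. f (x + z *s v)) z)"
  proof (rule deriv_continuous_param)
    show "continuous_on (ball 0 r \<times> ball x0 e) (\<lambda>(z, x). f (x + z *s v))"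
      unfolding split_beta
      by (rule continuous_on_compose2[OF contf]) (use mem in \<open>auto intro!: continuous_intros\<close>)
    show "(\<lambda>z. f (x + z *s v)) holomorphic_on ball 0 r" if "x \<in> ball x0 e" for x
      unfolding holomorphic_on_def
      using cdiff_line[OF f[OF mem[OF that]]] field_differentiable_at_within by blast
  qed auto
  then have "continuous_on (ball x0 e) (\<lambda>x. case (0, x) of (z, x) \<Rightarrow> deriv (\<lambda>z. f (x + z *s v)) z)"
    by (rule continuous_on_compose2) (use r in \<open>auto intro!: continuous_intros\<close>)
  then have "continuous_on (ball x0 e) (\<lambda>x. deriv (\<lambda>z. f (x + z *s v)) 0)" by simp
  moreover have "deriv (\<lambda>z. f (x + z *s v)) 0 = frechet_derivative f (at x) v" if x: "x \<in> ball x0 e" for x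
  proof -
    have "x \<in> S" using mem[OF x, of 0] r by simp
    then have "cdiff f x" by (rule f)
    then obtain D where D: "(f has_derivative D) (at x)" "\<And>c v. D (c *s v) = c * D v"
      by (auto simp: cdiff_def)
    have "(f has_derivative D) (at (x + 0 *s v))" using D(1) by simp
    from has_derivative_compose[OF has_derivative_line this]
    have "((\<lambda>z. f (x + z *s v)) has_derivative (\<lambda>s. D (s *s v))) (at 0)" .
    from has_derivative_complex_field[OF this]
    have "((\<lambda>z. f (x + z *s v)) has_field_derivative D v) (at 0)" by (simp add: D(2))
    then show ?thesis using frechet_derivative_at[OF D(1)] by (simp add: DERIV_imp_deriv)
  qed
  ultimately have "continuous_on (ball x0 e) (\<lambda>x. frechet_derivative f (at x) v)"
    by (rule continuous_on_eq)
  then have "isCont (\<lambda>x. frechet_derivative f (at x) v) x0" using e by (simp add: continuous_on_eq_continuous_at)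
  then show "continuous (at x0 within S) (\<lambda>x. frechet_derivative f (at x) v)"
    using continuous_at_imp_continuous_at_within by blast
qed

lemma cdiffv_C1:
  fixes f :: "complex^'n \<Rightarrow> complex^'m"
  assumes S: "open S" and f: "\<And>x. x \<in> S \<Longrightarrow> cdiffv f x"
  obtains f' :: "complex^'n \<Rightarrow> (complex^'n) \<Rightarrow>\<^sub>L (complex^'m)"
  where "\<And>x. x \<in> S \<Longrightarrow> (f has_derivative blinfun_apply (f' x)) (at x)" "continuous_on S f'"
    "\<And>x c v. x \<in> S \<Longrightarrow> blinfun_apply (f' x) (c *s v) = c *s blinfun_apply (f' x) v"
proof
  let ?f' = "\<lambda>x. Blinfun (frechet_derivative f (at x))"
  have D: "(f has_derivative frechet_derivative f (at x)) (at x)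
     \<and> (\<forall>c v. frechet_derivative f (at x) (c *s v) = c *s frechet_derivative f (at x) v)" if "x \<in> S" for x
  proof -
    have "cdiffv f x" using that by (rule f)
    then obtain D where D: "(f has_derivative D) (at x)" "\<And>c v. D (c *s v) = c *s D v"
      by (auto simp: cdiffv_def)
    show ?thesis using D frechet_derivative_at[OF D(1)] by simp
  qed
  have app: "blinfun_apply (?f' x) = frechet_derivative f (at x)" if "x \<in> S" for x
    using D[OF that] by (intro bounded_linear_Blinfun_apply has_derivative_bounded_linear) auto
  show "(f has_derivative blinfun_apply (?f' x)) (at x)" if "x \<in> S" for x using D app that by simp
  show "blinfun_apply (?f' x) (c *s v) = c *s blinfun_apply (?f' x) v" if "x \<in> S" for x c v using D app that by simp
  show "continuous_on S ?f'"
  proof (rule continuous_on_blinfun_componentwise)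
    fix v :: "complex^'n"
    have "continuous_on S (\<lambda>x. \<chi> i. frechet_derivative (\<lambda>x. f x $ i) (at x) v)"
      by (intro continuous_on_vec_lambda derivative_continuous[OF S]) (use f cdiffv_iff in blast)
    moreover have "(\<chi> i. frechet_derivative (\<lambda>x. f x $ i) (at x) v) = blinfun_apply (?f' x) v" if "x \<in> S" for x
    proof -
      have "frechet_derivative (\<lambda>x. f x $ i) (at x) = (\<lambda>h. frechet_derivative f (at x) h $ i)" for i
        by (rule frechet_derivative_at[symmetric], rule bounded_linear.has_derivative[OF bounded_linear_vec_nth])
          (use D[OF that] in auto)
      then show ?thesis by (simp add: app[OF that] vec_eq_iff)
    qed
    ultimately show "continuous_on S (\<lambda>x. blinfun_apply (?f' x) v)" by (rule continuous_on_eq)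
  qed
qed

lemma cdiffv_locally_Lipschitz:
  fixes f :: "complex^'n \<Rightarrow> complex^'m"
  assumes S: "open S" and f: "\<And>x. x \<in> S \<Longrightarrow> cdiffv f x" and x0: "x0 \<in> S"
  obtains r K where "r > 0" "K > 0" "cball x0 r \<subseteq> S"
    "\<And>x y. x \<in> cball x0 r \<Longrightarrow> y \<in> cball x0 r \<Longrightarrow> norm (f x - f y) \<le> K * norm (x - y)"
proof -
  obtain f' :: "complex^'n \<Rightarrow> (complex^'n) \<Rightarrow>\<^sub>L (complex^'m)"
    where f': "\<And>x. x \<in> S \<Longrightarrow> (f has_derivative blinfun_apply (f' x)) (at x)" "continuous_on S f'"
    using cdiffv_C1[OF S f] by metis
  obtain r where r: "r > 0" "cball x0 r \<subseteq> S" using S x0 open_contains_cball_eq by metis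
  have "compact (f' ` cball x0 r)"
    by (rule compact_continuous_image[OF continuous_on_subset[OF f'(2) r(2)]]) auto
  then have "bounded (f' ` cball x0 r)" by (rule compact_imp_bounded)
  then obtain K where K: "K > 0" "\<And>x. x \<in> cball x0 r \<Longrightarrow> norm (f' x) \<le> K"
    unfolding bounded_pos by auto
  show thesis
  proof (rule that[OF r(1) K(1) r(2)])
    fix x y assume xy: "x \<in> cball x0 r" "y \<in> cball x0 r"
    show "norm (f x - f y) \<le> K * norm (x - y)"
    proof (rule differentiable_bound[OF convex_cball])
      show "(f has_derivative blinfun_apply (f' z)) (at z within cball x0 r)" if "z \<in> cball x0 r" for z
        using f'(1) r(2) that has_derivative_at_withinI by blast
      show "onorm (blinfun_apply (f' z)) \<le> K" if "z \<in> cball x0 r" for z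
        using K(2)[OF that] by (simp add: norm_blinfun.rep_eq)
    qed (use xy in auto)
  qed
qed

text \<open>The real inverse function theorem does the work; the derivative of the inverse is the
  inverse of a complex linear map and therefore complex linear. Injectivity of \<open>D\<close>
  suffices because the dimensions agree.\<close>

lemma holomorphic_inverse_function:
  fixes f :: "complex^'n \<Rightarrow> complex^'n"
  assumes U: "open U" and f: "\<And>x. x \<in> U \<Longrightarrow> cdiffv f x" and x0: "x0 \<in> U"
    and D: "(f has_derivative D) (at x0)" and inj: "\<And>v. D v = 0 \<Longrightarrow> v = 0"
  obtains U' V g where "open U'" "U' \<subseteq> U" "x0 \<in> U'" "open V" "f x0 \<in> V" "homeomorphism U' V f g"
    "\<And>y. y \<in> V \<Longrightarrow> cdiffv g y"
proof -
  obtain f' :: "complex^'n \<Rightarrow> (complex^'n) \<Rightarrow>\<^sub>L (complex^'n)"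
    where f': "\<And>x. x \<in> U \<Longrightarrow> (f has_derivative blinfun_apply (f' x)) (at x)" "continuous_on U f'"
      "\<And>x c v. x \<in> U \<Longrightarrow> blinfun_apply (f' x) (c *s v) = c *s blinfun_apply (f' x) v"
    using cdiffv_C1[OF U f] by metis
  have D': "D = blinfun_apply (f' x0)" by (rule has_derivative_unique[OF D f'(1)[OF x0]])
  have lin: "linear D" using D by (simp add: has_derivative_bounded_linear bounded_linear.linear)
  have "inj D" using inj lin by (simp add: linear_injective_0)
  then obtain E :: "complex^'n \<Rightarrow> complex^'n" where E: "linear E" "\<And>x. E (D x) = x"
    using linear_injective_left_inverse[OF lin] by (metis comp_apply id_apply)
  have bl: "bounded_linear E" using E(1) by (simp add: linear_conv_bounded_linear)
  have "Blinfun E o\<^sub>L f' x0 = id_blinfun"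
    using E(2) by (intro blinfun_eqI) (simp add: bounded_linear_Blinfun_apply[OF bl] D')
  then obtain U' V g g' where g: "open U'" "U' \<subseteq> U" "x0 \<in> U'" "open V" "f x0 \<in> V" "homeomorphism U' V f g"
    "\<And>y. y \<in> V \<Longrightarrow> (g has_derivative (g' y)) (at y)"
    "\<And>y. y \<in> V \<Longrightarrow> g' y = inv_into UNIV (blinfun_apply (f'(g y)))"
    "\<And>y. y \<in> V \<Longrightarrow> bij (blinfun_apply (f'(g y)))"
    using inverse_function_theorem[OF U f'(1,2) x0] by metis
  have "cdiffv g y" if y: "y \<in> V" for y
    unfolding cdiffv_def
  proof (intro exI conjI allI)
    show "(g has_derivative (g' y)) (at y)" by (rule g(7)[OF y])
    have gy: "g y \<in> U" using g(2,6) y by (auto simp: homeomorphism_def)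
    let ?D = "blinfun_apply (f' (g y))"
    fix c w
    have "?D (c *s inv_into UNIV ?D w) = c *s w"
      using f'(3)[OF gy] g(9)[OF y] by (simp add: bij_is_surj surj_f_inv_f)
    then show "g' y (c *s w) = c *s g' y w"
      using g(9)[OF y] unfolding g(8)[OF y] by (metis bij_inv_eq_iff)
  qed
  then show thesis using that g by blast
qed

subsection \<open>Differential equations with holomorphic parameters\<close>

text \<open>This is the primitive vanishing at 0, integrated along the segment from 0 to t. Scaling
  to a fixed interval keeps it a parameter integral, so that it stays holomorphic in other variables
  too.\<close>

lemma radial_primitive:
  assumes g: "g holomorphic_on ball 0 r" and t: "t \<in> ball 0 r"
  shows "((\<lambda>t. t * integral (cbox 0 1) (\<lambda>s::real. g (of_real s * t))) has_field_derivative g t) (at t)"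
proof -
  obtain G where G: "\<And>x. x \<in> ball 0 r \<Longrightarrow> (G has_field_derivative g x) (at x within ball 0 r)"
    using holomorphic_convex_primitive'[OF convex_ball open_ball g] by metis
  then have G': "(G has_field_derivative g x) (at x)" if "x \<in> ball 0 r" for x
    using that at_within_open[OF that open_ball] by metis
  have eq: "t * integral (cbox 0 1) (\<lambda>s::real. g (of_real s * t)) = G t - G 0" if t: "t \<in> ball 0 r" for t
  proof -
    have mem: "of_real s * t \<in> ball 0 r" if "s \<in> {0..1}" for s :: real
    proof -
      have "norm (of_real s * t) \<le> 1 * norm t" unfolding norm_mult using that by (intro mult_right_mono) auto
      then show ?thesis using t by simp
    qed
    have "((\<lambda>s::real. t * g (of_real s * t)) has_integral (G (of_real 1 * t) - G (of_real 0 * t))) {0..1}"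
    proof (rule fundamental_theorem_of_calculus)
      fix s :: real assume s: "s \<in> {0..1}"
      have "((\<lambda>s. of_real s * t) has_vector_derivative t) (at s within {0..1})"
        by (auto intro!: derivative_eq_intros simp: has_vector_derivative_def scaleR_conv_of_real)
      from field_vector_diff_chain_within[OF this has_field_derivative_at_within[OF G'[OF mem[OF s]]]]
      show "((\<lambda>s. G (of_real s * t)) has_vector_derivative t * g (of_real s * t)) (at s within {0..1})"
        by (simp add: o_def)
    qed auto
    then show ?thesis by (simp add: integral_unique flip: integral_mult_right)
  qed
  have "((\<lambda>t. G t - G 0) has_field_derivative g t - 0) (at t)"
    by (intro DERIV_diff G' t DERIV_const)
  then show ?thesis
    using has_field_derivative_transform_within_open[OF _ open_ball t eq[symmetric]] by simp
qed

text \<open>The unknown is a function of a complex parameter z, labelling the initial point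
  \<open>x0 + z *s v\<close>, and of complex time t. The bound on \<open>r * norm v + r * M\<close>
  keeps the iteration in the ball, and \<open>r * K \<le> 1/2\<close> makes it a
  contraction.\<close>

locale picard =
  fixes F :: "complex^'n \<Rightarrow> complex^'n" and x0 v :: "complex^'n" and R K M r :: real
  assumes F: "\<And>x. x \<in> cball x0 R \<Longrightarrow> cdiffv F x"
    and K: "\<And>x y. x \<in> cball x0 R \<Longrightarrow> y \<in> cball x0 R \<Longrightarrow> norm (F x - F y) \<le> K * norm (x - y)"
    and M: "\<And>x. x \<in> cball x0 R \<Longrightarrow> norm (F x) \<le> M"
    and r: "r > 0" "r * norm v + r * M \<le> R" "r * K \<le> 1/2" and K0: "K > 0" and M0: "M > 0"
begin

definition admissible :: "(complex \<Rightarrow> complex \<Rightarrow> complex^'n) \<Rightarrow> bool" where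
  "admissible \<psi> \<longleftrightarrow> continuous_on (ball 0 r \<times> ball 0 r) (\<lambda>(z, t). \<psi> z t) \<and>
     (\<forall>z\<in>ball 0 r. \<forall>t\<in>ball 0 r. \<psi> z t \<in> cball x0 R) \<and>
     (\<forall>i. \<forall>t\<in>ball 0 r. (\<lambda>z. \<psi> z t $ i) holomorphic_on ball 0 r) \<and>
     (\<forall>i. \<forall>z\<in>ball 0 r. (\<lambda>t. \<psi> z t $ i) holomorphic_on ball 0 r)"

text \<open>The Picard operator; the time integral runs over the segment from 0 to t.\<close>

definition step :: "(complex \<Rightarrow> complex \<Rightarrow> complex^'n) \<Rightarrow> complex \<Rightarrow> complex \<Rightarrow> complex^'n" where
  "step \<psi> z t = x0 + z *s v + t *s integral (cbox 0 1) (\<lambda>s::real. F (\<psi> z (of_real s * t)))"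

lemma contF: "continuous_on (cball x0 R) F"
  using F cdiffv_isCont continuous_at_imp_continuous_on by blast

lemma scaled_in_ball: "t \<in> ball 0 r \<Longrightarrow> s \<in> {0..1} \<Longrightarrow> complex_of_real s * t \<in> ball 0 r"
proof -
  assume t: "t \<in> ball 0 r" "s \<in> {0..1}"
  have "norm (of_real s * t) \<le> 1 * norm t" unfolding norm_mult using t by (intro mult_right_mono) auto
  then show ?thesis using t by simp
qed

lemma admissible_continuous_integrand:
  assumes "admissible \<psi>"
  shows "continuous_on ((ball 0 r \<times> ball 0 r) \<times> cbox 0 1) (\<lambda>(p, s). F (\<psi> (fst p) (complex_of_real s * snd p)))"
proof -
  have c: "continuous_on (ball 0 r \<times> ball 0 r) (\<lambda>(z, t). \<psi> z t)" using assms by (simp add: admissible_def)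
  have "continuous_on ((ball 0 r \<times> ball 0 r) \<times> cbox 0 1)
      (\<lambda>q. case (fst (fst q), complex_of_real (snd q) * snd (fst q)) of (z, t) \<Rightarrow> \<psi> z t)"
    by (rule continuous_on_compose2[OF c])
      (use scaled_in_ball in \<open>auto intro!: continuous_intros simp del: mem_ball\<close>)
  then have "continuous_on ((ball 0 r \<times> ball 0 r) \<times> cbox 0 1)
      (\<lambda>q. \<psi> (fst (fst q)) (complex_of_real (snd q) * snd (fst q)))" by simp
  moreover have "(\<lambda>q. \<psi> (fst (fst q)) (complex_of_real (snd q) * snd (fst q))) `
      ((ball 0 r \<times> ball 0 r) \<times> cbox 0 1) \<subseteq> cball x0 R"
    using assms scaled_in_ball by (auto simp: admissible_def simp del: mem_ball mem_cball)
  ultimately show ?thesis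
    using continuous_on_compose2[OF contF] unfolding split_beta by blast
qed

lemma admissible_integrand:
  assumes "admissible \<psi>" "z \<in> ball 0 r" "t \<in> ball 0 r"
  shows "continuous_on {0..1} (\<lambda>s. F (\<psi> z (complex_of_real s * t)))"
proof -
  have "continuous_on {0..1} (\<lambda>s. case ((z, t), s) of (p, s) \<Rightarrow> F (\<psi> (fst p) (complex_of_real s * snd p)))"
    by (rule continuous_on_compose2[OF admissible_continuous_integrand[OF assms(1)]])
      (use assms in \<open>auto intro!: continuous_intros\<close>)
  then show ?thesis by simp
qed

lemma admissible_step_nth:
  assumes "admissible \<psi>" "z \<in> ball 0 r" "t \<in> ball 0 r"
  shows "step \<psi> z t $ i = x0 $ i + z * v $ i + t * integral (cbox 0 1) (\<lambda>s::real. F (\<psi> z (of_real s * t)) $ i)"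
proof -
  have "(\<lambda>s. F (\<psi> z (complex_of_real s * t))) integrable_on cbox 0 1"
    using admissible_integrand[OF assms] by (simp add: integrable_continuous_real)
  from integral_linear[OF this bounded_linear_vec_nth, of i] show ?thesis
    by (simp add: step_def o_def)
qed

lemma admissible_F_holomorphic:
  assumes "admissible \<psi>"
  shows "t \<in> ball 0 r \<Longrightarrow> (\<lambda>z. F (\<psi> z t) $ i) holomorphic_on ball 0 r"
    and "z \<in> ball 0 r \<Longrightarrow> (\<lambda>t. F (\<psi> z t) $ i) holomorphic_on ball 0 r"
proof -
  have *: "(\<lambda>z. F (g z) $ i) holomorphic_on ball 0 r"
    if g: "\<And>z. z \<in> ball 0 r \<Longrightarrow> g z \<in> cball x0 R" and h: "\<And>i. (\<lambda>z. g z $ i) holomorphic_on ball 0 r" for g i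
    unfolding holomorphic_on_def
  proof
    fix z assume z: "z \<in> ball (0::complex) r"
    have "((\<lambda>z. g z $ i) has_field_derivative (\<chi> i. deriv (\<lambda>z. g z $ i) z) $ i) (at z)" for i
      using holomorphic_derivI[OF h open_ball z] by simp
    from cdiff_curve[of "\<lambda>x. F x $ i", OF _ has_derivative_curve[OF this]] F[OF g[OF z]]
    show "(\<lambda>z. F (g z) $ i) field_differentiable (at z within ball 0 r)"
      by (simp add: cdiffv_iff field_differentiable_at_within)
  qed
  show "t \<in> ball 0 r \<Longrightarrow> (\<lambda>z. F (\<psi> z t) $ i) holomorphic_on ball 0 r"
    by (rule *) (use assms in \<open>auto simp: admissible_def\<close>)
  show "z \<in> ball 0 r \<Longrightarrow> (\<lambda>t. F (\<psi> z t) $ i) holomorphic_on ball 0 r"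
    by (rule *) (use assms in \<open>auto simp: admissible_def\<close>)
qed

lemma admissible_step:
  assumes a: "admissible \<psi>"
  shows "admissible (step \<psi>)"
  unfolding admissible_def
proof (intro conjI ballI allI)
  have "continuous_on (ball 0 r \<times> ball 0 r) (\<lambda>p. integral (cbox 0 1) (\<lambda>s::real. F (\<psi> (fst p) (of_real s * snd p))))"
    by (rule integral_continuous_on_param[OF admissible_continuous_integrand[OF a]])
  then show "continuous_on (ball 0 r \<times> ball 0 r) (\<lambda>(z, t). step \<psi> z t)"
    unfolding step_def split_beta by (intro continuous_intros)
next
  fix z t :: complex assume z: "z \<in> ball 0 r" and t: "t \<in> ball 0 r"
  have "norm (integral {0..1} (\<lambda>s::real. F (\<psi> z (of_real s * t)))) \<le> M * (1 - 0)"
    by (rule integral_bound[OF _ admissible_integrand[OF a z t]])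
      (use a z scaled_in_ball[OF t] in \<open>auto intro!: M simp: admissible_def simp del: mem_ball mem_cball\<close>)
  then have "norm (t *s integral {0..1} (\<lambda>s::real. F (\<psi> z (of_real s * t)))) \<le> r * M"
    unfolding norm_smult using t r(1) by (intro mult_mono) auto
  moreover have "norm (z *s v) \<le> r * norm v" unfolding norm_smult using z by (intro mult_right_mono) auto
  ultimately have "norm (z *s v + t *s integral {0..1} (\<lambda>s::real. F (\<psi> z (of_real s * t)))) \<le> R"
    using r(2) norm_triangle_ineq[of "z *s v" "t *s integral {0..1} (\<lambda>s::real. F (\<psi> z (of_real s * t)))"]
    by linarith
  then have "norm (step \<psi> z t - x0) \<le> R" by (simp add: step_def add.assoc)
  then show "step \<psi> z t \<in> cball x0 R" by (simp add: dist_norm norm_minus_commute)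
next
  fix i t assume t: "t \<in> ball (0::complex) r"
  have "continuous_on (ball 0 r \<times> cbox 0 1) (\<lambda>q. case ((fst q, t), snd q) of (p, s) \<Rightarrow> F (\<psi> (fst p) (complex_of_real s * snd p)))"
    by (rule continuous_on_compose2[OF admissible_continuous_integrand[OF a]])
      (use t in \<open>auto intro!: continuous_intros\<close>)
  then have "continuous_on (ball 0 r \<times> cbox 0 1) (\<lambda>(z, s). F (\<psi> z (complex_of_real s * t)) $ i)"
    unfolding split_beta by (intro continuous_intros) simp
  then have "(\<lambda>z. integral (cbox 0 1) (\<lambda>s::real. F (\<psi> z (of_real s * t)) $ i)) holomorphic_on ball 0 r"
    by (rule integral_holomorphic[OF open_ball])
      (use scaled_in_ball[OF t] in \<open>auto intro!: admissible_F_holomorphic[OF a] simp del: mem_ball\<close>)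
  then have "(\<lambda>z. x0 $ i + z * v $ i + t * integral (cbox 0 1) (\<lambda>s::real. F (\<psi> z (of_real s * t)) $ i)) holomorphic_on ball 0 r"
    by (intro holomorphic_intros)
  then show "(\<lambda>z. step \<psi> z t $ i) holomorphic_on ball 0 r"
    by (rule holomorphic_transform) (use admissible_step_nth[OF a _ t] in simp)
next
  fix i z assume z: "z \<in> ball (0::complex) r"
  have "(\<lambda>t. t * integral (cbox 0 1) (\<lambda>s::real. F (\<psi> z (of_real s * t)) $ i)) holomorphic_on ball 0 r"
    unfolding holomorphic_on_def field_differentiable_def
    using radial_primitive[OF admissible_F_holomorphic(2)[OF a z]] has_field_derivative_at_within by blast
  from holomorphic_on_add[OF holomorphic_on_const this, of "x0 $ i + z * v $ i"]
  have "(\<lambda>t. x0 $ i + z * v $ i + t * integral (cbox 0 1) (\<lambda>s::real. F (\<psi> z (of_real s * t)) $ i)) holomorphic_on ball 0 r" .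
  then show "(\<lambda>t. step \<psi> z t $ i) holomorphic_on ball 0 r"
    by (rule holomorphic_transform) (use admissible_step_nth[OF a z] in simp)
qed

lemma step_contraction:
  assumes a: "admissible \<psi>" "admissible \<phi>" and z: "z \<in> ball 0 r" and t: "t \<in> ball 0 r"
    and d: "\<And>t. t \<in> ball 0 r \<Longrightarrow> norm (\<psi> z t - \<phi> z t) \<le> d"
  shows "norm (step \<psi> z t - step \<phi> z t) \<le> d / 2"
proof -
  have d0: "d \<ge> 0" using order_trans[OF norm_ge_zero d[OF t]] .
  let ?f = "\<lambda>s::real. F (\<psi> z (of_real s * t))" and ?g = "\<lambda>s::real. F (\<phi> z (of_real s * t))"
  note c = admissible_integrand[OF a(1) z t] admissible_integrand[OF a(2) z t]
  have "integral {0..1} ?f - integral {0..1} ?g = integral {0..1} (\<lambda>s. ?f s - ?g s)"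
    by (rule integral_diff[symmetric]) (use c in \<open>auto intro: integrable_continuous_real\<close>)
  moreover have "norm (integral {0..1} (\<lambda>s. ?f s - ?g s)) \<le> (K * d) * (1 - 0)"
  proof (rule integral_bound)
    show "continuous_on {0..1} (\<lambda>s. ?f s - ?g s)" by (intro continuous_intros c)
    fix s :: real assume s: "s \<in> {0..1}"
    have st: "of_real s * t \<in> ball 0 r" by (rule scaled_in_ball[OF t s])
    have "norm (?f s - ?g s) \<le> K * norm (\<psi> z (of_real s * t) - \<phi> z (of_real s * t))"
      by (rule K) (use a z st in \<open>auto simp: admissible_def\<close>)
    also have "\<dots> \<le> K * d" using d[OF st] K0 by (intro mult_left_mono) auto
    finally show "norm (?f s - ?g s) \<le> K * d" .
  qed auto
  ultimately have 1: "norm (integral {0..1} ?f - integral {0..1} ?g) \<le> K * d" by simp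
  have "step \<psi> z t - step \<phi> z t = t *s (integral {0..1} ?f - integral {0..1} ?g)"
    by (simp add: step_def vec_eq_iff algebra_simps)
  then have "norm (step \<psi> z t - step \<phi> z t) = norm t * norm (integral {0..1} ?f - integral {0..1} ?g)"
    by (simp only: norm_smult)
  also have "\<dots> \<le> r * (K * d)" using 1 t r(1) by (intro mult_mono) auto
  also have "\<dots> = (r * K) * d" by simp
  also have "\<dots> \<le> (1/2) * d" using r(3) d0 by (intro mult_right_mono)
  finally show ?thesis by simp
qed

definition iterate :: "nat \<Rightarrow> complex \<Rightarrow> complex \<Rightarrow> complex^'n" where
  "iterate n = (step ^^ n) (\<lambda>z t. x0 + z *s v)"

lemma admissible_iterate: "admissible (iterate n)"
proof (induction n)
  case 0
  have "norm (z *s v) \<le> R" if "z \<in> ball 0 r" for z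
  proof -
    have "norm (z *s v) \<le> r * norm v" unfolding norm_smult using that by (intro mult_right_mono) auto
    moreover have "0 \<le> r * M" using r M0 by simp
    ultimately show ?thesis using r(2) by linarith
  qed
  then show ?case
    by (auto simp: iterate_def admissible_def split_beta dist_norm intro!: continuous_intros holomorphic_intros)
next
  case (Suc n)
  then show ?case using admissible_step by (simp add: iterate_def)
qed

lemma iterate_diff:
  assumes z: "z \<in> ball 0 r"
  shows "t \<in> ball 0 r \<Longrightarrow> norm (iterate (Suc n) z t - iterate n z t) \<le> 2 * R * (1/2) ^ n"
proof (induction n arbitrary: t)
  case 0
  have "iterate n z t \<in> cball x0 R" for n using admissible_iterate[of n] z 0 by (auto simp: admissible_def)
  then have "dist x0 (iterate 0 z t) \<le> R" "dist x0 (iterate (Suc 0) z t) \<le> R" by auto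
  then have "dist (iterate (Suc 0) z t) (iterate 0 z t) \<le> 2 * R"
    using dist_triangle3[of "iterate (Suc 0) z t" "iterate 0 z t" x0] by linarith
  then show ?case by (simp add: dist_norm)
next
  case (Suc n)
  have "norm (step (iterate (Suc n)) z t - step (iterate n) z t) \<le> (2 * R * (1/2) ^ n) / 2"
    by (rule step_contraction[OF admissible_iterate admissible_iterate z Suc.prems Suc.IH])
  then show ?case by (simp add: iterate_def)
qed

text \<open>The telescoping series of differences of iterates converges geometrically and uniformly,
  so continuity and holomorphy in each variable pass to the limit. The contraction estimate lets the
  fixed point equation pass as well.\<close>

lemma solution:
  obtains \<psi> where "admissible \<psi>" "\<And>z t. z \<in> ball 0 r \<Longrightarrow> t \<in> ball 0 r \<Longrightarrow> \<psi> z t = step \<psi> z t"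
proof -
  let ?B = "ball (0::complex) r \<times> ball (0::complex) r"
  define f where "f n p = iterate (Suc n) (fst p) (snd p) - iterate n (fst p) (snd p)" for n and p :: "complex \<times> complex"
  define \<psi> where "\<psi> z t = suminf (\<lambda>n. f n (z, t)) + iterate 0 z t" for z t
  have sm: "summable (\<lambda>n. 2 * R * (1/2) ^ n)" by (intro summable_mult summable_geometric) auto
  have "uniform_limit ?B (\<lambda>n x. \<Sum>i<n. f i x) (\<lambda>x. suminf (\<lambda>i. f i x)) sequentially"
    by (rule Weierstrass_m_test_ev[OF _ sm]) (use iterate_diff in \<open>auto simp: f_def\<close>)
  moreover have tel: "(\<Sum>i<n. f i p) = iterate n (fst p) (snd p) - iterate 0 (fst p) (snd p)" for n p
    unfolding f_def by (rule sum_lessThan_telescope)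
  ultimately have "uniform_limit ?B (\<lambda>n p. (iterate n (fst p) (snd p) - iterate 0 (fst p) (snd p)) + iterate 0 (fst p) (snd p))
     (\<lambda>p. suminf (\<lambda>i. f i p) + iterate 0 (fst p) (snd p)) sequentially"
    by (intro uniform_limit_add uniform_limit_const) simp
  then have u: "uniform_limit ?B (\<lambda>n p. iterate n (fst p) (snd p)) (\<lambda>p. \<psi> (fst p) (snd p)) sequentially"
    by (simp add: \<psi>_def)
  have pt: "(\<lambda>n. iterate n z t) \<longlonglongrightarrow> \<psi> z t" if "z \<in> ball 0 r" "t \<in> ball 0 r" for z t
    using tendsto_uniform_limitI[OF u, of "(z, t)"] that by simp
  have ui: "uniform_limit ?B (\<lambda>n p. iterate n (fst p) (snd p) $ i) (\<lambda>p. \<psi> (fst p) (snd p) $ i) sequentially" for i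
    by (rule bounded_linear.uniform_limit[OF bounded_linear_vec_nth u])
  have hol: "g holomorphic_on ball 0 r"
    if "\<And>n. G n holomorphic_on ball 0 r" "uniform_limit (ball 0 r) G g sequentially" for G g
  proof (rule holomorphic_uniform_sequence[OF open_ball that(1)])
    fix x :: complex assume "x \<in> ball 0 r"
    then obtain d where "d > 0" "cball x d \<subseteq> ball 0 r" using open_contains_cball_eq open_ball by metis
    then show "\<exists>d>0. cball x d \<subseteq> ball 0 r \<and> uniform_limit (cball x d) G g sequentially"
      using that(2) uniform_limit_on_subset by blast
  qed
  have a: "admissible \<psi>"
    unfolding admissible_def
  proof (intro conjI ballI allI)
    have "continuous_on ?B (\<lambda>p. \<psi> (fst p) (snd p))"
      by (rule uniform_limit_theorem[OF _ u])
        (use admissible_iterate in \<open>auto simp: admissible_def split_beta\<close>)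
    then show "continuous_on ?B (\<lambda>(z, t). \<psi> z t)" by (simp add: split_beta)
  next
    fix z t :: complex assume zt: "z \<in> ball 0 r" "t \<in> ball 0 r"
    show "\<psi> z t \<in> cball x0 R"
      by (rule closed_sequentially[OF closed_cball _ pt[OF zt]]) (use admissible_iterate zt in \<open>auto simp: admissible_def\<close>)
  next
    fix i and t :: complex assume t: "t \<in> ball 0 r"
    show "(\<lambda>z. \<psi> z t $ i) holomorphic_on ball 0 r"
    proof (rule hol)
      show "(\<lambda>z. iterate n z t $ i) holomorphic_on ball 0 r" for n
        using admissible_iterate t by (auto simp: admissible_def)
      show "uniform_limit (ball 0 r) (\<lambda>n z. iterate n z t $ i) (\<lambda>z. \<psi> z t $ i) sequentially"
        using uniform_limit_compose'[OF ui[of i], of "\<lambda>z. (z, t)" "ball 0 r"] t by auto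
    qed
  next
    fix i and z :: complex assume z: "z \<in> ball 0 r"
    show "(\<lambda>t. \<psi> z t $ i) holomorphic_on ball 0 r"
    proof (rule hol)
      show "(\<lambda>t. iterate n z t $ i) holomorphic_on ball 0 r" for n
        using admissible_iterate z by (auto simp: admissible_def)
      show "uniform_limit (ball 0 r) (\<lambda>n t. iterate n z t $ i) (\<lambda>t. \<psi> z t $ i) sequentially"
        using uniform_limit_compose'[OF ui[of i], of "\<lambda>t. (z, t)" "ball 0 r"] z by auto
    qed
  qed
  have "\<psi> z t = step \<psi> z t" if zt: "z \<in> ball 0 r" "t \<in> ball 0 r" for z t
  proof (rule LIMSEQ_unique)
    show "(\<lambda>n. iterate (Suc n) z t) \<longlonglongrightarrow> \<psi> z t" by (rule LIMSEQ_Suc[OF pt[OF zt]])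
    show "(\<lambda>n. iterate (Suc n) z t) \<longlonglongrightarrow> step \<psi> z t"
    proof (rule tendstoI)
      fix e :: real assume e: "e > 0"
      have "\<forall>\<^sub>F n in sequentially. \<forall>p\<in>?B. dist (iterate n (fst p) (snd p)) (\<psi> (fst p) (snd p)) < e"
        using uniform_limitD[OF u e] .
      then show "\<forall>\<^sub>F n in sequentially. dist (iterate (Suc n) z t) (step \<psi> z t) < e"
      proof (rule eventually_mono)
        fix n assume n: "\<forall>p\<in>?B. dist (iterate n (fst p) (snd p)) (\<psi> (fst p) (snd p)) < e"
        have "norm (iterate n z t - \<psi> z t) \<le> e" if "t \<in> ball 0 r" for t
          using bspec[OF n, of "(z, t)"] zt(1) that by (simp add: dist_norm)
        from step_contraction[OF admissible_iterate a zt this]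
        show "dist (iterate (Suc n) z t) (step \<psi> z t) < e" using e by (simp add: iterate_def dist_norm)
      qed
    qed
  qed
  then show thesis using that a by blast
qed

end

text \<open>Initial points vary only on the complex line through \<open>x0\<close> in direction
  \<open>v\<close>. Together with time this gives two complex coordinates, which is what a flow box
  on a surface consists of.\<close>

lemma holomorphic_local_flow:
  fixes F :: "complex^'n \<Rightarrow> complex^'n"
  assumes S: "open S" and F: "\<And>x. x \<in> S \<Longrightarrow> cdiffv F x" and x0: "x0 \<in> S"
  obtains r \<psi> where "r > 0" "continuous_on (ball 0 r \<times> ball 0 r) (\<lambda>(z, t). \<psi> z t)"
    "\<And>z t. z \<in> ball 0 r \<Longrightarrow> t \<in> ball 0 r \<Longrightarrow> \<psi> z t \<in> S"
    "\<And>z. z \<in> ball 0 r \<Longrightarrow> \<psi> z 0 = x0 + z *s v"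
    "\<And>t i. t \<in> ball 0 r \<Longrightarrow> (\<lambda>z. \<psi> z t $ i) holomorphic_on ball 0 r"
    "\<And>z i. z \<in> ball 0 r \<Longrightarrow> (\<lambda>t. \<psi> z t $ i) holomorphic_on ball 0 r"
    "\<And>z t. z \<in> ball 0 r \<Longrightarrow> t \<in> ball 0 r \<Longrightarrow> (\<psi> z has_derivative (\<lambda>s. s *s F (\<psi> z t))) (at t)"
proof -
  obtain R K where RK: "R > 0" "K > 0" "cball x0 R \<subseteq> S"
    "\<And>x y. x \<in> cball x0 R \<Longrightarrow> y \<in> cball x0 R \<Longrightarrow> norm (F x - F y) \<le> K * norm (x - y)"
    using cdiffv_locally_Lipschitz[OF S F x0] by metis
  define M where "M = norm (F x0) + K * R"
  have M0: "M > 0" using RK by (simp add: M_def add_nonneg_pos)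
  have M: "norm (F x) \<le> M" if x: "x \<in> cball x0 R" for x
  proof -
    have "norm (F x - F x0) \<le> K * norm (x - x0)" using RK x by simp
    also have "\<dots> \<le> K * R" using x RK by (intro mult_left_mono) (auto simp: dist_norm norm_minus_commute)
    finally show ?thesis using norm_triangle_sub[of "F x" "F x0"] by (simp add: M_def)
  qed
  \<comment> \<open>The first entry keeps solutions inside the ball of radius \<open>R\<close>, the
    second makes the Picard operator halve distances.\<close>
  define r where "r = min (R / (norm v + M)) (1 / (2 * K))"
  have nv: "norm v + M > 0" using M0 by (simp add: add_nonneg_pos)
  have r0: "r > 0" using RK nv by (simp add: r_def)
  have "r \<le> R / (norm v + M)" "r \<le> 1 / (2 * K)" by (auto simp: r_def)
  then have r: "r * norm v + r * M \<le> R" "r * K \<le> 1/2"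
    using nv RK by (auto simp: field_simps)
  interpret picard F x0 v R K M r
    by standard (use F RK M r r0 M0 in auto)
  obtain \<psi> where a: "admissible \<psi>" and \<psi>: "\<And>z t. z \<in> ball 0 r \<Longrightarrow> t \<in> ball 0 r \<Longrightarrow> \<psi> z t = step \<psi> z t"
    using solution by metis
  show thesis
  proof (rule that[OF r0])
    show "\<psi> z 0 = x0 + z *s v" if "z \<in> ball 0 r" for z
      using \<psi>[OF that, of 0] r0 by (simp add: step_def)
    show "(\<psi> z has_derivative (\<lambda>s. s *s F (\<psi> z t))) (at t)" if z: "z \<in> ball 0 r" and t: "t \<in> ball 0 r" for z t
    proof (rule has_derivative_curve)
      fix i
      have "((\<lambda>t. x0 $ i + z * v $ i + t * integral (cbox 0 1) (\<lambda>s::real. F (\<psi> z (of_real s * t)) $ i))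
          has_field_derivative 0 + (F (\<psi> z t) $ i)) (at t)"
        by (intro DERIV_add DERIV_const radial_primitive[OF admissible_F_holomorphic(2)[OF a z] t])
      moreover have "x0 $ i + z * v $ i + t * integral (cbox 0 1) (\<lambda>s::real. F (\<psi> z (of_real s * t)) $ i) = \<psi> z t $ i"
        if "t \<in> ball 0 r" for t
        using admissible_step_nth[OF a z that, of i] \<psi>[OF z that] by simp
      ultimately show "((\<lambda>t. \<psi> z t $ i) has_field_derivative (F (\<psi> z t) $ i)) (at t)"
        by (simp, elim has_field_derivative_transform_within_open[OF _ open_ball t]) simp
    qed
  qed (use a RK in \<open>auto simp: admissible_def simp del: mem_ball mem_cball\<close>)
qed

subsection \<open>Removal of isolated singularities\<close>

text \<open>Integrate over a circle in the first variable around \<open>a $ 1\<close>. For every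
  second coordinate this circle misses \<open>a\<close>, so the Cauchy integral is holomorphic on
  the full bidisc. It reproduces \<open>f\<close> on every horizontal disc that misses
  \<open>a\<close>.\<close>

lemma hartogs_isolated:
  fixes f :: "complex^2 \<Rightarrow> complex"
  assumes S: "open S" "a \<in> S" and f: "\<And>x. x \<in> S \<Longrightarrow> x \<noteq> a \<Longrightarrow> cdiff f x"
  obtains g e where "e > 0" "\<And>x. x \<in> ball a e \<Longrightarrow> cdiff g x" "\<And>x. x \<in> ball a e \<Longrightarrow> x \<noteq> a \<Longrightarrow> g x = f x"
proof -
  obtain e0 where e0: "e0 > 0" "ball a e0 \<subseteq> S" using S openE by metis
  define r where "r = e0 / 3"
  have r: "r > 0" using e0 by (simp add: r_def)
  have mem: "vec2 z w \<in> S" if "z \<in> cball (a $ 1) r" "w \<in> ball (a $ 2) r" for z w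
  proof -
    have "norm (vec2 z w - a) \<le> (\<Sum>i\<in>UNIV. norm ((vec2 z w - a) $ i))" unfolding norm_vec_def by (rule L2_set_le_sum) simp
    also have "\<dots> = norm (z - a $ 1) + norm (w - a $ 2)" by (simp add: UNIV_2)
    also have "\<dots> < e0" using that r by (simp add: dist_norm norm_minus_commute r_def)
    finally show ?thesis using e0 by (auto simp: dist_norm norm_minus_commute)
  qed
  have cd: "cdiff f (vec2 z w)" if "z \<in> cball (a $ 1) r" "w \<in> ball (a $ 2) r" "z \<noteq> a $ 1 \<or> w \<noteq> a $ 2" for z w
    using f[OF mem[OF that(1,2)]] that(3) by (metis vec2_nth)
  have hz: "(\<lambda>z. f (vec2 z w)) field_differentiable (at z)"
    if "z \<in> cball (a $ 1) r" "w \<in> ball (a $ 2) r" "z \<noteq> a $ 1 \<or> w \<noteq> a $ 2" for z w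
  proof (rule cdiff_curve[of _ _ _ "vec2 1 0"])
    show "((\<lambda>z. vec2 z w) has_derivative (\<lambda>s. s *s vec2 1 0)) (at z)"
      by (rule has_derivative_curve) (simp add: vec2_def)
  qed (rule cd[OF that])
  have hw: "(\<lambda>w. f (vec2 z w)) field_differentiable (at w)"
    if "z \<in> cball (a $ 1) r" "w \<in> ball (a $ 2) r" "z \<noteq> a $ 1 \<or> w \<noteq> a $ 2" for z w
  proof (rule cdiff_curve[of _ _ _ "vec2 0 1"])
    show "((\<lambda>w. vec2 z w) has_derivative (\<lambda>s. s *s vec2 0 1)) (at w)"
      by (rule has_derivative_curve) (simp add: vec2_def)
  qed (rule cd[OF that])
  let ?U = "ball (a $ 1) r" and ?V = "ball (a $ 2) r"
  let ?c = "\<lambda>t::real. circlepath (a $ 1) r t"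
  define k where "k t = 2 * pi * \<i> * r * exp (2 * of_real pi * \<i> * of_real t)" for t :: real
  define H where "H z w t = f (vec2 (?c t) w) / (?c t - z) * k t" for z w and t :: real
  define G where "G z w = integral (cbox 0 1) (H z w) / (2 * pi * \<i>)" for z w
  have c: "?c t \<in> sphere (a $ 1) r" for t using r by (simp add: circlepath dist_norm norm_mult norm_exp_eq_Re)
  have c': "?c t \<in> cball (a $ 1) r" "?c t \<noteq> a $ 1" "z \<in> ?U \<Longrightarrow> ?c t \<noteq> z" for t z
    using c[of t] r by auto
  have cc: "continuous_on S ?c" for S unfolding circlepath by (intro continuous_intros)
  have contf: "continuous_on ({vec2 (?c t) w |t w. w \<in> ?V}) f"
  proof (intro continuous_at_imp_continuous_on ballI)
    fix x assume "x \<in> {vec2 (?c t) w |t w. w \<in> ?V}"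
    then obtain t w where x: "x = vec2 (?c t) w" "w \<in> ?V" by blast
    show "isCont f x" unfolding x(1) by (rule cdiff_isCont[OF cd[OF c'(1) x(2)]]) (simp add: c'(2))
  qed
  have contH: "continuous_on ((?U \<times> ?V) \<times> cbox 0 1) (\<lambda>(p, t). H (fst p) (snd p) t)"
  proof -
    let ?T = "(?U \<times> ?V) \<times> cbox (0::real) 1"
    have c1: "continuous_on ?T (\<lambda>q. ?c (snd q))"
      by (rule continuous_on_compose2[OF cc[of UNIV]]) (auto intro!: continuous_intros)
    then have c2: "continuous_on ?T (\<lambda>q. vec2 (?c (snd q)) (snd (fst q)))" by (intro continuous_intros)
    have c3: "continuous_on ?T (\<lambda>q. f (vec2 (?c (snd q)) (snd (fst q))))"
      by (rule continuous_on_compose2[OF contf c2]) (auto; blast)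
    have "\<forall>q\<in>?T. ?c (snd q) - fst (fst q) \<noteq> 0"
    proof
      fix q assume "q \<in> ?T"
      then have "fst (fst q) \<in> ?U" by auto
      then show "?c (snd q) - fst (fst q) \<noteq> 0" using c'(3) by (metis right_minus_eq)
    qed
    then show ?thesis unfolding H_def k_def split_beta by (intro continuous_intros c1 c3)
  qed
  have contG: "continuous_on (?U \<times> ?V) (\<lambda>(z, w). G z w)"
    using integral_continuous_on_param[OF contH] unfolding G_def split_beta by (intro continuous_intros) auto
  have G1: "(\<lambda>z. G z w) holomorphic_on ?U" if w: "w \<in> ?V" for w
  proof -
    have "continuous_on (?U \<times> cbox 0 1) (\<lambda>q. case ((fst q, w), snd q) of (p, t) \<Rightarrow> H (fst p) (snd p) t)"
      by (rule continuous_on_compose2[OF contH]) (use w in \<open>auto intro!: continuous_intros\<close>)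
    then have ch: "continuous_on (?U \<times> cbox 0 1) (\<lambda>(z, t). H z w t)" by (simp add: split_beta)
    have "(\<lambda>z. H z w t) holomorphic_on ?U" for t
      unfolding H_def by (intro holomorphic_intros) (metis c'(3) right_minus_eq)
    then have "(\<lambda>z. integral (cbox 0 1) (H z w)) holomorphic_on ?U"
      by (rule integral_holomorphic[OF open_ball ch])
    then show ?thesis unfolding G_def by (intro holomorphic_intros) auto
  qed
  have G2: "G z holomorphic_on ?V" if z: "z \<in> ?U" for z
  proof -
    have "continuous_on (?V \<times> cbox 0 1) (\<lambda>q. case ((z, fst q), snd q) of (p, t) \<Rightarrow> H (fst p) (snd p) t)"
      by (rule continuous_on_compose2[OF contH]) (use z in \<open>auto intro!: continuous_intros\<close>)
    then have ch: "continuous_on (?V \<times> cbox 0 1) (\<lambda>(w, t). H z w t)" by (simp add: split_beta)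
    have "(\<lambda>w. f (vec2 (?c t) w)) holomorphic_on ?V" for t
      unfolding holomorphic_on_def
      using hw[OF c'(1)] c'(2) field_differentiable_at_within by blast
    moreover have "?c t - z \<noteq> 0" for t using c'(3)[OF z] by (metis right_minus_eq)
    ultimately have "(\<lambda>w. H z w t) holomorphic_on ?V" for t
      unfolding H_def by (intro holomorphic_intros)
    then have "(\<lambda>w. integral (cbox 0 1) (H z w)) holomorphic_on ?V"
      by (rule integral_holomorphic[OF open_ball ch])
    then have "(\<lambda>w. integral (cbox 0 1) (H z w) / (2 * pi * \<i>)) holomorphic_on ?V" by (intro holomorphic_intros) auto
    then show ?thesis unfolding G_def .
  qed
  have eq0: "G z w = f (vec2 z w)" if z: "z \<in> ?U" and w: "w \<in> ?V" and ne: "w \<noteq> a $ 2" for z w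
  proof -
    have h: "(\<lambda>z. f (vec2 z w)) holomorphic_on cball (a $ 1) r"
      unfolding holomorphic_on_def using hz[OF _ w] ne field_differentiable_at_within by blast
    have "contour_integral (circlepath (a $ 1) r) (\<lambda>u. f (vec2 u w) / (u - z) ^ Suc 0)
        = (2 * pi * \<i>) * (deriv ^^ 0) (\<lambda>z. f (vec2 z w)) z / fact 0"
      by (rule Cauchy_contour_integral_circlepath[OF holomorphic_on_imp_continuous_on[OF h] _ z])
        (rule holomorphic_on_subset[OF h], auto)
    moreover have "contour_integral (circlepath (a $ 1) r) (\<lambda>u. f (vec2 u w) / (u - z) ^ Suc 0) = integral (cbox 0 1) (H z w)"
      unfolding contour_integral_integral H_def k_def
      by (auto intro!: integral_cong simp: vector_derivative_circlepath)
    ultimately have "integral (cbox 0 1) (H z w) = (2 * pi * \<i>) * f (vec2 z w)" by simp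
    then show ?thesis unfolding G_def by simp
  qed
  have eq: "G z w = f (vec2 z w)" if z: "z \<in> ?U" and w: "w \<in> ?V" and ne: "z \<noteq> a $ 1 \<or> w \<noteq> a $ 2" for z w
  proof (cases "w = a $ 2")
    case True
    have zc: "z \<in> cball (a $ 1) r" using z by auto
    have "isCont (G z) w"
      using holomorphic_on_imp_continuous_on[OF G2[OF z]] w by (simp add: continuous_on_eq_continuous_at)
    then have 1: "(G z \<longlongrightarrow> G z w) (at w)" by (simp add: isCont_def)
    have "isCont (\<lambda>w. f (vec2 z w)) w" using hw[OF zc w ne] field_differentiable_imp_continuous_at by blast
    then have 2: "((\<lambda>w. f (vec2 z w)) \<longlongrightarrow> f (vec2 z w)) (at w)" by (simp add: isCont_def)
    have "\<forall>\<^sub>F u in at w. u \<in> ?V - {w}" by (rule eventually_at_in_open) (use w in auto)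
    then have "\<forall>\<^sub>F u in at w. G z u = f (vec2 z u)"
      by (rule eventually_mono) (use eq0[OF z] True in auto)
    then have "(G z \<longlongrightarrow> f (vec2 z w)) (at w)" using 2 by (simp add: tendsto_cong)
    then show ?thesis using 1 tendsto_unique trivial_limit_at by blast
  next
    case False then show ?thesis by (rule eq0[OF z w])
  qed
  have ball: "x $ 1 \<in> ?U \<and> x $ 2 \<in> ?V" if "x \<in> ball a r" for x
    using that dist_vec_nth_le[of a 1 x] dist_vec_nth_le[of a 2 x] by auto
  show thesis
  proof (rule that[OF r])
    show "cdiff (\<lambda>x. G (x $ 1) (x $ 2)) x" if "x \<in> ball a r" for x
      by (rule osgood[OF open_ball open_ball contG G1 G2]) (use ball[OF that] in auto)
    show "G (x $ 1) (x $ 2) = f x" if "x \<in> ball a r" "x \<noteq> a" for x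
      using eq[of "x $ 1" "x $ 2"] ball[OF that(1)] that(2) by (metis vec2_eta)
  qed
qed

section \<open>Holomorphic calculus on a complex surface\<close>

locale surface =
  fixes A :: "('a::{t2_space, second_countable_topology}, 2) chart set"
  assumes manifold: "complex_manifold A"
begin

section \<open>Charts, holomorphic functions and curves\<close>

lemma chart_open: "c \<in> A \<Longrightarrow> open (fst c)" "c \<in> A \<Longrightarrow> open (snd c ` fst c)"
  and chart_homeo: "c \<in> A \<Longrightarrow> homeomorphism (fst c) (snd c ` fst c) (snd c) (chart_inv c)"
  and transition: "c \<in> A \<Longrightarrow> d \<in> A \<Longrightarrow> holomorphic_map_on (snd d \<circ> chart_inv c) (snd c ` (fst c \<inter> fst d))"
  using manifold by (auto simp: complex_manifold_def)

lemma chart_at: obtains c where "c \<in> A" "p \<in> fst c"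
proof -
  have "p \<in> (\<Union>c\<in>A. fst c)" using manifold by (simp add: complex_manifold_def)
  then show thesis using that by blast
qed

lemma chart_inv_chart [simp]: "c \<in> A \<Longrightarrow> p \<in> fst c \<Longrightarrow> chart_inv c (snd c p) = p"
  using chart_homeo by (auto simp: homeomorphism_def)

lemma chart_chart_inv [simp]: "x \<in> snd c ` fst c \<Longrightarrow> snd c (chart_inv c x) = x"
  by (rule f_inv_into_f)

lemma chart_inv_in [simp]: "x \<in> snd c ` fst c \<Longrightarrow> chart_inv c x \<in> fst c"
  by (rule inv_into_into)

lemma chart_cont: "c \<in> A \<Longrightarrow> p \<in> fst c \<Longrightarrow> isCont (snd c) p"
  using homeomorphism_cont1[OF chart_homeo] chart_open(1) by (simp add: continuous_on_eq_continuous_at)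

lemma chart_inv_cont: "c \<in> A \<Longrightarrow> x \<in> snd c ` fst c \<Longrightarrow> isCont (chart_inv c) x"
  using homeomorphism_cont2[OF chart_homeo] continuous_on_eq_continuous_at[OF chart_open(2)] by blast

lemma chart_image_open:
  assumes "c \<in> A" "open S" "S \<subseteq> fst c" shows "open (snd c ` S)"
proof -
  have "openin (top_of_set (snd c ` fst c)) (snd c ` S)"
    by (rule homeomorphism_imp_open_map[OF chart_homeo[OF assms(1)]]) (use assms in \<open>simp add: open_subset\<close>)
  then show ?thesis using chart_open(2)[OF assms(1)] openin_open_trans by blast
qed

lemma chart_inv_image_open:
  assumes "c \<in> A" "open S" "S \<subseteq> snd c ` fst c" shows "open (chart_inv c ` S)"
proof -
  have "openin (top_of_set (fst c)) (chart_inv c ` S)"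
    by (rule homeomorphism_imp_open_map[OF homeomorphism_symD[OF chart_homeo[OF assms(1)]]])
      (use assms in \<open>simp add: open_subset\<close>)
  then show ?thesis using chart_open(1)[OF assms(1)] openin_open_trans by blast
qed

lemma cdiffv_transition:
  assumes "c \<in> A" "d \<in> A" "p \<in> fst c" "p \<in> fst d"
  shows "cdiffv (snd d \<circ> chart_inv c) (snd c p)"
  using transition[OF assms(1,2)] assms by (auto simp: holomorphic_map_on_cdiffv)

lemma eventually_chart: "c \<in> A \<Longrightarrow> p \<in> fst c \<Longrightarrow> \<forall>\<^sub>F q in nhds p. q \<in> fst c"
  using chart_open(1) by (intro eventually_nhds_in_open) auto

lemma eventually_chart_inv:
  assumes "c \<in> A" "p \<in> fst c" "\<forall>\<^sub>F q in nhds p. P q"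
  shows "\<forall>\<^sub>F x in nhds (snd c p). x \<in> snd c ` fst c \<and> P (chart_inv c x)"
proof (rule eventually_conj)
  show "\<forall>\<^sub>F x in nhds (snd c p). x \<in> snd c ` fst c"
    using chart_open(2)[OF assms(1)] assms by (intro eventually_nhds_in_open) auto
  have "filterlim (chart_inv c) (nhds p) (nhds (snd c p))"
    using chart_inv_cont[OF assms(1), of "snd c p"] assms
    by (metis chart_inv_chart imageI isCont_def tendsto_at_iff_tendsto_nhds)
  then show "\<forall>\<^sub>F x in nhds (snd c p). P (chart_inv c x)"
    using eventually_compose_filterlim assms(3) by blast
qed

definition hol_at :: "('a \<Rightarrow> complex) \<Rightarrow> 'a \<Rightarrow> bool" where
  "hol_at f p \<longleftrightarrow> (\<forall>c\<in>A. p \<in> fst c \<longrightarrow> cdiff (f \<circ> chart_inv c) (snd c p))"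

lemma holo_on_hol_at: "holo_on A S f \<longleftrightarrow> (\<forall>p\<in>S. hol_at f p)"
  unfolding holo_on_def holomorphic_fun_on_cdiff hol_at_def by auto

text \<open>A single chart suffices because transition maps are holomorphic.\<close>

lemma hol_atI:
  assumes c: "c \<in> A" "p \<in> fst c" and f: "cdiff (f \<circ> chart_inv c) (snd c p)"
  shows "hol_at f p"
  unfolding hol_at_def
proof (intro ballI impI)
  fix d assume d: "d \<in> A" "p \<in> fst d"
  have "cdiff (\<lambda>x. (f \<circ> chart_inv c) ((snd c \<circ> chart_inv d) x)) (snd d p)"
    by (rule cdiff_compose[OF cdiffv_transition[OF d(1) c(1) d(2) c(2)]]) (use f d in \<open>simp add: o_def\<close>)
  then show "cdiff (f \<circ> chart_inv d) (snd d p)"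
  proof (rule cdiff_transform)
    show "\<forall>\<^sub>F x in nhds (snd d p). (f \<circ> chart_inv c) ((snd c \<circ> chart_inv d) x) = (f \<circ> chart_inv d) x"
      using eventually_chart_inv[OF d eventually_chart[OF c]] by (rule eventually_mono) (use c in auto)
  qed
qed

lemma hol_atD: "hol_at f p \<Longrightarrow> c \<in> A \<Longrightarrow> p \<in> fst c \<Longrightarrow> cdiff (f \<circ> chart_inv c) (snd c p)"
  by (simp add: hol_at_def)

lemma hol_at_cong:
  assumes "hol_at f p" "\<forall>\<^sub>F q in nhds p. f q = g q" shows "hol_at g p"
proof -
  obtain c where c: "c \<in> A" "p \<in> fst c" by (rule chart_at)
  show ?thesis
    by (rule hol_atI[OF c], rule cdiff_transform[OF hol_atD[OF assms(1) c]])
      (use eventually_chart_inv[OF c assms(2)] in \<open>auto elim: eventually_mono\<close>)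
qed

lemma hol_at_isCont: assumes "hol_at f p" shows "isCont f p"
proof -
  obtain c where c: "c \<in> A" "p \<in> fst c" by (rule chart_at)
  have "isCont (f \<circ> chart_inv c) (snd c p)" by (rule cdiff_isCont[OF hol_atD[OF assms c]])
  from isCont_o2[OF chart_cont[OF c] this] have "isCont (\<lambda>q. f (chart_inv c (snd c q))) p" by simp
  moreover have "\<forall>\<^sub>F q in nhds p. f (chart_inv c (snd c q)) = f q"
    using eventually_chart[OF c] by (rule eventually_mono) (use c in simp)
  ultimately show ?thesis by (simp add: isCont_cong)
qed

lemma hol_at_const [simp]: "hol_at (\<lambda>_. k) p"
  by (simp add: hol_at_def o_def)

lemma hol_at_mult: "hol_at f p \<Longrightarrow> hol_at g p \<Longrightarrow> hol_at (\<lambda>x. f x * g x) p"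
  and hol_at_diff: "hol_at f p \<Longrightarrow> hol_at g p \<Longrightarrow> hol_at (\<lambda>x. f x - g x) p"
  and hol_at_power: "hol_at f p \<Longrightarrow> hol_at (\<lambda>x. f x ^ n) p"
  by (auto simp: hol_at_def o_def intro: cdiff_mult cdiff_add cdiff_diff cdiff_power)

lemma hol_at_divide: "hol_at f p \<Longrightarrow> hol_at g p \<Longrightarrow> g p \<noteq> 0 \<Longrightarrow> hol_at (\<lambda>x. f x / g x) p"
  unfolding hol_at_def o_def by (intro ballI impI cdiff_divide) simp_all

text \<open>Continuity is a separate clause: a chart map is arbitrary off its domain, so
  differentiability of its composition with \<open>\<Phi>\<close> does not keep nearby values in
  that domain.\<close>

definition hmap_at :: "(complex^2 \<Rightarrow> 'a) \<Rightarrow> complex^2 \<Rightarrow> bool" where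
  "hmap_at \<Phi> x \<longleftrightarrow> isCont \<Phi> x \<and> (\<forall>c\<in>A. \<Phi> x \<in> fst c \<longrightarrow> cdiffv (snd c \<circ> \<Phi>) x)"

lemma isCont_filterlim: "isCont f x \<Longrightarrow> filterlim f (nhds (f x)) (nhds x)"
  by (metis isCont_def tendsto_at_iff_tendsto_nhds)

lemma isCont_eventually: "isCont f x \<Longrightarrow> \<forall>\<^sub>F y in nhds (f x). P y \<Longrightarrow> \<forall>\<^sub>F y in nhds x. P (f y)"
  using eventually_compose_filterlim isCont_filterlim by blast

lemma hmap_atI:
  assumes "isCont \<Phi> x" and c: "c \<in> A" "\<Phi> x \<in> fst c" and f: "cdiffv (snd c \<circ> \<Phi>) x"
  shows "hmap_at \<Phi> x"
  unfolding hmap_at_def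
proof (intro conjI ballI impI assms)
  fix d assume d: "d \<in> A" "\<Phi> x \<in> fst d"
  have "cdiffv (\<lambda>x. (snd d \<circ> chart_inv c) ((snd c \<circ> \<Phi>) x)) x"
    by (rule cdiffv_compose[OF f]) (use cdiffv_transition[OF c(1) d(1) c(2) d(2)] in \<open>simp add: o_def\<close>)
  then show "cdiffv (snd d \<circ> \<Phi>) x"
  proof (rule cdiffv_transform)
    show "\<forall>\<^sub>F y in nhds x. (snd d \<circ> chart_inv c) ((snd c \<circ> \<Phi>) y) = (snd d \<circ> \<Phi>) y"
      using isCont_eventually[OF assms(1) eventually_chart[OF c]] by (rule eventually_mono) (use c in auto)
  qed
qed

lemma hol_at_coordinates:
  assumes "\<And>i. hol_at (\<lambda>p. g p $ i) p" "cdiff f (g p)"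
  shows "hol_at (\<lambda>p. f (g p)) p"
  unfolding hol_at_def
proof (intro ballI impI)
  fix c assume c: "c \<in> A" "p \<in> fst c"
  have "cdiffv (g \<circ> chart_inv c) (snd c p)"
    using assms(1) c by (simp add: cdiffv_iff hol_at_def o_def)
  from cdiff_compose[OF this, of f] show "cdiff ((\<lambda>p. f (g p)) \<circ> chart_inv c) (snd c p)"
    using assms(2) c by (simp add: o_def)
qed

definition hcurve_at :: "(complex \<Rightarrow> 'a) \<Rightarrow> complex \<Rightarrow> bool" where
  "hcurve_at \<mu> z \<longleftrightarrow> isCont \<mu> z \<and> (\<forall>c\<in>A. \<mu> z \<in> fst c \<longrightarrow> (\<exists>v. has_velocity c \<mu> z v))"

lemma hcurve_hmap:
  assumes "hmap_at \<Phi> (g z)" "(g has_derivative (\<lambda>s. s *s v)) (at z)"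
  shows "hcurve_at (\<lambda>z. \<Phi> (g z)) z"
  unfolding hcurve_at_def
proof (intro conjI ballI impI)
  have "isCont g z" using assms(2) by (rule has_derivative_continuous)
  then show "isCont (\<lambda>z. \<Phi> (g z)) z" using assms(1) isCont_o2 unfolding hmap_at_def by blast
  fix c assume "c \<in> A" "\<Phi> (g z) \<in> fst c"
  then obtain D where D: "(snd c \<circ> \<Phi> has_derivative D) (at (g z))" "\<And>k v. D (k *s v) = k *s D v"
    using assms(1) unfolding hmap_at_def cdiffv_def by blast
  have "(snd c \<circ> (\<lambda>z. \<Phi> (g z)) has_derivative (\<lambda>s. s *s D v)) (at z)"
    using has_derivative_compose[OF assms(2) D(1)] by (simp add: o_def D(2))
  then show "\<exists>v. has_velocity c (\<lambda>z. \<Phi> (g z)) z v" by (auto simp: has_velocity_def)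
qed

lemma hol_at_hcurve:
  assumes "hcurve_at \<mu> z" "hol_at f (\<mu> z)"
  shows "(\<lambda>z. f (\<mu> z)) field_differentiable (at z)"
proof -
  obtain c where c: "c \<in> A" "\<mu> z \<in> fst c" by (rule chart_at)
  then obtain v where v: "(snd c \<circ> \<mu> has_derivative (\<lambda>s. s *s v)) (at z)"
    using assms(1) unfolding hcurve_at_def has_velocity_def by blast
  have "(\<lambda>z. (f \<circ> chart_inv c) ((snd c \<circ> \<mu>) z)) field_differentiable (at z)"
    by (rule cdiff_curve[OF _ v]) (use assms c in \<open>simp add: hol_at_def o_def\<close>)
  moreover have ev: "\<forall>\<^sub>F w in nhds z. (f \<circ> chart_inv c) ((snd c \<circ> \<mu>) w) = f (\<mu> w)"
  proof -
    have "isCont \<mu> z" using assms(1) by (simp add: hcurve_at_def)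
    from isCont_eventually[OF this eventually_chart[OF c]] show ?thesis
      by (rule eventually_mono) (use c in simp)
  qed
  ultimately show ?thesis
    unfolding field_differentiable_def using DERIV_cong_ev[OF refl ev refl] by simp
qed

end

locale flow_surface = surface A
  for A :: "('a::{t2_space, second_countable_topology}, 2) chart set" +
  fixes X :: "('a, 2) vfield"
  assumes connected_surface: "connected (UNIV :: 'a set)"
    and vfield: "holomorphic_vfield A X"
    and complete: "complete_vfield A X"
    and isolated: "isolated_singularities A X"
    and separated: "\<And>x y. x \<noteq> y \<Longrightarrow> \<exists>f. holo_on A UNIV f \<and> f x \<noteq> f y"
begin

section \<open>Uniqueness of integral curves\<close>

lemma vfield_chart: "c \<in> A \<Longrightarrow> x \<in> snd c ` fst c \<Longrightarrow> cdiffv (X c \<circ> chart_inv c) x"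
  using vfield unfolding holomorphic_vfield_def holomorphic_map_on_cdiffv by blast

lemma vfield_transform:
  "c \<in> A \<Longrightarrow> d \<in> A \<Longrightarrow> p \<in> fst c \<Longrightarrow> p \<in> fst d \<Longrightarrow>
     X d p = frechet_derivative (snd d \<circ> chart_inv c) (at (snd c p)) (X c p)"
  using vfield unfolding holomorphic_vfield_def by blast

text \<open>Integral curves on a set of times: the solutions that make up a flow box exist on a disc
  only, before uniqueness recognizes them as pieces of the global flow.\<close>

definition local_curve :: "complex set \<Rightarrow> (complex \<Rightarrow> 'a) \<Rightarrow> bool" where
  "local_curve T \<gamma> \<longleftrightarrow> (\<forall>t\<in>T. isCont \<gamma> t \<and> (\<forall>c\<in>A. \<gamma> t \<in> fst c \<longrightarrow> has_velocity c \<gamma> t (X c (\<gamma> t))))"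

lemma integral_curve_local: "integral_curve A X \<gamma> \<longleftrightarrow> local_curve UNIV \<gamma>"
  unfolding integral_curve_def local_curve_def continuous_on_eq_continuous_at[OF open_UNIV] by blast

lemma local_curve_subset: "local_curve T \<gamma> \<Longrightarrow> S \<subseteq> T \<Longrightarrow> local_curve S \<gamma>"
  by (auto simp: local_curve_def)

lemma velocity_transform:
  assumes c: "c \<in> A" "\<gamma> t \<in> fst c" and d: "d \<in> A" "\<gamma> t \<in> fst d"
    and cont: "isCont \<gamma> t" and v: "has_velocity c \<gamma> t (X c (\<gamma> t))"
  shows "has_velocity d \<gamma> t (X d (\<gamma> t))"
proof -
  obtain D where D: "(snd d \<circ> chart_inv c has_derivative D) (at (snd c (\<gamma> t)))" "\<And>k v. D (k *s v) = k *s D v"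
    using cdiffv_transition[OF c(1) d(1) c(2) d(2)] unfolding cdiffv_def by blast
  have eq: "X d (\<gamma> t) = D (X c (\<gamma> t))"
    using vfield_transform[OF c(1) d(1) c(2) d(2)] frechet_derivative_at[OF D(1)] by simp
  have d1: "((\<lambda>s. (snd d \<circ> chart_inv c) ((snd c \<circ> \<gamma>) s)) has_derivative (\<lambda>s. D (s *s X c (\<gamma> t)))) (at t)"
    by (rule has_derivative_compose[OF v[unfolded has_velocity_def]]) (use D in \<open>simp add: o_def\<close>)
  have d2: "\<forall>\<^sub>F s in nhds t. (snd d \<circ> chart_inv c) ((snd c \<circ> \<gamma>) s) = (snd d \<circ> \<gamma>) s"
    using isCont_eventually[OF cont eventually_chart[OF c]] by (rule eventually_mono) (use c in auto)
  from has_derivative_transform_nhds[OF d1 d2] show ?thesis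
    unfolding has_velocity_def by (simp add: D(2) eq o_def)
qed

text \<open>Near a common point the difference of two solutions, read in a chart, is at most half of its
  own supremum.\<close>

lemma local_curve_unique_near:
  assumes T: "open T" "t0 \<in> T" and \<gamma>: "local_curve T \<gamma>" "local_curve T \<gamma>'" and eq: "\<gamma> t0 = \<gamma>' t0"
  shows "\<forall>\<^sub>F t in nhds t0. \<gamma> t = \<gamma>' t"
proof -
  obtain c where c: "c \<in> A" "\<gamma> t0 \<in> fst c" by (rule chart_at)
  define F where "F = X c \<circ> chart_inv c"
  let ?x = "snd c (\<gamma> t0)"
  have "?x \<in> snd c ` fst c" using c by simp
  then obtain r K where rK: "r > 0" "K > 0" "cball ?x r \<subseteq> snd c ` fst c"
    "\<And>x y. x \<in> cball ?x r \<Longrightarrow> y \<in> cball ?x r \<Longrightarrow> norm (F x - F y) \<le> K * norm (x - y)"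
    using cdiffv_locally_Lipschitz[OF chart_open(2)[OF c(1)] vfield_chart[OF c(1)]] unfolding F_def by metis
  have near: "\<forall>\<^sub>F t in nhds t0. \<beta> t \<in> fst c \<and> snd c (\<beta> t) \<in> cball ?x r"
    if \<beta>: "local_curve T \<beta>" "\<beta> t0 = \<gamma> t0" for \<beta>
  proof (rule eventually_conj)
    have i: "isCont \<beta> t0" using \<beta> T by (simp add: local_curve_def)
    show "\<forall>\<^sub>F t in nhds t0. \<beta> t \<in> fst c"
      by (rule isCont_eventually[OF i]) (use eventually_chart[OF c] \<beta>(2) in simp)
    have "isCont (\<lambda>t. snd c (\<beta> t)) t0" by (rule isCont_o2[OF i]) (use chart_cont[OF c] \<beta>(2) in simp)
    moreover have "\<forall>\<^sub>F y in nhds (snd c (\<beta> t0)). y \<in> ball ?x r"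
      by (rule eventually_nhds_in_open) (use rK \<beta>(2) in auto)
    ultimately have "\<forall>\<^sub>F t in nhds t0. snd c (\<beta> t) \<in> ball ?x r" by (rule isCont_eventually)
    then show "\<forall>\<^sub>F t in nhds t0. snd c (\<beta> t) \<in> cball ?x r" by (rule eventually_mono) auto
  qed
  have "\<forall>\<^sub>F t in nhds t0. t \<in> T" using T by (rule eventually_nhds_in_open)
  then have "\<forall>\<^sub>F t in nhds t0. (\<gamma> t \<in> fst c \<and> snd c (\<gamma> t) \<in> cball ?x r) \<and> (\<gamma>' t \<in> fst c \<and> snd c (\<gamma>' t) \<in> cball ?x r) \<and> t \<in> T"
    using near[OF \<gamma>(1) refl] near[OF \<gamma>(2) eq[symmetric]] by eventually_elim blast
  then obtain e where e: "e > 0" "\<And>t. dist t t0 < e \<Longrightarrow>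
      (\<gamma> t \<in> fst c \<and> snd c (\<gamma> t) \<in> cball ?x r) \<and> (\<gamma>' t \<in> fst c \<and> snd c (\<gamma>' t) \<in> cball ?x r) \<and> t \<in> T"
    by (auto simp: eventually_nhds_metric)
  define \<delta> where "\<delta> = min (e / 2) (1 / (2 * K))"
  have \<delta>: "\<delta> > 0" "\<delta> < e" "\<delta> * K \<le> 1/2"
    using e rK by (auto simp: \<delta>_def min_def field_simps)
  have mem: "(\<gamma> t \<in> fst c \<and> snd c (\<gamma> t) \<in> cball ?x r) \<and> (\<gamma>' t \<in> fst c \<and> snd c (\<gamma>' t) \<in> cball ?x r) \<and> t \<in> T"
    if "t \<in> cball t0 \<delta>" for t
    using e(2)[of t] that \<delta> by (simp add: dist_commute)
  define w where "w t = snd c (\<gamma> t) - snd c (\<gamma>' t)" for t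
  have dw: "(w has_derivative (\<lambda>s. s *s (F (snd c (\<gamma> t)) - F (snd c (\<gamma>' t))))) (at t)"
    if t: "t \<in> cball t0 \<delta>" for t
  proof -
    have "((\<lambda>t. snd c (\<gamma> t)) has_derivative (\<lambda>s. s *s X c (\<gamma> t))) (at t)"
      "((\<lambda>t. snd c (\<gamma>' t)) has_derivative (\<lambda>s. s *s X c (\<gamma>' t))) (at t)"
      using \<gamma> mem[OF t] c(1) unfolding local_curve_def has_velocity_def o_def by blast+
    from has_derivative_diff[OF this] show ?thesis
      using mem[OF t] c(1) by (simp add: w_def[abs_def] F_def vector_sub_rdistrib vec.scale_right_diff_distrib)
  qed
  have "continuous_on (cball t0 \<delta>) (\<lambda>t. norm (w t))"
    using dw has_derivative_continuous by (intro continuous_intros continuous_at_imp_continuous_on) blast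
  then obtain t1 where t1: "t1 \<in> cball t0 \<delta>" "\<And>t. t \<in> cball t0 \<delta> \<Longrightarrow> norm (w t) \<le> norm (w t1)"
    using continuous_attains_sup[of "cball t0 \<delta>" "\<lambda>t. norm (w t)"] \<delta>(1) by fastforce
  have "norm (w t1 - w t0) \<le> (K * norm (w t1)) * norm (t1 - t0)"
  proof (rule differentiable_bound[OF convex_cball has_derivative_at_withinI[OF dw]])
    show "onorm (\<lambda>s. s *s (F (snd c (\<gamma> t)) - F (snd c (\<gamma>' t)))) \<le> K * norm (w t1)" if t: "t \<in> cball t0 \<delta>" for t
    proof (rule onorm_le)
      fix s :: complex
      have "norm (F (snd c (\<gamma> t)) - F (snd c (\<gamma>' t))) \<le> K * norm (w t)"
        using rK(4) mem[OF t] by (simp add: w_def)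
      also have "\<dots> \<le> K * norm (w t1)" using t1(2)[OF t] rK(2) by (intro mult_left_mono) auto
      finally show "norm (s *s (F (snd c (\<gamma> t)) - F (snd c (\<gamma>' t)))) \<le> K * norm (w t1) * norm s"
        unfolding norm_smult by (subst mult.commute) (intro mult_right_mono, auto)
    qed
  qed (use t1 \<delta> in auto)
  also have "\<dots> \<le> (K * norm (w t1)) * \<delta>"
    using t1(1) rK(2) by (intro mult_left_mono) (auto simp: dist_norm norm_minus_commute)
  also have "\<dots> = (\<delta> * K) * norm (w t1)" by simp
  also have "\<dots> \<le> (1/2) * norm (w t1)" using \<delta>(3) by (intro mult_right_mono) auto
  finally have "norm (w t1) \<le> (1/2) * norm (w t1)" using eq by (simp add: w_def)
  then have "norm (w t1) = 0" by simp
  then have "w t = 0" if "t \<in> cball t0 \<delta>" for t using t1(2)[OF that] by simp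
  then have "\<gamma> t = \<gamma>' t" if "t \<in> cball t0 \<delta>" for t
    using that mem[OF that] c(1) unfolding w_def by (metis chart_inv_chart right_minus_eq)
  moreover have "\<forall>\<^sub>F t in nhds t0. t \<in> ball t0 \<delta>" by (rule eventually_nhds_in_open) (use \<delta> in auto)
  ultimately show ?thesis by (auto elim!: eventually_mono)
qed

text \<open>The set of times where the curves agree is open by local uniqueness and closed because
  the surface is Hausdorff.\<close>

lemma local_curve_unique:
  assumes T: "open T" "connected T" and \<gamma>: "local_curve T \<gamma>" "local_curve T \<gamma>'"
    and t0: "t0 \<in> T" "\<gamma> t0 = \<gamma>' t0" and t: "t \<in> T"
  shows "\<gamma> t = \<gamma>' t"
proof -
  let ?E = "{t \<in> T. \<gamma> t = \<gamma>' t}"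
  have c: "continuous_on T \<gamma>" "continuous_on T \<gamma>'"
    using \<gamma> by (auto simp: local_curve_def intro: continuous_at_imp_continuous_on)
  have "open ?E"
  proof (subst open_subopen, intro ballI)
    fix s assume s: "s \<in> ?E"
    then have "\<forall>\<^sub>F t in nhds s. \<gamma> t = \<gamma>' t \<and> t \<in> T"
      using local_curve_unique_near[OF T(1) _ \<gamma>] T(1) by (intro eventually_conj eventually_nhds_in_open) auto
    then show "\<exists>U. open U \<and> s \<in> U \<and> U \<subseteq> ?E" unfolding eventually_nhds by blast
  qed
  moreover have "open {t \<in> T. \<gamma> t \<noteq> \<gamma>' t}"
  proof (subst open_subopen, intro ballI)
    fix s assume s: "s \<in> {t \<in> T. \<gamma> t \<noteq> \<gamma>' t}"
    then obtain U V where UV: "open U" "open V" "\<gamma> s \<in> U" "\<gamma>' s \<in> V" "U \<inter> V = {}"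
      using hausdorff[of "\<gamma> s" "\<gamma>' s"] by blast
    have "open (T \<inter> \<gamma> -` U)" "open (T \<inter> \<gamma>' -` V)"
      using c T(1) UV by (auto intro: continuous_open_preimage)
    then show "\<exists>W. open W \<and> s \<in> W \<and> W \<subseteq> {t \<in> T. \<gamma> t \<noteq> \<gamma>' t}"
      using UV s by (intro exI[of _ "(T \<inter> \<gamma> -` U) \<inter> (T \<inter> \<gamma>' -` V)"]) (auto intro: open_Int)
  qed
  ultimately have "?E \<inter> T = {} \<or> {t \<in> T. \<gamma> t \<noteq> \<gamma>' t} \<inter> T = {}"
    by (intro connectedD[OF T(2)]) auto
  then have "T \<subseteq> ?E" using t0 by blast
  then show ?thesis using t by blast
qed

end

section \<open>Bidiscs and coordinate vectors\<close>

definition bidisc :: "real \<Rightarrow> (complex^2) set" where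
  "bidisc \<rho> = {x. x $ 1 \<in> ball 0 \<rho> \<and> x $ 2 \<in> ball 0 \<rho>}"

lemma open_bidisc0: "open (bidisc \<rho>)"
  unfolding bidisc_def by (rule open_bidisc) auto

lemma vec2_bidisc: "vec2 z t \<in> bidisc \<rho> \<longleftrightarrow> z \<in> ball 0 \<rho> \<and> t \<in> ball 0 \<rho>"
  by (simp add: bidisc_def)

lemma bidiscE: "x \<in> bidisc \<rho> \<Longrightarrow> (\<And>z t. x = vec2 z t \<Longrightarrow> z \<in> ball 0 \<rho> \<Longrightarrow> t \<in> ball 0 \<rho> \<Longrightarrow> P) \<Longrightarrow> P"
  by (metis (no_types, lifting) bidisc_def mem_Collect_eq vec2_eta)

lemma bidisc_in_open:
  assumes "open U" "0 \<in> U" obtains \<rho> where "\<rho> > 0" "bidisc \<rho> \<subseteq> U"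
proof -
  obtain e where e: "e > 0" "ball 0 e \<subseteq> U" using assms openE by metis
  have "bidisc (e/2) \<subseteq> U"
  proof
    fix x assume "x \<in> bidisc (e/2)"
    moreover have "norm x \<le> norm (x $ 1) + norm (x $ 2)"
      using L2_set_le_sum[of UNIV "\<lambda>i. norm (x $ i)"] by (simp add: norm_vec_def UNIV_2)
    ultimately have "x \<in> ball 0 e" by (simp add: bidisc_def)
    then show "x \<in> U" using e by blast
  qed
  then show thesis using that[of "e/2"] e by simp
qed

lemma has_derivative_vec2_1: "((\<lambda>z. vec2 z t) has_derivative (\<lambda>s. s *s vec2 1 0)) (at z)"
  by (rule has_derivative_curve) (simp add: vec2_def)

lemma has_derivative_vec2_2: "((\<lambda>t. vec2 z t) has_derivative (\<lambda>s. s *s vec2 0 1)) (at t)"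
  by (rule has_derivative_curve) (simp add: vec2_def)

lemma vec2_decompose: "(x::complex^2) = x $ 1 *s vec2 1 0 + x $ 2 *s vec2 0 1"
  by (simp add: vec_eq_iff forall_2)

lemma independent_vector:
  assumes "(w::complex^2) \<noteq> 0"
  obtains v where "\<And>a b. a *s v + b *s w = 0 \<Longrightarrow> a = 0 \<and> b = 0"
proof (cases "w $ 1 = 0")
  case True
  then have "w $ 2 \<noteq> 0" using assms by (simp add: vec_eq_iff forall_2)
  then show thesis using True that[of "vec2 1 0"] by (auto simp: vec_eq_iff forall_2)
next
  case False
  show thesis
  proof (rule that[of "vec2 0 1"])
    fix a b assume "a *s vec2 0 1 + b *s w = 0"
    then have "b * w $ 1 = 0" "a + b * w $ 2 = 0" by (simp_all add: vec_eq_iff forall_2)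
    then show "a = 0 \<and> b = 0" using False by simp
  qed
qed

context flow_surface
begin

subsection \<open>The flow\<close>

abbreviation "fl \<equiv> flow A X"
abbreviation "reg \<equiv> - sing A X"

lemma local_curve_shift:
  assumes "local_curve T \<gamma>" shows "local_curve {t. s + t \<in> T} (\<lambda>t. \<gamma> (s + t))"
  unfolding local_curve_def
proof (intro ballI conjI impI)
  fix t assume "t \<in> {t. s + t \<in> T}"
  then have t: "s + t \<in> T" by simp
  have "isCont (\<lambda>t. s + t) t" by simp
  then show "isCont (\<lambda>t. \<gamma> (s + t)) t"
    using assms t isCont_o2 unfolding local_curve_def by blast
  fix c assume c: "c \<in> A" "\<gamma> (s + t) \<in> fst c"
  have d: "((\<lambda>t. s + t) has_derivative (\<lambda>h. h)) (at t)"
    by (auto intro!: derivative_eq_intros)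
  have "(snd c \<circ> \<gamma> has_derivative (\<lambda>h. h *s X c (\<gamma> (s + t)))) (at (s + t))"
    using assms t c unfolding local_curve_def has_velocity_def by blast
  from has_derivative_compose[OF d this]
  show "has_velocity c (\<lambda>t. \<gamma> (s + t)) t (X c (\<gamma> (s + t)))"
    by (simp add: has_velocity_def o_def)
qed

lemma flow_curve: "local_curve UNIV (fl p)" and flow_0 [simp]: "fl p 0 = p"
proof -
  obtain \<gamma> where \<gamma>: "local_curve UNIV \<gamma>" "\<gamma> 0 = p"
    using complete unfolding complete_vfield_def integral_curve_local by blast
  have "fl p = \<gamma>"
    unfolding flow_def integral_curve_local
  proof (rule the_equality)
    fix \<beta> assume "local_curve UNIV \<beta> \<and> \<beta> 0 = p"
    then show "\<beta> = \<gamma>"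
      using local_curve_unique[OF open_UNIV connected_UNIV _ \<gamma>(1)] \<gamma>(2) by (intro ext) auto
  qed (use \<gamma> in auto)
  then show "local_curve UNIV (fl p)" "fl p 0 = p" using \<gamma> by auto
qed

text \<open>Shifting time by s turns the given curve into an integral curve starting at
  \<open>\<gamma> s\<close>, which uniqueness compares with the flow. Connectedness of the time
  domain is essential here.\<close>

lemma flow_local:
  assumes "local_curve T \<gamma>" "open T" "connected T" "s \<in> T" "t \<in> T"
  shows "fl (\<gamma> s) (t - s) = \<gamma> t"
proof -
  let ?T = "(\<lambda>u. u - s) ` T"
  have eq: "{u. s + u \<in> T} = ?T"
  proof (intro equalityI subsetI)
    fix u assume "u \<in> {u. s + u \<in> T}"
    then show "u \<in> ?T" by (intro image_eqI[of _ _ "s + u"]) auto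
  qed auto
  have "connected ?T" by (intro connected_continuous_image assms continuous_intros)
  moreover have "open ?T" by (rule open_translation_subtract[OF assms(2)])
  moreover have "local_curve ?T (\<lambda>u. \<gamma> (s + u))" using local_curve_shift[OF assms(1), of s] unfolding eq .
  moreover have "local_curve ?T (fl (\<gamma> s))" by (rule local_curve_subset[OF flow_curve]) simp
  moreover have "0 \<in> ?T" "t - s \<in> ?T" using assms(4,5) by force+
  moreover have "fl (\<gamma> s) 0 = \<gamma> (s + 0)" by simp
  ultimately have "fl (\<gamma> s) (t - s) = \<gamma> (s + (t - s))"
    using local_curve_unique[of ?T "fl (\<gamma> s)" "\<lambda>u. \<gamma> (s + u)" 0 "t - s"] by blast
  then show ?thesis by simp
qed

lemma flow_add: "fl (fl p s) t = fl p (s + t)"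
  using flow_local[OF flow_curve open_UNIV connected_UNIV, of s "s + t" p] by simp

lemma flow_isCont: "isCont (fl p) t"
  using flow_curve[of p] by (simp add: local_curve_def)

lemma flow_periodic_of_int: assumes "fl p T = p" shows "fl p (of_int n * T) = p"
proof -
  have nat: "fl p (of_nat n * T) = p" for n
  proof (induction n)
    case (Suc n)
    have "fl p (of_nat (Suc n) * T) = fl (fl p (of_nat n * T)) T" unfolding flow_add by (simp add: algebra_simps)
    then show ?case using Suc assms by simp
  qed simp
  have neg: "fl p (- S) = p" if "fl p S = p" for S
    using flow_add[of p S "- S"] that by simp
  show ?thesis
  proof (cases "n \<ge> 0")
    case True then show ?thesis using nat[of "nat n"] by simp
  next
    case False then show ?thesis using neg[OF nat[of "nat (- n)"]] by simp
  qed
qed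

lemma flow_periodic_uminus: "fl p T = p \<Longrightarrow> fl p (- T) = p"
  using flow_periodic_of_int[of p T "-1"] by simp

lemma sing_iff:
  assumes "c \<in> A" "p \<in> fst c" shows "p \<in> sing A X \<longleftrightarrow> X c p = 0"
proof
  assume "X c p = 0"
  show "p \<in> sing A X" unfolding sing_def
  proof (intro CollectI ballI impI)
    fix d assume d: "d \<in> A" "p \<in> fst d"
    obtain D where D: "(snd d \<circ> chart_inv c has_derivative D) (at (snd c p))"
      using cdiffv_transition[OF assms(1) d(1) assms(2) d(2)] unfolding cdiffv_def by blast
    have "X d p = D 0"
      using vfield_transform[OF assms(1) d(1) assms(2) d(2)] frechet_derivative_at[OF D] \<open>X c p = 0\<close> by simp
    then show "X d p = 0"
      using D by (simp add: has_derivative_bounded_linear linear_0 bounded_linear.linear)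
  qed
qed (use assms in \<open>auto simp: sing_def\<close>)

lemma open_reg: "open reg"
proof (subst open_subopen, intro ballI)
  fix p assume p: "p \<in> reg"
  obtain c where c: "c \<in> A" "p \<in> fst c" by (rule chart_at)
  have nz: "(X c \<circ> chart_inv c) (snd c p) \<noteq> 0" using p c sing_iff by simp
  have "isCont (X c \<circ> chart_inv c) (snd c p)"
    by (rule cdiffv_isCont[OF vfield_chart]) (use c in auto)
  from isCont_o2[OF chart_cont[OF c] this] have "isCont (\<lambda>q. (X c \<circ> chart_inv c) (snd c q)) p" .
  from isCont_eventually[OF this, of "\<lambda>y. y \<noteq> 0"] nz
  have "\<forall>\<^sub>F q in nhds p. (X c \<circ> chart_inv c) (snd c q) \<noteq> 0"
    using t1_space_nhds[of _ 0] by blast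
  then have "\<forall>\<^sub>F q in nhds p. q \<in> reg"
    using eventually_chart[OF c] by eventually_elim (use c sing_iff in simp)
  then show "\<exists>T. open T \<and> p \<in> T \<and> T \<subseteq> reg" unfolding eventually_nhds by blast
qed

lemma flow_sing: assumes "p \<in> sing A X" shows "fl p t = p"
proof -
  have "local_curve UNIV (\<lambda>_. p)"
    using assms by (auto simp: local_curve_def has_velocity_def o_def sing_def)
  from local_curve_unique[OF open_UNIV connected_UNIV flow_curve this, of 0 p t] show ?thesis by simp
qed

lemma flow_reg: assumes "p \<in> reg" shows "fl p t \<in> reg"
proof
  assume s: "fl p t \<in> sing A X"
  have "p = fl (fl p t) (- t)" by (simp add: flow_add)
  then show False using flow_sing[OF s] s assms by (metis ComplD)
qed

subsection \<open>Flow boxes\<close>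

text \<open>The first coordinate labels pieces of leaves and the second is flow time;
  \<open>g\<close> is the inverse chart, constrained on the image only. The two times in the last
  clause are arbitrary points of one disc, so that motions between any two points of a vertical disc
  are covered.\<close>

definition flow_box :: "'a \<Rightarrow> real \<Rightarrow> (complex^2 \<Rightarrow> 'a) \<Rightarrow> ('a \<Rightarrow> complex^2) \<Rightarrow> bool" where
  "flow_box p \<rho> \<Phi> g \<longleftrightarrow> \<rho> > 0 \<and> \<Phi> 0 = p \<and>
     (\<forall>x\<in>bidisc \<rho>. hmap_at \<Phi> x \<and> g (\<Phi> x) = x) \<and>
     open (\<Phi> ` bidisc \<rho>) \<and> (\<forall>q\<in>\<Phi> ` bidisc \<rho>. \<forall>i. hol_at (\<lambda>q. g q $ i) q) \<and>
     (\<forall>z\<in>ball 0 \<rho>. \<forall>s\<in>ball 0 \<rho>. \<forall>t\<in>ball 0 \<rho>. fl (\<Phi> (vec2 z s)) (t - s) = \<Phi> (vec2 z t))"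

lemma flow_boxD:
  assumes "flow_box p \<rho> \<Phi> g"
  shows "\<rho> > 0" "\<Phi> 0 = p" "\<And>x. x \<in> bidisc \<rho> \<Longrightarrow> hmap_at \<Phi> x" "\<And>x. x \<in> bidisc \<rho> \<Longrightarrow> g (\<Phi> x) = x"
    "open (\<Phi> ` bidisc \<rho>)" "\<And>q i. q \<in> \<Phi> ` bidisc \<rho> \<Longrightarrow> hol_at (\<lambda>q. g q $ i) q"
    "\<And>z s t. z \<in> ball 0 \<rho> \<Longrightarrow> s \<in> ball 0 \<rho> \<Longrightarrow> t \<in> ball 0 \<rho> \<Longrightarrow> fl (\<Phi> (vec2 z s)) (t - s) = \<Phi> (vec2 z t)"
  using assms unfolding flow_box_def by blast+

text \<open>Solve the equation with initial points on a line in a direction \<open>v\<close>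
  independent of the vector field. At the centre the derivative sends the two coordinate vectors to
  \<open>v\<close> and to the field, so it is injective and the inverse function theorem
  applies.\<close>

lemma flow_box_exists:
  assumes p: "p \<in> reg"
  obtains \<rho> \<Phi> g where "flow_box p \<rho> \<Phi> g"
proof -
  obtain c where c: "c \<in> A" "p \<in> fst c" by (rule chart_at)
  define F where "F = X c \<circ> chart_inv c"
  define S where "S = snd c ` fst c"
  define x0 where "x0 = snd c p"
  have x0: "x0 \<in> S" using c by (simp add: x0_def S_def)
  have S: "open S" using chart_open c by (simp add: S_def)
  have F: "cdiffv F x" if "x \<in> S" for x using vfield_chart[OF c(1)] that by (simp add: F_def S_def)
  have "F x0 \<noteq> 0" using p c sing_iff by (simp add: F_def x0_def)
  then obtain v where v: "\<And>a b. a *s v + b *s F x0 = 0 \<Longrightarrow> a = 0 \<and> b = 0"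
    using independent_vector by blast
  obtain r \<psi> where r: "r > 0" and \<psi>: "continuous_on (ball 0 r \<times> ball 0 r) (\<lambda>(z, t). \<psi> z t)"
    "\<And>z t. z \<in> ball 0 r \<Longrightarrow> t \<in> ball 0 r \<Longrightarrow> \<psi> z t \<in> S"
    "\<And>z. z \<in> ball 0 r \<Longrightarrow> \<psi> z 0 = x0 + z *s v"
    "\<And>t i. t \<in> ball 0 r \<Longrightarrow> (\<lambda>z. \<psi> z t $ i) holomorphic_on ball 0 r"
    "\<And>z i. z \<in> ball 0 r \<Longrightarrow> (\<lambda>t. \<psi> z t $ i) holomorphic_on ball 0 r"
    "\<And>z t. z \<in> ball 0 r \<Longrightarrow> t \<in> ball 0 r \<Longrightarrow> (\<psi> z has_derivative (\<lambda>s. s *s F (\<psi> z t))) (at t)"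
    using holomorphic_local_flow[OF S F x0, where v = v] by blast
  define \<Psi> where "\<Psi> x = \<psi> (x $ 1) (x $ 2)" for x :: "complex^2"
  have \<Psi>: "cdiffv \<Psi> x" if x: "x \<in> bidisc r" for x
    unfolding cdiffv_iff
  proof
    fix i
    have "continuous_on (ball 0 r \<times> ball 0 r) (\<lambda>(z, t). \<psi> z t $ i)"
      using \<psi>(1) unfolding split_beta by (intro continuous_intros)
    then show "cdiff (\<lambda>x. \<Psi> x $ i) x"
      unfolding \<Psi>_def by (rule osgood[OF open_ball open_ball]) (use \<psi>(4,5) x in \<open>auto simp: bidisc_def simp del: mem_ball\<close>)
  qed
  have z0: "0 \<in> bidisc r" using r by (simp add: bidisc_def)
  obtain D where D: "(\<Psi> has_derivative D) (at 0)" "\<And>k w. D (k *s w) = k *s D w"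
    using \<Psi>[OF z0] unfolding cdiffv_def by blast
  have D1: "D (vec2 1 0) = v"
  proof -
    have "(\<Psi> has_derivative D) (at (vec2 0 0))" using D(1) by (simp add: vec2_0)
    from has_derivative_compose[OF has_derivative_vec2_1 this]
    have "((\<lambda>z. \<psi> z 0) has_derivative (\<lambda>s. s *s D (vec2 1 0))) (at 0)" by (simp add: \<Psi>_def D(2))
    moreover have "((\<lambda>z. \<psi> z 0) has_derivative (\<lambda>s. s *s v)) (at 0)"
    proof (rule has_derivative_transform_nhds[OF has_derivative_line[of x0]])
      have "\<forall>\<^sub>F z in nhds 0. z \<in> ball (0::complex) r" by (rule eventually_nhds_in_open) (use r in auto)
      then show "\<forall>\<^sub>F z in nhds 0. x0 + z *s v = \<psi> z 0" by (rule eventually_mono) (use \<psi>(3) in simp)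
    qed
    ultimately have "(\<lambda>s. s *s D (vec2 1 0)) = (\<lambda>s. s *s v)" by (rule has_derivative_unique)
    from fun_cong[OF this, of 1] show ?thesis by simp
  qed
  have D2: "D (vec2 0 1) = F x0"
  proof -
    have "(\<Psi> has_derivative D) (at (vec2 0 0))" using D(1) by (simp add: vec2_0)
    from has_derivative_compose[OF has_derivative_vec2_2 this]
    have "(\<psi> 0 has_derivative (\<lambda>s. s *s D (vec2 0 1))) (at 0)" by (simp add: \<Psi>_def D(2))
    moreover have "(\<psi> 0 has_derivative (\<lambda>s. s *s F x0)) (at 0)" using \<psi>(6)[of 0 0] \<psi>(3)[of 0] r by simp
    ultimately have "(\<lambda>s. s *s D (vec2 0 1)) = (\<lambda>s. s *s F x0)" by (rule has_derivative_unique)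
    from fun_cong[OF this, of 1] show ?thesis by simp
  qed
  have lin: "linear D" using D(1) by (simp add: has_derivative_bounded_linear bounded_linear.linear)
  have inj: "h = 0" if "D h = 0" for h
  proof -
    have "D h = D (h $ 1 *s vec2 1 0) + D (h $ 2 *s vec2 0 1)"
      using linear_add[OF lin] vec2_decompose[of h] by metis
    then have "h $ 1 = 0 \<and> h $ 2 = 0" using v that by (simp add: D(2) D1 D2)
    then show ?thesis by (simp add: vec_eq_iff forall_2)
  qed
  obtain U V k where U: "open U" "U \<subseteq> bidisc r" "0 \<in> U" "open V" "\<Psi> 0 \<in> V" "homeomorphism U V \<Psi> k"
    "\<And>y. y \<in> V \<Longrightarrow> cdiffv k y"
    using holomorphic_inverse_function[OF open_bidisc0 \<Psi> z0 D(1) inj] by blast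
  obtain \<rho> where \<rho>: "\<rho> > 0" "bidisc \<rho> \<subseteq> U" using bidisc_in_open[OF U(1,3)] by blast
  have \<rho>r: "z \<in> ball 0 r" "t \<in> ball 0 r" if "z \<in> ball 0 \<rho>" "t \<in> ball 0 \<rho>" for z t :: complex
  proof -
    have "vec2 z t \<in> bidisc r" using \<rho>(2) U(2) that vec2_bidisc by blast
    then show "z \<in> ball 0 r" "t \<in> ball 0 r" by (simp_all add: vec2_bidisc)
  qed
  define \<Phi> where "\<Phi> x = chart_inv c (\<Psi> x)" for x
  define g where "g q = k (snd c q)" for q
  have \<Psi>S: "\<Psi> x \<in> S" if "x \<in> bidisc r" for x
    using that \<psi>(2) by (auto simp: \<Psi>_def bidisc_def)
  have kU: "k (\<Psi> x) = x" "\<Psi> x \<in> V" if "x \<in> U" for x using U(6) that by (auto simp: homeomorphism_def)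
  have sc: "snd c (\<Phi> x) = \<Psi> x" "\<Phi> x \<in> fst c" if "x \<in> bidisc r" for x
    using \<Psi>S[OF that] by (simp_all add: \<Phi>_def S_def)
  have i\<Psi>: "isCont \<Psi> x" if "x \<in> bidisc r" for x using cdiffv_isCont[OF \<Psi>[OF that]] .
  have i\<Phi>: "isCont \<Phi> x" if "x \<in> bidisc r" for x
    unfolding \<Phi>_def by (rule isCont_o2[OF i\<Psi>[OF that] chart_inv_cont[OF c(1)]]) (use \<Psi>S[OF that] in \<open>simp add: S_def\<close>)
  have "flow_box p \<rho> \<Phi> g"
    unfolding flow_box_def
  proof (intro conjI ballI allI)
    show "\<rho> > 0" by (rule \<rho>)
    have "\<Psi> 0 = x0" using \<psi>(3)[of 0] r by (simp add: \<Psi>_def)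
    then show "\<Phi> 0 = p" using c by (simp add: \<Phi>_def x0_def)
    fix x assume x: "x \<in> bidisc \<rho>"
    then have xr: "x \<in> bidisc r" using \<rho> U by blast
    show "hmap_at \<Phi> x"
    proof (rule hmap_atI[OF i\<Phi>[OF xr] c(1) sc(2)[OF xr]])
      have "\<forall>\<^sub>F y in nhds x. y \<in> bidisc r" using xr open_bidisc0 by (intro eventually_nhds_in_open)
      then show "cdiffv (snd c \<circ> \<Phi>) x"
        by (intro cdiffv_transform[OF \<Psi>[OF xr]]) (auto elim!: eventually_mono simp: sc)
    qed
    show "g (\<Phi> x) = x" using kU x \<rho>(2) sc[OF xr] by (auto simp: g_def)
  next
    have "openin (top_of_set V) (\<Psi> ` bidisc \<rho>)"
      by (rule homeomorphism_imp_open_map[OF U(6)]) (use \<rho> open_bidisc0 in \<open>simp add: open_subset\<close>)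
    then have "open (\<Psi> ` bidisc \<rho>)" using U(4) openin_open_trans by blast
    moreover have "\<Psi> ` bidisc \<rho> \<subseteq> snd c ` fst c" using \<Psi>S \<rho> U by (auto simp: S_def)
    ultimately have "open (chart_inv c ` (\<Psi> ` bidisc \<rho>))" by (rule chart_inv_image_open[OF c(1)])
    then show "open (\<Phi> ` bidisc \<rho>)" by (simp add: \<Phi>_def[abs_def] image_image)
  next
    fix q i assume "q \<in> \<Phi> ` bidisc \<rho>"
    then obtain x where x: "x \<in> bidisc \<rho>" "q = \<Phi> x" by blast
    then have xr: "x \<in> bidisc r" and xU: "x \<in> U" using \<rho> U by blast+
    have q: "q \<in> fst c" "snd c q = \<Psi> x" using sc[OF xr] x by auto
    show "hol_at (\<lambda>q. g q $ i) q"
    proof (rule hol_atI[OF c(1) q(1)], rule cdiff_transform)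
      show "cdiff (\<lambda>y. k y $ i) (snd c q)" using U(7)[OF kU(2)[OF xU]] q by (simp add: cdiffv_iff)
      have "\<forall>\<^sub>F y in nhds (snd c q). y \<in> snd c ` fst c"
        using chart_open(2)[OF c(1)] imageI[OF q(1), of "snd c"] by (rule eventually_nhds_in_open)
      then show "\<forall>\<^sub>F y in nhds (snd c q). k y $ i = ((\<lambda>q. g q $ i) \<circ> chart_inv c) y"
        by (rule eventually_mono) (simp add: g_def)
    qed
  next
    fix z s t :: complex assume z: "z \<in> ball 0 \<rho>" and s: "s \<in> ball 0 \<rho>" and t: "t \<in> ball 0 \<rho>"
    have zr: "z \<in> ball 0 r" using \<rho>r z by blast
    let ?\<gamma> = "\<lambda>t. \<Phi> (vec2 z t)"
    have lc: "local_curve (ball 0 \<rho>) ?\<gamma>"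
      unfolding local_curve_def
    proof
      fix u assume u: "u \<in> ball (0::complex) \<rho>"
      then have ur: "u \<in> ball 0 r" and zu: "vec2 z u \<in> bidisc r" using \<rho>r z zr by (auto simp: vec2_bidisc simp del: mem_ball)
      have "isCont (\<lambda>t. vec2 z t) u" using has_derivative_vec2_2 by (rule has_derivative_continuous)
      then have i: "isCont ?\<gamma> u" by (rule isCont_o2) (rule i\<Phi>[OF zu])
      have "has_velocity c ?\<gamma> u (X c (?\<gamma> u))"
        unfolding has_velocity_def
      proof (rule has_derivative_transform_nhds)
        have "F (\<psi> z u) = X c (?\<gamma> u)" by (simp add: F_def \<Phi>_def \<Psi>_def)
        then show "(\<psi> z has_derivative (\<lambda>s. s *s X c (?\<gamma> u))) (at u)" using \<psi>(6)[OF zr ur] by simp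
        have "\<forall>\<^sub>F t in nhds u. t \<in> ball 0 r" using ur by (intro eventually_nhds_in_open) auto
        then show "\<forall>\<^sub>F t in nhds u. \<psi> z t = (snd c \<circ> ?\<gamma>) t"
          by (rule eventually_mono) (use zr in \<open>simp add: sc(1) vec2_bidisc, simp add: \<Psi>_def\<close>)
      qed
      then show "isCont ?\<gamma> u \<and> (\<forall>d\<in>A. ?\<gamma> u \<in> fst d \<longrightarrow> has_velocity d ?\<gamma> u (X d (?\<gamma> u)))"
        using i velocity_transform[OF c(1), of ?\<gamma> u] sc(2)[OF zu] by blast
    qed
    show "fl (\<Phi> (vec2 z s)) (t - s) = \<Phi> (vec2 z t)"
      by (rule flow_local[OF lc open_ball connected_ball s t])
  qed
  then show thesis by (rule that)
qed

lemma flow_box_cont: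
  assumes "flow_box p \<rho> \<Phi> g" "q \<in> \<Phi> ` bidisc \<rho>" shows "isCont g q"
proof -
  have "((\<lambda>q. \<chi> i. g q $ i) \<longlongrightarrow> (\<chi> i. g q $ i)) (at q)"
    by (intro tendsto_vec_lambda hol_at_isCont[unfolded isCont_def] flow_boxD(6)[OF assms])
  then show ?thesis by (simp add: isCont_def)
qed

lemma flow_box_shrink:
  assumes b: "flow_box p \<rho> \<Phi> g" and r: "0 < r" "r \<le> \<rho>"
  shows "flow_box p r \<Phi> g"
proof -
  have sub: "bidisc r \<subseteq> bidisc \<rho>" "ball (0::complex) r \<subseteq> ball 0 \<rho>" using r by (auto simp: bidisc_def)
  have eq: "\<Phi> ` bidisc r = \<Phi> ` bidisc \<rho> \<inter> g -` bidisc r"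
    using flow_boxD(4)[OF b] sub(1) by (auto simp: image_iff)
  have "continuous_on (\<Phi> ` bidisc \<rho>) g"
    using flow_box_cont[OF b] by (intro continuous_at_imp_continuous_on) blast
  then have "open (\<Phi> ` bidisc r)"
    unfolding eq using flow_boxD(5)[OF b] open_bidisc0 by (rule continuous_open_preimage)
  then show ?thesis
    unfolding flow_box_def using flow_boxD[OF b] r sub by blast
qed

text \<open>Through a singular point the flow is constant, whereas a vertical disc of the box is
  embedded.\<close>

lemma flow_box_reg:
  assumes b: "flow_box p \<rho> \<Phi> g" and x: "x \<in> bidisc \<rho>" shows "\<Phi> x \<in> reg"
proof
  assume s: "\<Phi> x \<in> sing A X"
  from x obtain z t where zt: "x = vec2 z t" "z \<in> ball 0 \<rho>" "t \<in> ball 0 \<rho>" by (rule bidiscE)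
  have eq: "\<Phi> (vec2 z u) = \<Phi> x" if "u \<in> ball 0 \<rho>" for u
    using flow_boxD(7)[OF b zt(2,3) that] flow_sing[OF s] zt(1) by simp
  have "\<rho> / 2 \<in> ball 0 \<rho>" "complex_of_real (\<rho> / 2) \<in> ball 0 \<rho>" "0 \<in> ball (0::complex) \<rho>" using flow_boxD(1)[OF b] by auto
  then have "vec2 z 0 = vec2 z (complex_of_real (\<rho> / 2))"
    using eq flow_boxD(4)[OF b] zt(2) vec2_bidisc by metis
  then show False using flow_boxD(1)[OF b] by (simp add: vec2_eq_iff)
qed

lemma flow_box_vertical:
  assumes "flow_box p \<rho> \<Phi> g" "z \<in> ball 0 \<rho>" "t \<in> ball 0 \<rho>"
  shows "\<Phi> (vec2 z t) = fl (\<Phi> (vec2 z 0)) t"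
  using flow_boxD(7)[OF assms(1,2), of 0 t] flow_boxD(1)[OF assms(1)] assms(3) by simp

lemma flow_box_point:
  assumes b: "flow_box p \<rho> \<Phi> g" and q: "q \<in> \<Phi> ` bidisc \<rho>"
  shows "g q $ 1 \<in> ball 0 \<rho>" "g q $ 2 \<in> ball 0 \<rho>" "\<Phi> (g q) = q" "q = fl (\<Phi> (vec2 (g q $ 1) 0)) (g q $ 2)"
proof -
  obtain x where x: "x \<in> bidisc \<rho>" "q = \<Phi> x" using q by blast
  then have gq: "g q = x" using flow_boxD(4)[OF b] by simp
  show *: "g q $ 1 \<in> ball 0 \<rho>" "g q $ 2 \<in> ball 0 \<rho>" "\<Phi> (g q) = q" using gq x by (auto simp: bidisc_def)
  show "q = fl (\<Phi> (vec2 (g q $ 1) 0)) (g q $ 2)"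
    using flow_box_vertical[OF b *(1,2)] *(3) by (simp add: vec2_eta)
qed

lemma flow_box_center: "flow_box p \<rho> \<Phi> g \<Longrightarrow> p \<in> \<Phi> ` bidisc \<rho>"
proof -
  assume b: "flow_box p \<rho> \<Phi> g"
  have "0 \<in> bidisc \<rho>" using flow_boxD(1)[OF b] by (simp add: bidisc_def)
  then show ?thesis using flow_boxD(2)[OF b] by (metis imageI)
qed

lemma flow_box_inj:
  assumes b: "flow_box p \<rho> \<Phi> g" and eq: "\<Phi> (vec2 z t) = \<Phi> (vec2 z' t')"
    and in_ball: "z \<in> ball 0 \<rho>" "t \<in> ball 0 \<rho>" "z' \<in> ball 0 \<rho>" "t' \<in> ball 0 \<rho>"
  shows "z = z'" "t = t'"
proof -
  have "vec2 z t \<in> bidisc \<rho>" "vec2 z' t' \<in> bidisc \<rho>" using in_ball by (simp_all add: vec2_bidisc)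
  then have "vec2 z t = vec2 z' t'" using flow_boxD(4)[OF b] eq by metis
  then show "z = z'" "t = t'" by (simp_all add: vec2_eq_iff)
qed

text \<open>The derivative of \<open>\<Phi>\<close> sends the coordinate vectors to the velocity of
  the section and to the vector field. It is injective because \<open>g\<close> inverts
  \<open>\<Phi>\<close>, so the two images are independent.\<close>

lemma transversal_section:
  assumes b: "flow_box p \<rho> \<Phi> g"
  shows "transverse_section A X p (\<lambda>z. \<Phi> (vec2 z 0)) \<rho>"
  unfolding transverse_section_def
proof (intro conjI ballI impI)
  have 0: "(0::complex) \<in> ball 0 \<rho>" using flow_boxD(1)[OF b] by simp
  have mem: "vec2 z 0 \<in> bidisc \<rho>" if "z \<in> ball 0 \<rho>" for z using that 0 by (simp add: vec2_bidisc)
  show "\<rho> > 0" "\<Phi> (vec2 0 0) = p" using flow_boxD[OF b] by (auto simp: vec2_0)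
  show "continuous_on (ball 0 \<rho>) (\<lambda>z. \<Phi> (vec2 z 0))"
  proof (rule continuous_at_imp_continuous_on, rule ballI)
    fix z assume z: "z \<in> ball (0::complex) \<rho>"
    have "isCont (\<lambda>z. vec2 z 0) z" using has_derivative_vec2_1 by (rule has_derivative_continuous)
    then show "isCont (\<lambda>z. \<Phi> (vec2 z 0)) z"
      by (rule isCont_o2) (use flow_boxD(3)[OF b mem[OF z]] in \<open>simp add: hmap_at_def\<close>)
  qed
  show "inj_on (\<lambda>z. \<Phi> (vec2 z 0)) (ball 0 \<rho>)"
    by (rule inj_onI) (metis flow_boxD(4)[OF b] mem vec2_nth(1))
  fix z c assume z: "z \<in> ball (0::complex) \<rho>" and c: "c \<in> A" "\<Phi> (vec2 z 0) \<in> fst c"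
  obtain D where D: "(snd c \<circ> \<Phi> has_derivative D) (at (vec2 z 0))" "\<And>k w. D (k *s w) = k *s D w"
    using flow_boxD(3)[OF b mem[OF z]] c unfolding hmap_at_def cdiffv_def by blast
  let ?q = "\<Phi> (vec2 z 0)"
  have vel: "has_velocity c (\<lambda>z. \<Phi> (vec2 z 0)) z (D (vec2 1 0))"
    using has_derivative_compose[OF has_derivative_vec2_1 D(1)] by (simp add: has_velocity_def o_def D(2))
  have XD: "X c ?q = D (vec2 0 1)"
  proof -
    have 1: "((\<lambda>t. snd c (\<Phi> (vec2 z t))) has_derivative (\<lambda>s. s *s D (vec2 0 1))) (at 0)"
      using has_derivative_compose[OF has_derivative_vec2_2 D(1)] by (simp add: D(2))
    have f: "(snd c \<circ> fl ?q has_derivative (\<lambda>s. s *s X c ?q)) (at 0)"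
    proof -
      have "\<forall>c\<in>A. fl ?q 0 \<in> fst c \<longrightarrow> has_velocity c (fl ?q) 0 (X c (fl ?q 0))"
        using flow_curve[of ?q] unfolding local_curve_def by blast
      then have "has_velocity c (fl ?q) 0 (X c ?q)" using c by simp
      then show ?thesis by (simp only: has_velocity_def)
    qed
    have "\<forall>\<^sub>F t in nhds 0. t \<in> ball (0::complex) \<rho>" using 0 by (intro eventually_nhds_in_open) auto
    then have "\<forall>\<^sub>F t in nhds 0. (snd c \<circ> fl ?q) t = snd c (\<Phi> (vec2 z t))"
      by (rule eventually_mono) (simp add: flow_box_vertical[OF b z])
    then have 2: "((\<lambda>t. snd c (\<Phi> (vec2 z t))) has_derivative (\<lambda>s. s *s X c ?q)) (at 0)"
      by (rule has_derivative_transform_nhds[OF f])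
    have "(\<lambda>s. s *s X c ?q) = (\<lambda>s. s *s D (vec2 0 1))" using has_derivative_unique[OF 2 1] .
    from fun_cong[OF this, of 1] show ?thesis by simp
  qed
  show "\<exists>v. has_velocity c (\<lambda>z. \<Phi> (vec2 z 0)) z v \<and>
          (\<forall>a b. a *s v + b *s X c ?q = 0 \<longrightarrow> a = 0 \<and> b = 0)"
  proof (intro exI conjI allI impI, rule vel)
    fix a b' assume "a *s D (vec2 1 0) + b' *s X c ?q = 0"
    moreover have lin: "linear D" using D(1) by (simp add: has_derivative_bounded_linear bounded_linear.linear)
    ultimately have D0: "D (vec2 a b') = 0"
      using vec2_decompose[of "vec2 a b'"] by (simp add: XD linear_add D(2))
    have "h = 0" if "D h = 0" for h
    proof -
      have "cdiffv (g \<circ> chart_inv c) (snd c ?q)"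
        using flow_boxD(6)[OF b imageI[OF mem[OF z]]] c by (simp add: cdiffv_iff hol_at_def o_def)
      then obtain E where E: "(g \<circ> chart_inv c has_derivative E) (at ((snd c \<circ> \<Phi>) (vec2 z 0)))"
        unfolding cdiffv_def by auto
      from has_derivative_compose[OF D(1) E]
      have "((\<lambda>x. (g \<circ> chart_inv c) ((snd c \<circ> \<Phi>) x)) has_derivative (\<lambda>h. E (D h))) (at (vec2 z 0))" .
      then have "((\<lambda>x. x) has_derivative (\<lambda>h. E (D h))) (at (vec2 z 0))"
      proof (rule has_derivative_transform_nhds)
        have i: "isCont \<Phi> (vec2 z 0)" using flow_boxD(3)[OF b mem[OF z]] by (simp add: hmap_at_def)
        have "\<forall>\<^sub>F x in nhds (vec2 z 0). x \<in> bidisc \<rho>"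
          using mem[OF z] open_bidisc0 by (intro eventually_nhds_in_open)
        then show "\<forall>\<^sub>F x in nhds (vec2 z 0). (g \<circ> chart_inv c) ((snd c \<circ> \<Phi>) x) = x"
          using isCont_eventually[OF i eventually_chart[OF c]]
          by eventually_elim (use c flow_boxD(4)[OF b] in simp)
      qed
      then have "(\<lambda>h. E (D h)) = (\<lambda>h. h)" by (rule has_derivative_unique) (rule has_derivative_ident)
      from fun_cong[OF this, of h] have "h = E (D h)" by simp
      then show ?thesis using that E by (simp add: has_derivative_bounded_linear linear_0 bounded_linear.linear)
    qed
    then have "vec2 a b' = 0" using D0 by blast
    then show "a = 0" "b' = 0" by (metis vec2_nth zero_index)+
  qed
qed

subsection \<open>Dependence of the flow on the initial point\<close>

lemma hcurve_at_cong:
  assumes "hcurve_at \<mu> z" "\<forall>\<^sub>F w in nhds z. \<mu> w = \<nu> w" shows "hcurve_at \<nu> z"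
  unfolding hcurve_at_def
proof (intro conjI ballI impI)
  have eq: "\<mu> z = \<nu> z" using eventually_nhds_x_imp_x[OF assms(2)] .
  show "isCont \<nu> z" using assms isCont_cong unfolding hcurve_at_def by blast
  fix c assume c: "c \<in> A" "\<nu> z \<in> fst c"
  then obtain v where "(snd c \<circ> \<mu> has_derivative (\<lambda>s. s *s v)) (at z)"
    using assms(1) eq unfolding hcurve_at_def has_velocity_def by auto
  moreover have "\<forall>\<^sub>F w in nhds z. (snd c \<circ> \<mu>) w = (snd c \<circ> \<nu>) w"
    using assms(2) by (rule eventually_mono) simp
  ultimately show "\<exists>v. has_velocity c \<nu> z v"
    unfolding has_velocity_def using has_derivative_transform_nhds by blast
qed

lemma hcurve_coordinates:
  assumes \<mu>: "hcurve_at \<mu> z" and h: "\<And>i. hol_at (\<lambda>q. g q $ i) (\<mu> z)"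
    and \<Phi>: "hmap_at \<Phi> (g (\<mu> z) + k)"
  shows "hcurve_at (\<lambda>w. \<Phi> (g (\<mu> w) + k)) z"
proof -
  obtain v where v: "\<And>i. ((\<lambda>w. g (\<mu> w) $ i) has_field_derivative v i) (at z)"
    using hol_at_hcurve[OF \<mu> h] unfolding field_differentiable_def by metis
  have "((\<lambda>w. g (\<mu> w) + k) has_derivative (\<lambda>s. s *s (\<chi> i. v i))) (at z)"
    by (rule has_derivative_curve) (use v in \<open>auto intro!: derivative_eq_intros\<close>)
  from hcurve_hmap[of \<Phi> "\<lambda>w. g (\<mu> w) + k", OF \<Phi> this] show ?thesis .
qed

text \<open>In box coordinates the time-s map is the translation by (0, s). The neighbourhood and
  the bound on times are uniform, as the propagation to large times requires.\<close>

lemma local_flow: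
  assumes p: "p \<in> reg"
  obtains V \<eta> where "open V" "p \<in> V" "\<eta> > 0"
    "\<And>x s. x \<in> V \<Longrightarrow> s \<in> ball 0 \<eta> \<Longrightarrow> isCont (\<lambda>q. fl (fst q) (snd q)) (x, s)"
    "\<And>\<mu> z s. hcurve_at \<mu> z \<Longrightarrow> \<mu> z \<in> V \<Longrightarrow> s \<in> ball 0 \<eta> \<Longrightarrow> hcurve_at (\<lambda>z. fl (\<mu> z) s) z"
proof -
  obtain \<rho> \<Phi> g where b: "flow_box p \<rho> \<Phi> g" using flow_box_exists[OF p] by blast
  \<comment> \<open>A point of the half-size box can be translated by any time below half the radius
    without leaving the large box.\<close>
  define r where "r = \<rho> / 2"
  have r: "0 < r" "r \<le> \<rho>" using flow_boxD(1)[OF b] by (auto simp: r_def)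
  note b' = flow_box_shrink[OF b r]
  let ?V = "\<Phi> ` bidisc r"
  have gm: "g x + vec2 0 s \<in> bidisc \<rho>" if "x \<in> ?V" "s \<in> ball 0 r" for x and s :: complex
  proof -
    have "norm (g x $ 2) < r" "norm s < r" "norm (g x $ 1) < r" using flow_box_point[OF b' that(1)] that(2) by auto
    moreover have "norm (g x $ 2 + s) \<le> norm (g x $ 2) + norm s" by (rule norm_triangle_ineq)
    ultimately show ?thesis using r by (auto simp: bidisc_def r_def)
  qed
  have eq: "fl x s = \<Phi> (g x + vec2 0 s)" if "x \<in> ?V" "s \<in> ball 0 r" for x and s :: complex
  proof -
    note m = flow_box_point[OF b' that(1)]
    have e: "g x + vec2 0 s = vec2 (g x $ 1) (g x $ 2 + s)" by (simp add: vec_eq_iff forall_2)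
    have "fl (\<Phi> (vec2 (g x $ 1) (g x $ 2))) ((g x $ 2 + s) - g x $ 2) = \<Phi> (vec2 (g x $ 1) (g x $ 2 + s))"
    proof (rule flow_boxD(7)[OF b])
      show "g x $ 1 \<in> ball 0 \<rho>" "g x $ 2 + s \<in> ball 0 \<rho>" using gm[OF that] unfolding e vec2_bidisc by auto
      show "g x $ 2 \<in> ball 0 \<rho>" using m(2) r(2) by auto
    qed
    then show ?thesis using m(3) by (simp add: vec2_eta e)
  qed
  have V: "open ?V" by (rule flow_boxD(5)[OF b'])
  show thesis
  proof (rule that[OF V flow_box_center[OF b'] r(1)])
    fix x and s :: complex assume xs: "x \<in> ?V" "s \<in> ball 0 r"
    have xr: "x \<in> \<Phi> ` bidisc \<rho>" using xs(1) r by (auto simp: bidisc_def)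
    have "isCont (\<lambda>q. g (fst q)) (x, s)" by (rule isCont_o2[OF _ flow_box_cont[OF b]]) (use xr in auto)
    moreover have "isCont (\<lambda>q. vec2 0 (snd q)) (x, s)"
    proof (rule isCont_o2[of _ snd])
      have "continuous_on UNIV (\<lambda>t. vec2 0 t)" by (intro continuous_intros)
      then show "isCont (\<lambda>t. vec2 0 t) (snd (x, s))" by (simp add: continuous_on_eq_continuous_at)
    qed auto
    ultimately have "isCont (\<lambda>q. g (fst q) + vec2 0 (snd q)) (x, s)" by (rule isCont_add)
    then have "isCont (\<lambda>q. \<Phi> (g (fst q) + vec2 0 (snd q))) (x, s)"
      by (rule isCont_o2) (use flow_boxD(3)[OF b gm[OF xs]] in \<open>simp add: hmap_at_def\<close>)
    moreover have "\<forall>\<^sub>F q in nhds (x, s). q \<in> ?V \<times> ball 0 r"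
      by (rule eventually_nhds_in_open) (use V xs in \<open>auto intro: open_Times\<close>)
    then have "\<forall>\<^sub>F q in nhds (x, s). fl (fst q) (snd q) = \<Phi> (g (fst q) + vec2 0 (snd q))"
      by (rule eventually_mono) (auto simp: eq simp del: mem_ball)
    ultimately show "isCont (\<lambda>q. fl (fst q) (snd q)) (x, s)" by (simp add: isCont_cong)
  next
    fix \<mu> z and s :: complex assume \<mu>: "hcurve_at \<mu> z" "\<mu> z \<in> ?V" "s \<in> ball 0 r"
    have "\<mu> z \<in> \<Phi> ` bidisc \<rho>" using \<mu>(2) r by (auto simp: bidisc_def)
    from hcurve_coordinates[OF \<mu>(1) flow_boxD(6)[OF b this] flow_boxD(3)[OF b gm[OF \<mu>(2,3)]]]
    have "hcurve_at (\<lambda>w. \<Phi> (g (\<mu> w) + vec2 0 s)) z" .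
    moreover have "isCont \<mu> z" using \<mu>(1) by (simp add: hcurve_at_def)
    from isCont_eventually[OF this eventually_nhds_in_open[OF V \<mu>(2)]]
    have "\<forall>\<^sub>F w in nhds z. \<Phi> (g (\<mu> w) + vec2 0 s) = fl (\<mu> w) s"
      by (rule eventually_mono) (use eq \<mu>(3) in simp)
    ultimately show "hcurve_at (\<lambda>z. fl (\<mu> z) s) z" by (rule hcurve_at_cong)
  qed
qed

text \<open>Dependence on the initial point is known for short times near each regular point. Since
  the plane of times is connected and the orbit of \<open>p\<close> stays regular, any property that
  survives one short step holds for all times.\<close>

lemma flow_time_induct [consumes 1, case_names zero step]:
  assumes p: "p \<in> reg" and 0: "P 0"
    and step: "\<And>a b V \<eta>. P a \<Longrightarrow> fl p a \<in> V \<Longrightarrow> b - a \<in> ball 0 \<eta> \<Longrightarrow> open V \<Longrightarrow>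
      (\<And>x s. x \<in> V \<Longrightarrow> s \<in> ball 0 \<eta> \<Longrightarrow> isCont (\<lambda>q. fl (fst q) (snd q)) (x, s)) \<Longrightarrow>
      (\<And>\<mu> z s. hcurve_at \<mu> z \<Longrightarrow> \<mu> z \<in> V \<Longrightarrow> s \<in> ball 0 \<eta> \<Longrightarrow> hcurve_at (\<lambda>z. fl (\<mu> z) s) z) \<Longrightarrow> P b"
  shows "P t"
proof (rule connected_induction_simple[OF connected_UNIV UNIV_I UNIV_I, of P 0 t])
  fix t0 :: complex
  obtain V \<eta> where V: "open V" "fl p t0 \<in> V" "\<eta> > 0"
    "\<And>x s. x \<in> V \<Longrightarrow> s \<in> ball 0 \<eta> \<Longrightarrow> isCont (\<lambda>q. fl (fst q) (snd q)) (x, s)"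
    "\<And>\<mu> z s. hcurve_at \<mu> z \<Longrightarrow> \<mu> z \<in> V \<Longrightarrow> s \<in> ball 0 \<eta> \<Longrightarrow> hcurve_at (\<lambda>z. fl (\<mu> z) s) z"
    using local_flow[OF flow_reg[OF p]] by blast
  let ?T = "fl p -` V \<inter> ball t0 (\<eta>/2)"
  have "continuous_on UNIV (fl p)" by (simp add: continuous_on_eq_continuous_at flow_isCont)
  then have "open ?T" using V(1) by (intro open_Int open_vimage) auto
  moreover have "t0 \<in> ?T" using V by simp
  moreover have "P b" if "a \<in> ?T" "b \<in> ?T" "P a" for a b
  proof (rule step[OF that(3) _ _ V(1,4,5)])
    show "fl p a \<in> V" using that(1) by simp
    show "b - a \<in> ball 0 \<eta>"
    proof -
      have "dist b t0 < \<eta> / 2" "dist a t0 < \<eta> / 2" using that(1,2) by (auto simp: dist_commute)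
      then have "dist b a < \<eta>" by (rule dist_triangle_half_l)
      then show ?thesis by (simp add: dist_norm norm_minus_commute[of a b])
    qed
  qed
  ultimately show "\<exists>T. openin (top_of_set UNIV) T \<and> t0 \<in> T \<and> (\<forall>x\<in>T. \<forall>y\<in>T. P x \<longrightarrow> P y)"
    unfolding subtopology_UNIV open_openin[symmetric] by blast
qed (rule 0)

lemma flow_continuous:
  assumes p: "p \<in> reg" shows "isCont (\<lambda>q. fl (fst q) (snd q)) (p, t)"
  using p
proof (induction t rule: flow_time_induct)
  case zero
  obtain V \<eta> where V: "open V" "p \<in> V" "\<eta> > 0"
    "\<And>x s. x \<in> V \<Longrightarrow> s \<in> ball 0 \<eta> \<Longrightarrow> isCont (\<lambda>q. fl (fst q) (snd q)) (x, s)"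
    "\<And>\<mu> z s. hcurve_at \<mu> z \<Longrightarrow> \<mu> z \<in> V \<Longrightarrow> s \<in> ball 0 \<eta> \<Longrightarrow> hcurve_at (\<lambda>z. fl (\<mu> z) s) z"
    using local_flow[OF p] by blast
  show ?case by (rule V(4)[OF V(2)]) (use V(3) in simp)
next
  case (step a b V \<eta>)
  have "isCont (\<lambda>q. (fst q, a)) (p, b)" by (intro continuous_intros)
  from isCont_o2[OF this, of "\<lambda>q. fl (fst q) (snd q)"]
  have "isCont (\<lambda>q. fl (fst q) a) (p, b)" using step.IH by simp
  then have 1: "isCont (\<lambda>q. (fl (fst q) a, snd q - a)) (p, b)" by (intro continuous_intros)
  have 2: "isCont (\<lambda>q. fl (fst q) (snd q)) (fl (fst (p, b)) a, snd (p, b) - a)"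
    using step.hyps(4)[OF step.hyps(1,2)] by simp
  have "isCont (\<lambda>q. fl (fst (fl (fst q) a, snd q - a)) (snd (fl (fst q) a, snd q - a))) (p, b)"
    by (rule isCont_o2[OF 1 2])
  then show ?case by (simp add: flow_add)
qed

lemma hcurve_flow:
  assumes \<mu>: "hcurve_at \<mu> z" "\<mu> z \<in> reg" shows "hcurve_at (\<lambda>z. fl (\<mu> z) t) z"
  using \<mu>(2)
proof (induction t rule: flow_time_induct)
  case zero
  then show ?case using \<mu>(1) by simp
next
  case (step a b V \<eta>)
  from step.hyps(5)[OF step.IH step.hyps(1,2)] show ?case by (simp add: flow_add)
qed

lemma flow_isCont_point: "p \<in> reg \<Longrightarrow> isCont (\<lambda>q. fl q t) p"
  using isCont_o2[where f = "\<lambda>q. (q, t)" and a = p and g = "\<lambda>q. fl (fst q) (snd q)"]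
    flow_continuous[of p t] by simp

section \<open>Return maps of a section and propagation of periods\<close>

lemma section_hcurve:
  assumes b: "flow_box p \<rho> \<Phi> g" and z: "z \<in> ball 0 \<rho>"
  shows "hcurve_at (\<lambda>z. \<Phi> (vec2 z 0)) z" "\<Phi> (vec2 z 0) \<in> reg"
proof -
  have "vec2 z 0 \<in> bidisc \<rho>" using z flow_boxD(1)[OF b] by (simp add: vec2_bidisc)
  then show "hcurve_at (\<lambda>z. \<Phi> (vec2 z 0)) z" "\<Phi> (vec2 z 0) \<in> reg"
    using hcurve_hmap[OF flow_boxD(3)[OF b] has_derivative_vec2_1] flow_box_reg[OF b] by blast+
qed

text \<open>At a fixed time \<open>T\<close> a section point returns to the box but not exactly to
  the section: \<open>f\<close> is the transverse coordinate of the image, a holonomy map, and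
  \<open>u\<close> the time by which the section is missed.\<close>

lemma return_map:
  assumes b: "flow_box p \<rho> \<Phi> g" and T: "fl p T = p"
  obtains \<delta> f u where "0 < \<delta>" "\<delta> \<le> \<rho>" "f holomorphic_on ball 0 \<delta>" "u holomorphic_on ball 0 \<delta>"
    "f 0 = 0" "u 0 = 0" "\<And>z. z \<in> ball 0 \<delta> \<Longrightarrow> f z \<in> ball 0 \<rho>" "\<And>z. z \<in> ball 0 \<delta> \<Longrightarrow> u z \<in> ball 0 \<rho>"
    "\<And>z. z \<in> ball 0 \<delta> \<Longrightarrow> fl (\<Phi> (vec2 z 0)) T = \<Phi> (vec2 (f z) (u z))"
proof -
  define \<mu> where "\<mu> z = fl (\<Phi> (vec2 z 0)) T" for z
  have \<mu>: "hcurve_at \<mu> z" if "z \<in> ball 0 \<rho>" for z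
    unfolding \<mu>_def using hcurve_flow[OF section_hcurve[OF b that]] .
  have 0: "0 \<in> ball (0::complex) \<rho>" using flow_boxD(1)[OF b] by simp
  have \<mu>0: "\<mu> 0 = p" using T flow_boxD(2)[OF b] by (simp add: \<mu>_def vec2_0)
  have "isCont \<mu> 0" using \<mu>[OF 0] by (simp add: hcurve_at_def)
  from isCont_eventually[OF this, of "\<lambda>q. q \<in> \<Phi> ` bidisc \<rho>"]
  have "\<forall>\<^sub>F z in nhds 0. \<mu> z \<in> \<Phi> ` bidisc \<rho>"
    using eventually_nhds_in_open[OF flow_boxD(5)[OF b] flow_box_center[OF b]] \<mu>0 by simp
  then obtain d where d: "d > 0" "\<And>z. dist z 0 < d \<Longrightarrow> \<mu> z \<in> \<Phi> ` bidisc \<rho>"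
    by (auto simp: eventually_nhds_metric)
  define \<delta> where "\<delta> = min d \<rho>"
  have \<delta>: "0 < \<delta>" "\<delta> \<le> \<rho>" using d flow_boxD(1)[OF b] by (auto simp: \<delta>_def)
  have m: "\<mu> z \<in> \<Phi> ` bidisc \<rho>" "z \<in> ball 0 \<rho>" if "z \<in> ball 0 \<delta>" for z
    using that d(2)[of z] by (auto simp: \<delta>_def simp del: image_iff)
  have hol: "(\<lambda>z. g (\<mu> z) $ i) holomorphic_on ball 0 \<delta>" for i
    unfolding holomorphic_on_def
    using hol_at_hcurve[OF \<mu>[OF m(2)] flow_boxD(6)[OF b m(1)]] field_differentiable_at_within by blast
  have "0 \<in> bidisc \<rho>" using flow_boxD(1)[OF b] by (simp add: bidisc_def)
  then have g0: "g (\<mu> 0) = 0" using \<mu>0 flow_boxD(2)[OF b] flow_boxD(4)[OF b, of 0] by simp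
  show thesis
  proof (rule that[OF \<delta> hol[of 1] hol[of 2]])
    fix z assume z: "z \<in> ball (0::complex) \<delta>"
    note pt = flow_box_point[OF b m(1)[OF z]]
    show "g (\<mu> z) $ 1 \<in> ball 0 \<rho>" "g (\<mu> z) $ 2 \<in> ball 0 \<rho>" by (rule pt)+
    show "fl (\<Phi> (vec2 z 0)) T = \<Phi> (vec2 (g (\<mu> z) $ 1) (g (\<mu> z) $ 2))"
      using pt(3) by (simp add: vec2_eta \<mu>_def)
  qed (use g0 in auto)
qed

lemma return_map_period:
  assumes b: "flow_box p \<rho> \<Phi> g" and z: "f \<in> ball 0 \<rho>" "u \<in> ball 0 \<rho>"
    and eq: "fl (\<Phi> (vec2 z 0)) T = \<Phi> (vec2 f u)"
  shows "fl (\<Phi> (vec2 z 0)) (T - u) = \<Phi> (vec2 f 0)"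
proof -
  have "fl (\<Phi> (vec2 z 0)) (T - u) = fl (\<Phi> (vec2 f u)) (0 - u)"
    using flow_add[of "\<Phi> (vec2 z 0)" T "- u"] by (simp add: eq)
  also have "\<dots> = \<Phi> (vec2 f 0)"
    by (rule flow_boxD(7)[OF b z]) (use flow_boxD(1)[OF b] in simp)
  finally show ?thesis .
qed

text \<open>Points of the section with period \<open>T\<close> are common zeros of
  \<open>f z - z\<close> and \<open>u\<close>. An accumulation point of such zeros inside the disc
  makes both functions vanish identically, so the time-\<open>T\<close> map is the identity on the
  section and then on the box.\<close>

lemma period_near:
  assumes b: "flow_box p \<rho> \<Phi> g" and T: "fl p T = p"
  obtains \<delta> where "0 < \<delta>" "\<delta> \<le> \<rho>"
    "\<And>K \<xi> q. K \<subseteq> ball 0 \<delta> \<Longrightarrow> \<xi> \<in> ball 0 \<delta> \<Longrightarrow> \<xi> islimpt K \<Longrightarrow>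
       (\<And>z. z \<in> K \<Longrightarrow> fl (\<Phi> (vec2 z 0)) T = \<Phi> (vec2 z 0)) \<Longrightarrow> q \<in> \<Phi> ` bidisc \<delta> \<Longrightarrow> fl q T = q"
proof -
  obtain \<delta> f u where \<delta>: "0 < \<delta>" "\<delta> \<le> \<rho>" and fu: "f holomorphic_on ball 0 \<delta>" "u holomorphic_on ball 0 \<delta>"
    "f 0 = 0" "u 0 = 0" "\<And>z. z \<in> ball 0 \<delta> \<Longrightarrow> f z \<in> ball 0 \<rho>" "\<And>z. z \<in> ball 0 \<delta> \<Longrightarrow> u z \<in> ball 0 \<rho>"
    "\<And>z. z \<in> ball 0 \<delta> \<Longrightarrow> fl (\<Phi> (vec2 z 0)) T = \<Phi> (vec2 (f z) (u z))"
    using return_map[OF b T] by blast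
  have sub: "z \<in> ball 0 \<rho>" if "z \<in> ball 0 \<delta>" for z :: complex using that \<delta> by auto
  have 0: "0 \<in> ball (0::complex) \<rho>" using flow_boxD(1)[OF b] by simp
  show thesis
  proof (rule that[OF \<delta>])
    fix K \<xi> q assume K: "K \<subseteq> ball 0 \<delta>" "\<xi> \<in> ball 0 \<delta>" "\<xi> islimpt K"
      and per: "\<And>z. z \<in> K \<Longrightarrow> fl (\<Phi> (vec2 z 0)) T = \<Phi> (vec2 z 0)" and q: "q \<in> \<Phi> ` bidisc \<delta>"
    have fuK: "f z - z = 0 \<and> u z = 0" if z: "z \<in> K" for z
    proof -
      have zd: "z \<in> ball 0 \<delta>" using z K by blast
      have "\<Phi> (vec2 (f z) (u z)) = \<Phi> (vec2 z 0)" using per[OF z] fu(7)[OF zd] by simp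
      then have "vec2 (f z) (u z) = vec2 z 0"
        using flow_boxD(4)[OF b] fu(5,6)[OF zd] sub[OF zd] 0 vec2_bidisc by metis
      then show ?thesis by (simp add: vec2_eq_iff)
    qed
    have hf: "(\<lambda>z. f z - z) holomorphic_on ball 0 \<delta>" by (intro holomorphic_intros fu)
    have zero: "f z - z = 0" "u z = 0" if "z \<in> ball 0 \<delta>" for z
      using analytic_continuation[OF hf open_ball connected_ball K _ that]
        analytic_continuation[OF fu(2) open_ball connected_ball K _ that] fuK by blast+
    note pt = flow_box_point[OF flow_box_shrink[OF b \<delta>] q]
    let ?s = "\<Phi> (vec2 (g q $ 1) 0)"
    have "fl ?s T = ?s" using fu(7)[OF pt(1)] zero[OF pt(1)] by simp
    moreover have "fl q T = fl (fl ?s T) (g q $ 2)" unfolding pt(4)[symmetric] flow_add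
      by (subst pt(4)) (simp add: flow_add add.commute)
    ultimately show "fl q T = q" using pt(4) by simp
  qed
qed

section \<open>Isolated singularities and connectedness of the regular set\<close>

lemma punctured_neighbourhood:
  assumes p: "p \<in> sing A X"
  obtains c e where "c \<in> A" "p \<in> fst c" "e > 0" "ball (snd c p) e \<subseteq> snd c ` fst c"
    "chart_inv c ` ball (snd c p) e \<inter> sing A X = {p}"
proof -
  obtain W where W: "open W" "W \<inter> sing A X = {p}"
    using isolated p unfolding isolated_singularities_def isolated_in_def by blast
  obtain c where c: "c \<in> A" "p \<in> fst c" by (rule chart_at)
  have "open (snd c ` (fst c \<inter> W))"
    by (rule chart_image_open[OF c(1)]) (use W chart_open(1)[OF c(1)] in auto)
  moreover have "snd c p \<in> snd c ` (fst c \<inter> W)" using c W by blast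
  ultimately obtain e where e: "e > 0" "ball (snd c p) e \<subseteq> snd c ` (fst c \<inter> W)" using openE by blast
  have "chart_inv c ` ball (snd c p) e \<subseteq> W" using e(2) c(1) by auto
  moreover have "p \<in> chart_inv c ` ball (snd c p) e"
    using e(1) c by (intro image_eqI[of _ _ "snd c p"]) auto
  ultimately have "chart_inv c ` ball (snd c p) e \<inter> sing A X = {p}" using W p by blast
  then show thesis using that c e by blast
qed

text \<open>A punctured ball in C^2 is connected, so near a singular point the regular set lies on
  one side of any separation. Adding the point to that side (\<open>ext\<close>) turns the
  separation into one of the whole surface.\<close>

lemma connected_reg: "connected reg"
proof (rule connectedI)
  fix U V assume UV: "open U" "open V" "U \<inter> reg \<noteq> {}" "V \<inter> reg \<noteq> {}" "U \<inter> V \<inter> reg = {}" "reg \<subseteq> U \<union> V"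
  define ext where "ext S = (S \<inter> reg) \<union> {p \<in> sing A X. \<exists>W. open W \<and> p \<in> W \<and> W - {p} \<subseteq> S \<inter> reg}" for S
  have opn: "open (ext S)" if S: "open S" for S
  proof (subst open_subopen, intro ballI)
    fix p assume "p \<in> ext S"
    then consider "p \<in> S \<inter> reg" | W where "open W" "p \<in> W" "W - {p} \<subseteq> S \<inter> reg" "p \<in> sing A X"
      unfolding ext_def by blast
    then show "\<exists>T. open T \<and> p \<in> T \<and> T \<subseteq> ext S"
    proof cases
      case 1 then show ?thesis using S open_reg by (intro exI[of _ "S \<inter> reg"]) (auto simp: ext_def)
    next
      case 2 then show ?thesis by (intro exI[of _ W]) (auto simp: ext_def)
    qed
  qed
  have cover: "p \<in> ext U \<union> ext V" for p
  proof (cases "p \<in> sing A X")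
    case False then show ?thesis using UV(6) by (auto simp: ext_def)
  next
    case True
    obtain c e where c: "c \<in> A" "p \<in> fst c" "e > 0" "ball (snd c p) e \<subseteq> snd c ` fst c"
      "chart_inv c ` ball (snd c p) e \<inter> sing A X = {p}"
      using punctured_neighbourhood[OF True] by blast
    let ?B = "ball (snd c p) e" and ?W = "chart_inv c ` ball (snd c p) e"
    have W: "open ?W" "p \<in> ?W" using chart_inv_image_open[OF c(1) open_ball c(4)] c by blast+
    have "connected (?B - {snd c p})" by (rule connected_punctured_ball) simp
    moreover have "continuous_on (?B - {snd c p}) (chart_inv c)"
      using chart_inv_cont[OF c(1)] c(4) by (intro continuous_at_imp_continuous_on) blast
    ultimately have con: "connected (chart_inv c ` (?B - {snd c p}))" by (rule connected_continuous_image[rotated])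
    have eq: "?W - {p} = chart_inv c ` (?B - {snd c p})"
    proof (intro equalityI subsetI)
      fix y assume "y \<in> chart_inv c ` (?B - {snd c p})"
      then obtain x where x: "x \<in> ?B" "x \<noteq> snd c p" "y = chart_inv c x" by blast
      have "x \<in> snd c ` fst c" using x(1) c(4) by blast
      then have "snd c y = x" using x(3) by simp
      then show "y \<in> ?W - {p}" using x by blast
    next
      fix y assume y: "y \<in> ?W - {p}"
      then obtain x where x: "x \<in> ?B" "y = chart_inv c x" by blast
      moreover have "x \<noteq> snd c p" using y x(2) c(1,2) by (metis DiffE chart_inv_chart singletonI)
      ultimately show "y \<in> chart_inv c ` (?B - {snd c p})" by blast
    qed
    have "?W - {p} \<subseteq> reg" using c(5) by blast
    then have "?W - {p} \<subseteq> U \<inter> reg \<or> ?W - {p} \<subseteq> V \<inter> reg"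
      using connectedD[OF con UV(1,2)] UV(5,6) unfolding eq[symmetric] by blast
    then show ?thesis using True W unfolding ext_def by blast
  qed
  have "ext U \<inter> ext V = {}"
  proof (rule ccontr)
    assume "ext U \<inter> ext V \<noteq> {}"
    then obtain p where p: "p \<in> ext U" "p \<in> ext V" by blast
    show False
    proof (cases "p \<in> sing A X")
      case False then show ?thesis using p UV(5) by (auto simp: ext_def)
    next
      case True
      then obtain W1 W2 where W: "open W1" "p \<in> W1" "W1 - {p} \<subseteq> U \<inter> reg" "open W2" "p \<in> W2" "W2 - {p} \<subseteq> V \<inter> reg"
        using p unfolding ext_def by blast
      obtain c where c: "c \<in> A" "p \<in> fst c" by (rule chart_at)
      \<comment> \<open>If a singular point belonged to both sides it would be an open point, which
        a chart into C^2 excludes.\<close>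
      have "W1 \<inter> W2 = {p}" using W UV(5) by blast
      then have "open {p}" using W by (metis open_Int)
      then have "open (snd c ` {p})" by (rule chart_image_open[OF c(1)]) (use c in auto)
      then show False by (simp add: not_open_singleton)
    qed
  qed
  moreover have "ext U \<noteq> {}" "ext V \<noteq> {}" using UV(3,4) by (auto simp: ext_def)
  ultimately show False
    using connectedD[OF connected_surface opn[OF UV(1)] opn[OF UV(2)]] cover by blast
qed

text \<open>Analytic continuation of the identity: being the identity near a point spreads through a
  flow box by the identity theorem, and the regular set is connected. Around a point that the
  time-\<open>T\<close> map moves, continuity makes the property fail everywhere nearby.\<close>

lemma period_global:
  assumes W: "open W" "W \<noteq> {}" "W \<subseteq> reg" and per: "\<And>q. q \<in> W \<Longrightarrow> fl q T = q"
  shows "fl q T = q"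
proof (cases "q \<in> reg")
  case False
  then show ?thesis using flow_sing by blast
next
  case True
  obtain w where w: "w \<in> W" using W by blast
  let ?P = "\<lambda>x. \<forall>\<^sub>F y in nhds x. fl y T = y"
  have "?P q"
  proof (rule connected_induction_simple[OF connected_reg, of w q ?P])
    fix x assume x: "x \<in> reg"
    show "\<exists>S. openin (top_of_set reg) S \<and> x \<in> S \<and> (\<forall>y\<in>S. \<forall>y'\<in>S. ?P y \<longrightarrow> ?P y')"
    proof (cases "fl x T = x")
      case False
      have "isCont (\<lambda>y. (fl y T, y)) x" using flow_isCont_point[OF x] by (intro continuous_intros)
      moreover have "open {(a, b). a \<noteq> (b::'a)}"
      proof -
        have "{(a, b). a \<noteq> (b::'a)} = - {y. \<exists>x. y = (x, x)}" by auto
        then show ?thesis using closed_diagonal by (simp add: closed_def)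
      qed
      ultimately have "\<forall>\<^sub>F y in nhds x. (fl y T, y) \<in> {(a, b). a \<noteq> b}"
        by (intro isCont_eventually[where f = "\<lambda>y. (fl y T, y)"] eventually_nhds_in_open) (use False in auto)
      then obtain S where S: "open S" "x \<in> S" "\<And>y. y \<in> S \<Longrightarrow> fl y T \<noteq> y" unfolding eventually_nhds by auto
      have "\<not> ?P y" if "y \<in> S" for y using S(3)[OF that] eventually_nhds_x_imp_x by blast
      moreover have "open (S \<inter> reg)" using S(1) open_reg by (rule open_Int)
      ultimately show ?thesis using S(2) x
        unfolding openin_open_eq[OF open_reg] by (intro exI[of _ "S \<inter> reg"]) blast
    next
      case True
      obtain \<rho> \<Phi> g where b: "flow_box x \<rho> \<Phi> g" using flow_box_exists[OF x] by blast
      obtain \<delta> where \<delta>: "0 < \<delta>" "\<delta> \<le> \<rho>" and id: "\<And>K \<xi> q. K \<subseteq> ball 0 \<delta> \<Longrightarrow> \<xi> \<in> ball 0 \<delta> \<Longrightarrow> \<xi> islimpt K \<Longrightarrow>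
         (\<And>z. z \<in> K \<Longrightarrow> fl (\<Phi> (vec2 z 0)) T = \<Phi> (vec2 z 0)) \<Longrightarrow> q \<in> \<Phi> ` bidisc \<delta> \<Longrightarrow> fl q T = q"
        using period_near[OF b True] by blast
      note b' = flow_box_shrink[OF b \<delta>]
      let ?S = "\<Phi> ` bidisc \<delta>"
      have "?P y'" if y: "y \<in> ?S" "?P y" and y': "y' \<in> ?S" for y y'
      proof -
        note pt = flow_box_point[OF b' y(1)]
        \<comment> \<open>The points known to have period \<open>T\<close> surround
          \<open>y\<close>, so the disc is taken at the height of \<open>y\<close>. Flowing back by
          \<open>g y $ 2\<close> moves their periods to the section, where the identity theorem is
          stated.\<close>
        define s where "s z = \<Phi> (vec2 z (g y $ 2))" for z
        have "isCont (\<lambda>z. vec2 z (g y $ 2)) (g y $ 1)" using has_derivative_vec2_1 by (rule has_derivative_continuous)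
        then have i: "isCont s (g y $ 1)"
          unfolding s_def by (rule isCont_o2)
            (use flow_boxD(3)[OF b', of "vec2 (g y $ 1) (g y $ 2)"] pt(1,2) in \<open>simp add: hmap_at_def vec2_bidisc\<close>)
        have "s (g y $ 1) = y" using pt(3) by (simp add: s_def vec2_eta)
        then have "\<forall>\<^sub>F z in nhds (g y $ 1). fl (s z) T = s z"
          using isCont_eventually[OF i, of "\<lambda>x. fl x T = x"] y(2) by simp
        then have "\<forall>\<^sub>F z in nhds (g y $ 1). fl (s z) T = s z \<and> z \<in> ball 0 \<delta>"
          using pt(1) by (intro eventually_conj eventually_nhds_in_open) auto
        then obtain e where e: "e > 0" "\<And>z. z \<in> ball (g y $ 1) e \<Longrightarrow> fl (s z) T = s z \<and> z \<in> ball 0 \<delta>"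
          by (auto simp: eventually_nhds_metric dist_commute)
        have "fl r T = r" if "r \<in> ?S" for r
        proof (rule id[OF _ pt(1) _ _ that])
          show "ball (g y $ 1) e \<subseteq> ball 0 \<delta>" using e(2) by blast
          show "(g y $ 1) islimpt ball (g y $ 1) e" using e(1) by (simp add: islimpt_ball)
          fix z assume z: "z \<in> ball (g y $ 1) e"
          have sz: "s z = fl (\<Phi> (vec2 z 0)) (g y $ 2)"
            unfolding s_def by (rule flow_box_vertical[OF b']) (use e(2)[OF z] pt(2) in auto)
          have "fl (fl (\<Phi> (vec2 z 0)) T) (g y $ 2) = fl (\<Phi> (vec2 z 0)) (g y $ 2)"
            using conjunct1[OF e(2)[OF z]] unfolding sz flow_add by (simp add: add.commute)
          then have "fl (fl (fl (\<Phi> (vec2 z 0)) T) (g y $ 2)) (- (g y $ 2)) = fl (fl (\<Phi> (vec2 z 0)) (g y $ 2)) (- (g y $ 2))"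
            by simp
          then show "fl (\<Phi> (vec2 z 0)) T = \<Phi> (vec2 z 0)" unfolding flow_add by simp
        qed
        then show ?thesis using flow_boxD(5)[OF b'] y' unfolding eventually_nhds by blast
      qed
      moreover have "?S \<subseteq> reg" using flow_box_reg[OF b'] by blast
      ultimately show ?thesis using flow_boxD(5)[OF b'] flow_box_center[OF b'] open_reg
        unfolding openin_open_eq[OF open_reg] by blast
    qed
  next
    show "?P w" using W(1) w per unfolding eventually_nhds by blast
  qed (use True w W in auto)
  then show ?thesis by (rule eventually_nhds_x_imp_x)
qed

end

section \<open>Global holomorphic functions and periodic flows\<close>

lemma periodic_of_int:
  fixes E :: "complex \<Rightarrow> 'b"
  assumes "\<And>w. E (w + 1) = E w" shows "E (w + of_int n) = E w"
proof -
  have nat: "E (w + of_nat n) = E w" for w n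
  proof (induction n)
    case (Suc n)
    have "E (w + of_nat (Suc n)) = E ((w + of_nat n) + 1)" by (simp add: algebra_simps)
    then show ?case using assms Suc by simp
  qed simp
  show ?thesis
  proof (cases "n \<ge> 0")
    case True then show ?thesis using nat[of w "nat n"] by simp
  next
    case False then show ?thesis using nat[of "w + of_int n" "nat (- n)"] by simp
  qed
qed

text \<open>Jumps of the logarithm change the argument of \<open>E\<close> by an integer, which
  periodicity absorbs. Near \<open>z0\<close> one may therefore use
  \<open>Ln (z / z0) + Ln z0\<close>, which is continuous at \<open>z0\<close> even on the branch
  cut.\<close>

lemma circle_function_continuous:
  fixes E :: "complex \<Rightarrow> complex"
  assumes cont: "continuous_on UNIV E" and per: "\<And>w. E (w + 1) = E w"
  shows "continuous_on (sphere 0 1) (\<lambda>z. E (Ln z / (2 * of_real pi * \<i>)))"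
proof (rule continuous_at_imp_continuous_on, rule ballI)
  fix z0 :: complex assume "z0 \<in> sphere 0 1"
  then have z0: "z0 \<noteq> 0" by auto
  let ?d = "2 * of_real pi * \<i> :: complex"
  have eq: "E (Ln z / ?d) = E ((Ln (z / z0) + Ln z0) / ?d)" if z: "z \<noteq> 0" for z
  proof -
    have "exp (Ln (z / z0) + Ln z0) = exp (Ln z)" using z z0 by (simp add: exp_add)
    then obtain n :: int where "Ln (z / z0) + Ln z0 = Ln z + of_real (of_int (2 * n) * pi) * \<i>"
      unfolding exp_eq by blast
    then have "(Ln (z / z0) + Ln z0) / ?d = Ln z / ?d + of_int n" by (simp add: field_simps)
    then show ?thesis using periodic_of_int[of E, OF per] by metis
  qed
  have "isCont (\<lambda>z. (Ln (z / z0) + Ln z0) / ?d) z0"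
    by (intro continuous_intros) (use z0 in auto)
  moreover have "isCont E ((Ln (z0 / z0) + Ln z0) / ?d)" using cont by (simp add: continuous_on_eq_continuous_at)
  ultimately have "isCont (\<lambda>z. E ((Ln (z / z0) + Ln z0) / ?d)) z0" by (rule isCont_o2)
  moreover have "\<forall>\<^sub>F z in nhds z0. z \<noteq> 0" using z0 by (rule t1_space_nhds)
  then have "\<forall>\<^sub>F z in nhds z0. E (Ln z / ?d) = E ((Ln (z / z0) + Ln z0) / ?d)"
    by (rule eventually_mono) (rule eq)
  ultimately show "isCont (\<lambda>z. E (Ln z / ?d)) z0" by (simp add: isCont_cong)
qed

text \<open>Vanishing coefficients make \<open>E\<close> orthogonal to all trigonometric
  polynomials. Approximating the conjugate of \<open>E\<close> by these shows that the integral of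
  the squared modulus is 0, hence so is the continuous integrand.\<close>

lemma fourier_unique:
  fixes E :: "complex \<Rightarrow> complex"
  assumes cont: "continuous_on UNIV E" and per: "\<And>w. E (w + 1) = E w"
    and zero: "\<And>k::int. integral {0..1} (\<lambda>s::real. E (of_real s) * exp (- 2 * of_real pi * \<i> * of_int k * of_real s)) = 0"
  shows "E 0 = 0"
proof -
  let ?e = "\<lambda>s::real. exp (2 * of_real pi * \<i> * of_real s)"
  define \<Delta> where "\<Delta> z = E (Ln z / (2 * of_real pi * \<i>))" for z
  have ne: "norm (?e s) = 1" for s by (simp add: norm_exp_eq_Re)
  have \<Delta>e: "\<Delta> (?e s) = E (of_real s)" for s
  proof -
    have "exp (Ln (?e s)) = ?e s" by simp
    then obtain n :: int where "Ln (?e s) = 2 * of_real pi * \<i> * of_real s + of_real (of_int (2 * n) * pi) * \<i>"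
      unfolding exp_eq by blast
    then have "Ln (?e s) / (2 * of_real pi * \<i>) = of_real s + of_int n" by (simp add: field_simps)
    then show ?thesis unfolding \<Delta>_def using periodic_of_int[of E, OF per] by simp
  qed
  have cE: "continuous_on S (\<lambda>s::real. E (of_real s))" for S
    by (rule continuous_on_compose2[OF cont]) (auto intro!: continuous_intros)
  have trig_cont: "continuous_on {0..1} (\<lambda>s. u (?e s))" if "u \<in> trig" for u
  proof -
    obtain p where p: "p holomorphic_on UNIV" "\<And>z. norm z = 1 \<Longrightarrow> u z = Re (p z)" using trig_entire[OF \<open>u \<in> trig\<close>] by blast
    have "continuous_on {0..1} (\<lambda>s. Re (p (?e s)))"
      by (intro continuous_intros continuous_on_compose2[OF holomorphic_on_imp_continuous_on[OF p(1)]]) auto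
    then show ?thesis using p(2) ne by simp
  qed
  have orth: "integral {0..1} (\<lambda>s. E (of_real s) * of_real (u (?e s))) = 0" if "u \<in> trig" for u
    using that
  proof (induction u rule: trig.induct)
    case (mono u c k)
    have pw: "?e s ^ k = exp (- 2 * of_real pi * \<i> * of_int (- int k) * of_real s)"
      "cnj (?e s) ^ k = exp (- 2 * of_real pi * \<i> * of_int (int k) * of_real s)" for s
      by (simp_all add: exp_of_nat_mult[symmetric] exp_cnj mult_ac)
    define B where "B j s = E (of_real s) * exp (- 2 * of_real pi * \<i> * of_int j * of_real s)" for j :: int and s :: real
    have hB: "(B j has_integral 0) {0..1}" for j
    proof -
      have "(\<lambda>s. E (of_real s) * exp (- 2 * of_real pi * \<i> * of_int j * of_real s)) integrable_on {0..1}"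
        by (intro integrable_continuous_real continuous_intros cE)
      then have "B j integrable_on {0..1}" unfolding B_def .
      from integrable_integral[OF this] have "(B j has_integral (integral {0..1} (B j))) {0..1}" .
      moreover have "integral {0..1} (B j) = 0" using zero[of j] unfolding B_def .
      ultimately show ?thesis by (simp only:)
    qed
    have "E (of_real s) * of_real (u (?e s)) = (c / 2) * B (- int k) s + (cnj c / 2) * B (int k) s" for s
    proof -
      have "x * of_real (Re (c * z ^ k)) = (c / 2) * (x * z ^ k) + (cnj c / 2) * (x * cnj z ^ k)" for x z :: complex
      proof -
        have "complex_of_real (Re (c * z ^ k)) = (c * z ^ k + cnj c * cnj z ^ k) / 2"
          using complex_add_cnj[of "c * z ^ k"] by simp
        also have "x * \<dots> = (c / 2) * (x * z ^ k) + (cnj c / 2) * (x * cnj z ^ k)" by (simp add: algebra_simps)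
        finally show ?thesis .
      qed
      from this[of "E (of_real s)" "?e s"]
      have "E (of_real s) * of_real (u (?e s)) = (c / 2) * (E (of_real s) * ?e s ^ k) + (cnj c / 2) * (E (of_real s) * cnj (?e s) ^ k)"
        unfolding mono[OF ne] .
      then show ?thesis unfolding pw B_def .
    qed
    then show ?case
      using has_integral_add[OF has_integral_mult_right[OF hB[of "- int k"], of "c / 2"]
          has_integral_mult_right[OF hB[of "int k"], of "cnj c / 2"]]
      by (simp add: integral_unique)
  next
    case (add u v w)
    have "E (of_real s) * of_real (w (?e s)) = E (of_real s) * of_real (u (?e s)) + E (of_real s) * of_real (v (?e s))" for s
      unfolding add.hyps(3)[OF ne] by (simp only: of_real_add distrib_left)
    moreover have "(\<lambda>s. E (of_real s) * of_real (t (?e s))) integrable_on {0..1}" if "t \<in> trig" for t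
      by (intro integrable_continuous_real continuous_intros cE trig_cont that)
    ultimately show ?case using add.hyps(1,2) add.IH by (simp add: integral_add)
  qed
  have cs: "continuous_on (sphere 0 1) \<Delta>" unfolding \<Delta>_def by (rule circle_function_continuous[OF cont per])
  obtain M where M: "M > 0" "\<And>s. s \<in> {0..1} \<Longrightarrow> norm (E (of_real s)) \<le> M"
  proof -
    have "compact ((\<lambda>s::real. E (of_real s)) ` {0..1})" by (rule compact_continuous_image[OF cE]) auto
    from compact_imp_bounded[OF this] obtain b where b: "b > 0" "\<forall>x\<in>(\<lambda>s::real. E (of_real s)) ` {0..1}. norm x \<le> b"
      unfolding bounded_pos by blast
    have "norm (E (of_real s)) \<le> b" if "s \<in> {0..1}" for s using bspec[OF b(2) imageI[OF that]] .
    then show thesis by (rule that[OF b(1)])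
  qed
  define I where "I = integral {0..1} (\<lambda>s. E (of_real s) * cnj (E (of_real s)))"
  have "norm I \<le> 0 + e" if e: "e > 0" for e
  proof -
    \<comment> \<open>Two approximations with error \<open>d\<close>, one for each of the real and
      imaginary parts, give an error of at most \<open>2 * d\<close>; multiplied by the bound
      \<open>M\<close> for \<open>E\<close> this is \<open>e\<close>.\<close>
    define d where "d = e / (2 * M)"
    have d: "d > 0" using e M by (simp add: d_def)
    have "continuous_on (sphere 0 1) (\<lambda>z. Re (\<Delta> z))" "continuous_on (sphere 0 1) (\<lambda>z. - Im (\<Delta> z))"
      by (intro continuous_intros cs)+
    from circle_approx_trig[OF this(1) d] circle_approx_trig[OF this(2) d] obtain u v
      where u: "u \<in> trig" "\<And>z. norm z = 1 \<Longrightarrow> \<bar>Re (\<Delta> z) - u z\<bar> < d"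
        and v: "v \<in> trig" "\<And>z. norm z = 1 \<Longrightarrow> \<bar>- Im (\<Delta> z) - v z\<bar> < d" by metis
    have int: "(\<lambda>s. E (of_real s) * of_real (t (?e s))) integrable_on {0..1}" if "t \<in> trig" for t
      by (intro integrable_continuous_real continuous_intros cE trig_cont that)
    have int': "(\<lambda>s. \<i> * (E (of_real s) * of_real (t (?e s)))) integrable_on {0..1}" if "t \<in> trig" for t
      by (intro integrable_continuous_real continuous_intros cE trig_cont that)
    \<comment> \<open>\<open>P\<close> is \<open>E\<close> times u + iv, where u and v approximate
      the real part of \<open>E\<close> and the negative of its imaginary part: an approximation of
      the squared modulus with integral zero.\<close>
    define P where "P s = E (of_real s) * of_real (u (?e s)) + \<i> * (E (of_real s) * of_real (v (?e s)))" for s :: real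
    have cP: "continuous_on {0..1} P" unfolding P_def by (intro continuous_intros cE trig_cont u v)
    have "integral {0..1} P = 0"
      unfolding P_def using orth[OF u(1)] orth[OF v(1)]
      by (simp only: integral_add[OF int[OF u(1)] int'[OF v(1)]] integral_mult_right) simp
    then have "I = integral {0..1} (\<lambda>s. E (of_real s) * cnj (E (of_real s)) - P s)"
      unfolding I_def
      by (subst integral_diff) (auto intro!: integrable_continuous_real continuous_intros cE cP)
    also have "norm \<dots> \<le> e * (1 - 0)"
    proof (rule integral_bound)
      show "continuous_on {0..1} (\<lambda>s. E (of_real s) * cnj (E (of_real s)) - P s)" by (intro continuous_intros cE cP)
      fix s :: real assume s: "s \<in> {0..1}"
      let ?w = "cnj (\<Delta> (?e s)) - Complex (u (?e s)) (v (?e s))"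
      have "E (of_real s) * cnj (E (of_real s)) - P s = E (of_real s) * ?w"
        unfolding P_def \<Delta>e Complex_eq by (simp only: right_diff_distrib distrib_left mult_ac)
      moreover have "norm ?w \<le> 2 * d"
        using cmod_le[of ?w] u(2)[OF ne, of s] v(2)[OF ne, of s]
        unfolding minus_complex.sel cnj.sel complex.sel by linarith
      ultimately have "norm (E (of_real s) * cnj (E (of_real s)) - P s) \<le> M * (2 * d)"
        using mult_mono[OF M(2)[OF s] \<open>norm ?w \<le> 2 * d\<close>] M(1) by (simp only: norm_mult norm_ge_zero less_imp_le simp_thms)
      then show "norm (E (of_real s) * cnj (E (of_real s)) - P s) \<le> e" using M by (simp add: d_def)
    qed auto
    finally show ?thesis by simp
  qed
  then have "norm I \<le> 0" by (rule field_le_epsilon)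
  then have "I = 0" by simp
  moreover have "I = of_real (integral {0..1} (\<lambda>s. (norm (E (of_real s)))\<^sup>2))"
  proof -
    have "I = integral {0..1} (\<lambda>s. of_real ((norm (E (of_real s)))\<^sup>2))"
      unfolding I_def by (simp only: complex_norm_square)
    also have "\<dots> = of_real (integral {0..1} (\<lambda>s. (norm (E (of_real s)))\<^sup>2))"
    proof -
      have "(\<lambda>s::real. (norm (E (of_real s)))\<^sup>2) integrable_on {0..1}"
        by (intro integrable_continuous_real continuous_intros cE)
      from integral_linear[OF this bounded_linear_of_real] show ?thesis unfolding o_def .
    qed
    finally show ?thesis .
  qed
  ultimately have "integral {0..1} (\<lambda>s::real. (norm (E (of_real s)))\<^sup>2) = 0" by simp
  moreover have c2: "continuous_on {0..1} (\<lambda>s::real. (norm (E (of_real s)))\<^sup>2)"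
    by (intro continuous_intros cE)
  ultimately have "((\<lambda>s::real. (norm (E (of_real s)))\<^sup>2) has_integral 0) {0..1}"
    using integrable_integral[OF integrable_continuous_real] by metis
  from has_integral_0_cbox_imp_0[of 0 1 "\<lambda>s::real. (norm (E (of_real s)))\<^sup>2" 0] this
    c2
  have "(norm (E (of_real 0)))\<^sup>2 = 0" by simp
  then show ?thesis by simp
qed

context flow_surface
begin

text \<open>Each singular point has a punctured chart ball of regular points, on which Hartogs'
  theorem in the chart applies.\<close>

lemma extend_over_sing:
  assumes h: "\<And>p. p \<in> reg \<Longrightarrow> hol_at h p"
  obtains H where "holo_on A UNIV H" "\<And>p. p \<in> reg \<Longrightarrow> H p = h p"
proof -
  have "\<exists>k. hol_at k p \<and> (\<forall>\<^sub>F q in nhds p. q \<in> reg \<or> q = p) \<and> (\<forall>\<^sub>F q in nhds p. q \<noteq> p \<longrightarrow> k q = h q)"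
    if p: "p \<in> sing A X" for p
  proof -
    obtain c e where c: "c \<in> A" "p \<in> fst c" and e: "e > 0" "ball (snd c p) e \<subseteq> snd c ` fst c"
      "chart_inv c ` ball (snd c p) e \<inter> sing A X = {p}"
      using punctured_neighbourhood[OF p] by blast
    let ?a = "snd c p"
    have reg: "chart_inv c x \<in> reg" if x: "x \<in> ball ?a e" "x \<noteq> ?a" for x
    proof
      assume "chart_inv c x \<in> sing A X"
      then have "chart_inv c x = p" using e(3) x(1) by blast
      moreover have "snd c (chart_inv c x) = x" using e(2) x(1) by (intro chart_chart_inv) blast
      ultimately show False using x(2) by simp
    qed
    have "cdiff (h \<circ> chart_inv c) x" if x: "x \<in> ball ?a e" "x \<noteq> ?a" for x
    proof -
      have "x \<in> snd c ` fst c" using e(2) x(1) by blast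
      then show ?thesis using hol_atD[OF h[OF reg[OF x]] c(1)] by simp
    qed
    then obtain G e' where e': "e' > 0" "\<And>x. x \<in> ball ?a e' \<Longrightarrow> cdiff G x"
      "\<And>x. x \<in> ball ?a e' \<Longrightarrow> x \<noteq> ?a \<Longrightarrow> G x = (h \<circ> chart_inv c) x"
      using hartogs_isolated[of "ball ?a e" ?a "h \<circ> chart_inv c"] e(1) by (metis centre_in_ball open_ball)
    have near: "\<forall>\<^sub>F q in nhds p. q \<in> fst c \<and> snd c q \<in> ball ?a (min e e')"
    proof (rule eventually_conj[OF eventually_chart[OF c]])
      show "\<forall>\<^sub>F q in nhds p. snd c q \<in> ball ?a (min e e')"
        by (rule isCont_eventually[OF chart_cont[OF c]], rule eventually_nhds_in_open) (use e e' in auto)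
    qed
    show ?thesis
    proof (intro exI conjI)
      show "hol_at (\<lambda>q. G (snd c q)) p"
      proof (rule hol_atI[OF c], rule cdiff_transform)
        show "cdiff G ?a" using e' by simp
        have "\<forall>\<^sub>F x in nhds ?a. x \<in> snd c ` fst c"
          using chart_open(2)[OF c(1)] imageI[OF c(2), of "snd c"] by (rule eventually_nhds_in_open)
        then show "\<forall>\<^sub>F x in nhds ?a. G x = ((\<lambda>q. G (snd c q)) \<circ> chart_inv c) x"
          by (rule eventually_mono) simp
      qed
      show "\<forall>\<^sub>F q in nhds p. q \<in> reg \<or> q = p"
        using near
      proof (rule eventually_mono)
        fix q assume q: "q \<in> fst c \<and> snd c q \<in> ball ?a (min e e')"
        show "q \<in> reg \<or> q = p"
        proof (cases "snd c q = ?a")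
          case True then show ?thesis using q c by (metis chart_inv_chart)
        next
          case False
          have "chart_inv c (snd c q) \<in> reg" by (rule reg[OF _ False]) (use q in simp)
          then show ?thesis using q c(1) by simp
        qed
      qed
      show "\<forall>\<^sub>F q in nhds p. q \<noteq> p \<longrightarrow> G (snd c q) = h q"
        using near
      proof (rule eventually_mono, intro impI)
        fix q assume q: "q \<in> fst c \<and> snd c q \<in> ball ?a (min e e')" "q \<noteq> p"
        then have "snd c q \<noteq> ?a" using c by (metis chart_inv_chart)
        then show "G (snd c q) = h q" using e'(3)[of "snd c q"] q c(1) by simp
      qed
    qed
  qed
  then have "\<forall>p\<in>sing A X. \<exists>k. hol_at k p \<and> (\<forall>\<^sub>F q in nhds p. q \<in> reg \<or> q = p) \<and>
      (\<forall>\<^sub>F q in nhds p. q \<noteq> p \<longrightarrow> k q = h q)" by blast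
  from bchoice[OF this] obtain k where k0: "\<forall>p\<in>sing A X. hol_at (k p) p \<and> (\<forall>\<^sub>F q in nhds p. q \<in> reg \<or> q = p) \<and>
      (\<forall>\<^sub>F q in nhds p. q \<noteq> p \<longrightarrow> k p q = h q)" ..
  have k: "hol_at (k p) p" "\<forall>\<^sub>F q in nhds p. q \<in> reg \<or> q = p"
    "\<forall>\<^sub>F q in nhds p. q \<noteq> p \<longrightarrow> k p q = h q" if "p \<in> sing A X" for p
    using bspec[OF k0 that] by blast+
  \<comment> \<open>From each local extension only the value at the singular point itself is taken;
    around that point the extension agrees with \<open>h\<close> anyway.\<close>
  define H where "H q = (if q \<in> sing A X then k q q else h q)" for q
  have "hol_at H p" for p
  proof (cases "p \<in> sing A X")
    case True
    have "\<forall>\<^sub>F q in nhds p. k p q = H q"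
      using k(2,3)[OF True] by eventually_elim (use True in \<open>auto simp: H_def\<close>)
    then show ?thesis by (rule hol_at_cong[OF k(1)[OF True]])
  next
    case False
    have "\<forall>\<^sub>F q in nhds p. q \<in> reg" by (rule eventually_nhds_in_open[OF open_reg]) (use False in simp)
    then have "\<forall>\<^sub>F q in nhds p. h q = H q" by (rule eventually_mono) (simp add: H_def)
    moreover have "hol_at h p" by (rule h) (use False in simp)
    ultimately show ?thesis by (rule hol_at_cong[rotated])
  qed
  then have hol: "holo_on A UNIV H" by (simp add: holo_on_hol_at)
  have eq: "H p = h p" if "p \<in> reg" for p using that by (simp add: H_def)
  show thesis by (rule that[of H, OF hol eq])
qed

text \<open>Functions that transform by a character under the flow have product form in a box, so
  holomorphy on a one-dimensional section implies holomorphy in both variables. For invariant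
  functions \<open>k\<close> is constant.\<close>

lemma hol_at_box:
  assumes b: "flow_box p \<rho> \<Phi> g" and a: "a holomorphic_on ball 0 \<rho>" and k: "k holomorphic_on UNIV"
    and f: "\<And>z t. z \<in> ball 0 \<rho> \<Longrightarrow> t \<in> ball 0 \<rho> \<Longrightarrow> f (\<Phi> (vec2 z t)) = a z * k t"
  shows "hol_at f p"
proof -
  have 0: "(0::complex) \<in> ball 0 \<rho>" using flow_boxD(1)[OF b] by simp
  have gp: "g p = 0" using flow_boxD(2)[OF b] flow_boxD(4)[OF b, of 0] 0 by (simp add: bidisc_def)
  have "cdiff (\<lambda>x. a (x $ 1) * k (x $ 2)) (g p)"
  proof (rule cdiff_mult)
    show "cdiff (\<lambda>x. a (x $ 1)) (g p)"
      by (rule cdiff_field_compose[OF cdiff_nth holomorphic_derivI[OF a open_ball]]) (use gp 0 in simp)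
    show "cdiff (\<lambda>x. k (x $ 2)) (g p)"
      by (rule cdiff_field_compose[OF cdiff_nth holomorphic_derivI[OF k open_UNIV]]) simp
  qed
  then have "hol_at (\<lambda>q. a (g q $ 1) * k (g q $ 2)) p"
    by (rule hol_at_coordinates[rotated]) (rule flow_boxD(6)[OF b flow_box_center[OF b]])
  then show ?thesis
  proof (rule hol_at_cong)
    have "\<forall>\<^sub>F q in nhds p. q \<in> \<Phi> ` bidisc \<rho>"
      by (rule eventually_nhds_in_open[OF flow_boxD(5)[OF b] flow_box_center[OF b]])
    then show "\<forall>\<^sub>F q in nhds p. a (g q $ 1) * k (g q $ 2) = f q"
    proof (rule eventually_mono)
      fix q assume q: "q \<in> \<Phi> ` bidisc \<rho>"
      note pt = flow_box_point[OF b q]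
      have "f (\<Phi> (vec2 (g q $ 1) (g q $ 2))) = a (g q $ 1) * k (g q $ 2)" by (rule f[OF pt(1,2)])
      then show "a (g q $ 1) * k (g q $ 2) = f q" using pt(3) by (simp add: vec2_eta)
    qed
  qed
qed

text \<open>Nonvanishing of \<open>H\<close> puts \<open>x\<close> and \<open>y\<close> among the
  regular points, so two different values there refute constancy. Invariance is also asked at zeros
  of \<open>H\<close>, where the quotient is 0.\<close>

lemma first_integralI:
  assumes G: "holo_on A UNIV G" and H: "holo_on A UNIV H"
    and inv: "\<And>p t. G (fl p t) / H (fl p t) = G p / H p"
    and xy: "H x \<noteq> 0" "H y \<noteq> 0" "G x / H x \<noteq> G y / H y"
  shows "meromorphic_first_integral A X (\<lambda>p. G p / H p)"
  unfolding meromorphic_first_integral_def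
proof (intro conjI allI)
  show "meromorphic_fun A (\<lambda>p. G p / H p)"
    unfolding meromorphic_fun_def using G H xy(1) connected_surface
    by (intro allI exI[of _ UNIV] exI[of _ G] exI[of _ H]) auto
  have "continuous_on UNIV H"
    using H hol_at_isCont by (auto simp: holo_on_hol_at intro!: continuous_at_imp_continuous_on)
  then have "open (H -` (- {0}))" by (intro open_vimage) auto
  moreover have "holo_on A (H -` (- {0})) (\<lambda>p. G p / H p)"
    using G H by (auto simp: holo_on_hol_at intro: hol_at_divide)
  ultimately have "H -` (- {0}) \<subseteq> regular_points A (\<lambda>p. G p / H p)" unfolding regular_points_def by blast
  then have "x \<in> regular_points A (\<lambda>p. G p / H p)" "y \<in> regular_points A (\<lambda>p. G p / H p)" using xy by auto
  then show "\<not> (\<lambda>p. G p / H p) constant_on regular_points A (\<lambda>p. G p / H p)"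
    using xy(3) unfolding constant_on_def by metis
  fix p
  show "(\<lambda>p. G p / H p) constant_on (orbit A X p \<inter> regular_points A (\<lambda>p. G p / H p))"
    unfolding constant_on_def orbit_def using inv by blast
qed

lemma flow_hcurve: "hcurve_at (fl p) t"
  using flow_curve[of p] unfolding local_curve_def hcurve_at_def by blast

lemma flow_holomorphic:
  assumes "holo_on A UNIV h" shows "(\<lambda>t. h (fl p t)) holomorphic_on S"
  unfolding holomorphic_on_def
  using hol_at_hcurve[OF flow_hcurve] assms holo_on_hol_at field_differentiable_at_within by blast

subsection \<open>Periodic flows\<close>

context
  fixes \<tau> :: complex
  assumes \<tau>: "\<tau> \<noteq> 0" and period: "\<And>p. fl p \<tau> = p"
begin

text \<open>The k-th Fourier coefficient of \<open>h\<close> along the orbit closed up by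
  \<open>\<tau>\<close>, that is, the projection to the eigenfunctions of weight k.\<close>

definition average :: "('a \<Rightarrow> complex) \<Rightarrow> int \<Rightarrow> 'a \<Rightarrow> complex" where
  "average h k p = integral (cbox 0 1)
     (\<lambda>s::real. h (fl p (of_real s * \<tau>)) * exp (- 2 * of_real pi * \<i> * of_int k * of_real s))"

lemma orbit_function:
  assumes h: "holo_on A UNIV h"
  shows "(\<lambda>w. h (fl p (w * \<tau>))) holomorphic_on UNIV" "h (fl p ((w + 1) * \<tau>)) = h (fl p (w * \<tau>))"
proof -
  have "((\<lambda>t. h (fl p t)) \<circ> (\<lambda>w. w * \<tau>)) holomorphic_on UNIV"
    by (rule holomorphic_on_compose_gen[OF _ flow_holomorphic[OF h]]) (auto intro!: holomorphic_intros)
  then show "(\<lambda>w. h (fl p (w * \<tau>))) holomorphic_on UNIV" by (simp add: o_def)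
  have "fl p ((w + 1) * \<tau>) = fl (fl p (w * \<tau>)) \<tau>" by (simp add: flow_add algebra_simps)
  then show "h (fl p ((w + 1) * \<tau>)) = h (fl p (w * \<tau>))" using period by simp
qed

text \<open>For real \<open>u\<close> this is a shift of the integration interval. For complex
  \<open>u\<close> it uses that the integral of a 1-periodic entire function over [u, u + 1] does
  not depend on \<open>u\<close>: with a primitive \<open>P\<close> the derivative of P(u + 1) -
  P(u) is zero.\<close>

lemma average_flow:
  assumes h: "holo_on A UNIV h"
  shows "average h k (fl p (u * \<tau>)) = exp (2 * of_real pi * \<i> * of_int k * u) * average h k p"
proof -
  define Q where "Q w = h (fl p (w * \<tau>)) * exp (- 2 * of_real pi * \<i> * of_int k * w)" for w
  have hQ: "Q holomorphic_on UNIV" unfolding Q_def by (intro holomorphic_intros orbit_function(1)[OF h])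
  have pQ: "Q (w + 1) = Q w" for w
  proof -
    have "- 2 * of_real pi * \<i> * of_int k * (w + 1) = - 2 * of_real pi * \<i> * of_int k * w + of_int (2 * (- k)) * of_real pi * \<i>"
      by (simp add: algebra_simps)
    moreover have "exp (of_int (2 * (- k)) * of_real pi * \<i>) = (1::complex)"
      unfolding exp_eq_1 by (auto intro!: exI[of _ "- k"])
    ultimately have "exp (- 2 * of_real pi * \<i> * of_int k * (w + 1)) = exp (- 2 * of_real pi * \<i> * of_int k * w)"
      by (simp only: exp_add mult_1_right)
    then show ?thesis unfolding Q_def using orbit_function(2)[OF h] by simp
  qed
  obtain P where P: "\<And>w. (P has_field_derivative Q w) (at w)"
    using holomorphic_convex_primitive'[OF convex_UNIV open_UNIV hQ] by auto
  have int: "integral (cbox 0 1) (\<lambda>s::real. Q (u + of_real s)) = P (u + 1) - P u" for u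
  proof -
    have "((\<lambda>s::real. Q (u + of_real s)) has_integral (P (u + of_real 1) - P (u + of_real 0))) {0..1}"
    proof (rule fundamental_theorem_of_calculus)
      fix s :: real
      have "((\<lambda>s::real. u + of_real s) has_vector_derivative 1) (at s within {0..1})"
        by (auto intro!: derivative_eq_intros simp: has_vector_derivative_def scaleR_conv_of_real)
      from field_vector_diff_chain_within[OF this has_field_derivative_at_within[OF P]]
      show "((\<lambda>s. P (u + of_real s)) has_vector_derivative Q (u + of_real s)) (at s within {0..1})"
        by (simp add: o_def)
    qed auto
    then show ?thesis by (simp add: integral_unique)
  qed
  have "((\<lambda>u. P (u + 1) - P u) has_field_derivative 0) (at u)" for u
  proof -
    have "((\<lambda>u. P (u + 1)) has_field_derivative Q (u + 1) * 1) (at u)"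
      by (rule DERIV_chain2[OF P]) (auto intro!: derivative_eq_intros)
    from DERIV_diff[OF this P[of u]] show ?thesis by (simp add: pQ)
  qed
  then have "(\<lambda>u. P (u + 1) - P u) constant_on UNIV"
    by (intro has_field_derivative_0_imp_constant_on) auto
  then have c: "P (u + 1) - P u = P (0 + 1) - P 0" unfolding constant_on_def by (metis UNIV_I)
  have "average h k (fl p (u * \<tau>)) = integral (cbox 0 1) (\<lambda>s::real. exp (2 * of_real pi * \<i> * of_int k * u) * Q (u + of_real s))"
    unfolding average_def Q_def flow_add
    by (rule arg_cong[where f = "integral (cbox 0 1)"], rule ext)
      (simp add: algebra_simps exp_add exp_diff exp_minus field_class.field_divide_inverse)
  also have "\<dots> = exp (2 * of_real pi * \<i> * of_int k * u) * integral (cbox 0 1) (\<lambda>s::real. Q (0 + of_real s))"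
    unfolding integral_mult_right int c ..
  also have "integral (cbox 0 1) (\<lambda>s::real. Q (0 + of_real s)) = average h k p"
    by (simp add: average_def Q_def)
  finally show ?thesis .
qed

lemma average_flow_time:
  assumes h: "holo_on A UNIV h"
  shows "average h k (fl p t) = exp (2 * of_real pi * \<i> * of_int k * (t / \<tau>)) * average h k p"
  using average_flow[OF h, of k p "t / \<tau>"] \<tau> by simp

text \<open>On a section the average is a parameter integral of holomorphic functions. In the time
  direction it is an exponential, so the product criterion for boxes applies.\<close>

lemma average_hol:
  assumes h: "holo_on A UNIV h" and p: "p \<in> reg"
  shows "hol_at (average h k) p"
proof -
  obtain \<rho> \<Phi> g where b: "flow_box p \<rho> \<Phi> g" using flow_box_exists[OF p] by blast
  let ?s = "\<lambda>z. \<Phi> (vec2 z 0)"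
  have hh: "hol_at h q" for q using h by (simp add: holo_on_hol_at)
  have "(\<lambda>z. average h k (?s z)) holomorphic_on ball 0 \<rho>"
    unfolding average_def
  proof (rule integral_holomorphic[OF open_ball])
    show "continuous_on (ball 0 \<rho> \<times> cbox 0 1)
       (\<lambda>(z, s::real). h (fl (?s z) (of_real s * \<tau>)) * exp (- 2 * of_real pi * \<i> * of_int k * of_real s))"
      unfolding split_beta
    proof (intro continuous_intros continuous_at_imp_continuous_on ballI)
      fix q :: "complex \<times> real" assume "q \<in> ball 0 \<rho> \<times> cbox 0 1"
      then have z: "fst q \<in> ball 0 \<rho>" by auto
      have "isCont ?s (fst q)" using section_hcurve(1)[OF b z] by (simp add: hcurve_at_def)
      then have "isCont (\<lambda>q. ?s (fst q)) q" by (rule isCont_o2[rotated]) simp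
      then have 1: "isCont (\<lambda>q. (?s (fst q), of_real (snd q) * \<tau>)) q" by (intro continuous_intros)
      have 2: "isCont (\<lambda>x. fl (fst x) (snd x)) (?s (fst q), of_real (snd q) * \<tau>)"
        by (rule flow_continuous[OF section_hcurve(2)[OF b z]])
      from isCont_o2[OF 1 2] have "isCont (\<lambda>q. fl (?s (fst q)) (of_real (snd q) * \<tau>)) q" by simp
      from isCont_o2[OF this hol_at_isCont[OF hh]]
      show "isCont (\<lambda>q. h (fl (?s (fst q)) (of_real (snd q) * \<tau>))) q" .
    qed
    show "(\<lambda>z. h (fl (?s z) (of_real s * \<tau>)) * exp (- 2 * of_real pi * \<i> * of_int k * of_real s)) holomorphic_on ball 0 \<rho>"
      for s :: real
    proof (intro holomorphic_intros)
      show "(\<lambda>z. h (fl (?s z) (of_real s * \<tau>))) holomorphic_on ball 0 \<rho>"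
        unfolding holomorphic_on_def
        using hol_at_hcurve[OF hcurve_flow[OF section_hcurve[OF b]] hh] field_differentiable_at_within by blast
    qed
  qed
  then show ?thesis
  proof (rule hol_at_box[OF b])
    show "(\<lambda>t. exp (2 * of_real pi * \<i> * of_int k * (t / \<tau>))) holomorphic_on UNIV"
      using \<tau> by (intro holomorphic_intros) auto
    fix z t assume zt: "z \<in> ball (0::complex) \<rho>" "t \<in> ball (0::complex) \<rho>"
    show "average h k (\<Phi> (vec2 z t)) = average h k (?s z) * exp (2 * of_real pi * \<i> * of_int k * (t / \<tau>))"
      unfolding flow_box_vertical[OF b zt] average_flow_time[OF h] by (rule mult.commute)
  qed
qed

text \<open>The coefficients determine the whole function along an orbit; applied to the difference
  of two orbits this compares their starting points.\<close>

lemma average_separates: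
  assumes h: "holo_on A UNIV h" and eq: "\<And>k. average h k p = average h k q"
  shows "h p = h q"
proof -
  let ?E = "\<lambda>w. h (fl p (w * \<tau>)) - h (fl q (w * \<tau>))"
  have c: "continuous_on S (\<lambda>s::real. h (fl x (of_real s * \<tau>)))" for S x
    by (rule continuous_on_compose2[OF holomorphic_on_imp_continuous_on[OF orbit_function(1)[OF h]]])
      (auto intro!: continuous_intros)
  have "?E 0 = 0"
  proof (rule fourier_unique)
    show "continuous_on UNIV ?E"
      by (intro continuous_intros holomorphic_on_imp_continuous_on orbit_function(1)[OF h])
    show "?E (w + 1) = ?E w" for w using orbit_function(2)[OF h] by simp
    fix k
    let ?e = "\<lambda>s::real. exp (- 2 * of_real pi * \<i> * of_int k * of_real s)"
    have int: "(\<lambda>s. h (fl x (of_real s * \<tau>)) * ?e s) integrable_on {0..1}" for x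
      by (intro integrable_continuous_real continuous_intros c)
    have "integral {0..1} (\<lambda>s. h (fl p (of_real s * \<tau>)) * ?e s - h (fl q (of_real s * \<tau>)) * ?e s) = 0"
      unfolding integral_diff[OF int int] using eq[of k] by (simp add: average_def)
    then show "integral {0..1} (\<lambda>s::real. ?E (of_real s) * ?e s) = 0" by (simp only: left_diff_distrib)
  qed
  then show ?thesis by simp
qed

text \<open>Suppose there is no first integral. Take an eigenfunction \<open>G\<close> of nonzero
  weight with \<open>G q\<close> nonzero and slide the section along the flow to a curve
  \<open>P\<close> on which \<open>G\<close> is constant. A suitable power of any other
  eigenfunction, times a power of \<open>G\<close> or its inverse, has weight zero and is constant;
  so along \<open>P\<close> every eigenfunction takes finitely many values and is constant. Then no
  global function separates the points of \<open>P\<close>, although they lie in different vertical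
  discs of a box.\<close>

theorem periodic_flow_first_integral:
  assumes q: "q \<in> reg"
  shows "\<exists>f. meromorphic_first_integral A X f"
proof (rule ccontr)
  assume NF: "\<not> ?thesis"
  define e where "e k t = exp (2 * of_real pi * \<i> * of_int k * (t / \<tau>))" for k :: int and t
  have ext: "\<exists>H. holo_on A UNIV H \<and> (\<forall>p\<in>reg. H p = average h k p)" if "holo_on A UNIV h" for h k
  proof (rule extend_over_sing[of "average h k", OF average_hol[OF that]])
    fix H assume "holo_on A UNIV H" "\<And>p. p \<in> reg \<Longrightarrow> H p = average h k p"
    then show ?thesis by blast
  qed
  have weight: "L (fl p t) = e k t * L p" if "holo_on A UNIV h" "\<forall>p\<in>reg. L p = average h k p" "p \<in> reg" for L h k p t
    using bspec[OF that(2) that(3)] bspec[OF that(2) flow_reg[OF that(3)]]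
      average_flow_time[OF that(1), of k p t] unfolding e_def by (simp only:)
  have e0: "e k t \<noteq> 0" for k t by (simp add: e_def)
  have epow: "e k t ^ m = e (int m * k) t" for k t m
    by (simp add: e_def exp_of_nat_mult[symmetric] mult_ac)
  have emult: "e k t * e l t = e (k + l) t" for k l t
    by (simp add: e_def exp_add[symmetric] distrib_left distrib_right add_divide_distrib)
  \<comment> \<open>Equal weights cancel in a quotient of powers. This serves weights of the same
    sign, where the quotient is a priori only meromorphic.\<close>
  have quot: "L x ^ m / G x ^ n = L y ^ m / G y ^ n"
    if G: "holo_on A UNIV G" "\<And>p t. p \<in> reg \<Longrightarrow> G (fl p t) = e k t * G p"
      and L: "holo_on A UNIV L" "\<And>p t. p \<in> reg \<Longrightarrow> L (fl p t) = e l t * L p"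
      and mn: "int m * l = int n * k" and xy: "G x \<noteq> 0" "G y \<noteq> 0" for G L k l m n x y
  proof (rule ccontr)
    assume ne: "L x ^ m / G x ^ n \<noteq> L y ^ m / G y ^ n"
    have "meromorphic_first_integral A X (\<lambda>p. L p ^ m / G p ^ n)"
    proof (rule first_integralI[OF _ _ _ _ _ ne])
      show "holo_on A UNIV (\<lambda>p. L p ^ m)" "holo_on A UNIV (\<lambda>p. G p ^ n)"
        using L(1) G(1) by (auto simp: holo_on_hol_at intro: hol_at_power)
      fix p t
      show "L (fl p t) ^ m / G (fl p t) ^ n = L p ^ m / G p ^ n"
      proof (cases "p \<in> reg")
        case True
        then show ?thesis using mn e0[of "int n * k" t] by (simp add: G(2) L(2) power_mult_distrib epow)
      qed (simp add: flow_sing)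
    qed (use xy in auto)
    then show False using NF by blast
  qed
  \<comment> \<open>For opposite weights the invariant combination is a product; exponents are
    natural numbers, so this is a case of its own.\<close>
  have prod: "L x ^ m * G x ^ n = L y ^ m * G y ^ n"
    if G: "holo_on A UNIV G" "\<And>p t. p \<in> reg \<Longrightarrow> G (fl p t) = e k t * G p"
      and L: "holo_on A UNIV L" "\<And>p t. p \<in> reg \<Longrightarrow> L (fl p t) = e l t * L p"
      and mn: "int m * l + int n * k = 0" for G L k l m n x y
  proof (rule ccontr)
    assume ne: "\<not> ?thesis"
    have "meromorphic_first_integral A X (\<lambda>p. (L p ^ m * G p ^ n) / (\<lambda>_. 1) p)"
    proof (rule first_integralI[of _ _ x y])
      show "holo_on A UNIV (\<lambda>p. L p ^ m * G p ^ n)" "holo_on A UNIV (\<lambda>_. 1)"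
        using L(1) G(1) hol_at_mult[OF hol_at_power hol_at_power] hol_at_const by (simp_all add: holo_on_hol_at)
      fix p t
      show "(L (fl p t) ^ m * G (fl p t) ^ n) / 1 = (L p ^ m * G p ^ n) / 1"
      proof (cases "p \<in> reg")
        case True
        have "L (fl p t) ^ m * G (fl p t) ^ n = (e (int m * l) t * e (int n * k) t) * (L p ^ m * G p ^ n)"
          using True by (simp add: G(2) L(2) power_mult_distrib epow)
        then show ?thesis unfolding emult mn by (simp add: e_def)
      qed (simp add: flow_sing)
    qed (use ne in auto)
    then show False using NF by blast
  qed
  obtain \<rho> \<Phi> g where b: "flow_box q \<rho> \<Phi> g" using flow_box_exists[OF q] by blast
  have \<rho>: "\<rho> > 0" by (rule flow_boxD(1)[OF b])
  have 0: "(0::complex) \<in> ball 0 \<rho>" using \<rho> by simp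
  let ?s = "\<lambda>z. \<Phi> (vec2 z 0)"
  have s0: "?s 0 = q" using flow_boxD(2)[OF b] by (simp add: vec2_0)
  \<comment> \<open>If all coefficients of nonzero weight vanished at \<open>q\<close>, every global
    function would take the same value at \<open>q\<close> and at a nearby different point of its
    orbit.\<close>
  obtain h0 k0 where h0: "holo_on A UNIV h0" and k0: "k0 \<noteq> 0" "average h0 k0 q \<noteq> 0"
  proof -
    have t: "complex_of_real (\<rho> / 2) \<in> ball 0 \<rho>" using \<rho> by simp
    have "fl q (complex_of_real (\<rho> / 2)) \<noteq> q"
      using flow_box_inj(2)[OF b _ 0 t 0 0] flow_box_vertical[OF b 0 t] s0 \<rho> by auto
    then obtain h where h: "holo_on A UNIV h" "h (fl q (complex_of_real (\<rho> / 2))) \<noteq> h q" using separated by metis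
    have "\<exists>k. k \<noteq> 0 \<and> average h k q \<noteq> 0"
    proof (rule ccontr)
      assume n: "\<not> ?thesis"
      have "average h k (fl q (complex_of_real (\<rho> / 2))) = average h k q" for k
        unfolding average_flow_time[OF h(1)] using n by (cases "k = 0") auto
      then show False using average_separates[OF h(1)] h(2) by blast
    qed
    then show thesis using that h(1) by blast
  qed
  obtain G where G: "holo_on A UNIV G" "\<forall>p\<in>reg. G p = average h0 k0 p" using ext[OF h0] by blast
  note wG = weight[OF h0 G(2)]
  have G0: "G q \<noteq> 0" using G(2) q k0 by simp
  define \<gamma> where "\<gamma> z = G (?s z) / G q" for z
  \<comment> \<open>This time solves \<open>e k0 (t z) * \<gamma> z = 1\<close>, so that flowing by
    it restores the value of \<open>G\<close> at \<open>q\<close>. Below, \<open>\<gamma>\<close> is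
    kept within distance 1 of 1, away from the cut of \<open>Ln\<close>.\<close>
  define t where "t z = - \<tau> / (2 * of_real pi * \<i> * of_int k0) * Ln (\<gamma> z)" for z
  have c\<gamma>: "isCont \<gamma> z" if z: "z \<in> ball 0 \<rho>" for z
  proof -
    have "isCont ?s z" using section_hcurve(1)[OF b z] by (simp add: hcurve_at_def)
    then have "isCont (\<lambda>z. G (?s z)) z"
      by (rule isCont_o2) (use G(1) hol_at_isCont holo_on_hol_at in blast)
    then show ?thesis unfolding \<gamma>_def using G0 by (intro continuous_intros)
  qed
  have \<gamma>0: "\<gamma> 0 = 1" using G0 by (simp add: \<gamma>_def s0)
  have ct: "isCont t z" if z: "z \<in> ball 0 \<rho>" "\<gamma> z \<notin> \<real>\<^sub>\<le>\<^sub>0" for z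
    unfolding t_def using c\<gamma>[OF z(1)] z(2) by (intro continuous_intros) auto
  have "\<forall>\<^sub>F z in nhds 0. \<gamma> z \<in> ball 1 1"
    by (rule isCont_eventually[OF c\<gamma>[OF 0]], rule eventually_nhds_in_open) (auto simp: \<gamma>0)
  moreover have "\<forall>\<^sub>F z in nhds 0. t z \<in> ball 0 \<rho>"
    by (rule isCont_eventually[OF ct[OF 0]], simp add: \<gamma>0, rule eventually_nhds_in_open)
      (auto simp: t_def \<gamma>0 \<rho>)
  moreover have "\<forall>\<^sub>F z in nhds 0. z \<in> ball (0::complex) \<rho>" by (rule eventually_nhds_in_open) (use 0 in auto)
  ultimately have "\<forall>\<^sub>F z in nhds 0. \<gamma> z \<in> ball 1 1 \<and> t z \<in> ball 0 \<rho> \<and> z \<in> ball 0 \<rho>" by eventually_elim blast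
  then obtain r where r: "r > 0" "\<And>z. z \<in> ball 0 r \<Longrightarrow> \<gamma> z \<in> ball 1 1 \<and> t z \<in> ball 0 \<rho> \<and> z \<in> ball 0 \<rho>"
    by (auto simp: eventually_nhds_metric)
  have \<gamma>n: "\<gamma> z \<notin> \<real>\<^sub>\<le>\<^sub>0" if "z \<in> ball 0 r" for z
  proof
    assume "\<gamma> z \<in> \<real>\<^sub>\<le>\<^sub>0"
    then have "Re (1 - \<gamma> z) \<ge> 1" by (auto simp: complex_nonpos_Reals_iff)
    moreover have "norm (1 - \<gamma> z) < 1" using r(2)[OF that] by (simp add: dist_norm)
    ultimately show False using complex_Re_le_cmod[of "1 - \<gamma> z"] by linarith
  qed
  define P where "P z = fl (?s z) (t z)" for z
  have regs: "?s z \<in> reg" if "z \<in> ball 0 r" for z using section_hcurve(2)[OF b] r(2)[OF that] by blast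
  have GP: "G (P z) = G q" if z: "z \<in> ball 0 r" for z
  proof -
    have \<gamma>z: "\<gamma> z \<noteq> 0" using \<gamma>n[OF z] by auto
    have "2 * of_real pi * \<i> * of_int k0 * (t z / \<tau>) = - Ln (\<gamma> z)"
      using \<tau> k0(1) by (simp add: t_def)
    then have "e k0 (t z) = inverse (\<gamma> z)" using \<gamma>z by (simp add: e_def exp_minus)
    then show ?thesis using wG[OF regs[OF z], of "t z"] \<gamma>z G0 by (simp add: P_def \<gamma>_def field_simps)
  qed
  have P0: "P 0 = q" by (simp add: P_def s0 t_def \<gamma>0)
  have r0: "0 \<in> ball (0::complex) r" using r(1) by simp
  define z1 where "z1 = complex_of_real (r / 2)"
  have z1: "z1 \<in> ball 0 r" "z1 \<noteq> 0" using r(1) by (auto simp: z1_def)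
  have Preg: "P z \<in> reg" if "z \<in> ball 0 r" for z unfolding P_def by (rule flow_reg[OF regs[OF that]])
  have "h (P z1) = h q" if h: "holo_on A UNIV h" for h
  proof (rule average_separates[OF h])
    fix l
    obtain L where L: "holo_on A UNIV L" "\<forall>p\<in>reg. L p = average h l p" using ext[OF h] by blast
    note wL = weight[OF h L(2)]
    \<comment> \<open>With these exponents the weights m * l and n * k0 have equal absolute value;
      the signs of \<open>k0\<close> and \<open>l\<close> decide between quotient and product. That
      m is positive makes the m-th roots below finitely many.\<close>
    define m n where "m = nat \<bar>k0\<bar>" and "n = nat \<bar>l\<bar>"
    have m: "m > 0" using k0 by (simp add: m_def)
    have pw: "L (P z) ^ m = L q ^ m" if z: "z \<in> ball 0 r" for z
    proof (cases "k0 * l \<ge> 0")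
      case True
      have "int m * l = int n * k0"
        using True k0(1) by (cases "k0 > 0"; cases "l > 0") (auto simp: m_def n_def zero_le_mult_iff)
      from quot[OF G(1) wG L(1) wL this, of "P z" q] GP[OF z] G0 show ?thesis by simp
    next
      case False
      have "int m * l + int n * k0 = 0"
        using False k0(1) by (cases "k0 > 0"; cases "l > 0") (auto simp: m_def n_def zero_le_mult_iff)
      from prod[OF G(1) wG L(1) wL this, of "P z" q] GP[OF z] G0 show ?thesis by simp
    qed
    have "continuous_on (ball 0 r) (\<lambda>z. L (P z))"
    proof (rule continuous_at_imp_continuous_on, rule ballI)
      fix z assume z: "z \<in> ball (0::complex) r"
      have z\<rho>: "z \<in> ball 0 \<rho>" using r(2)[OF z] by blast
      have "isCont ?s z" using section_hcurve(1)[OF b z\<rho>] by (simp add: hcurve_at_def)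
      then have 1: "isCont (\<lambda>z. (?s z, t z)) z" using ct[OF z\<rho> \<gamma>n[OF z]] by (intro continuous_intros)
      have "isCont (\<lambda>x. fl (fst x) (snd x)) (?s z, t z)" by (rule flow_continuous[OF regs[OF z]])
      from isCont_o2[OF 1 this] have "isCont P z" by (simp add: P_def[abs_def])
      then show "isCont (\<lambda>z. L (P z)) z"
        by (rule isCont_o2) (use L(1) hol_at_isCont holo_on_hol_at in blast)
    qed
    moreover have "finite ((\<lambda>z. L (P z)) ` ball 0 r)"
      by (rule finite_subset[OF _ finite_nth_roots[OF m, of "L q ^ m"]]) (use pw in auto)
    ultimately have "(\<lambda>z. L (P z)) constant_on ball 0 r"
      by (rule continuous_finite_range_constant[OF connected_ball])
    then have "L (P z1) = L (P 0)" using z1 r0 unfolding constant_on_def by metis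
    then show "average h l (P z1) = average h l q" using L(2) Preg[OF z1(1)] q P0 by simp
  qed
  then have "P z1 = q" using separated by metis
  moreover have "P z1 = \<Phi> (vec2 z1 (t z1))"
    unfolding P_def using flow_box_vertical[OF b] r(2)[OF z1(1)] by simp
  ultimately have "\<Phi> (vec2 z1 (t z1)) = \<Phi> (vec2 0 0)" using s0 by simp
  then have "z1 = 0" using flow_box_inj(1)[OF b _ _ _ 0 0] r(2)[OF z1(1)] by blast
  then show False using z1 by simp
qed

end

end

section \<open>Stable periods\<close>

text \<open>Any nonzero element \<open>x\<close> whose length is within \<open>\<epsilon>\<close> of
  the infimum m generates. A fractional remainder z of a division by \<open>x\<close>, if nonzero,
  has length at least m, and then x - z is an element of length below \<open>\<epsilon>\<close>,
  hence 0, which is impossible for a proper fraction.\<close>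

lemma discrete_line_subgroup:
  fixes G :: "complex set"
  assumes 0: "0 \<in> G" and add: "\<And>x y. x \<in> G \<Longrightarrow> y \<in> G \<Longrightarrow> x + y \<in> G" and neg: "\<And>x. x \<in> G \<Longrightarrow> - x \<in> G"
    and disc: "\<epsilon> > 0" "\<And>x. x \<in> G \<Longrightarrow> norm x < \<epsilon> \<Longrightarrow> x = 0"
    and line: "\<And>x y. x \<in> G \<Longrightarrow> y \<in> G \<Longrightarrow> x \<noteq> 0 \<Longrightarrow> \<exists>r::real. y = of_real r * x"
  shows "\<exists>\<tau>. G = range (\<lambda>n::int. of_int n * \<tau>)"
proof (cases "G = {0}")
  case True
  then show ?thesis by (intro exI[of _ 0]) auto
next
  case False
  define m where "m = Inf (norm ` (G - {0}))"
  have ne: "norm ` (G - {0}) \<noteq> {}" using False 0 by auto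
  have bdd: "bdd_below (norm ` (G - {0}))" by (rule bdd_belowI[of _ 0]) auto
  have low: "m \<le> norm x" if "x \<in> G" "x \<noteq> 0" for x
    unfolding m_def by (rule cInf_lower[OF _ bdd]) (use that in auto)
  have "\<exists>y\<in>norm ` (G - {0}). y < m + \<epsilon>"
    using cInf_lessD[OF ne, of "m + \<epsilon>"] disc(1) by (auto simp: m_def)
  then obtain x where x: "x \<in> G" "x \<noteq> 0" "norm x < m + \<epsilon>" by auto
  have nmult: "of_nat n * x \<in> G" for n :: nat
    by (induction n) (auto simp: 0 distrib_right intro: add x)
  have zmult: "of_int n * x \<in> G" for n :: int
  proof (cases n rule: int_cases2)
    case (nonneg k)
    then show ?thesis using nmult[of k] by simp
  next
    case (nonpos k)
    then show ?thesis using neg[OF nmult[of k]] by simp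
  qed
  have "y \<in> range (\<lambda>n::int. of_int n * x)" if y: "y \<in> G" for y
  proof -
    obtain r where r: "y = of_real r * x" using line[OF x(1) y x(2)] by blast
    define z where "z = of_real (frac r) * x"
    have zeq: "z = y + - (of_int \<lfloor>r\<rfloor> * x)" by (simp add: z_def r frac_def algebra_simps)
    have zG: "z \<in> G" unfolding zeq by (intro add neg zmult y)
    have "z = 0"
    proof (rule ccontr)
      assume z0: "z \<noteq> 0"
      have "x + - z \<in> G" by (intro add neg zG x)
      moreover have "norm (x + - z) < \<epsilon>"
      proof -
        have "x + - z = of_real (1 - frac r) * x" by (simp add: z_def algebra_simps)
        then have "norm (x + - z) = (1 - frac r) * norm x"
          using frac_lt_1[of r] by (simp only: norm_mult norm_of_real)
        moreover have "norm z = frac r * norm x" by (simp add: z_def norm_mult)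
        ultimately have "norm (x + - z) = norm x - norm z" by (simp only: left_diff_distrib mult_1_left)
        then show ?thesis using low[OF zG z0] x(3) by linarith
      qed
      ultimately have "x + - z = 0" by (rule disc(2))
      then have "x = of_real (frac r) * x" by (simp add: z_def)
      then have "complex_of_real (frac r) = 1" using x(2) by simp
      then show False using frac_lt_1[of r] by simp
    qed
    then have "y = of_int \<lfloor>r\<rfloor> * x" using zeq by simp
    then show ?thesis by blast
  qed
  then show ?thesis using zmult by (intro exI[of _ x]) blast
qed

text \<open>Two generators of the same cyclic group differ by a sign at most, so the square of a
  generator is a well-defined quantity.\<close>

lemma int_range_unique:
  fixes s t :: complex
  assumes "range (\<lambda>n::int. of_int n * s) = range (\<lambda>n::int. of_int n * t)"
  shows "s\<^sup>2 = t\<^sup>2"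
proof -
  have "s \<in> range (\<lambda>n::int. of_int n * s)" by (rule range_eqI[of _ _ 1]) simp
  then obtain n :: int where n: "s = of_int n * t" unfolding assms by blast
  have "t \<in> range (\<lambda>n::int. of_int n * t)" by (rule range_eqI[of _ _ 1]) simp
  then obtain m :: int where m: "t = of_int m * s" unfolding assms[symmetric] by blast
  show ?thesis
  proof (cases "s = 0")
    case False
    have "s = of_int (n * m) * s" using n m by simp
    then have "of_int (n * m) = (1::complex)" using False by simp
    then have "n * m = 1" by (simp only: of_int_eq_1_iff)
    then have "n = 1 \<or> n = -1" by (auto simp: zmult_eq_1_iff)
    then show ?thesis using n by auto
  qed (use m in simp)
qed

text \<open>Boundedness supplies convergent subsequences, so continuity reduces to identifying
  limits that are already assumed to exist.\<close>

lemma isCont_by_limits: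
  fixes f :: "'m::metric_space \<Rightarrow> complex"
  assumes bdd: "\<forall>\<^sub>F x in nhds a. norm (f x) \<le> B"
    and lim: "\<And>x w. x \<longlonglongrightarrow> a \<Longrightarrow> (\<lambda>n. f (x n)) \<longlonglongrightarrow> w \<Longrightarrow> f a = w"
  shows "isCont f a"
proof (rule ccontr)
  assume "\<not> ?thesis"
  then obtain e where e: "e > 0" "\<And>d. d > 0 \<Longrightarrow> \<exists>x. dist x a < d \<and> e \<le> dist (f x) (f a)"
    unfolding continuous_at_eps_delta by (meson not_le)
  obtain d where d: "d > 0" "\<And>x. dist x a < d \<Longrightarrow> norm (f x) \<le> B" using bdd by (auto simp: eventually_nhds_metric)
  have "\<exists>x. dist x a < min d (inverse (real (Suc n))) \<and> e \<le> dist (f x) (f a)" for n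
    by (rule e(2)) (use d in simp)
  then obtain x where x: "\<And>n. dist (x n) a < min d (inverse (real (Suc n)))" "\<And>n. e \<le> dist (f (x n)) (f a)" by metis
  have xa: "x \<longlonglongrightarrow> a"
  proof (rule metric_tendsto_imp_tendsto[OF LIMSEQ_inverse_real_of_nat])
    show "\<forall>\<^sub>F n in sequentially. dist (x n) a \<le> dist (inverse (real (Suc n))) 0"
      using x(1) by (intro always_eventually allI) (simp add: less_imp_le)
  qed
  have "bounded (range (\<lambda>n. f (x n)))"
    using d(2) x(1) by (intro boundedI[of _ B]) auto
  then obtain w r where r: "strict_mono r" "((\<lambda>n. f (x n)) \<circ> r) \<longlonglongrightarrow> w"
    using bounded_imp_convergent_subsequence by blast
  have "f a = w"
    by (rule lim[of "\<lambda>n. x (r n)"]) (use LIMSEQ_subseq_LIMSEQ[OF xa r(1)] r(2) in \<open>simp_all add: o_def\<close>)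
  with r(2) have "(\<lambda>n. dist (f (x (r n))) (f a)) \<longlonglongrightarrow> 0" by (simp add: o_def tendsto_dist_iff[symmetric])
  then have "e \<le> 0" by (rule LIMSEQ_le_const) (use x(2) in auto)
  then show False using e(1) by simp
qed

context flow_surface
begin

section \<open>Period groups of regular orbits\<close>

lemma period_transport: "fl (fl p t) T = fl p t \<longleftrightarrow> fl p T = p"
proof -
  have *: "fl (fl q s) T = fl q s" if "fl q T = q" for q s
    using that by (metis add.commute flow_add)
  have "fl (fl p t) (- t) = p" by (simp add: flow_add)
  then show ?thesis using *[of "fl p t" "- t"] *[of p t] by auto
qed

text \<open>From a point of the half-size box a time below half the radius leads to another point of
  the same embedded vertical disc. The bound is uniform around \<open>p\<close>, which later rules
  out periods shrinking to 0 and makes nearby periods equal.\<close>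

lemma no_small_period:
  assumes p: "p \<in> reg"
  obtains \<epsilon> where "\<epsilon> > 0" "\<forall>\<^sub>F x in nhds p. \<forall>T. norm T < \<epsilon> \<longrightarrow> fl x T = x \<longrightarrow> T = 0"
proof -
  obtain \<rho> \<Phi> g where b: "flow_box p \<rho> \<Phi> g" using flow_box_exists[OF p] by blast
  have \<rho>: "\<rho> > 0" by (rule flow_boxD(1)[OF b])
  have b2: "flow_box p (\<rho> / 2) \<Phi> g" by (rule flow_box_shrink[OF b]) (use \<rho> in auto)
  have small: "T = 0" if x: "x \<in> \<Phi> ` bidisc (\<rho> / 2)" and T: "norm T < \<rho> / 2" "fl x T = x" for x T
  proof -
    obtain y where y: "x = \<Phi> y" "y \<in> bidisc (\<rho> / 2)" using x by blast
    obtain z s where zs: "x = \<Phi> (vec2 z s)" "z \<in> ball 0 (\<rho> / 2)" "s \<in> ball 0 (\<rho> / 2)"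
      by (rule bidiscE[OF y(2)]) (use y(1) in blast)
    have in_ball: "z \<in> ball 0 \<rho>" "s \<in> ball 0 \<rho>" "s + T \<in> ball 0 \<rho>"
      using zs(2,3) T(1) norm_triangle_ineq[of s T] \<rho> by auto
    have "\<Phi> (vec2 z (s + T)) = \<Phi> (vec2 z s)"
      using flow_boxD(7)[OF b in_ball] T(2) zs(1) by simp
    from flow_box_inj(2)[OF b this in_ball(1,3,1,2)] show ?thesis by simp
  qed
  have "\<forall>\<^sub>F x in nhds p. x \<in> \<Phi> ` bidisc (\<rho> / 2)"
    by (rule eventually_nhds_in_open[OF flow_boxD(5)[OF b2] flow_box_center[OF b2]])
  then have "\<forall>\<^sub>F x in nhds p. \<forall>T. norm T < \<rho> / 2 \<longrightarrow> fl x T = x \<longrightarrow> T = 0"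
    by (rule eventually_mono) (use small in blast)
  moreover have "\<rho> / 2 > 0" using \<rho> by simp
  ultimately show thesis by (rule that[rotated])
qed

lemma no_small_period_point:
  assumes p: "p \<in> reg"
  shows "\<exists>\<epsilon>>0. \<forall>T. norm T < \<epsilon> \<longrightarrow> fl p T = p \<longrightarrow> T = 0"
proof (rule no_small_period[OF p])
  fix \<epsilon> :: real assume e: "\<epsilon> > 0" "\<forall>\<^sub>F x in nhds p. \<forall>T. norm T < \<epsilon> \<longrightarrow> fl x T = x \<longrightarrow> T = 0"
  show ?thesis using e(1) eventually_nhds_x_imp_x[OF e(2)] by blast
qed

lemma nonconstant_orbit:
  assumes p: "p \<in> reg" shows "\<exists>t. fl p t \<noteq> p"
proof -
  obtain \<epsilon> where e: "\<epsilon> > 0" "\<And>T. norm T < \<epsilon> \<Longrightarrow> fl p T = p \<Longrightarrow> T = 0"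
    using no_small_period_point[OF p] by blast
  have "norm (complex_of_real (\<epsilon> / 2)) < \<epsilon>" "complex_of_real (\<epsilon> / 2) \<noteq> 0" using e(1) by auto
  then show ?thesis using e(2) by blast
qed

text \<open>Two independent periods would make the orbit the image of a compact parallelogram.
  Global functions along it would be bounded and entire, hence constant by Liouville, and could not
  separate its points.\<close>

lemma periods_on_line:
  assumes p: "p \<in> reg" and T: "fl p T1 = p" "fl p T2 = p" and T1: "T1 \<noteq> 0"
  shows "\<exists>r::real. T2 = of_real r * T1"
proof (rule ccontr)
  assume n: "\<not> ?thesis"
  define \<kappa> where "\<kappa> = T2 / T1"
  have \<kappa>: "Im \<kappa> \<noteq> 0"
  proof
    assume "Im \<kappa> = 0"
    then have "\<kappa> = of_real (Re \<kappa>)" by (simp add: complex_eq_iff)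
    then have "T2 = of_real (Re \<kappa>) * T1" using T1 by (metis \<kappa>_def nonzero_divide_eq_eq)
    then show False using n by blast
  qed
  \<comment> \<open>The fundamental parallelogram of the period lattice; fractional parts of the
    coordinates bring any time into it.\<close>
  define C where "C = (\<lambda>x::real \<times> real. of_real (fst x) * T1 + of_real (snd x) * T2) ` ({0..1} \<times> {0..1})"
  have cC: "compact C" unfolding C_def
    by (intro compact_continuous_image continuous_intros compact_Times compact_Icc)
  have red: "\<exists>c\<in>C. fl p w = fl p c" for w
  proof -
    define b where "b = Im (w / T1) / Im \<kappa>"
    define a where "a = Re (w / T1) - b * Re \<kappa>"
    have "w / T1 = of_real a + of_real b * \<kappa>" using \<kappa> by (simp add: complex_eq_iff a_def b_def)
    then have w: "w = of_real a * T1 + of_real b * T2" using T1 by (simp add: \<kappa>_def field_simps)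
    define c where "c = of_real (frac a) * T1 + of_real (frac b) * T2"
    have c: "c \<in> C" unfolding C_def c_def
      by (rule image_eqI[of _ _ "(frac a, frac b)"]) (auto simp: frac_lt_1 less_imp_le)
    have "w = of_int \<lfloor>a\<rfloor> * T1 + (of_int \<lfloor>b\<rfloor> * T2 + c)"
      by (simp add: w c_def frac_def algebra_simps)
    then have "fl p w = fl (fl (fl p (of_int \<lfloor>a\<rfloor> * T1)) (of_int \<lfloor>b\<rfloor> * T2)) c"
      by (simp only: flow_add add.assoc)
    also have "\<dots> = fl p c" by (simp only: flow_periodic_of_int T)
    finally show ?thesis using c by blast
  qed
  have "h (fl p t) = h p" if h: "holo_on A UNIV h" for h t
  proof -
    have hol: "(\<lambda>t. h (fl p t)) holomorphic_on S" for S by (rule flow_holomorphic[OF h])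
    have "range (\<lambda>t. h (fl p t)) \<subseteq> (\<lambda>t. h (fl p t)) ` C"
    proof
      fix y assume "y \<in> range (\<lambda>t. h (fl p t))"
      then obtain w where "y = h (fl p w)" by blast
      then show "y \<in> (\<lambda>t. h (fl p t)) ` C" using red[of w] by auto
    qed
    moreover have "bounded ((\<lambda>t. h (fl p t)) ` C)"
      by (intro compact_imp_bounded compact_continuous_image cC holomorphic_on_imp_continuous_on hol)
    ultimately have "bounded (range (\<lambda>t. h (fl p t)))" by (rule bounded_subset[rotated])
    from Liouville_theorem[OF hol this] obtain k where k: "\<forall>t\<in>UNIV. h (fl p t) = k"
      unfolding constant_on_def ..
    show ?thesis using bspec[OF k UNIV_I[of t]] bspec[OF k UNIV_I[of 0]] by simp
  qed
  then have "fl p t = p" for t using separated by metis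
  then show False using nonconstant_orbit[OF p] by blast
qed

lemma period_group:
  assumes p: "p \<in> reg"
  obtains \<tau> where "\<And>T. fl p T = p \<longleftrightarrow> (\<exists>n::int. T = of_int n * \<tau>)"
proof -
  obtain \<epsilon> where e: "\<epsilon> > 0" "\<And>T. norm T < \<epsilon> \<Longrightarrow> fl p T = p \<Longrightarrow> T = 0"
    using no_small_period_point[OF p] by blast
  have "\<exists>\<tau>. {T. fl p T = p} = range (\<lambda>n::int. of_int n * \<tau>)"
  proof (rule discrete_line_subgroup[OF _ _ _ e(1)])
    fix x y assume "x \<in> {T. fl p T = p}" "y \<in> {T. fl p T = p}"
    then show "x + y \<in> {T. fl p T = p}" by (simp add: flow_add[symmetric])
  qed (use e(2) periods_on_line[OF p] flow_periodic_uminus in auto)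
  then obtain \<tau> where \<tau>: "{T. fl p T = p} = range (\<lambda>n::int. of_int n * \<tau>)" by blast
  have "fl p T = p \<longleftrightarrow> (\<exists>n::int. T = of_int n * \<tau>)" for T
  proof -
    have "fl p T = p \<longleftrightarrow> T \<in> {T. fl p T = p}" by simp
    also have "\<dots> \<longleftrightarrow> (\<exists>n::int. T = of_int n * \<tau>)" unfolding \<tau> by blast
    finally show ?thesis .
  qed
  then show thesis by (rule that)
qed

text \<open>Continuity is required at all nearby points and not only at \<open>p\<close>, so that
  the property passes to neighbouring points.\<close>

definition period_function :: "('a \<Rightarrow> complex) \<Rightarrow> 'a \<Rightarrow> bool" where
  "period_function S p \<longleftrightarrow> (\<forall>\<^sub>F x in nhds p. isCont S x \<and> fl x (S x) = x)"

text \<open>Periods that persist on all nearby leaves. At a leaf whose return germ has finite order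
  n > 1 its own shortest period is not stable, but n times it is.\<close>

definition stable_period :: "'a \<Rightarrow> complex \<Rightarrow> bool" where
  "stable_period p T \<longleftrightarrow> (\<exists>S. period_function S p \<and> S p = T)"

lemma period_functionD:
  assumes "period_function S p" shows "isCont S p" "fl p (S p) = p"
  using eventually_nhds_x_imp_x[OF assms[unfolded period_function_def]] by auto

lemma period_function_near:
  assumes "period_function S p" shows "\<forall>\<^sub>F x in nhds p. period_function S x"
  using assms unfolding period_function_def by (simp add: eventually_eventually)

lemma period_function_zero: "period_function (\<lambda>_. 0) p"
  unfolding period_function_def by simp

lemma period_function_add:
  assumes "period_function S p" "period_function S' p"
  shows "period_function (\<lambda>x. S x + S' x) p"
  using assms unfolding period_function_def
proof eventually_elim
  case (elim x)
  have "fl x (S x + S' x) = fl (fl x (S x)) (S' x)" by (simp add: flow_add)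
  then show ?case using elim by (simp add: continuous_intros)
qed

lemma period_function_uminus:
  assumes "period_function S p" shows "period_function (\<lambda>x. - S x) p"
  using assms unfolding period_function_def
  by eventually_elim (auto intro: flow_periodic_uminus continuous_intros)

lemma period_function_of_int:
  assumes "period_function S p" shows "period_function (\<lambda>x. of_int n * S x) p"
  using assms unfolding period_function_def
  by eventually_elim (auto intro: flow_periodic_of_int intro!: continuous_intros)

text \<open>The difference is a period at nearby points and small there, hence 0 by the uniform
  lower bound on nonzero periods.\<close>

lemma period_function_unique:
  assumes p: "p \<in> reg" and S: "period_function S p" "period_function S' p" and eq: "S p = S' p"
  shows "\<forall>\<^sub>F x in nhds p. S x = S' x"
proof -
  obtain \<epsilon> where e: "\<epsilon> > 0" "\<forall>\<^sub>F x in nhds p. \<forall>T. norm T < \<epsilon> \<longrightarrow> fl x T = x \<longrightarrow> T = 0"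
    by (rule no_small_period[OF p])
  have D: "period_function (\<lambda>x. S x + - S' x) p"
    by (intro period_function_add period_function_uminus S)
  have "\<forall>\<^sub>F x in nhds p. S x + - S' x \<in> ball 0 \<epsilon>"
    by (rule isCont_eventually[OF period_functionD(1)[OF D]], rule eventually_nhds_in_open) (use e(1) eq in auto)
  with D[unfolded period_function_def] e(2) show ?thesis
  proof eventually_elim
    case (elim x)
    then have "S x + - S' x = 0" by (simp only: mem_ball_0)
    then show ?case by simp
  qed
qed

lemma stable_period_flow:
  assumes p: "p \<in> reg" and T: "stable_period p T" shows "stable_period (fl p t) T"
proof -
  obtain S where S: "period_function S p" "S p = T" using T unfolding stable_period_def by blast
  let ?S = "\<lambda>x. S (fl x (- t))"
  have ret: "fl (fl p t) (- t) = p" by (simp add: flow_add)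
  have "isCont (\<lambda>x. fl x (- t)) (fl p t)" by (rule flow_isCont_point[OF flow_reg[OF p]])
  from isCont_eventually[OF this, unfolded ret, OF S(1)[unfolded period_function_def]]
  have 1: "\<forall>\<^sub>F x in nhds (fl p t). isCont S (fl x (- t)) \<and> fl (fl x (- t)) (S (fl x (- t))) = fl x (- t)" .
  have 2: "\<forall>\<^sub>F x in nhds (fl p t). x \<in> reg"
    by (rule eventually_nhds_in_open[OF open_reg flow_reg[OF p]])
  from 1 2 have "period_function ?S (fl p t)" unfolding period_function_def
  proof eventually_elim
    case (elim x)
    have "isCont ?S x" by (rule isCont_o2[OF flow_isCont_point[OF elim(2)]]) (use elim(1) in blast)
    then show ?case using elim(1) unfolding period_transport by blast
  qed
  moreover have "?S (fl p t) = T" using S(2) ret by simp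
  ultimately show ?thesis unfolding stable_period_def by blast
qed

lemma stable_period_flow_iff:
  assumes p: "p \<in> reg" shows "stable_period (fl p t) T \<longleftrightarrow> stable_period p T"
proof -
  have "fl (fl p t) (- t) = p" by (simp add: flow_add)
  then show ?thesis using stable_period_flow[OF p, of T t] stable_period_flow[OF flow_reg[OF p], of t T "- t"] by auto
qed

lemma stable_period_group:
  assumes p: "p \<in> reg"
  shows "\<exists>\<tau>. {T. stable_period p T} = range (\<lambda>n::int. of_int n * \<tau>)"
proof -
  obtain \<epsilon> where e: "\<epsilon> > 0" "\<And>T. norm T < \<epsilon> \<Longrightarrow> fl p T = p \<Longrightarrow> T = 0"
    using no_small_period_point[OF p] by blast
  have per: "fl p T = p" if "stable_period p T" for T
    using that period_functionD(2) unfolding stable_period_def by blast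
  show ?thesis
  proof (rule discrete_line_subgroup[OF _ _ _ e(1)])
    show "0 \<in> {T. stable_period p T}" using period_function_zero unfolding stable_period_def by blast
    fix x y assume xy: "x \<in> {T. stable_period p T}" "y \<in> {T. stable_period p T}"
    obtain S S' where S: "period_function S p" "S p = x" "period_function S' p" "S' p = y"
      using xy unfolding stable_period_def by blast
    have "stable_period p (x + y)" unfolding stable_period_def
      by (intro exI[of _ "\<lambda>x. S x + S' x"] conjI period_function_add S) (simp add: S)
    then show "x + y \<in> {T. stable_period p T}" by simp
    assume "x \<noteq> 0"
    then show "\<exists>r::real. y = of_real r * x" using periods_on_line[OF p per per] xy by simp
  next
    fix x assume x: "x \<in> {T. stable_period p T}"
    obtain S where S: "period_function S p" "S p = x" using x unfolding stable_period_def by blast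
    have "stable_period p (- x)" unfolding stable_period_def
      by (intro exI[of _ "\<lambda>x. - S x"] conjI period_function_uminus S) (simp add: S)
    then show "- x \<in> {T. stable_period p T}" by simp
    assume "norm x < \<epsilon>"
    then show "x = 0" using e(2) per x by simp
  qed
qed

definition period_gen :: "'a \<Rightarrow> complex" where
  "period_gen p = (SOME \<tau>. {T. stable_period p T} = range (\<lambda>n::int. of_int n * \<tau>))"

text \<open>A generator of the stable periods is only determined up to sign, hence the square; the
  junk value \<open>1 / 0 = 0\<close> is the intended one when there is no nonzero stable period.\<close>

definition frequency :: "'a \<Rightarrow> complex" where
  "frequency p = 1 / (period_gen p)\<^sup>2"

lemma period_gen:
  assumes p: "p \<in> reg"
  shows "{T. stable_period p T} = range (\<lambda>n::int. of_int n * period_gen p)"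
  unfolding period_gen_def by (rule someI_ex[OF stable_period_group[OF p]])

lemma stable_period_iff:
  assumes p: "p \<in> reg" shows "stable_period p T \<longleftrightarrow> (\<exists>n::int. T = of_int n * period_gen p)"
proof -
  have "stable_period p T \<longleftrightarrow> T \<in> {T. stable_period p T}" by simp
  also have "\<dots> \<longleftrightarrow> (\<exists>n::int. T = of_int n * period_gen p)" unfolding period_gen[OF p] by blast
  finally show ?thesis .
qed

lemma stable_period_gen: "p \<in> reg \<Longrightarrow> stable_period p (period_gen p)"
  unfolding stable_period_iff by (rule exI[of _ 1]) simp

lemma frequency_flow:
  assumes p: "p \<in> reg" shows "frequency (fl p t) = frequency p"
proof -
  have "range (\<lambda>n::int. of_int n * period_gen (fl p t)) = range (\<lambda>n::int. of_int n * period_gen p)"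
    unfolding period_gen[OF p, symmetric] period_gen[OF flow_reg[OF p], symmetric] stable_period_flow_iff[OF p] ..
  from int_range_unique[OF this] show ?thesis unfolding frequency_def by simp
qed

lemma stable_period_period:
  assumes "stable_period p T" shows "fl p T = p"
proof -
  obtain S where S: "period_function S p" "S p = T" using assms unfolding stable_period_def by blast
  show ?thesis using period_functionD(2)[OF S(1)] unfolding S(2) .
qed

text \<open>A stable period T' near \<open>T\<close> at one point of the box forces the holonomy
  \<open>f\<close> to fix an open set of section points, so \<open>f\<close> is the identity. Then
  the corrected return time \<open>a = T - u\<close> is a period at every point of the small box,
  and it is holomorphic. Here \<open>T\<close> is any period of \<open>p\<close>; its stability is a
  consequence.\<close>

lemma stable_near:
  assumes b: "flow_box p \<rho> \<Phi> g" and T: "fl p T = p"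
  shows "\<exists>r a. 0 < r \<and> r \<le> \<rho> \<and> a holomorphic_on ball 0 r \<and> a 0 = T \<and>
    (\<forall>x\<in>\<Phi> ` bidisc r. \<forall>T'. stable_period x T' \<longrightarrow> dist T' T < r \<longrightarrow>
       a (g x $ 1) = T' \<and> (\<forall>y\<in>\<Phi> ` bidisc r. fl y (a (g y $ 1)) = y))"
proof -
  obtain \<delta> f u where \<delta>: "0 < \<delta>" "\<delta> \<le> \<rho>" and f: "f holomorphic_on ball 0 \<delta>" and u: "u holomorphic_on ball 0 \<delta>"
    and fu0: "f 0 = 0" "u 0 = 0" and fr: "\<And>z. z \<in> ball 0 \<delta> \<Longrightarrow> f z \<in> ball 0 \<rho>"
    and ur: "\<And>z. z \<in> ball 0 \<delta> \<Longrightarrow> u z \<in> ball 0 \<rho>"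
    and ret: "\<And>z. z \<in> ball 0 \<delta> \<Longrightarrow> fl (\<Phi> (vec2 z 0)) T = \<Phi> (vec2 (f z) (u z))"
    by (rule return_map[OF b T]) blast
  have \<rho>: "\<rho> > 0" by (rule flow_boxD(1)[OF b])
  have cu: "isCont u z" if "z \<in> ball 0 \<delta>" for z
    using holomorphic_on_imp_continuous_on[OF u] that by (simp add: continuous_on_eq_continuous_at)
  have "\<forall>\<^sub>F z in nhds 0. u z \<in> ball 0 (\<rho> / 2)"
    by (rule isCont_eventually[OF cu], simp add: \<delta>, rule eventually_nhds_in_open) (use fu0 \<rho> in auto)
  then obtain r1 where r1: "r1 > 0" "\<And>z. z \<in> ball 0 r1 \<Longrightarrow> u z \<in> ball 0 (\<rho> / 2)"
    unfolding eventually_nhds_metric by (metis dist_commute mem_ball)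
  \<comment> \<open>Both \<open>u\<close> and the difference of the two periods stay below half the
    radius, so their sum is a legitimate box time.\<close>
  define r where "r = min (min r1 \<delta>) (\<rho> / 2)"
  have r: "r > 0" "r \<le> r1" "r \<le> \<delta>" "r \<le> \<rho> / 2" using r1(1) \<delta>(1) \<rho> by (auto simp: r_def)
  have sub: "z \<in> ball 0 \<delta>" "z \<in> ball 0 \<rho>" "u z \<in> ball 0 (\<rho> / 2)" if "z \<in> ball 0 r" for z
    using that r \<delta>(2) r1(2)[of z] by auto
  have main: "T - u (g x $ 1) = T' \<and> (\<forall>y\<in>\<Phi> ` bidisc r. fl y (T - u (g y $ 1)) = y)"
    if x: "x \<in> \<Phi> ` bidisc r" and st: "stable_period x T'" and d: "dist T' T < r" for x T'
  proof -
    obtain x' where x': "x = \<Phi> x'" "x' \<in> bidisc r" using x by blast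
    obtain z s where zs: "x = \<Phi> (vec2 z s)" "z \<in> ball 0 r" "s \<in> ball 0 r"
      by (rule bidiscE[OF x'(2)]) (use x'(1) in blast)
    have zs\<rho>: "vec2 z s \<in> bidisc \<rho>" using sub(2) zs(2,3) by (simp only: vec2_bidisc)
    have gx: "g x $ 1 = z" using flow_boxD(4)[OF b zs\<rho>] zs(1) by simp
    obtain S where S: "period_function S x" "S x = T'" using st unfolding stable_period_def by blast
    let ?y = "\<lambda>w. \<Phi> (vec2 w s)"
    \<comment> \<open>Reach time \<open>S\<close> by first flowing for \<open>T\<close> and then
      correcting within the vertical disc; the result must be the starting point. Injectivity of the
      box gives both the fixed point and the value of the period.\<close>
    have key: "f w = w" "S (?y w) = T - u w"
      if w: "w \<in> ball 0 r" and per: "fl (?y w) (S (?y w)) = ?y w" and R: "u w + (S (?y w) - T) \<in> ball 0 \<rho>" for w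
    proof -
      let ?R = "S (?y w)"
      have "?y w = fl (\<Phi> (vec2 w 0)) s" by (rule flow_box_vertical[OF b sub(2)[OF w] sub(2)[OF zs(3)]])
      then have "fl (\<Phi> (vec2 w 0)) ?R = \<Phi> (vec2 w 0)" using per period_transport by metis
      moreover have "fl (\<Phi> (vec2 w 0)) ?R = fl (fl (\<Phi> (vec2 w 0)) T) (?R - T)" by (simp add: flow_add)
      moreover have "\<dots> = \<Phi> (vec2 (f w) (u w + (?R - T)))"
        using flow_boxD(7)[OF b fr[OF sub(1)[OF w]] ur[OF sub(1)[OF w]] R] unfolding ret[OF sub(1)[OF w]] by simp
      ultimately have e: "\<Phi> (vec2 (f w) (u w + (?R - T))) = \<Phi> (vec2 w 0)" by simp
      have 0: "(0::complex) \<in> ball 0 \<rho>" using \<rho> by simp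
      note inj = flow_box_inj[OF b e fr[OF sub(1)[OF w]] R sub(2)[OF w] 0]
      show "f w = w" by (rule inj(1))
      show "?R = T - u w" using inj(2) by (simp add: algebra_simps)
    qed
    have "isCont \<Phi> (vec2 z s)" using flow_boxD(3)[OF b zs\<rho>] unfolding hmap_at_def by blast
    then have cy: "isCont ?y z"
      by (rule isCont_o2[OF has_derivative_continuous[OF has_derivative_vec2_1]])
    have "isCont S (?y z)" using period_functionD(1)[OF S(1)] zs(1) by simp
    from isCont_o2[OF cy this] have cS: "isCont (\<lambda>w. S (?y w)) z" .
    have cR: "isCont (\<lambda>w. u w + (S (?y w) - T)) z" by (intro continuous_intros cS cu sub(1) zs(2))
    have "norm (u z) < \<rho> / 2" using sub(3)[OF zs(2)] by simp
    moreover have "norm (T' - T) < \<rho> / 2" using d r(4) by (simp add: dist_norm)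
    ultimately have Rz: "u z + (S (?y z) - T) \<in> ball 0 \<rho>"
      using norm_triangle_ineq[of "u z" "T' - T"] S(2) zs(1) by simp
    have "\<forall>\<^sub>F y in nhds (?y z). fl y (S y) = y"
      using S(1)[unfolded period_function_def zs(1)] by (rule eventually_mono) blast
    from isCont_eventually[OF cy this] have e1: "\<forall>\<^sub>F w in nhds z. fl (?y w) (S (?y w)) = ?y w" .
    have e2: "\<forall>\<^sub>F w in nhds z. u w + (S (?y w) - T) \<in> ball 0 \<rho>"
      by (rule isCont_eventually[OF cR eventually_nhds_in_open[OF open_ball Rz]])
    have e3: "\<forall>\<^sub>F w in nhds z. w \<in> ball 0 r" by (rule eventually_nhds_in_open[OF open_ball zs(2)])
    have "\<forall>\<^sub>F w in nhds z. f w = w" using e1 e2 e3 by eventually_elim (rule key)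
    then obtain N where N: "open N" "z \<in> N" "\<And>w. w \<in> N \<Longrightarrow> f w = w" unfolding eventually_nhds by blast
    have fid: "f w = w" if "w \<in> ball 0 \<delta>" for w
    proof (rule analytic_continuation_open[of "N \<inter> ball 0 \<delta>" "ball 0 \<delta>" f "\<lambda>w. w"])
      show "N \<inter> ball 0 \<delta> \<noteq> {}" using N(2) sub(1)[OF zs(2)] by blast
    qed (use N(1,3) f that in \<open>auto intro: holomorphic_intros\<close>)
    have "fl y (T - u (g y $ 1)) = y" if yin: "y \<in> \<Phi> ` bidisc r" for y
    proof -
      obtain y' where y': "y = \<Phi> y'" "y' \<in> bidisc r" using yin by blast
      obtain w t where wt: "y = \<Phi> (vec2 w t)" "w \<in> ball 0 r" "t \<in> ball 0 r"
        by (rule bidiscE[OF y'(2)]) (use y'(1) in blast)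
      have wt\<rho>: "vec2 w t \<in> bidisc \<rho>" using sub(2) wt(2,3) by (simp only: vec2_bidisc)
      have gy: "g y $ 1 = w" using flow_boxD(4)[OF b wt\<rho>] wt(1) by simp
      have w\<delta>: "w \<in> ball 0 \<delta>" by (rule sub(1)[OF wt(2)])
      have "fl (\<Phi> (vec2 w 0)) (T - u w) = \<Phi> (vec2 w 0)"
        using return_map_period[OF b fr[OF w\<delta>] ur[OF w\<delta>] ret[OF w\<delta>]] fid[OF w\<delta>] by simp
      moreover have "y = fl (\<Phi> (vec2 w 0)) t"
        unfolding wt(1) by (rule flow_box_vertical[OF b sub(2)[OF wt(2)] sub(2)[OF wt(3)]])
      ultimately show ?thesis unfolding gy by (simp only: period_transport)
    qed
    moreover have "S (?y z) = T - u z"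
      by (rule key(2)[OF zs(2) eventually_nhds_x_imp_x[OF e1] Rz])
    ultimately show ?thesis using S(2) zs(1) gx by simp
  qed
  have "(\<lambda>z. T - u z) holomorphic_on ball 0 r"
    by (intro holomorphic_intros holomorphic_on_subset[OF u]) (use r in auto)
  then show ?thesis
    using r \<rho> fu0(2) main by (intro exI[of _ r] exI[of _ "\<lambda>z. T - u z"]) auto
qed

lemma box_coordinate_eventually:
  assumes b: "flow_box p \<rho> \<Phi> g" and a: "a holomorphic_on ball 0 r" and r: "0 < r" "r \<le> \<rho>"
    and per: "\<forall>y\<in>\<Phi> ` bidisc r. fl y (a (g y $ 1)) = y"
  shows "period_function (\<lambda>y. a (g y $ 1)) p"
proof -
  have b': "flow_box p r \<Phi> g" by (rule flow_box_shrink[OF b r])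
  have "\<forall>\<^sub>F y in nhds p. y \<in> \<Phi> ` bidisc r"
    by (rule eventually_nhds_in_open[OF flow_boxD(5)[OF b'] flow_box_center[OF b']])
  then show ?thesis unfolding period_function_def
  proof eventually_elim
    case (elim y)
    have "isCont (\<lambda>y. g y $ 1) y" by (rule hol_at_isCont[OF flow_boxD(6)[OF b' elim]])
    moreover have "isCont a (g y $ 1)"
      using holomorphic_on_imp_continuous_on[OF a] flow_box_point(1)[OF b' elim]
      by (simp add: continuous_on_eq_continuous_at)
    ultimately have "isCont (\<lambda>y. a (g y $ 1)) y" by (rule isCont_o2)
    then show ?case using per elim by blast
  qed
qed

text \<open>The limit \<open>L\<close> is a period of \<open>p\<close> by continuity of the flow.
  For large n the stable periods \<open>T n\<close> lie within reach of \<open>stable_near\<close>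
  at \<open>L\<close>, which yields a family of periods around \<open>p\<close> and identifies its
  value at \<open>x n\<close> with \<open>T n\<close>.\<close>

lemma stable_limit:
  assumes p: "p \<in> reg" and x: "x \<longlonglongrightarrow> p" and T: "T \<longlonglongrightarrow> L" and st: "\<And>n::nat. stable_period (x n) (T n)"
  shows "\<exists>S. period_function S p \<and> S p = L \<and> (\<forall>\<^sub>F n in sequentially. S (x n) = T n)"
proof -
  have per: "fl (x n) (T n) = x n" for n
    by (rule stable_period_period[OF st])
  have "(\<lambda>n. (\<lambda>q. fl (fst q) (snd q)) (x n, T n)) \<longlonglongrightarrow> (\<lambda>q. fl (fst q) (snd q)) (p, L)"
    by (rule isCont_tendsto_compose[OF flow_continuous[OF p]]) (intro tendsto_Pair x T)
  then have "x \<longlonglongrightarrow> fl p L" by (simp add: per)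
  then have L: "fl p L = p" using x by (rule LIMSEQ_unique)
  obtain \<rho> \<Phi> g where b: "flow_box p \<rho> \<Phi> g" using flow_box_exists[OF p] by blast
  obtain r a where r: "0 < r" "r \<le> \<rho>" and a: "a holomorphic_on ball 0 r" "a 0 = L"
    and near: "\<And>x T'. x \<in> \<Phi> ` bidisc r \<Longrightarrow> stable_period x T' \<Longrightarrow> dist T' L < r \<Longrightarrow>
       a (g x $ 1) = T' \<and> (\<forall>y\<in>\<Phi> ` bidisc r. fl y (a (g y $ 1)) = y)"
    using stable_near[OF b L] by blast
  have b': "flow_box p r \<Phi> g" by (rule flow_box_shrink[OF b r])
  have "\<forall>\<^sub>F n in sequentially. x n \<in> \<Phi> ` bidisc r"
    by (rule topological_tendstoD[OF x flow_boxD(5)[OF b'] flow_box_center[OF b']])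
  moreover have "\<forall>\<^sub>F n in sequentially. dist (T n) L < r" by (rule tendstoD[OF T r(1)])
  ultimately have ev: "\<forall>\<^sub>F n in sequentially. a (g (x n) $ 1) = T n \<and> (\<forall>y\<in>\<Phi> ` bidisc r. fl y (a (g y $ 1)) = y)"
    by eventually_elim (rule near[OF _ st])
  then have "\<forall>y\<in>\<Phi> ` bidisc r. fl y (a (g y $ 1)) = y"
    using eventually_happens'[OF sequentially_bot] by blast
  then have "period_function (\<lambda>y. a (g y $ 1)) p" by (rule box_coordinate_eventually[OF b a(1) r])
  moreover have "g p $ 1 = 0"
    using flow_boxD(2)[OF b'] flow_boxD(4)[OF b', of 0] r(1) by (simp add: bidisc_def)
  moreover have "\<forall>\<^sub>F n in sequentially. a (g (x n) $ 1) = T n" using ev by (rule eventually_mono) blast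
  ultimately show ?thesis using a(2) by (intro exI[of _ "\<lambda>y. a (g y $ 1)"]) simp
qed

section \<open>Continuity and holomorphy of the frequency\<close>

lemma frequency_bounded:
  assumes p: "p \<in> reg" shows "\<exists>B. \<forall>\<^sub>F x in nhds p. norm (frequency x) \<le> B"
proof -
  obtain \<epsilon> where e: "\<epsilon> > 0" "\<forall>\<^sub>F x in nhds p. \<forall>T. norm T < \<epsilon> \<longrightarrow> fl x T = x \<longrightarrow> T = 0"
    by (rule no_small_period[OF p])
  have "\<forall>\<^sub>F x in nhds p. x \<in> reg" by (rule eventually_nhds_in_open[OF open_reg p])
  with e(2) have "\<forall>\<^sub>F x in nhds p. norm (frequency x) \<le> 1 / \<epsilon>\<^sup>2"
  proof eventually_elim
    case (elim x)
    have "fl x (period_gen x) = x"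
      by (rule stable_period_period[OF stable_period_gen[OF elim(2)]])
    then have "period_gen x = 0 \<or> \<epsilon> \<le> norm (period_gen x)" using elim(1) not_less by blast
    then show ?case
    proof
      assume "\<epsilon> \<le> norm (period_gen x)"
      then have "\<epsilon>\<^sup>2 \<le> (norm (period_gen x))\<^sup>2" using e(1) by (intro power_mono) auto
      then have "1 / (norm (period_gen x))\<^sup>2 \<le> 1 / \<epsilon>\<^sup>2" using e(1) by (intro frac_le) auto
      then show ?thesis by (simp add: frequency_def norm_divide norm_power)
    qed (simp add: frequency_def)
  qed
  then show ?thesis by blast
qed

text \<open>Squares of integers are discrete: a continuous family of stable periods has a locally
  constant ratio to the generator wherever this product is known to be continuous.\<close>

lemma frequency_multiple:
  assumes x: "x \<in> reg" and T: "stable_period x T" "T \<noteq> 0"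
  shows "\<exists>m::int. m \<noteq> 0 \<and> frequency x * T\<^sup>2 = of_int (m\<^sup>2)"
proof -
  obtain m :: int where m: "T = of_int m * period_gen x" using T(1) stable_period_iff[OF x] by blast
  have "m \<noteq> 0" "period_gen x \<noteq> 0" using m T(2) by auto
  moreover have "frequency x * T\<^sup>2 = of_int (m\<^sup>2)"
    using \<open>period_gen x \<noteq> 0\<close> by (simp add: frequency_def m power_mult_distrib)
  ultimately show ?thesis by blast
qed

text \<open>If w = 0 but \<open>p\<close> had a nonzero stable generator, its continuation
  \<open>S0\<close> to \<open>x n\<close> would make the products of
  \<open>frequency_multiple\<close> at least 1, while they tend to 0. If w is nonzero, generators at
  \<open>x n\<close> subconverge to a stable period L of \<open>p\<close> with L^2 = 1/w. L is a
  multiple of the generator at \<open>p\<close>, whose continuation is in turn a multiple of the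
  generators at \<open>x n\<close>; so both factors are 1 or -1.\<close>

lemma frequency_limit:
  assumes p: "p \<in> reg" and x: "x \<longlonglongrightarrow> p" and w: "(\<lambda>n::nat. frequency (x n)) \<longlonglongrightarrow> w"
  shows "frequency p = w"
proof -
  have xr: "\<forall>\<^sub>F n in sequentially. x n \<in> reg" by (rule topological_tendstoD[OF x open_reg p])
  obtain S0 where S0: "period_function S0 p" "S0 p = period_gen p"
    using stable_period_gen[OF p] unfolding stable_period_def by blast
  have "\<forall>\<^sub>F y in nhds p. stable_period y (S0 y)"
    using period_function_near[OF S0(1)] by (rule eventually_mono) (auto simp: stable_period_def)
  then have st0: "\<forall>\<^sub>F n in sequentially. stable_period (x n) (S0 (x n))"
    using x unfolding filterlim_iff by blast
  have lim0: "(\<lambda>n. S0 (x n)) \<longlonglongrightarrow> period_gen p"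
    using isCont_tendsto_compose[OF period_functionD(1)[OF S0(1)] x] S0(2) by simp
  show ?thesis
  proof (cases "w = 0")
    case True
    show ?thesis
    proof (rule ccontr)
      assume "frequency p \<noteq> w"
      then have g0: "period_gen p \<noteq> 0" using True by (auto simp: frequency_def)
      have "\<forall>\<^sub>F n in sequentially. S0 (x n) \<noteq> 0" by (rule tendsto_imp_eventually_ne[OF lim0 g0])
      with xr st0 have ev: "\<forall>\<^sub>F n in sequentially. 1 \<le> norm (frequency (x n) * (S0 (x n))\<^sup>2)"
      proof eventually_elim
        case (elim n)
        obtain m :: int where m: "m \<noteq> 0" "frequency (x n) * (S0 (x n))\<^sup>2 = of_int (m\<^sup>2)"
          using frequency_multiple[OF elim] by blast
        have "1 \<le> \<bar>m\<^sup>2\<bar>" using m(1) by (simp add: int_one_le_iff_zero_less)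
        then have "1 \<le> real_of_int \<bar>m\<^sup>2\<bar>" by linarith
        then show ?case unfolding m(2) norm_of_int by simp
      qed
      have "(\<lambda>n. norm (frequency (x n) * (S0 (x n))\<^sup>2)) \<longlonglongrightarrow> norm (w * (period_gen p)\<^sup>2)"
        by (intro tendsto_intros w lim0)
      from tendsto_lowerbound[OF this ev] True show False by simp
    qed
  next
    case False
    have G: "(\<lambda>n. (period_gen (x n))\<^sup>2) \<longlonglongrightarrow> inverse w"
      using tendsto_inverse[OF w False] by (simp add: frequency_def)
    have "Bseq (\<lambda>n. (period_gen (x n))\<^sup>2)" by (rule convergent_imp_Bseq) (use G convergent_def in blast)
    then obtain K where K: "K > 0" "\<And>n. norm ((period_gen (x n))\<^sup>2) \<le> K" by (auto elim: BseqE)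
    have "norm (period_gen (x n)) \<le> sqrt K" for n
      using K(2)[of n] by (intro real_le_rsqrt) (simp add: norm_power)
    then have "bounded (range (\<lambda>n. period_gen (x n)))" by (intro boundedI[of _ "sqrt K"]) auto
    then obtain L r where r: "strict_mono r" "((\<lambda>n. period_gen (x n)) \<circ> r) \<longlonglongrightarrow> L"
      using bounded_imp_convergent_subsequence by blast
    have xrr: "(\<lambda>n. x (r n)) \<longlonglongrightarrow> p" using LIMSEQ_subseq_LIMSEQ[OF x r(1)] by (simp add: o_def)
    have gL: "(\<lambda>n. period_gen (x (r n))) \<longlonglongrightarrow> L" using r(2) by (simp add: o_def)
    have "(\<lambda>n. (period_gen (x (r n)))\<^sup>2) \<longlonglongrightarrow> inverse w" using LIMSEQ_subseq_LIMSEQ[OF G r(1)] by (simp add: o_def)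
    with tendsto_power[OF gL, of 2] have L2: "L\<^sup>2 = inverse w" by (rule LIMSEQ_unique)
    then have L0: "L \<noteq> 0" using False by auto
    note sub = eventually_subseq[OF r(1)]
    \<comment> \<open>The sequence is shifted because \<open>stable_limit\<close> asks for stable
      periods at every index, and generators are known to be stable at regular points only.\<close>
    obtain N where N: "\<And>n. n \<ge> N \<Longrightarrow> x (r n) \<in> reg" using sub[OF xr] unfolding eventually_sequentially by blast
    have "\<exists>S. period_function S p \<and> S p = L \<and> (\<forall>\<^sub>F n in sequentially. S (x (r (n + N))) = period_gen (x (r (n + N))))"
      by (rule stable_limit[OF p LIMSEQ_ignore_initial_segment[OF xrr] LIMSEQ_ignore_initial_segment[OF gL]])
        (rule stable_period_gen, rule N, simp)
    then obtain S where S: "period_function S p" "S p = L"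
      "\<forall>\<^sub>F n in sequentially. S (x (r (n + N))) = period_gen (x (r (n + N)))" by blast
    have S3: "\<forall>\<^sub>F n in sequentially. S (x (r n)) = period_gen (x (r n))"
      using S(3) by (rule eventually_sequentially_seg[THEN iffD1])
    have "stable_period p L" using S(1,2) unfolding stable_period_def by blast
    then obtain n :: int where n: "L = of_int n * period_gen p" using stable_period_iff[OF p] by blast
    have "\<forall>\<^sub>F y in nhds p. S y = of_int n * S0 y"
      by (rule period_function_unique[OF p S(1) period_function_of_int[OF S0(1)]]) (simp add: S S0 n)
    then have "\<forall>\<^sub>F k in sequentially. S (x (r k)) = of_int n * S0 (x (r k))"
      using xrr unfolding filterlim_iff by blast
    moreover have "\<forall>\<^sub>F k in sequentially. period_gen (x (r k)) \<noteq> 0" by (rule tendsto_imp_eventually_ne[OF gL L0])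
    ultimately have "\<forall>\<^sub>F k in sequentially. S (x (r k)) = of_int n * S0 (x (r k)) \<and> period_gen (x (r k)) \<noteq> 0 \<and>
        S (x (r k)) = period_gen (x (r k)) \<and> x (r k) \<in> reg \<and> stable_period (x (r k)) (S0 (x (r k)))"
      using S3 sub[OF xr] sub[OF st0] by eventually_elim blast
    then obtain k where k: "S (x (r k)) = of_int n * S0 (x (r k))" "period_gen (x (r k)) \<noteq> 0"
        "S (x (r k)) = period_gen (x (r k))" "x (r k) \<in> reg" "stable_period (x (r k)) (S0 (x (r k)))"
      using eventually_happens'[OF sequentially_bot] by blast
    obtain m :: int where "S0 (x (r k)) = of_int m * period_gen (x (r k))"
      using k(5) stable_period_iff[OF k(4)] by blast
    then have "period_gen (x (r k)) = of_int (n * m) * period_gen (x (r k))" using k(1,3) by simp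
    then have "of_int (n * m) = (1::complex)" using k(2) by simp
    then have "n * m = 1" by (simp only: of_int_eq_1_iff)
    then have "n = 1 \<or> n = -1" by (auto simp: zmult_eq_1_iff)
    then have "(period_gen p)\<^sup>2 = L\<^sup>2" using n by auto
    then show ?thesis unfolding frequency_def L2 by (simp add: divide_inverse)
  qed
qed

text \<open>Continuity holds everywhere by boundedness and identification of limits. Where the
  frequency is nonzero the generator continues to a holomorphic family of periods, so the hypotheses
  of Rado's theorem are met on the section disc.\<close>

lemma section_frequency:
  assumes b: "flow_box p \<rho> \<Phi> g"
  shows "(\<lambda>z. frequency (\<Phi> (vec2 z 0))) holomorphic_on ball 0 \<rho>"
proof (rule rado[OF open_ball])
  let ?s = "\<lambda>z. \<Phi> (vec2 z 0)"
  have cs: "isCont ?s z" if "z \<in> ball 0 \<rho>" for z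
    using section_hcurve(1)[OF b that] unfolding hcurve_at_def by blast
  have cf: "isCont (\<lambda>z. frequency (?s z)) z" if z: "z \<in> ball 0 \<rho>" for z
  proof -
    have reg: "?s z \<in> reg" by (rule section_hcurve(2)[OF b z])
    obtain B where B: "\<forall>\<^sub>F x in nhds (?s z). norm (frequency x) \<le> B" using frequency_bounded[OF reg] by blast
    show ?thesis
    proof (rule isCont_by_limits[OF isCont_eventually[OF cs[OF z] B]])
      fix x w assume x: "x \<longlonglongrightarrow> z" "(\<lambda>n. frequency (?s (x n))) \<longlonglongrightarrow> w"
      show "frequency (?s z) = w"
        by (rule frequency_limit[OF reg isCont_tendsto_compose[OF cs[OF z] x(1)] x(2)])
    qed
  qed
  show "continuous_on (ball 0 \<rho>) (\<lambda>z. frequency (?s z))"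
    by (rule continuous_at_imp_continuous_on, rule ballI, rule cf)
  show "(\<lambda>z. frequency (?s z)) holomorphic_on {z \<in> ball 0 \<rho>. frequency (?s z) \<noteq> 0}"
    unfolding holomorphic_on_def
  proof (rule ballI, rule field_differentiable_at_within)
    fix z assume "z \<in> {z \<in> ball 0 \<rho>. frequency (?s z) \<noteq> 0}"
    then have z: "z \<in> ball 0 \<rho>" and nz: "frequency (?s z) \<noteq> 0" by simp_all
    let ?q = "?s z"
    let ?T = "period_gen ?q"
    have q: "?q \<in> reg" by (rule section_hcurve(2)[OF b z])
    have T0: "?T \<noteq> 0" using nz by (auto simp: frequency_def)
    have st: "stable_period ?q ?T" by (rule stable_period_gen[OF q])
    obtain \<rho>' \<Phi>' g' where b': "flow_box ?q \<rho>' \<Phi>' g'" using flow_box_exists[OF q] by blast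
    obtain r a where r: "0 < r" "r \<le> \<rho>'" and a: "a holomorphic_on ball 0 r" "a 0 = ?T"
      and near: "\<And>x T'. x \<in> \<Phi>' ` bidisc r \<Longrightarrow> stable_period x T' \<Longrightarrow> dist T' ?T < r \<Longrightarrow>
         a (g' x $ 1) = T' \<and> (\<forall>y\<in>\<Phi>' ` bidisc r. fl y (a (g' y $ 1)) = y)"
      using stable_near[OF b' stable_period_period[OF st]] by blast
    have b2: "flow_box ?q r \<Phi>' g'" by (rule flow_box_shrink[OF b' r])
    have "\<forall>y\<in>\<Phi>' ` bidisc r. fl y (a (g' y $ 1)) = y"
      using near[OF flow_box_center[OF b2] st] r(1) by simp
    then have S: "period_function (\<lambda>y. a (g' y $ 1)) ?q" by (rule box_coordinate_eventually[OF b' a(1) r])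
    have gq: "g' ?q $ 1 = 0"
      using flow_boxD(2)[OF b2] flow_boxD(4)[OF b2, of 0] r(1) by (simp add: bidisc_def)
    let ?A = "\<lambda>y. a (g' (?s y) $ 1)"
    have "(\<lambda>y. g' (?s y) $ 1) field_differentiable at z"
      by (rule hol_at_hcurve[OF section_hcurve(1)[OF b z] flow_boxD(6)[OF b2 flow_box_center[OF b2]]])
    moreover have "a field_differentiable at (g' ?q $ 1)"
      unfolding gq using a(1) r(1) by (simp add: holomorphic_on_imp_differentiable_at)
    ultimately have "(a \<circ> (\<lambda>y. g' (?s y) $ 1)) field_differentiable at z"
      by (rule field_differentiable_compose)
    then have fA: "?A field_differentiable at z" by (simp add: o_def)
    have Az: "?A z = ?T" by (simp add: gq a(2))
    have cA: "isCont ?A z" using fA by (rule field_differentiable_imp_continuous_at)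
    have "\<forall>\<^sub>F y in nhds ?q. stable_period y (a (g' y $ 1))"
      using period_function_near[OF S] by (rule eventually_mono) (auto simp: stable_period_def)
    from isCont_eventually[OF cs[OF z] this]
    have e1: "\<forall>\<^sub>F y in nhds z. stable_period (?s y) (?A y)" .
    have "?A z \<in> - {0}" using Az T0 by simp
    from isCont_eventually[OF cA eventually_nhds_in_open[OF _ this]]
    have e2: "\<forall>\<^sub>F y in nhds z. ?A y \<noteq> 0" by auto
    have e3: "\<forall>\<^sub>F y in nhds z. y \<in> ball 0 \<rho>" by (rule eventually_nhds_in_open[OF open_ball z])
    \<comment> \<open>This product is continuous, equals 1 at \<open>z\<close> and is the square of
      an integer nearby, so it is 1 nearby: the continued period generates the stable periods of
      neighbouring points.\<close>
    have "isCont (\<lambda>y. frequency (?s y) * (?A y)\<^sup>2) z" by (intro continuous_intros cf[OF z] cA)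
    moreover have one: "frequency (?s z) * (?A z)\<^sup>2 = 1"
      unfolding Az using T0 by (simp add: frequency_def)
    then have "frequency (?s z) * (?A z)\<^sup>2 \<in> ball 1 1" by simp
    ultimately have e4: "\<forall>\<^sub>F y in nhds z. frequency (?s y) * (?A y)\<^sup>2 \<in> ball 1 1"
      by (rule isCont_eventually[OF _ eventually_nhds_in_open[OF open_ball]])
    from e1 e2 e3 e4 have eq: "\<forall>\<^sub>F y in nhds z. frequency (?s y) = 1 / (?A y)\<^sup>2"
    proof eventually_elim
      case (elim y)
      obtain m :: int where m: "frequency (?s y) * (?A y)\<^sup>2 = of_int (m\<^sup>2)"
        using frequency_multiple[OF section_hcurve(2)[OF b elim(3)] elim(1,2)] by blast
      have "norm (complex_of_int (1 - m\<^sup>2)) < 1" using elim(4) unfolding m by (simp add: dist_norm)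
      then have "\<bar>real_of_int (1 - m\<^sup>2)\<bar> < 1" unfolding norm_of_int .
      then have "m\<^sup>2 = 1" by linarith
      then have "frequency (?s y) * (?A y)\<^sup>2 = 1" unfolding m by simp
      then show ?case using elim(2) by (simp add: nonzero_eq_divide_eq)
    qed
    have "(\<lambda>y. 1 / (?A y)\<^sup>2) field_differentiable at z"
      using Az T0 fA by (intro derivative_intros field_differentiable_divide field_differentiable_power) auto
    then obtain D where "((\<lambda>y. 1 / (?A y)\<^sup>2) has_field_derivative D) (at z)" unfolding field_differentiable_def by blast
    then have "((\<lambda>y. frequency (?s y)) has_field_derivative D) (at z)"
      by (rule DERIV_cong_ev[OF refl eq refl, THEN iffD2])
    then show "(\<lambda>z. frequency (?s z)) field_differentiable at z" unfolding field_differentiable_def by blast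
  qed
qed

text \<open>Rado's theorem was applied in one variable; constancy along the flow supplies the second
  variable.\<close>

lemma frequency_hol_at:
  assumes p: "p \<in> reg" shows "hol_at frequency p"
proof -
  obtain \<rho> \<Phi> g where b: "flow_box p \<rho> \<Phi> g" using flow_box_exists[OF p] by blast
  show ?thesis
  proof (rule hol_at_box[OF b section_frequency[OF b], of "\<lambda>_. 1"])
    fix z t assume zt: "z \<in> ball (0::complex) \<rho>" "t \<in> ball (0::complex) \<rho>"
    show "frequency (\<Phi> (vec2 z t)) = frequency (\<Phi> (vec2 z 0)) * 1"
      unfolding flow_box_vertical[OF b zt] frequency_flow[OF section_hcurve(2)[OF b zt(1)]] by simp
  qed simp
qed

text \<open>The extended frequency is invariant, hence a first integral unless it is constant. If it
  is the constant 1/\<tau>^2, continuous periods around \<open>p\<close> have square \<tau>^2, and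
  \<tau> becomes a period on an open set and then everywhere, which leads to the case of a periodic
  flow.\<close>

theorem stable_period_first_integral:
  assumes p: "p \<in> reg" and T: "stable_period p T" "T \<noteq> 0"
  shows "\<exists>f. meromorphic_first_integral A X f"
proof (rule extend_over_sing[OF frequency_hol_at])
  fix V assume V: "holo_on A UNIV V" "\<And>p. p \<in> reg \<Longrightarrow> V p = frequency p"
  have inv: "V (fl x t) = V x" for x t
  proof (cases "x \<in> reg")
    case True
    then show ?thesis unfolding V(2)[OF flow_reg[OF True]] V(2)[OF True] by (rule frequency_flow)
  qed (simp add: flow_sing)
  show ?thesis
  proof (cases "\<exists>x y. V x \<noteq> V y")
    case True
    then obtain x y where xy: "V x \<noteq> V y" by blast
    have "meromorphic_first_integral A X (\<lambda>p. V p / (\<lambda>_. 1) p)"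
      by (rule first_integralI[OF V(1), of _ x y]) (use xy inv in \<open>auto simp: holo_on_hol_at\<close>)
    then show ?thesis by blast
  next
    case False
    define \<tau> where "\<tau> = period_gen p"
    have st: "stable_period p \<tau>" unfolding \<tau>_def by (rule stable_period_gen[OF p])
    have \<tau>0: "\<tau> \<noteq> 0" using T stable_period_iff[OF p] unfolding \<tau>_def by auto
    have const: "frequency x = 1 / \<tau>\<^sup>2" if "x \<in> reg" for x
    proof -
      have "V x = V p" using False by blast
      then show ?thesis unfolding V(2)[OF that] V(2)[OF p] frequency_def[of p] \<tau>_def .
    qed
    obtain S where S: "period_function S p" "S p = \<tau>" using st unfolding stable_period_def by blast
    obtain \<epsilon> where e: "\<epsilon> > 0" "\<forall>\<^sub>F x in nhds p. \<forall>T. norm T < \<epsilon> \<longrightarrow> fl x T = x \<longrightarrow> T = 0"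
      by (rule no_small_period[OF p])
    have "isCont (\<lambda>x. (S x)\<^sup>2 / \<tau>\<^sup>2) p" by (intro continuous_intros period_functionD(1)[OF S(1)]) (use \<tau>0 in simp)
    moreover have "(S p)\<^sup>2 / \<tau>\<^sup>2 \<in> ball 1 1" using S(2) \<tau>0 by simp
    ultimately have e1: "\<forall>\<^sub>F x in nhds p. (S x)\<^sup>2 / \<tau>\<^sup>2 \<in> ball 1 1"
      by (rule isCont_eventually[OF _ eventually_nhds_in_open[OF open_ball]])
    \<comment> \<open>Constancy of the frequency fixes the period only up to sign; excluding the
      value \<open>- \<tau>\<close> nearby leaves \<open>S x = \<tau>\<close>.\<close>
    have "S p \<in> - {- \<tau>, 0}" using S(2) \<tau>0 by simp
    moreover have "open (- {- \<tau>, 0})" by (intro open_Compl finite_imp_closed) simp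
    ultimately have e2: "\<forall>\<^sub>F x in nhds p. S x \<in> - {- \<tau>, 0}"
      by (rule isCont_eventually[OF period_functionD(1)[OF S(1)] eventually_nhds_in_open, rotated])
    have e3: "\<forall>\<^sub>F x in nhds p. x \<in> reg" by (rule eventually_nhds_in_open[OF open_reg p])
    from e1 e2 e3 period_function_near[OF S(1)]
    have "\<forall>\<^sub>F x in nhds p. x \<in> reg \<and> fl x \<tau> = x"
    proof eventually_elim
      case (elim x)
      have "stable_period x (S x)" using elim(4) unfolding stable_period_def by blast
      moreover have "S x \<noteq> 0" using elim(2) by blast
      ultimately obtain m :: int where m: "frequency x * (S x)\<^sup>2 = of_int (m\<^sup>2)"
        using frequency_multiple[OF elim(3)] by blast
      then have m': "(S x)\<^sup>2 / \<tau>\<^sup>2 = of_int (m\<^sup>2)" using const[OF elim(3)] by simp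
      have "norm (complex_of_int (1 - m\<^sup>2)) < 1" using elim(1) unfolding m' by (simp add: dist_norm)
      then have "\<bar>real_of_int (1 - m\<^sup>2)\<bar> < 1" unfolding norm_of_int .
      then have "m\<^sup>2 = 1" by linarith
      then have "(S x)\<^sup>2 = \<tau>\<^sup>2" using m' \<tau>0 by simp
      then have "S x = \<tau>" using elim(2) by (simp add: power2_eq_iff)
      then show ?case using period_functionD(2)[OF elim(4)] elim(3) by simp
    qed
    then obtain W where W: "open W" "p \<in> W" "\<And>x. x \<in> W \<Longrightarrow> x \<in> reg \<and> fl x \<tau> = x"
      unfolding eventually_nhds by blast
    have "fl x \<tau> = x" for x
      by (rule period_global[OF W(1)]) (use W(2,3) in auto)
    then show ?thesis using periodic_flow_first_integral[OF \<tau>0 _ p] by blast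
  qed
qed

end

section \<open>Periodic orbits\<close>

lemma has_derivative_exp_mult:
  "((\<lambda>t. a * exp (c * t)) has_derivative (\<lambda>v. a * c * v * exp (c * t))) (at t)" for a c t :: complex
  by (auto intro!: derivative_eq_intros simp: mult_ac)

text \<open>Differentiation changes the coefficient in front of the exponential, so the induction is
  over all coefficients.\<close>

lemma smooth_map_exp: "smooth_map (\<lambda>t. exp (c * t) :: complex)"
proof -
  note d = has_derivative_exp_mult[where c = c]
  have fd: "frechet_derivative (\<lambda>t. a * exp (c * t)) (at t) = (\<lambda>v. a * c * v * exp (c * t))" for a t :: complex
    by (rule frechet_derivative_at[OF d, symmetric])
  have "Ck_map k (\<lambda>t. a * exp (c * t))" for k and a :: complex
  proof (induction k arbitrary: a)
    case 0
    show ?case by (auto intro!: continuous_intros)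
  next
    case (Suc k)
    have "(\<lambda>t. a * exp (c * t)) differentiable_on UNIV"
      using d unfolding differentiable_on_def differentiable_def by blast
    moreover have "Ck_map k (\<lambda>x. frechet_derivative (\<lambda>t. a * exp (c * t)) (at x) v)" for v
      unfolding fd by (rule Suc.IH)
    ultimately show ?case by simp
  qed
  from this[of _ 1] show ?thesis unfolding smooth_map_def by simp
qed

text \<open>By invariance of domain such a map would be a homeomorphism from the plane, which is
  simply connected, onto the punctured plane.\<close>

lemma punctured_plane_not_plane:
  fixes f :: "complex \<Rightarrow> complex"
  assumes f: "continuous_on UNIV f" "inj f" shows "range f \<noteq> - {0}"
proof
  assume r: "range f = - {0}"
  obtain g where "homeomorphism UNIV (range f) f g"
    by (rule invariance_of_domain_homeomorphism[OF open_UNIV f(1) _ f(2)]) simp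
  then have "(UNIV :: complex set) homeomorphic (- {0::complex})"
    unfolding r homeomorphic_def by blast
  from homeomorphic_simply_connected_eq[OF this]
  have "simply_connected (- {0::complex})"
    using convex_imp_simply_connected[OF convex_UNIV, where 'a = complex] by simp
  then show False unfolding simply_connected_punctured_universe_eq by simp
qed

context flow_surface
begin

section \<open>Orbit topology, simply connected and periodic orbits\<close>

lemma openin_orbit_topology:
  "openin (orbit_topology A X p) U \<longleftrightarrow> U \<subseteq> orbit A X p \<and> open (fl p -` U)"
proof -
  have "istopology (\<lambda>U. U \<subseteq> orbit A X p \<and> open (fl p -` U))"
    unfolding istopology_def by (auto simp: vimage_Union vimage_Int intro: open_Int)
  then show ?thesis unfolding orbit_topology_def by simp
qed

lemma topspace_orbit_topology: "topspace (orbit_topology A X p) = orbit A X p"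
proof
  show "topspace (orbit_topology A X p) \<subseteq> orbit A X p"
    unfolding topspace_def openin_orbit_topology by blast
  have "fl p -` orbit A X p = UNIV" by (auto simp: orbit_def)
  then have "openin (orbit_topology A X p) (orbit A X p)" unfolding openin_orbit_topology by simp
  then show "orbit A X p \<subseteq> topspace (orbit_topology A X p)" by (rule openin_subset)
qed

lemma continuous_map_orbit: "continuous_map euclidean (orbit_topology A X p) (fl p)"
  unfolding continuous_map_def topspace_orbit_topology openin_orbit_topology
  by (auto simp: orbit_def vimage_def)

lemma orbit_eq:
  assumes "x \<in> orbit A X p" shows "orbit A X x = orbit A X p"
proof -
  obtain t where t: "x = fl p t" using assms unfolding orbit_def by blast
  have 1: "fl p s = fl x (s - t)" for s by (simp add: t flow_add)
  have 2: "fl x s = fl p (t + s)" for s by (simp add: t flow_add)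
  show ?thesis unfolding orbit_def
  proof
    show "range (fl x) \<subseteq> range (fl p)" by (rule image_subsetI) (simp only: 2 rangeI)
    show "range (fl p) \<subseteq> range (fl x)" by (rule image_subsetI) (simp only: 1 rangeI)
  qed
qed

lemma path_connected_orbit: "path_connected_space (orbit_topology A X p)"
  unfolding path_connected_space_def
proof (intro ballI)
  fix x y assume "x \<in> topspace (orbit_topology A X p)" "y \<in> topspace (orbit_topology A X p)"
  then obtain s t where st: "x = fl p s" "y = fl p t" unfolding topspace_orbit_topology orbit_def by blast
  have "pathin euclidean (\<lambda>r. s + of_real r * (t - s))"
    unfolding pathin_def by (auto intro!: continuous_intros)
  from pathin_compose[OF this continuous_map_orbit, of p]
  show "\<exists>g. pathin (orbit_topology A X p) g \<and> g 0 = x \<and> g 1 = y"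
    by (intro exI[of _ "fl p \<circ> (\<lambda>r. s + of_real r * (t - s))"]) (simp add: st)
qed

text \<open>An injective parametrization is a homeomorphism from the plane, since open sets of the
  orbit are those with open preimage. Homotopies of loops are carried over from the plane.\<close>

lemma simply_connected_injective_orbit:
  assumes inj: "inj (fl p)"
  shows "simply_connected_top (orbit_topology A X p)"
  unfolding simply_connected_top_def
proof (intro conjI allI impI path_connected_orbit)
  fix g h assume gh: "pathin (orbit_topology A X p) g \<and> g 1 = g 0 \<and> pathin (orbit_topology A X p) h \<and> h 1 = h 0"
  define k where "k = inv_into UNIV (fl p)"
  have kf: "k (fl p t) = t" for t unfolding k_def by (rule inv_into_f_f[OF inj UNIV_I])
  have fk: "fl p (k x) = x" if "x \<in> orbit A X p" for x
    unfolding k_def by (rule f_inv_into_f) (use that in \<open>simp add: orbit_def\<close>)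
  have ck: "continuous_map (orbit_topology A X p) euclidean k"
    unfolding continuous_map_def topspace_orbit_topology openin_orbit_topology
  proof (intro conjI allI impI)
    fix U :: "complex set" assume U: "openin euclidean U"
    have "fl p -` {x \<in> orbit A X p. k x \<in> U} = U" by (auto simp: kf orbit_def)
    then show "open (fl p -` {x \<in> orbit A X p. k x \<in> U})" using U by simp
  qed auto
  have loop: "path (k \<circ> g) \<and> pathfinish (k \<circ> g) = pathstart (k \<circ> g)"
    if "pathin (orbit_topology A X p) g" "g 1 = g 0" for g
    using pathin_compose[OF that(1) ck] that(2) by (simp add: pathin_def path_def pathfinish_def pathstart_def)
  have "homotopic_loops UNIV (k \<circ> g) (k \<circ> h)"
    using convex_imp_simply_connected[OF convex_UNIV, where 'a = complex] loop gh
    unfolding simply_connected_def by auto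
  then have hom: "homotopic_with (\<lambda>r. pathfinish r = pathstart r) (top_of_set {0..1}) euclidean (k \<circ> g) (k \<circ> h)"
    unfolding homotopic_loops_def by simp
  have in_orbit: "g x \<in> orbit A X p" if "pathin (orbit_topology A X p) g" "x \<in> {0..1}" for g x
    using that unfolding pathin_def continuous_map_def topspace_orbit_topology by auto
  have "homotopic_with (\<lambda>r. r 1 = r 0) (top_of_set {0..1}) (orbit_topology A X p) (fl p \<circ> (k \<circ> g)) (fl p \<circ> (k \<circ> h))"
    by (rule homotopic_with_compose_continuous_map_left[OF hom continuous_map_orbit])
      (simp add: pathfinish_def pathstart_def)
  then show "homotopic_with (\<lambda>r. r 1 = r 0) (top_of_set {0..1}) (orbit_topology A X p) g h"
  proof (rule homotopic_with_eq)
    fix x :: real assume "x \<in> topspace (top_of_set {0..1})"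
    then have x: "x \<in> {0..1}" by simp
    show "g x = (fl p \<circ> (k \<circ> g)) x" "h x = (fl p \<circ> (k \<circ> h)) x"
      using fk[OF in_orbit[OF _ x]] gh by simp_all
  qed auto
qed

lemma simply_connected_singular_orbit:
  assumes p: "p \<in> sing A X"
  shows "simply_connected_top (orbit_topology A X p)"
  unfolding simply_connected_top_def
proof (intro conjI allI impI path_connected_orbit)
  have orb: "orbit A X p = {p}" using flow_sing[OF p] by (auto simp: orbit_def)
  fix g h assume gh: "pathin (orbit_topology A X p) g \<and> g 1 = g 0 \<and> pathin (orbit_topology A X p) h \<and> h 1 = h 0"
  have const: "g x = p" if "pathin (orbit_topology A X p) g" "x \<in> {0..1}" for g x
    using that unfolding pathin_def continuous_map_def topspace_orbit_topology orb by auto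
  show "homotopic_with (\<lambda>r. r 1 = r 0) (top_of_set {0..1}) (orbit_topology A X p) g h"
    by (rule homotopic_with_equal) (use gh const in \<open>auto simp: pathin_def\<close>)
qed

text \<open>A convergence point is not given to lie on a periodic orbit. The failure of simple
  connectivity excludes singular points and injective orbits, and so supplies the period.\<close>

lemma periodic_if_not_simply_connected:
  assumes "\<not> simply_connected_top (orbit_topology A X q)"
  shows "q \<in> reg" "\<exists>T. T \<noteq> 0 \<and> fl q T = q"
proof -
  show "q \<in> reg" using simply_connected_singular_orbit assms by blast
  obtain s t where st: "fl q s = fl q t" "s \<noteq> t"
    using simply_connected_injective_orbit assms unfolding inj_def by blast
  have "fl q (s - t) = fl (fl q s) (- t)" by (simp add: flow_add)
  also have "\<dots> = q" unfolding st(1) by (simp add: flow_add)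
  finally show "\<exists>T. T \<noteq> 0 \<and> fl q T = q" using st(2) by (intro exI[of _ "s - t"]) simp
qed

text \<open>Without a nonzero period the diffeomorphism composed with the flow would map the plane
  injectively and continuously onto the punctured plane.\<close>

lemma periodic_orbit_period:
  assumes "periodic_orbit A X p"
  shows "\<exists>T. T \<noteq> 0 \<and> fl p T = p"
proof (rule ccontr)
  assume n: "\<not> ?thesis"
  obtain h where h: "orbit_diffeo A X p h" using assms unfolding periodic_orbit_def ..
  note bij = h[unfolded orbit_diffeo_def, THEN conjunct1]
  note smooth = h[unfolded orbit_diffeo_def, THEN conjunct2, THEN conjunct1]
  have "fl p s \<noteq> fl p t" if "s \<noteq> t" for s t
  proof
    assume "fl p s = fl p t"
    then have "fl (fl p s) (- t) = fl (fl p t) (- t)" by simp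
    then have "fl p (s - t) = p" by (simp add: flow_add)
    moreover have "s - t \<noteq> 0" using that by simp
    ultimately show False using n by blast
  qed
  then have "inj (fl p)" unfolding inj_def by blast
  then have "inj (h \<circ> fl p)"
    using comp_inj_on[of "fl p" UNIV h] bij unfolding bij_betw_def orbit_def by simp
  moreover have "continuous_on UNIV (h \<circ> fl p)"
    using smooth unfolding smooth_map_def by (metis Ck_map.simps(1))
  moreover have "range (h \<circ> fl p) = - {0}"
    using bij unfolding bij_betw_def orbit_def by (simp add: image_comp)
  ultimately show False using punctured_plane_not_plane by blast
qed

text \<open>The exponential with period \<tau> takes equal values exactly at times leading to the
  same point, so it descends to the orbit. The unit circle then corresponds to the flow from time 0
  to \<tau>, which ties the holonomy of this loop to the return map.\<close>

lemma orbit_diffeo_exp: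
  assumes p: "p \<in> reg" and per: "\<And>T. fl p T = p \<longleftrightarrow> (\<exists>n::int. T = of_int n * \<tau>)" and \<tau>: "\<tau> \<noteq> 0"
  obtains h where "orbit_diffeo A X p h" "\<And>s. orbit_loop A X p h s = fl p (of_real s * \<tau>)"
proof -
  let ?e = "\<lambda>t. exp (2 * of_real pi * \<i> / \<tau> * t) :: complex"
  \<comment> \<open>Any time leading to \<open>x\<close> may be chosen, because the exponential does
    not depend on the choice.\<close>
  define h where "h x = ?e (SOME t. fl p t = x)" for x
  have ee: "?e s = ?e t \<longleftrightarrow> fl p s = fl p t" for s t
  proof -
    have "?e s = ?e t \<longleftrightarrow> (\<exists>n::int. 2 * of_real pi * \<i> / \<tau> * s = 2 * of_real pi * \<i> / \<tau> * t + of_real (of_int (2 * n) * pi) * \<i>)"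
      by (rule exp_eq)
    also have "\<dots> \<longleftrightarrow> (\<exists>n::int. s - t = of_int n * \<tau>)"
    proof (rule arg_cong[where f = Ex], rule ext)
      fix n :: int
      have K: "2 * of_real pi * \<i> / \<tau> \<noteq> 0" using \<tau> by simp
      have "of_real (of_int (2 * n) * pi) * \<i> = 2 * of_real pi * \<i> / \<tau> * (of_int n * \<tau>)" using \<tau> by simp
      moreover have "K * s = K * t + K * N \<longleftrightarrow> s - t = N" if "K \<noteq> 0" for K N :: complex
        unfolding distrib_left[symmetric] mult_cancel_left using that by (auto simp: algebra_simps)
      ultimately show "(2 * of_real pi * \<i> / \<tau> * s = 2 * of_real pi * \<i> / \<tau> * t + of_real (of_int (2 * n) * pi) * \<i>)
          = (s - t = of_int n * \<tau>)" using K by (simp only:) blast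
    qed
    also have "\<dots> \<longleftrightarrow> fl p (s - t) = p" by (simp only: per)
    also have "\<dots> \<longleftrightarrow> fl p s = fl p t"
    proof
      assume "fl p (s - t) = p"
      then have "fl (fl p (s - t)) t = fl p t" by simp
      then show "fl p s = fl p t" by (simp add: flow_add)
    next
      assume "fl p s = fl p t"
      then have "fl (fl p s) (- t) = fl (fl p t) (- t)" by simp
      then show "fl p (s - t) = p" by (simp add: flow_add)
    qed
    finally show ?thesis .
  qed
  have he: "h (fl p t) = ?e t" for t
  proof -
    have "fl p (SOME s. fl p s = fl p t) = fl p t" by (rule someI) (rule refl)
    then show ?thesis unfolding h_def by (simp only: ee)
  qed
  have comp: "h \<circ> fl p = ?e" by (rule ext) (simp add: he)
  have "inj_on h (orbit A X p)"
  proof (rule inj_onI)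
    fix x y assume xy: "x \<in> orbit A X p" "y \<in> orbit A X p" "h x = h y"
    then obtain s t where "x = fl p s" "y = fl p t" unfolding orbit_def by blast
    then show "x = y" using xy(3) by (simp only: he ee)
  qed
  moreover have "h ` orbit A X p = - {0}"
  proof (rule Set.set_eqI)
    fix w
    have "w \<in> h ` orbit A X p \<longleftrightarrow> (\<exists>t. w = ?e t)" unfolding orbit_def image_image he by blast
    also have "\<dots> \<longleftrightarrow> w \<in> - {0}"
    proof
      assume "w \<in> - {0}"
      then have "w = ?e (Ln w * \<tau> / (2 * of_real pi * \<i>))" using \<tau> by simp
      then show "\<exists>t. w = ?e t" by blast
    qed auto
    finally show "w \<in> h ` orbit A X p \<longleftrightarrow> w \<in> - {0}" .
  qed
  ultimately have bij: "bij_betw h (orbit A X p) (- {0})" unfolding bij_betw_def by blast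
  have "bij (frechet_derivative (h \<circ> fl p) (at t))" for t
  proof -
    define c where "c = 2 * of_real pi * \<i> / \<tau> * ?e t"
    have c0: "c \<noteq> 0" using \<tau> by (simp add: c_def)
    have "(?e has_derivative (\<lambda>v. c * v)) (at t)"
      using has_derivative_exp_mult[of 1 "2 * of_real pi * \<i> / \<tau>" t] by (simp add: c_def mult_ac)
    then have "frechet_derivative (h \<circ> fl p) (at t) = (\<lambda>v. c * v)"
      unfolding comp by (rule frechet_derivative_at[symmetric])
    moreover have "bij (\<lambda>v. c * v)"
      by (rule o_bij[of "\<lambda>v. v / c"]) (use c0 in \<open>auto simp: fun_eq_iff\<close>)
    ultimately show ?thesis by simp
  qed
  then have diffeo: "orbit_diffeo A X p h"
    unfolding orbit_diffeo_def using bij smooth_map_exp[of "2 * of_real pi * \<i> / \<tau>"] comp by simp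
  have loop: "orbit_loop A X p h s = fl p (of_real s * \<tau>)" for s
  proof -
    have "h (fl p (of_real s * \<tau>)) = exp (2 * of_real pi * \<i> * of_real s)" unfolding he using \<tau> by (simp add: mult_ac)
    moreover have "inj_on h (orbit A X p)" using bij unfolding bij_betw_def by blast
    moreover have "fl p (of_real s * \<tau>) \<in> orbit A X p" unfolding orbit_def by blast
    ultimately show ?thesis unfolding orbit_loop_def using inv_into_f_f by metis
  qed
  show thesis by (rule that[OF diffeo loop])
qed

text \<open>The identity principle \<open>period_near\<close> is stated at the centre of a box,
  whereas points of a leaf accumulate at some other point of the section.\<close>

lemma flow_box_recenter:
  assumes b: "flow_box p \<rho> \<Phi> g" and w: "w \<in> ball 0 \<rho>"
  shows "flow_box (\<Phi> (vec2 w 0)) (\<rho> - norm w) (\<lambda>x. \<Phi> (x + vec2 w 0)) (\<lambda>q. g q - vec2 w 0)"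
proof -
  let ?r = "\<rho> - norm w" and ?\<Phi> = "\<lambda>x. \<Phi> (x + vec2 w 0)"
  have shift: "x + vec2 w 0 \<in> bidisc \<rho>" if "x \<in> bidisc ?r" for x
  proof -
    have "norm (x $ 1) < ?r" "norm (x $ 2) < ?r" using that by (auto simp: bidisc_def)
    moreover have "norm (x $ 1 + w) \<le> norm (x $ 1) + norm w" by (rule norm_triangle_ineq)
    moreover have "0 \<le> norm w" by simp
    ultimately have "norm (x $ 1 + w) < \<rho>" "norm (x $ 2) < \<rho>" by linarith+
    then show ?thesis by (simp add: bidisc_def vec2_nth)
  qed
  have 1: "?r > 0" using w by simp
  have 2: "?\<Phi> 0 = \<Phi> (vec2 w 0)" by simp
  have 3: "hmap_at ?\<Phi> x \<and> g (?\<Phi> x) - vec2 w 0 = x" if x: "x \<in> bidisc ?r" for x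
  proof -
    have h: "hmap_at \<Phi> (x + vec2 w 0)" by (rule flow_boxD(3)[OF b shift[OF x]])
    have cont: "isCont ?\<Phi> x"
      by (rule isCont_o2[where g = \<Phi>]) (use h in \<open>auto simp: hmap_at_def intro!: continuous_intros\<close>)
    obtain c where c: "c \<in> A" "?\<Phi> x \<in> fst c" by (rule chart_at)
    have "cdiffv (snd c \<circ> \<Phi>) (x + vec2 w 0)" using h c unfolding hmap_at_def by blast
    then have "cdiffv (\<lambda>x. (snd c \<circ> \<Phi>) (x + vec2 w 0)) x"
      by (rule cdiffv_compose[OF cdiffv_add[OF cdiffv_ident cdiffv_const]])
    then have "hmap_at ?\<Phi> x" by (intro hmap_atI[OF cont c]) (simp add: o_def)
    then show ?thesis using flow_boxD(4)[OF b shift[OF x]] by simp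
  qed
  let ?U = "(\<lambda>y. y - vec2 w 0) -` bidisc ?r"
  have img: "?\<Phi> ` bidisc ?r = \<Phi> ` bidisc \<rho> \<inter> g -` ?U"
  proof
    show "?\<Phi> ` bidisc ?r \<subseteq> \<Phi> ` bidisc \<rho> \<inter> g -` ?U" using 3 shift by auto
    show "\<Phi> ` bidisc \<rho> \<inter> g -` ?U \<subseteq> ?\<Phi> ` bidisc ?r"
    proof
      fix q assume q: "q \<in> \<Phi> ` bidisc \<rho> \<inter> g -` ?U"
      then have "?\<Phi> (g q - vec2 w 0) = q" using flow_box_point(3)[OF b] by simp
      moreover have "g q - vec2 w 0 \<in> bidisc ?r" using q by simp
      ultimately show "q \<in> ?\<Phi> ` bidisc ?r" by (metis imageI)
    qed
  qed
  have "continuous_on (\<Phi> ` bidisc \<rho>) g"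
    using flow_box_cont[OF b] by (intro continuous_at_imp_continuous_on) blast
  moreover have "open ?U" by (rule open_vimage[OF open_bidisc0]) (intro continuous_intros)
  ultimately have 4: "open (?\<Phi> ` bidisc ?r)"
    unfolding img using flow_boxD(5)[OF b] by (intro continuous_open_preimage)
  have 5: "hol_at (\<lambda>q. (g q - vec2 w 0) $ i) q" if q: "q \<in> ?\<Phi> ` bidisc ?r" for q i
  proof -
    have "hol_at (\<lambda>q. g q $ i) q" by (rule flow_boxD(6)[OF b]) (use q img in blast)
    from hol_at_diff[OF this hol_at_const] show ?thesis by simp
  qed
  have 6: "fl (?\<Phi> (vec2 z s)) (t - s) = ?\<Phi> (vec2 z t)"
    if "z \<in> ball 0 ?r" "s \<in> ball 0 ?r" "t \<in> ball 0 ?r" for z s t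
  proof -
    have "vec2 z s + vec2 w 0 = vec2 (z + w) s" for s by (simp add: vec_eq_iff forall_2 vec2_nth)
    moreover have "z + w \<in> ball 0 \<rho>" using that(1) norm_triangle_ineq[of z w] by simp
    moreover have "s \<in> ball 0 \<rho>" "t \<in> ball 0 \<rho>"
      using that(2,3) norm_ge_zero[of w] unfolding mem_ball_0 by linarith+
    moreover have "norm w \<ge> 0" by simp
    ultimately show ?thesis using flow_boxD(7)[OF b] by simp
  qed
  show ?thesis unfolding flow_box_def using 1 2 3 4 5 6 by blast
qed

end

section \<open>The trichotomy at a periodic orbit\<close>

context flow_surface
begin

text \<open>That the germ is invertible comes from the return map for \<open>- \<tau>\<close>: the
  composition of the two is the identity near 0, so the product of the derivatives is 1.\<close>

lemma return_germ:
  assumes b: "flow_box q \<rho> \<Phi> g" and \<tau>: "fl q \<tau> = q"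
  shows "\<exists>\<delta> f u. 0 < \<delta> \<and> \<delta> \<le> \<rho> \<and> germ_diffeo f \<and> u holomorphic_on ball 0 \<delta> \<and> u 0 = 0 \<and>
    (\<forall>z\<in>ball 0 \<delta>. f z \<in> ball 0 \<rho> \<and> u z \<in> ball 0 \<rho> \<and> fl (\<Phi> (vec2 z 0)) (\<tau> - u z) = \<Phi> (vec2 (f z) 0))"
proof -
  obtain \<delta> f u where \<delta>: "0 < \<delta>" "\<delta> \<le> \<rho>" and f: "f holomorphic_on ball 0 \<delta>" and u: "u holomorphic_on ball 0 \<delta>"
    and fu0: "f 0 = 0" "u 0 = 0" and fr: "\<And>z. z \<in> ball 0 \<delta> \<Longrightarrow> f z \<in> ball 0 \<rho>"
    and ur: "\<And>z. z \<in> ball 0 \<delta> \<Longrightarrow> u z \<in> ball 0 \<rho>"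
    and ret: "\<And>z. z \<in> ball 0 \<delta> \<Longrightarrow> fl (\<Phi> (vec2 z 0)) \<tau> = \<Phi> (vec2 (f z) (u z))"
    by (rule return_map[OF b \<tau>]) blast
  obtain \<delta>' f' u' where \<delta>': "0 < \<delta>'" "\<delta>' \<le> \<rho>" and f': "f' holomorphic_on ball 0 \<delta>'" and u': "u' holomorphic_on ball 0 \<delta>'"
    and fu0': "f' 0 = 0" "u' 0 = 0" and fr': "\<And>z. z \<in> ball 0 \<delta>' \<Longrightarrow> f' z \<in> ball 0 \<rho>"
    and ur': "\<And>z. z \<in> ball 0 \<delta>' \<Longrightarrow> u' z \<in> ball 0 \<rho>"
    and ret': "\<And>z. z \<in> ball 0 \<delta>' \<Longrightarrow> fl (\<Phi> (vec2 z 0)) (- \<tau>) = \<Phi> (vec2 (f' z) (u' z))"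
    by (rule return_map[OF b flow_periodic_uminus[OF \<tau>]]) blast
  have \<rho>: "\<rho> > 0" by (rule flow_boxD(1)[OF b])
  have sec: "fl (\<Phi> (vec2 z 0)) (\<tau> - u z) = \<Phi> (vec2 (f z) 0)" if "z \<in> ball 0 \<delta>" for z
    by (rule return_map_period[OF b fr[OF that] ur[OF that] ret[OF that]])
  have 0: "(0::complex) \<in> ball 0 \<delta>" "(0::complex) \<in> ball 0 \<delta>'" "(0::complex) \<in> ball 0 \<rho>" using \<delta> \<delta>' \<rho> by auto
  have cont: "isCont k 0" if "k holomorphic_on ball 0 r" "(0::complex) \<in> ball 0 r" for k r
    using holomorphic_on_imp_continuous_on[OF that(1)] that(2) by (simp add: continuous_on_eq_continuous_at)
  have cf: "isCont f 0" by (rule cont[OF f 0(1)])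
  have cu: "isCont u 0" by (rule cont[OF u 0(1)])
  have cu': "isCont u' (f 0)" unfolding fu0 by (rule cont[OF u' 0(2)])
  have "isCont (\<lambda>z. u z + u' (f z)) 0" by (intro continuous_intros cu isCont_o2[OF cf cu'])
  moreover have "u 0 + u' (f 0) \<in> ball 0 \<rho>" using fu0 fu0' \<rho> by simp
  ultimately have e1: "\<forall>\<^sub>F z in nhds 0. u z + u' (f z) \<in> ball 0 \<rho>"
    by (rule isCont_eventually[OF _ eventually_nhds_in_open[OF open_ball]])
  have "f 0 \<in> ball 0 \<delta>'" using fu0 0 by simp
  from isCont_eventually[OF cf eventually_nhds_in_open[OF open_ball this]]
  have e2: "\<forall>\<^sub>F z in nhds 0. f z \<in> ball 0 \<delta>'" .
  have e3: "\<forall>\<^sub>F z in nhds 0. z \<in> ball (0::complex) \<delta>" by (rule eventually_nhds_in_open[OF open_ball 0(1)])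
  \<comment> \<open>Going out and back amounts to a short flow of time
    \<open>- (u z + u' (f z))\<close>, which stays in one vertical disc. Returning to the section
    then means returning to the same point.\<close>
  from e1 e2 e3 have inverse: "\<forall>\<^sub>F z in nhds 0. f' (f z) = z"
  proof eventually_elim
    case (elim z)
    have z: "z \<in> ball 0 \<rho>" using elim(3) \<delta>(2) by auto
    have m: "- (u z + u' (f z)) \<in> ball 0 \<rho>" using elim(1) by (simp only: mem_ball_0 norm_minus_cancel)
    have "fl (\<Phi> (vec2 (f z) 0)) (- \<tau> - u' (f z)) = \<Phi> (vec2 (f' (f z)) 0)"
      by (rule return_map_period[OF b fr'[OF elim(2)] ur'[OF elim(2)] ret'[OF elim(2)]])
    then have "fl (\<Phi> (vec2 z 0)) (- (u z + u' (f z))) = \<Phi> (vec2 (f' (f z)) 0)"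
      unfolding sec[OF elim(3), symmetric] by (simp add: flow_add algebra_simps)
    then have "\<Phi> (vec2 z (- (u z + u' (f z)))) = \<Phi> (vec2 (f' (f z)) 0)"
      using flow_box_vertical[OF b z m] by simp
    from flow_box_inj(1)[OF b this z m fr'[OF elim(2)] 0(3)] show ?case by simp
  qed
  have df: "(f has_field_derivative deriv f 0) (at 0)"
    by (rule holomorphic_derivI[OF f open_ball 0(1)])
  have df': "(f' has_field_derivative deriv f' 0) (at (f 0))"
    unfolding fu0 by (rule holomorphic_derivI[OF f' open_ball 0(2)])
  have "((\<lambda>z. f' (f z)) has_field_derivative deriv f' 0 * deriv f 0) (at 0)" by (rule DERIV_chain2[OF df' df])
  then have "((\<lambda>z. z) has_field_derivative deriv f' 0 * deriv f 0) (at 0)"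
    using DERIV_cong_ev[OF refl inverse refl] by blast
  then have "deriv f' 0 * deriv f 0 = 1" using DERIV_ident DERIV_unique by blast
  then have "deriv f 0 \<noteq> 0" by auto
  then have "germ_diffeo f" unfolding germ_diffeo_def using f \<delta>(1) fu0(1) by blast
  then show ?thesis using \<delta> u fu0(2) fr ur sec
    by (intro exI[of _ \<delta>] exI[of _ f] exI[of _ u]) simp
qed

text \<open>The loop is deformed by rescaling time: over z the path flows for the fraction s of the
  return time \<open>\<tau> - u z\<close>. It stays in its leaf and is continuous in the leaf
  topology because it comes from a path of times.\<close>

lemma holonomy_return_germ:
  assumes b: "flow_box q \<rho> \<Phi> g" and h: "orbit_diffeo A X q h" "\<And>s. orbit_loop A X q h s = fl q (of_real s * \<tau>)"
    and \<delta>: "0 < \<delta>" "\<delta> \<le> \<rho>" and f: "germ_diffeo f" and u: "u holomorphic_on ball 0 \<delta>" "u 0 = 0"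
    and fr: "\<And>z. z \<in> ball 0 \<delta> \<Longrightarrow> f z \<in> ball 0 \<rho>"
    and ret: "\<And>z. z \<in> ball 0 \<delta> \<Longrightarrow> fl (\<Phi> (vec2 z 0)) (\<tau> - u z) = \<Phi> (vec2 (f z) 0)"
  shows "holonomy_map A X q f"
proof -
  let ?s = "\<lambda>z. \<Phi> (vec2 z 0)"
  define H where "H s z = fl (?s z) (of_real s * (\<tau> - u z))" for s :: real and z
  have s0: "?s 0 = q" using flow_boxD(2)[OF b] by (simp add: vec2_0)
  have "orbit_loop A X q h 0 = q" unfolding h(2) by simp
  then have trans: "transverse_section A X (orbit_loop A X q h 0) ?s \<rho>" using transversal_section[OF b] by simp
  have cH: "continuous_on ({0..1} \<times> ball 0 \<delta>) (\<lambda>(s, z). H s z)"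
    unfolding split_beta
  proof (rule continuous_at_imp_continuous_on, rule ballI)
    fix x :: "real \<times> complex" assume "x \<in> {0..1} \<times> ball 0 \<delta>"
    then have z\<delta>: "snd x \<in> ball 0 \<delta>" by auto
    then have z: "snd x \<in> ball 0 \<rho>" using \<delta>(2) by auto
    have cs: "isCont ?s (snd x)" using section_hcurve(1)[OF b z] unfolding hcurve_at_def by blast
    have "isCont u (snd x)"
      using holomorphic_on_imp_continuous_on[OF u(1)] z\<delta> by (simp add: continuous_on_eq_continuous_at)
    then have cu: "isCont (\<lambda>x. u (snd x)) x" by (rule isCont_o2[where f = snd and g = u, rotated]) (intro continuous_intros)
    have "isCont (\<lambda>x. ?s (snd x)) x" by (rule isCont_o2[where f = snd and g = ?s, OF _ cs]) (intro continuous_intros)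
    then have 1: "isCont (\<lambda>x. (?s (snd x), of_real (fst x) * (\<tau> - u (snd x)))) x"
      by (intro continuous_intros cu)
    have 2: "isCont (\<lambda>y. fl (fst y) (snd y)) (?s (snd x), of_real (fst x) * (\<tau> - u (snd x)))"
      by (rule flow_continuous[OF section_hcurve(2)[OF b z]])
    from isCont_o2[OF 1 2] show "isCont (\<lambda>x. H (fst x) (snd x)) x" unfolding H_def fst_conv snd_conv .
  qed
  have path: "pathin (orbit_topology A X (?s z)) (\<lambda>s. H s z)" for z
  proof -
    have "pathin euclidean (\<lambda>s. of_real s * (\<tau> - u z))"
      unfolding pathin_def by (auto intro!: continuous_intros)
    from pathin_compose[OF this continuous_map_orbit, of "?s z"] show ?thesis by (simp add: H_def o_def)
  qed
  have "H s 0 = orbit_loop A X q h s" for s by (simp add: H_def s0 u(2) h(2))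
  moreover have "H 0 z = ?s z" for z by (simp add: H_def)
  moreover have "H 1 z = ?s (f z)" if "z \<in> ball 0 \<delta>" for z using ret[OF that] by (simp add: H_def)
  ultimately have "holonomy_along A X (orbit_loop A X q h) ?s \<rho> f"
    unfolding holonomy_along_def using f \<delta> cH path fr by (intro conjI exI[of _ \<delta>] exI[of _ H]) auto
  then show ?thesis unfolding holonomy_map_def using h(1) trans by blast
qed

text \<open>The common period \<open>T\<close> passes to an accumulation point w of \<open>K\<close>
  by continuity. Around w the identity theorem makes \<open>T\<close> a period of all points, then
  of the whole surface, and the flow is periodic.\<close>

lemma recurrent_leaf_first_integral:
  assumes b: "flow_box q \<rho> \<Phi> g" and K: "infinite K" "K \<subseteq> cball 0 (\<rho> / 2)"
    and T: "T \<noteq> 0" "\<And>z. z \<in> K \<Longrightarrow> fl (\<Phi> (vec2 z 0)) T = \<Phi> (vec2 z 0)"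
  shows "\<exists>f. meromorphic_first_integral A X f"
proof -
  let ?s = "\<lambda>z. \<Phi> (vec2 z 0)"
  have \<rho>: "\<rho> > 0" by (rule flow_boxD(1)[OF b])
  obtain w where w: "w \<in> cball 0 (\<rho> / 2)" "w islimpt K"
    using Heine_Borel_imp_Bolzano_Weierstrass[OF compact_cball K] by blast
  have w\<rho>: "w \<in> ball 0 \<rho>" using w(1) \<rho> by auto
  have wreg: "?s w \<in> reg" by (rule section_hcurve(2)[OF b w\<rho>])
  have cs: "isCont ?s w" using section_hcurve(1)[OF b w\<rho>] unfolding hcurve_at_def by blast
  obtain x where x: "\<And>n. x n \<in> K" "x \<longlonglongrightarrow> w" using w(2) unfolding islimpt_sequential by blast
  have 1: "(\<lambda>n. ?s (x n)) \<longlonglongrightarrow> ?s w" by (rule isCont_tendsto_compose[OF cs x(2)])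
  have "(\<lambda>n. fl (?s (x n)) T) \<longlonglongrightarrow> fl (?s w) T" by (rule isCont_tendsto_compose[OF flow_isCont_point[OF wreg] 1])
  then have "(\<lambda>n. ?s (x n)) \<longlonglongrightarrow> fl (?s w) T" by (simp add: T(2) x(1))
  then have wT: "fl (?s w) T = ?s w" using 1 by (rule LIMSEQ_unique)
  let ?\<Phi> = "\<lambda>x. \<Phi> (x + vec2 w 0)"
  note b' = flow_box_recenter[OF b w\<rho>]
  obtain \<delta> where \<delta>: "0 < \<delta>" "\<delta> \<le> \<rho> - norm w"
    and near: "\<And>K \<xi> q. K \<subseteq> ball 0 \<delta> \<Longrightarrow> \<xi> \<in> ball 0 \<delta> \<Longrightarrow> \<xi> islimpt K \<Longrightarrow>
       (\<And>z. z \<in> K \<Longrightarrow> fl (?\<Phi> (vec2 z 0)) T = ?\<Phi> (vec2 z 0)) \<Longrightarrow> q \<in> ?\<Phi> ` bidisc \<delta> \<Longrightarrow> fl q T = q"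
    by (rule period_near[OF b' wT]) blast
  \<comment> \<open>\<open>K\<close> in the coordinate centred at w, cut down to the disc on which
    the identity principle holds.\<close>
  define K' where "K' = {z \<in> ball 0 \<delta>. w + z \<in> K}"
  have lim: "0 islimpt K'"
  proof (rule islimptI)
    fix U :: "complex set" assume U: "0 \<in> U" "open U"
    let ?V = "(\<lambda>z. z - w) -` (U \<inter> ball 0 \<delta>)"
    have oV: "open ?V" by (rule open_vimage) (use U(2) in \<open>auto intro!: continuous_intros\<close>)
    have wV: "w \<in> ?V" using U(1) \<delta>(1) by simp
    obtain y where y: "y \<in> K" "y \<in> ?V" "y \<noteq> w" by (rule islimptE[OF w(2) wV oV])
    show "\<exists>y\<in>K'. y \<in> U \<and> y \<noteq> 0" by (rule bexI[of _ "y - w"]) (use y in \<open>auto simp: K'_def\<close>)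
  qed
  have per': "fl (?\<Phi> (vec2 z 0)) T = ?\<Phi> (vec2 z 0)" if "z \<in> K'" for z
  proof -
    have "vec2 z 0 + vec2 w 0 = vec2 (w + z) 0" by (simp add: vec_eq_iff forall_2 vec2_nth)
    moreover have "w + z \<in> K" using that by (simp add: K'_def)
    ultimately show ?thesis using T(2) by simp
  qed
  have b2: "flow_box (?s w) \<delta> ?\<Phi> (\<lambda>q. g q - vec2 w 0)" by (rule flow_box_shrink[OF b' \<delta>])
  have 0: "(0::complex) \<in> ball 0 \<delta>" using \<delta>(1) by simp
  have K'b: "K' \<subseteq> ball 0 \<delta>" unfolding K'_def by blast
  have "fl x T = x" for x
  proof (rule period_global[OF flow_boxD(5)[OF b2]])
    show "?\<Phi> ` bidisc \<delta> \<noteq> {}" using flow_box_center[OF b2] by blast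
    show "?\<Phi> ` bidisc \<delta> \<subseteq> reg" using flow_box_reg[OF b2] by blast
    show "fl q T = q" if "q \<in> ?\<Phi> ` bidisc \<delta>" for q by (rule near[OF K'b 0 lim per' that])
  qed
  then show ?thesis using periodic_flow_first_integral[OF T(1) _ wreg] by blast
qed

text \<open>The return times along n successive iterates add up to a continuous function of the
  section point. As the n-th iterate is the identity, this sum is a period of nearby points and
  equals \<open>of_nat n * \<tau>\<close> at \<open>q\<close>, so that period is stable.\<close>

lemma periodic_germ_first_integral:
  assumes b: "flow_box q \<rho> \<Phi> g" and q: "q \<in> reg" and \<tau>: "\<tau> \<noteq> 0"
    and \<delta>: "0 < \<delta>" and f: "germ_diffeo f" and u: "u holomorphic_on ball 0 \<delta>" "u 0 = 0"
    and ret: "\<And>z. z \<in> ball 0 \<delta> \<Longrightarrow> fl (\<Phi> (vec2 z 0)) (\<tau> - u z) = \<Phi> (vec2 (f z) 0)"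
    and n: "n \<ge> 1" "\<forall>\<^sub>F z in nhds 0. (f ^^ n) z = z"
  shows "\<exists>F. meromorphic_first_integral A X F"
proof -
  let ?s = "\<lambda>z. \<Phi> (vec2 z 0)"
  have "\<exists>c. (\<forall>\<^sub>F z in nhds 0. isCont c z \<and> fl (?s z) (c z) = ?s ((f ^^ m) z)) \<and> c 0 = of_nat m * \<tau>" for m
  proof (induction m)
    case 0
    show ?case by (intro exI[of _ "\<lambda>_. 0"]) simp
  next
    case (Suc m)
    then obtain c where c: "\<forall>\<^sub>F z in nhds 0. isCont c z \<and> fl (?s z) (c z) = ?s ((f ^^ m) z)" "c 0 = of_nat m * \<tau>" by blast
    have fm: "germ_diffeo (f ^^ m)" by (rule germ_diffeo_funpow[OF f])
    then obtain r where r: "r > 0" "(f ^^ m) holomorphic_on ball 0 r" and fm0: "(f ^^ m) 0 = 0" unfolding germ_diffeo_def by blast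
    have "0 \<in> ball (0::complex) r" using r(1) by simp
    then have e1: "\<forall>\<^sub>F z in nhds 0. z \<in> ball (0::complex) r" by (rule eventually_nhds_in_open[OF open_ball])
    have "(0::complex) \<in> ball 0 \<delta>" using \<delta> by simp
    then have e2: "\<forall>\<^sub>F z in nhds 0. (f ^^ m) z \<in> ball 0 \<delta>"
      by (rule topological_tendstoD[OF germ_diffeo_tendsto(1)[OF fm] open_ball])
    \<comment> \<open>Append the return time from the m-th iterate, where the path has arrived, to
      the time already spent.\<close>
    let ?c = "\<lambda>z. c z + (\<tau> - u ((f ^^ m) z))"
    from c(1) e1 e2 have "\<forall>\<^sub>F z in nhds 0. isCont ?c z \<and> fl (?s z) (?c z) = ?s ((f ^^ Suc m) z)"
    proof eventually_elim
      case (elim z)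
      have "isCont (f ^^ m) z"
        using holomorphic_on_imp_continuous_on[OF r(2)] elim(2) by (simp add: continuous_on_eq_continuous_at)
      moreover have "isCont u ((f ^^ m) z)"
        using holomorphic_on_imp_continuous_on[OF u(1)] elim(3) by (simp add: continuous_on_eq_continuous_at)
      ultimately have "isCont (\<lambda>z. u ((f ^^ m) z)) z" by (rule isCont_o2)
      then have "isCont ?c z" using elim(1) by (intro continuous_intros) auto
      moreover have "fl (?s z) (?c z) = fl (fl (?s z) (c z)) (\<tau> - u ((f ^^ m) z))" by (simp add: flow_add)
      moreover have "\<dots> = ?s (f ((f ^^ m) z))" using elim(1) ret[OF elim(3)] by simp
      ultimately show ?case by simp
    qed
    moreover have "?c 0 = of_nat (Suc m) * \<tau>" by (simp add: c(2) fm0 u(2) algebra_simps)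
    ultimately show ?case by blast
  qed
  then obtain c where c: "\<forall>\<^sub>F z in nhds 0. isCont c z \<and> fl (?s z) (c z) = ?s ((f ^^ n) z)" "c 0 = of_nat n * \<tau>" by blast
  from c(1) n(2) have c': "\<forall>\<^sub>F z in nhds 0. isCont c z \<and> fl (?s z) (c z) = ?s z" by eventually_elim simp
  have qb: "q \<in> \<Phi> ` bidisc \<rho>" by (rule flow_box_center[OF b])
  have gq: "g q $ 1 = 0"
    using flow_boxD(2)[OF b] flow_boxD(4)[OF b, of 0] flow_boxD(1)[OF b] by (simp add: bidisc_def)
  have cg: "isCont (\<lambda>y. g y $ 1) q" by (rule hol_at_isCont[OF flow_boxD(6)[OF b qb]])
  from isCont_eventually[OF cg, unfolded gq, OF c']
  have e1: "\<forall>\<^sub>F y in nhds q. isCont c (g y $ 1) \<and> fl (?s (g y $ 1)) (c (g y $ 1)) = ?s (g y $ 1)" .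
  have e2: "\<forall>\<^sub>F y in nhds q. y \<in> \<Phi> ` bidisc \<rho>" by (rule eventually_nhds_in_open[OF flow_boxD(5)[OF b] qb])
  from e1 e2 have "period_function (\<lambda>y. c (g y $ 1)) q" unfolding period_function_def
  proof eventually_elim
    case (elim y)
    have "isCont (\<lambda>y. g y $ 1) y" by (rule hol_at_isCont[OF flow_boxD(6)[OF b elim(2)]])
    then have 1: "isCont (\<lambda>y. c (g y $ 1)) y" by (rule isCont_o2) (use elim(1) in blast)
    have "y = fl (?s (g y $ 1)) (g y $ 2)" by (rule flow_box_point(4)[OF b elim(2)])
    then have "fl y (c (g y $ 1)) = y" using elim(1) period_transport by metis
    then show ?case using 1 by blast
  qed
  moreover have "c (g q $ 1) = of_nat n * \<tau>" by (simp add: gq c(2))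
  ultimately have "stable_period q (of_nat n * \<tau>)" unfolding stable_period_def by blast
  moreover have "of_nat n * \<tau> \<noteq> 0" using n(1) \<tau> by simp
  ultimately show ?thesis by (rule stable_period_first_integral[OF q])
qed

text \<open>The return germ at \<open>q\<close> is fed into the trichotomy for germs, with lying on
  one leaf as the equivalence. In the recurrent case the convergence hypothesis provides a periodic
  leaf near \<open>q\<close>, whose infinitely many points in the section share one period.\<close>

theorem convergence_trichotomy:
  assumes conv: "q \<in> convergence_set A X (periodic_set A X)"
    and nsc: "\<not> simply_connected_top (orbit_topology A X q)"
  shows "(\<exists>f. meromorphic_first_integral A X f) \<or> nRnL_orbit A X q"
proof -
  have q: "q \<in> reg" by (rule periodic_if_not_simply_connected(1)[OF nsc])
  obtain \<tau> where per: "\<And>T. fl q T = q \<longleftrightarrow> (\<exists>n::int. T = of_int n * \<tau>)"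
    by (rule period_group[OF q]) blast
  have \<tau>: "\<tau> \<noteq> 0" using periodic_if_not_simply_connected(2)[OF nsc] unfolding per by auto
  have q\<tau>: "fl q \<tau> = q" unfolding per by (rule exI[of _ 1]) simp
  obtain h where h: "orbit_diffeo A X q h" "\<And>s. orbit_loop A X q h s = fl q (of_real s * \<tau>)"
    by (rule orbit_diffeo_exp[OF q per \<tau>]) blast
  obtain \<rho> \<Phi> g where b: "flow_box q \<rho> \<Phi> g" using flow_box_exists[OF q] by blast
  have \<rho>: "\<rho> > 0" by (rule flow_boxD(1)[OF b])
  let ?s = "\<lambda>z. \<Phi> (vec2 z 0)"
  have s0: "?s 0 = q" using flow_boxD(2)[OF b] by (simp add: vec2_0)
  obtain \<delta> f u where \<delta>: "0 < \<delta>" "\<delta> \<le> \<rho>" and f: "germ_diffeo f" and u: "u holomorphic_on ball 0 \<delta>" "u 0 = 0"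
    and R: "\<forall>z\<in>ball 0 \<delta>. f z \<in> ball 0 \<rho> \<and> u z \<in> ball 0 \<rho> \<and> fl (?s z) (\<tau> - u z) = ?s (f z)"
    using return_germ[OF b q\<tau>] by blast
  have fr: "f z \<in> ball 0 \<rho>" and ret: "fl (?s z) (\<tau> - u z) = ?s (f z)" if "z \<in> ball 0 \<delta>" for z
    using bspec[OF R that] by blast+
  interpret germ_class "\<lambda>z z'. ?s z' \<in> orbit A X (?s z)" "\<rho> / 2"
  proof
    show "\<rho> / 2 > 0" using \<rho> by simp
    show "?s x \<in> orbit A X (?s x)" for x unfolding orbit_def by (rule range_eqI[of _ _ 0]) simp
    then show "?s x \<in> orbit A X (?s y)" if "?s y \<in> orbit A X (?s x)" for x y
      using orbit_eq[OF that] by simp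
    show "?s z \<in> orbit A X (?s x)" if "?s y \<in> orbit A X (?s x)" "?s z \<in> orbit A X (?s y)" for x y z
      using orbit_eq[OF that(1)] that(2) by simp
  qed
  have 0: "(0::complex) \<in> ball 0 \<delta>" using \<delta>(1) by simp
  have "\<forall>\<^sub>F z in nhds 0. ?s (f z) \<in> orbit A X (?s z)"
    using eventually_nhds_in_open[OF open_ball 0]
  proof eventually_elim
    case (elim z)
    show ?case unfolding orbit_def ret[OF elim, symmetric] by (rule rangeI)
  qed
  from germ_trichotomy[OF f this]
  consider "nRnL_map f" | n where "n \<ge> 1" "\<forall>\<^sub>F z in nhds 0. (f ^^ n) z = z" | "\<forall>\<^sub>F z in at 0. recurrent z" by blast
  then show ?thesis
  proof cases
    case 1
    have "holonomy_map A X q f" by (rule holonomy_return_germ[OF b h \<delta> f u fr ret])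
    then have "nRnL_orbit A X q" unfolding nRnL_orbit_def periodic_orbit_def using h(1) 1 by blast
    then show ?thesis by blast
  next
    case (2 n)
    then show ?thesis using periodic_germ_first_integral[OF b q \<tau> \<delta>(1) f u ret] by blast
  next
    case 3
    then obtain d where d: "d > 0" "\<And>z. z \<noteq> 0 \<Longrightarrow> norm z < d \<Longrightarrow> recurrent z"
      unfolding eventually_at by auto
    define r where "r = min d \<rho>"
    have r: "0 < r" "r \<le> \<rho>" "r \<le> d" using d(1) \<rho> by (auto simp: r_def)
    have b2: "flow_box q r \<Phi> g" by (rule flow_box_shrink[OF b r(1,2)])
    let ?V = "\<Phi> ` bidisc r"
    have inf: "infinite {L \<in> orbit A X ` periodic_set A X. L \<inter> ?V \<noteq> {}}"
      using conv flow_boxD(5)[OF b2] flow_box_center[OF b2] unfolding convergence_set_def by blast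
    \<comment> \<open>Infinitely many periodic orbits meet the box, so one of them is not the orbit
      of \<open>q\<close>. Its parameter z is therefore nonzero, as recurrence requires.\<close>
    have "\<not> {L \<in> orbit A X ` periodic_set A X. L \<inter> ?V \<noteq> {}} \<subseteq> {orbit A X q}"
      using inf finite_subset by blast
    then obtain p x where p: "p \<in> periodic_set A X" "orbit A X p \<noteq> orbit A X q"
      and x: "x \<in> orbit A X p" "x \<in> ?V" by blast
    define z where "z = g x $ 1"
    have z: "z \<in> ball 0 r" unfolding z_def by (rule flow_box_point(1)[OF b2 x(2)])
    have xz: "x = fl (?s z) (g x $ 2)" unfolding z_def by (rule flow_box_point(4)[OF b2 x(2)])
    then have "x \<in> orbit A X (?s z)" unfolding orbit_def by blast
    then have oz: "orbit A X (?s z) = orbit A X p" using orbit_eq x(1) by metis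
    have "z \<noteq> 0" using oz p(2) s0 by auto
    moreover have "norm z < d" using z r(3) by simp
    ultimately have "recurrent z" by (rule d(2))
    then have K: "infinite {w \<in> cball 0 (\<rho> / 2). ?s w \<in> orbit A X (?s z)}" unfolding recurrent_def .
    obtain T where T: "T \<noteq> 0" "fl p T = p" using periodic_orbit_period p(1) unfolding periodic_set_def by blast
    have "fl (?s w) T = ?s w" if "w \<in> {w \<in> cball 0 (\<rho> / 2). ?s w \<in> orbit A X (?s z)}" for w
    proof -
      have "?s w \<in> orbit A X p" using that oz by simp
      then obtain t where "?s w = fl p t" unfolding orbit_def by blast
      then show ?thesis using T(2) by (simp only: period_transport)
    qed
    from recurrent_leaf_first_integral[OF b K _ T(1) this] show ?thesis by blast
  qed
qed

end

theorem theorem4: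
  fixes A :: "('a::{t2_space, second_countable_topology}, 2) chart set"
    and X :: "('a, 2) vfield"
  assumes "stein_surface A"
    and "connected (UNIV :: 'a set)"
    and "trivial_group (cohomology_group 2 (euclidean :: 'a topology))"
    and "holomorphic_vfield A X"
    and "complete_vfield A X"
    and "isolated_singularities A X"
  shows "(convergence_set A X (periodic_set A X) = {} \<or>
          (\<forall>q\<in>convergence_set A X (periodic_set A X).
             simply_connected_top (orbit_topology A X q)))
       \<or> (\<exists>f. meromorphic_first_integral A X f)
       \<or> (\<exists>p. nRnL_orbit A X p)"
proof -
  interpret flow_surface A X
  proof
    show "complex_manifold A" using assms(1) unfolding stein_manifold_def by blast
    show "\<exists>f. holo_on A UNIV f \<and> f x \<noteq> f y" if "x \<noteq> y" for x y
      using assms(1) that unfolding stein_manifold_def by blast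
  qed (fact assms)+
  show ?thesis using convergence_trichotomy by blast
qed

end
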